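(* Let $\delta\in\mathbb{R}$, $S>0$, $P\ge 0$, $T>0$, $U_0\in H^2_*(\Omega)$, $V_0\in L^2(\Omega)$ and $F\in \mathcal{C}^0([0,T],L^2(\Omega))$. Then there exists a unique weak solution $U$ on $[0,T]$ of the plate problem with data $(\delta,S,P,F,U_0,V_0)$. Moreover, for all $t\in[0,T]$, $$\frac12\|U'(t)\|_0^2+\frac12\|U(t)\|_2^2-\frac P2\|U_x(t)\|_0^2+\frac S4\|U_x(t)\|_0^4-\int_0^t (F,U')_0\,ds+\delta\int_0^t\|U'\|_0^2\,ds$$ $$=\frac12\|V_0\|_0^2+\frac12\|U_0\|_2^2-\frac P2\|(U_0)_x\|_0^2+\frac S4\|(U_0)_x\|_0^4 .$$
   Context: Let $0<\sigma<\frac12$, $l>0$ and $\Omega=(0,\pi)\times(-l,l)$. Let $H^2_*(\Omega)=\{U\in H^2(\Omega): U=0 \text{ on } \{0,\pi\}\times[-l,l]\}$, equipped with the inner product $(U,V)_2=\int_\Omega\big(\Delta U\Delta V-(1-\sigma)(U_{xx}V_{yy}+U_{yy}V_{xx}-2U_{xy}V_{xy})\big)$ and norm $\|\cdot\|_2$. Let $(\cdot,\cdot)_0,\|\cdot\|_0$ be the inner product and norm of $L^2(\Omega)$, $\mathcal{H}$ the dual space of $H^2_*(\Omega)$ and $\langle\cdot,\cdot\rangle$ the duality $\mathcal{H}\times H^2_*(\Omega)$ (with $L^2(\Omega)\subset\mathcal H$ via $\langle f,V\rangle=(f,V)_0$). Primes denote time derivatives. Put $\phi(U)=-P+S\int_\Omega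 U_x^2$. The plate problem is $U_{tt}+\delta U_t+\Delta^2U-\phi(U)U_{xx}=F$ in $\Omega\times(0,T)$, with $U=U_{xx}=0$ on $\{0,\pi\}\times[-l,l]$, $U_{yy}+\sigma U_{xx}=U_{yyy}+(2-\sigma)U_{xxy}=0$ on $[0,\pi]\times\{-l,l\}$, $U(\cdot,0)=U_0$, $U_t(\cdot,0)=V_0$ in $\Omega$. A weak solution on $[0,T]$ is a function $U\in\mathcal{C}^0([0,T],H^2_*(\Omega))\cap\mathcal{C}^1([0,T],L^2(\Omega))\cap\mathcal{C}^2([0,T],\mathcal{H})$ with $U(0)=U_0$, $U'(0)=V_0$ and $\langle U'',V\rangle+\delta(U',V)_0+(U,V)_2+\phi(U)(U_x,V_x)_0=(F,V)_0$ for all $t\in[0,T]$ and all $V\in H^2_*(\Omega)$. *)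

theory Defs
  imports "HOL-Analysis.Analysis"
begin

text \<open>
  Elements of \<open>L\<^sup>2\<close>, \<open>H\<^sup>2\<close> and their subspaces are represented by functions on the plane, of which
  only the restriction to the domain, up to null sets, matters; equality of classes is
  almost-everywhere equality.  The resulting norms are therefore seminorms on functions.
\<close>

type_synonym field = "real \<times> real \<Rightarrow> real"

definition Omega :: "real \<Rightarrow> (real \<times> real) set" where
  "Omega l = {0<..<pi} \<times> {-l<..<l}"

subsection \<open>Test functions and weak derivatives\<close>

definition dx :: "field \<Rightarrow> field" where
  "dx f = (\<lambda>(x, y). deriv (\<lambda>s. f (s, y)) x)"

definition dy :: "field \<Rightarrow> field" where
  "dy f = (\<lambda>(x, y). deriv (\<lambda>s. f (x, s)) y)"

primrec C_k :: "nat \<Rightarrow> field \<Rightarrow> bool" where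
  "C_k 0 f \<longleftrightarrow> continuous_on UNIV f"
| "C_k (Suc k) f \<longleftrightarrow> f differentiable_on UNIV \<and> C_k k (dx f) \<and> C_k k (dy f)"

definition test_functions :: "(real \<times> real) set \<Rightarrow> field set" where
  "test_functions D =
     {f. (\<forall>k. C_k k f) \<and> compact (closure {p. f p \<noteq> 0}) \<and> closure {p. f p \<noteq> 0} \<subseteq> D}"

definition L2 :: "(real \<times> real) set \<Rightarrow> field set" where
  "L2 D = {f. f \<in> borel_measurable (lebesgue_on D) \<and> integrable (lebesgue_on D) (\<lambda>p. (f p)\<^sup>2)}"

definition inner0 :: "(real \<times> real) set \<Rightarrow> field \<Rightarrow> field \<Rightarrow> real" where
  "inner0 D f g = (LINT p|lebesgue_on D. f p * g p)"

definition norm0 :: "(real \<times> real) set \<Rightarrow> field \<Rightarrow> real" where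
  "norm0 D f = sqrt (inner0 D f f)"

text \<open>\<open>g\<close> is a weak derivative of \<open>f\<close> of order \<open>i\<close> in \<open>x\<close> and \<open>j\<close> in \<open>y\<close>.\<close>

definition is_weak_deriv ::
  "(real \<times> real) set \<Rightarrow> nat \<Rightarrow> nat \<Rightarrow> field \<Rightarrow> field \<Rightarrow> bool" where
  "is_weak_deriv D i j f g \<longleftrightarrow>
     (\<forall>v\<in>test_functions D.
        (LINT p|lebesgue_on D. f p * (dx ^^ i) ((dy ^^ j) v) p)
        = (- 1) ^ (i + j) * (LINT p|lebesgue_on D. g p * v p))"

definition H2 :: "(real \<times> real) set \<Rightarrow> field set" where
  "H2 D = {f \<in> L2 D. \<forall>i j. i + j \<le> 2 \<longrightarrow> (\<exists>g\<in>L2 D. is_weak_deriv D i j f g)}"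

text \<open>A chosen representative; weak derivatives are unique almost everywhere.\<close>

definition wd :: "(real \<times> real) set \<Rightarrow> nat \<Rightarrow> nat \<Rightarrow> field \<Rightarrow> field" where
  "wd D i j f = (SOME g. g \<in> L2 D \<and> is_weak_deriv D i j f g)"

subsection \<open>The energy space and its dual\<close>

text \<open>
  In dimension two \<open>H\<^sup>2(\<Omega>)\<close> embeds into the continuous functions on the closed rectangle, so the
  boundary condition is a pointwise condition on the continuous representative.
\<close>

definition H2_star :: "real \<Rightarrow> field set" where
  "H2_star l =
     {U \<in> H2 (Omega l).
        \<exists>w. continuous_on (closure (Omega l)) w \<and>
            (AE p in lebesgue_on (Omega l). w p = U p) \<and>
            (\<forall>p\<in>{0, pi} \<times> {-l..l}. w p = 0)}"

definition laplacian :: "real \<Rightarrow> field \<Rightarrow> field" where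
  "laplacian l U = (\<lambda>p. wd (Omega l) 2 0 U p + wd (Omega l) 0 2 U p)"

definition inner2 :: "real \<Rightarrow> real \<Rightarrow> field \<Rightarrow> field \<Rightarrow> real" where
  "inner2 \<sigma> l U V =
     (LINT p|lebesgue_on (Omega l).
        laplacian l U p * laplacian l V p
        - (1 - \<sigma>) * (wd (Omega l) 2 0 U p * wd (Omega l) 0 2 V p
                     + wd (Omega l) 0 2 U p * wd (Omega l) 2 0 V p
                     - 2 * wd (Omega l) 1 1 U p * wd (Omega l) 1 1 V p))"

definition norm2 :: "real \<Rightarrow> real \<Rightarrow> field \<Rightarrow> real" where
  "norm2 \<sigma> l U = sqrt (inner2 \<sigma> l U U)"

definition dual :: "real \<Rightarrow> real \<Rightarrow> (field \<Rightarrow> real) set" where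
  "dual \<sigma> l =
     {L. (\<forall>V\<in>H2_star l. \<forall>W\<in>H2_star l. \<forall>a b.
            L (\<lambda>p. a * V p + b * W p) = a * L V + b * L W) \<and>
         (\<exists>C. \<forall>V\<in>H2_star l. \<bar>L V\<bar> \<le> C * norm2 \<sigma> l V)}"

definition dual_norm :: "real \<Rightarrow> real \<Rightarrow> (field \<Rightarrow> real) \<Rightarrow> real" where
  "dual_norm \<sigma> l L = (SUP V\<in>{V \<in> H2_star l. norm2 \<sigma> l V \<le> 1}. \<bar>L V\<bar>)"

subsection \<open>Curves with values in a (semi)normed space of functions\<close>

definition C0 :: "real set \<Rightarrow> ('a \<Rightarrow> real) set \<Rightarrow> (('a \<Rightarrow> real) \<Rightarrow> real) \<Rightarrow> (real \<Rightarrow> 'a \<Rightarrow> real) set" where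
  "C0 I X N =
     {u. (\<forall>t\<in>I. u t \<in> X) \<and>
         (\<forall>t\<in>I. ((\<lambda>s. N (\<lambda>p. u s p - u t p)) \<longlongrightarrow> 0) (at t within I))}"

text \<open>The curve \<open>u\<close> is of class \<open>C\<^sup>1\<close> with derivative \<open>u'\<close>; one-sided at endpoints of \<open>I\<close>.\<close>

definition C1_with ::
  "real set \<Rightarrow> ('a \<Rightarrow> real) set \<Rightarrow> (('a \<Rightarrow> real) \<Rightarrow> real) \<Rightarrow>
   (real \<Rightarrow> 'a \<Rightarrow> real) \<Rightarrow> (real \<Rightarrow> 'a \<Rightarrow> real) \<Rightarrow> bool" where
  "C1_with I X N u u' \<longleftrightarrow>
     u \<in> C0 I X N \<and> u' \<in> C0 I X N \<and>
     (\<forall>t\<in>I. ((\<lambda>s. N (\<lambda>p. (u s p - u t p) / (s - t) - u' t p)) \<longlongrightarrow> 0) (at t within I))"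

subsection \<open>Weak solutions of the plate problem\<close>

definition phi :: "real \<Rightarrow> real \<Rightarrow> real \<Rightarrow> field \<Rightarrow> real" where
  "phi l S P U = - P + S * (LINT p|lebesgue_on (Omega l). (wd (Omega l) 1 0 U p)\<^sup>2)"

text \<open>
  \<open>inner0 (Omega l) f\<close> is the functional induced by the square-integrable function \<open>f\<close>;
  \<open>U''\<close> is the second derivative of \<open>U\<close> as a curve in the dual space.
\<close>

definition weak_solution ::
  "real \<Rightarrow> real \<Rightarrow> real \<Rightarrow> real \<Rightarrow> real \<Rightarrow> real \<Rightarrow> (real \<Rightarrow> field) \<Rightarrow> field \<Rightarrow> field \<Rightarrow>
   (real \<Rightarrow> field) \<Rightarrow> bool" where
  "weak_solution \<sigma> l \<delta> S P T F U0 V0 U \<longleftrightarrow>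
     U \<in> C0 {0..T} (H2_star l) (norm2 \<sigma> l) \<and>
     (\<exists>U' U''.
        C1_with {0..T} (L2 (Omega l)) (norm0 (Omega l)) U U' \<and>
        C1_with {0..T} (dual \<sigma> l) (dual_norm \<sigma> l)
          (\<lambda>t. inner0 (Omega l) (U t)) (\<lambda>t. inner0 (Omega l) (U' t)) \<and>
        C1_with {0..T} (dual \<sigma> l) (dual_norm \<sigma> l) (\<lambda>t. inner0 (Omega l) (U' t)) U'' \<and>
        (AE p in lebesgue_on (Omega l). U 0 p = U0 p) \<and>
        (AE p in lebesgue_on (Omega l). U' 0 p = V0 p) \<and>
        (\<forall>t\<in>{0..T}. \<forall>V\<in>H2_star l.
           U'' t V + \<delta> * inner0 (Omega l) (U' t) V + inner2 \<sigma> l (U t) V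
           + phi l S P (U t) * inner0 (Omega l) (wd (Omega l) 1 0 (U t)) (wd (Omega l) 1 0 V)
           = inner0 (Omega l) (F t) V))"

end

theory Submission
  imports Defs "HOL-Computational_Algebra.Polynomial"
begin

text \<open>
  The plate equation is treated as a semilinear evolution equation in Hilbert spaces, and the whole
  argument rests on one bookkeeping device: a displacement \<open>U\<close> is replaced by its state
  \<open>(U, U\<^sub>x, K U)\<close>, where \<open>K U\<close> collects the three multiples of \<open>U\<^sub>x\<^sub>x + U\<^sub>y\<^sub>y\<close>, \<open>U\<^sub>x\<^sub>x - U\<^sub>y\<^sub>y\<close> and
  \<open>U\<^sub>x\<^sub>y\<close> for which \<open>(U, V)\<^sub>2 = K U \<bullet> K V\<close> (\<open>stiff_inner\<close>).  In these terms the weak equation consists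
  of inner products of state components; the boundary conditions on the horizontal sides are natural
  ones and are contained in it.

  \<^emph>\<open>The linear part.\<close>  The states form a closed subspace of a product of \<open>L\<^sup>2\<close> spaces
  (\<open>states_closed\<close>).  A closed single-valued graph and minus its adjoint make a skew-adjoint linear
  relation on pairs (state, velocity), whose resolvents exist by orthogonal projection onto the
  graph.  Bounded
  approximations of the relation give solutions of the linear problem (\<open>weak_sol_exists\<close>), and
  applying the resolvent to a weak solution makes it differentiable, which yields the energy
  identity \<open>|x(t)|\<^sup>2 = |x(0)|\<^sup>2 + 2 \<integral> g \<bullet> x\<close> for every weak solution (\<open>energy_identity\<close>).  Uniqueness and
  continuous dependence are consequences of that identity.

  \<^emph>\<open>The nonlinear part.\<close>  Since \<open>U\<^sub>x\<^sub>x\<close> is a bounded linear function of \<open>K U\<close>, the term \<open>\<phi>(U) U\<^sub>x\<^sub>x\<close> is a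
  locally Lipschitz map from states to \<open>L\<^sup>2\<close>.  After a radial truncation it is globally Lipschitz and
  a Picard iteration solves the equation.  To remove the truncation one needs an a priori bound
  (\<open>sol_a_priori\<close>): the potential energy \<open>- P/2 q + S/4 q\<^sup>2\<close> with \<open>q = \<parallel>U\<^sub>x\<parallel>\<^sup>2\<close> is bounded below because
  \<open>S > 0\<close>, so the energy identity and Gronwall's inequality control \<open>\<parallel>U'\<parallel>\<^sub>0\<close> and \<open>\<parallel>U\<parallel>\<^sub>2\<close>.  The nonlinear
  energy identity (\<open>sol_energy\<close>) comes from the linear one once \<open>q' = - 2 (U\<^sub>x\<^sub>x, U')\<^sub>0\<close> is known; this
  holds although \<open>U\<^sub>x\<close> need not be differentiable in time, because difference quotients of \<open>q\<close> can be
  integrated by parts in space (\<open>stretch_derivative\<close>).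

  \<^emph>\<open>The function spaces.\<close>  What has to be proved about \<open>H\<^sup>2\<^sub>*(\<Omega>)\<close> is the identity
  \<open>(U\<^sub>x, V\<^sub>x)\<^sub>0 = - (U\<^sub>x\<^sub>x, V)\<^sub>0\<close>, the coercivity of \<open>\<parallel>\<cdot>\<parallel>\<^sub>2\<close>, the closedness of the set of states and the
  density of \<open>H\<^sup>2\<^sub>*(\<Omega>)\<close> in \<open>L\<^sup>2(\<Omega>)\<close>.  On the rectangle all of it follows from one representation: for
  almost every \<open>y\<close> a weakly differentiable function is a primitive of its derivative along the
  horizontal line at height \<open>y\<close> (\<open>weak_derivative_primitive\<close>), and the boundary condition on the vertical
  sides says that the constant and the mean of \<open>U\<^sub>x\<close> on that line vanish (\<open>H2_star_trace\<close>).  Hence \<open>U\<close> is bounded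
  by \<open>U\<^sub>x\<close> and \<open>U\<^sub>x\<^sub>y\<close> in the supremum norm (\<open>H2_star_sup_bound\<close>), and \<open>U\<^sub>y\<close> by \<open>U\<^sub>x\<^sub>y\<close>
  in \<open>L\<^sup>2\<close> (\<open>H2_star_uy_bound\<close>).

  \<^emph>\<open>Back to the plate.\<close>  Bounded functionals on \<open>H\<^sup>2\<^sub>*(\<Omega>)\<close> of the form \<open>V \<mapsto> a \<bullet> state V\<close> translate between
  derivatives in the dual space and ordinary derivatives of Hilbert-space valued curves, in both
  directions (\<open>weak_solution_imp_sol\<close>, \<open>sol_imp_weak_solution\<close>).
\<close>

section \<open>Hilbert space curves\<close>

text \<open>
  The classical argument: by the parallelogram law a minimizing sequence for the distance to \<open>M\<close> is
  Cauchy, and at a minimizer the first variation vanishes.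
\<close>

lemma orthogonal_projection_exists:
  fixes M :: "'a::{real_inner,banach} set"
  assumes M: "subspace M" "closed M"
  shows "\<exists>y\<in>M. \<forall>z\<in>M. (x - y) \<bullet> z = 0"
proof -
  define d where "d = (INF y\<in>M. (norm (x - y))\<^sup>2)"
  have ne: "M \<noteq> {}" using M subspace_0 by blast
  have bdd: "bdd_below ((\<lambda>y. (norm (x - y))\<^sup>2) ` M)" by (rule bdd_belowI2[of _ 0]) simp
  have d_le: "d \<le> (norm (x - y))\<^sup>2" if "y \<in> M" for y
    unfolding d_def using bdd that by (rule cINF_lower)
  have "\<exists>y\<in>M. (norm (x - y))\<^sup>2 < d + 1 / Suc n" for n :: nat
  proof -
    have "d < d + 1 / Suc n" by simp
    then show ?thesis using ne bdd unfolding d_def by (subst (asm) (1) cINF_less_iff) auto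
  qed
  then obtain Y where Y: "\<And>n. Y n \<in> M" "\<And>n. (norm (x - Y n))\<^sup>2 < d + 1 / Suc n" by metis
  have par: "(norm (Y m - Y n))\<^sup>2 \<le> 2 * (1 / Suc m + 1 / Suc n)" for m n
  proof -
    have "(1/2) *\<^sub>R (Y m + Y n) \<in> M" using M Y by (simp add: subspace_add subspace_scale)
    then have "d \<le> (norm (x - (1/2) *\<^sub>R (Y m + Y n)))\<^sup>2" by (rule d_le)
    moreover have "(norm (Y m - Y n))\<^sup>2 + 4 * (norm (x - (1/2) *\<^sub>R (Y m + Y n)))\<^sup>2
        = 2 * (norm (x - Y m))\<^sup>2 + 2 * (norm (x - Y n))\<^sup>2"
      unfolding power2_norm_eq_inner
      by (simp add: inner_simps inner_commute algebra_simps)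
    ultimately show ?thesis using Y(2)[of m] Y(2)[of n] by (simp add: algebra_simps)
  qed
  have aux: "a \<le> c \<Longrightarrow> b \<le> c \<Longrightarrow> c < q / 4 \<Longrightarrow> 2 * (a + b) < q" for a b c q :: real by argo
  have "Cauchy Y"
  proof (rule metric_CauchyI)
    fix e :: real assume e: "e > 0"
    obtain N where N: "1 / real (Suc N) < e\<^sup>2 / 4"
      using reals_Archimedean[of "e\<^sup>2 / 4"] e by (auto simp: inverse_eq_divide)
    have "dist (Y m) (Y n) < e" if "m \<ge> N" "n \<ge> N" for m n
    proof -
      have "1 / real (Suc m) \<le> 1 / real (Suc N)" "1 / real (Suc n) \<le> 1 / real (Suc N)"
        using that by (auto intro!: divide_left_mono)
      then have "2 * (1 / real (Suc m) + 1 / real (Suc n)) < e\<^sup>2"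
        using N aux by blast
      then have "(norm (Y m - Y n))\<^sup>2 < e\<^sup>2" using par[of m n] by linarith
      then show ?thesis using e by (simp add: dist_norm power_less_imp_less_base)
    qed
    then show "\<exists>M. \<forall>m\<ge>M. \<forall>n\<ge>M. dist (Y m) (Y n) < e" by blast
  qed
  then obtain y where y: "Y \<longlonglongrightarrow> y" using Cauchy_convergent convergent_def by blast
  have yM: "y \<in> M" using closed_sequentially[OF M(2)] Y y by blast
  have "(\<lambda>n. (norm (x - Y n))\<^sup>2) \<longlonglongrightarrow> (norm (x - y))\<^sup>2"
    by (intro tendsto_intros y)
  moreover have "(\<lambda>n. d + 1 / Suc n) \<longlonglongrightarrow> d + 0"
    by (intro tendsto_intros LIMSEQ_Suc[OF lim_1_over_n])
  ultimately have "(norm (x - y))\<^sup>2 \<le> d + 0"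
    by (rule LIMSEQ_le) (use Y less_imp_le in blast)
  then have min: "(norm (x - y))\<^sup>2 \<le> (norm (x - z))\<^sup>2" if "z \<in> M" for z
    using d_le[OF that] by linarith
  have sq: "(a - c *\<^sub>R z) \<bullet> (a - c *\<^sub>R z) = a \<bullet> a - 2 * c * (a \<bullet> z) + c * c * (z \<bullet> z)" for a z :: 'a and c
    by (simp add: inner_diff_left inner_diff_right inner_commute[of z a] algebra_simps)
  have "(x - y) \<bullet> z = 0" if z: "z \<in> M" for z
  proof (cases "z = 0")
    case False
    \<comment> \<open>the step that minimizes the distance from \<open>x\<close> along the line \<open>y + c z\<close>\<close>
    define c where "c = ((x - y) \<bullet> z) / (z \<bullet> z)"
    have zz: "z \<bullet> z > 0" using False by simp
    have "y + c *\<^sub>R z \<in> M" using M yM z by (simp add: subspace_add subspace_scale)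
    from min[OF this] have "(x-y)\<bullet>(x-y) \<le> ((x-y) - c *\<^sub>R z) \<bullet> ((x-y) - c *\<^sub>R z)"
      by (simp add: power2_norm_eq_inner algebra_simps)
    also have "\<dots> = (x-y)\<bullet>(x-y) - 2 * c * ((x-y) \<bullet> z) + c * c * (z \<bullet> z)"
      by (rule sq)
    also have "c * c * (z \<bullet> z) = c * ((x-y) \<bullet> z)" using zz by (simp add: c_def)
    finally have "c * ((x-y) \<bullet> z) \<le> 0" by simp
    moreover have "c * ((x-y) \<bullet> z) = ((x-y) \<bullet> z)\<^sup>2 / (z \<bullet> z)" by (simp add: c_def power2_eq_square)
    ultimately have "((x-y) \<bullet> z)\<^sup>2 \<le> 0" using zz by (simp add: divide_le_0_iff)
    then show ?thesis by simp
  qed simp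
  then show ?thesis using yM by blast
qed

lemma continuous_on_integrable_sub:
  fixes f :: "real \<Rightarrow> 'a::banach"
  assumes "continuous_on {0..T} f" "t \<in> {0..T}"
  shows "f integrable_on {0..t}"
  by (rule integrable_continuous_real, rule continuous_on_subset[OF assms(1)]) (use assms(2) in auto)

lemma integral_inner_left:
  fixes f :: "real \<Rightarrow> 'a::{real_inner,banach}"
  assumes "f integrable_on S"
  shows "integral S f \<bullet> y = integral S (\<lambda>s. f s \<bullet> y)"
  using integral_linear[OF assms bounded_linear_inner_left[of y]] unfolding o_def by (rule sym)

lemma integral_of_vector_derivative:
  fixes f :: "real \<Rightarrow> 'a::banach"
  assumes "\<And>t. t \<in> {0..T} \<Longrightarrow> (x has_vector_derivative f t) (at t within {0..T})" "t \<in> {0..T}"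
  shows "integral {0..t} f = x t - x 0"
proof (rule integral_unique, rule fundamental_theorem_of_calculus)
  show "0 \<le> t" using assms by auto
  fix s assume "s \<in> {0..t}"
  then show "(x has_vector_derivative f s) (at s within {0..t})"
    using assms(1)[of s] assms(2) by (auto intro: has_vector_derivative_within_subset[of _ _ _ "{0..T}"])
qed

lemma integral_eq_imp_has_vector_derivative:
  fixes f :: "real \<Rightarrow> 'a::banach"
  assumes "continuous_on {0..T} f" "\<And>t. t \<in> {0..T} \<Longrightarrow> x t = x0 + integral {0..t} f" "t \<in> {0..T}"
  shows "(x has_vector_derivative f t) (at t within {0..T})"
proof -
  have "((\<lambda>t. x0 + integral {0..t} f) has_vector_derivative f t) (at t within {0..T})"
    using integral_has_vector_derivative[OF assms(1,3)]
    by (auto intro!: derivative_eq_intros)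
  then show ?thesis
    by (rule has_vector_derivative_transform[rotated 2]) (use assms in auto)
qed

lemma inner_self_integral:
  fixes x :: "real \<Rightarrow> 'a::{real_inner,banach}"
  assumes f: "continuous_on {0..T} f"
    and x: "\<And>t. t \<in> {0..T} \<Longrightarrow> x t = x0 + integral {0..t} f" and t: "t \<in> {0..T}"
  shows "x t \<bullet> x t = x0 \<bullet> x0 + 2 * integral {0..t} (\<lambda>s. f s \<bullet> x s)"
proof -
  have d: "(x has_vector_derivative f t) (at t within {0..T})" if "t \<in> {0..T}" for t
    by (rule integral_eq_imp_has_vector_derivative[OF f x that])
  have "((\<lambda>t. x t \<bullet> x t) has_vector_derivative 2 * (f t \<bullet> x t)) (at t within {0..T})" if "t \<in> {0..T}" for t
    using d[OF that] unfolding has_vector_derivative_def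
    by (auto intro!: derivative_eq_intros simp: inner_commute algebra_simps)
  from integral_of_vector_derivative[OF this t]
  have "integral {0..t} (\<lambda>s. 2 * (f s \<bullet> x s)) = x t \<bullet> x t - x 0 \<bullet> x 0" .
  moreover have "x 0 = x0" using x[of 0] t by simp
  ultimately show ?thesis by simp
qed

text \<open>
  Evaluating the quadratic inequality where \<open>|x|\<close> is largest on \<open>[0, t]\<close> allows one factor of that maximum
  to be cancelled.
\<close>

lemma norm_le_of_energy_le:
  fixes x g :: "real \<Rightarrow> 'a::{real_inner,banach}"
  assumes x: "continuous_on {0..T} x" and g: "continuous_on {0..T} g"
    and e: "\<And>t. t \<in> {0..T} \<Longrightarrow> x t \<bullet> x t \<le> x 0 \<bullet> x 0 + 2 * integral {0..t} (\<lambda>s. g s \<bullet> x s)"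
    and t: "t \<in> {0..T}"
  shows "norm (x t) \<le> norm (x 0) + 2 * integral {0..t} (\<lambda>s. norm (g s))"
proof -
  have "continuous_on {0..t} (\<lambda>s. norm (x s))"
    using x t by (intro continuous_intros) (auto intro: continuous_on_subset)
  moreover have "compact {0..t}" "{0..t} \<noteq> {}" using t by auto
  ultimately obtain u where u: "u \<in> {0..t}" "\<And>s. s \<in> {0..t} \<Longrightarrow> norm (x s) \<le> norm (x u)"
    using continuous_attains_sup by metis
  let ?M = "norm (x u)"
  have uT: "u \<in> {0..T}" using u t by auto
  have gi: "(\<lambda>s. norm (g s)) integrable_on {0..t}" if "t \<in> {0..T}" for t
    by (rule continuous_on_integrable_sub[OF _ that]) (intro continuous_intros g)
  have gxi: "(\<lambda>s. g s \<bullet> x s) integrable_on {0..u}"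
    by (rule continuous_on_integrable_sub[OF _ uT]) (intro continuous_intros g x)
  have "?M * ?M = x u \<bullet> x u" by (simp add: power2_norm_eq_inner[symmetric] power2_eq_square)
  also have "\<dots> \<le> x 0 \<bullet> x 0 + 2 * integral {0..u} (\<lambda>s. g s \<bullet> x s)" by (rule e[OF uT])
  also have "integral {0..u} (\<lambda>s. g s \<bullet> x s) \<le> integral {0..u} (\<lambda>s. norm (g s) * ?M)"
  proof (rule integral_le[OF gxi])
    show "(\<lambda>s. norm (g s) * ?M) integrable_on {0..u}"
      using gi[OF uT] by (rule integrable_on_mult_left)
    show "g s \<bullet> x s \<le> norm (g s) * ?M" if "s \<in> {0..u}" for s
    proof -
      have "norm (x s) \<le> ?M" using u that by auto
      then show ?thesis using norm_cauchy_schwarz[of "g s" "x s"]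
        by (meson mult_left_mono norm_ge_zero order_trans)
    qed
  qed
  also have "integral {0..u} (\<lambda>s. norm (g s) * ?M) \<le> integral {0..t} (\<lambda>s. norm (g s)) * ?M"
  proof -
    have "integral {0..u} (\<lambda>s. norm (g s)) \<le> integral {0..t} (\<lambda>s. norm (g s))"
      by (rule integral_subset_le) (use u gi[OF uT] gi[OF t] in auto)
    then show ?thesis by (simp add: mult_right_mono)
  qed
  also have "x 0 \<bullet> x 0 \<le> norm (x 0) * ?M"
    using u(2)[of 0] t by (simp add: power2_norm_eq_inner[symmetric] power2_eq_square mult_left_mono)
  finally have "?M * ?M \<le> (norm (x 0) + 2 * integral {0..t} (\<lambda>s. norm (g s))) * ?M"
    by (simp add: algebra_simps)
  moreover have "norm (x 0) + 2 * integral {0..t} (\<lambda>s. norm (g s)) \<ge> 0"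
    using integral_nonneg[OF gi[OF t]] by simp
  ultimately have "?M \<le> norm (x 0) + 2 * integral {0..t} (\<lambda>s. norm (g s))"
    by (cases "?M = 0") (auto simp: mult_le_cancel_right)
  then show ?thesis using u(2)[of t] t by simp
qed

text \<open>
  The function \<open>exp (- b t) (a + b \<integral> f)\<close> has a nonpositive derivative.
\<close>

lemma gronwall:
  fixes f :: "real \<Rightarrow> real"
  assumes f: "continuous_on {0..T} f" and b: "b \<ge> 0"
    and le: "\<And>t. t \<in> {0..T} \<Longrightarrow> f t \<le> a + b * integral {0..t} f" and t: "t \<in> {0..T}"
  shows "f t \<le> a * exp (b * t)"
proof -
  define h where "h = (\<lambda>t. exp (- b * t) * (a + b * integral {0..t} f))"
  have d: "(h has_derivative (\<lambda>y. y * (exp (- b * s) * b * (f s - (a + b * integral {0..s} f))))) (at s within {0..t})"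
    if s: "s \<in> {0..t}" for s
  proof -
    have "((\<lambda>u. integral {0..u} f) has_vector_derivative f s) (at s within {0..t})"
      by (rule integral_has_vector_derivative) (use f t s in \<open>auto intro: continuous_on_subset\<close>)
    then have "((\<lambda>u. integral {0..u} f) has_field_derivative f s) (at s within {0..t})"
      by (simp add: has_real_derivative_iff_has_vector_derivative)
    then have "(h has_field_derivative (exp (- b * s) * b * (f s - (a + b * integral {0..s} f)))) (at s within {0..t})"
      unfolding h_def by (auto intro!: derivative_eq_intros simp: algebra_simps)
    then show ?thesis unfolding has_field_derivative_def
      by (rule has_derivative_eq_rhs) (simp add: fun_eq_iff mult.commute)
  qed
  have "\<exists>s\<in>{0..t}. h t - h 0 = (t - 0) * (exp (- b * s) * b * (f s - (a + b * integral {0..s} f)))"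
    by (rule mvt_very_simple) (use t d in auto)
  then obtain s where s: "s \<in> {0..t}" "h t - h 0 = t * (exp (- b * s) * b * (f s - (a + b * integral {0..s} f)))" by auto
  have "f s - (a + b * integral {0..s} f) \<le> 0" using le[of s] s t by auto
  then have "h t \<le> h 0" using s b t
    by (smt (verit, ccfv_threshold) atLeastAtMost_iff exp_ge_zero mult_nonneg_nonneg mult_nonneg_nonpos)
  then have "h t \<le> a" by (simp add: h_def)
  have "f t \<le> a + b * integral {0..t} f" by (rule le[OF t])
  also have "\<dots> = exp (b * t) * h t" by (simp add: h_def exp_minus)
  also have "\<dots> \<le> exp (b * t) * a" using \<open>h t \<le> a\<close> by simp
  finally show ?thesis by (simp add: mult.commute)
qed

text \<open>
  The Lipschitz constant times the length of the interval may exceed one, so this is not a direct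
  contraction argument: the \<open>n\<close>-th iterate of a Volterra operator has Lipschitz constant at most
  \<open>(L t)\<^sup>n / n!\<close>, which is summable.
\<close>

lemma volterra_fixed_point:
  fixes \<Phi> :: "(real \<Rightarrow> 'a::banach) \<Rightarrow> real \<Rightarrow> 'a"
  assumes T: "T \<ge> 0" and cont: "\<And>x. continuous_on {0..T} x \<Longrightarrow> continuous_on {0..T} (\<Phi> x)"
    and L: "L \<ge> 0" and lip: "\<And>x y t. continuous_on {0..T} x \<Longrightarrow> continuous_on {0..T} y \<Longrightarrow> t \<in> {0..T} \<Longrightarrow>
       norm (\<Phi> x t - \<Phi> y t) \<le> L * integral {0..t} (\<lambda>s. norm (x s - y s))"
  shows "\<exists>x. continuous_on {0..T} x \<and> (\<forall>t\<in>{0..T}. \<Phi> x t = x t)"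
proof -
  define X where "X n = (\<Phi> ^^ n) (\<lambda>_. 0)" for n
  have XS: "X (Suc n) = \<Phi> (X n)" for n by (simp add: X_def)
  have Xc: "continuous_on {0..T} (X n)" for n
  proof (induction n)
    case 0
    show ?case by (simp add: X_def)
  next
    case (Suc n)
    then show ?case unfolding XS by (rule cont)
  qed
  have "continuous_on {0..T} (\<lambda>t. norm (X 1 t - X 0 t))"
    by (intro continuous_intros Xc)
  then obtain u where "\<And>t. t \<in> {0..T} \<Longrightarrow> norm (X 1 t - X 0 t) \<le> norm (X 1 u - X 0 u)"
    using continuous_attains_sup[of "{0..T}" "\<lambda>t. norm (X 1 t - X 0 t)"] T atLeastAtMost_iff
    by (metis compact_Icc empty_iff order_refl)
  then obtain B where B: "\<And>t. t \<in> {0..T} \<Longrightarrow> norm (X 1 t - X 0 t) \<le> B" by blast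
  have B0: "B \<ge> 0" using order_trans[OF norm_ge_zero B[of 0]] T by simp
  have bnd: "norm (X (Suc n) t - X n t) \<le> B * (L * t) ^ n / fact n" if "t \<in> {0..T}" for n t
    using that
  proof (induction n arbitrary: t)
    case 0
    then show ?case using B by simp
  next
    case (Suc n)
    have "norm (X (Suc (Suc n)) t - X (Suc n) t) \<le> L * integral {0..t} (\<lambda>s. norm (X (Suc n) s - X n s))"
      unfolding XS[of "Suc n"] XS[of n] using lip[OF Xc[of "Suc n"] Xc[of n] Suc.prems] by (simp add: XS)
    also have "integral {0..t} (\<lambda>s. norm (X (Suc n) s - X n s)) \<le> integral {0..t} (\<lambda>s. B * (L * s) ^ n / fact n)"
    proof (rule integral_le)
      show "(\<lambda>s. norm (X (Suc n) s - X n s)) integrable_on {0..t}"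
        by (rule continuous_on_integrable_sub[OF _ Suc.prems]) (intro continuous_intros Xc)
      show "(\<lambda>s. B * (L * s) ^ n / fact n) integrable_on {0..t}"
        by (intro integrable_continuous_real continuous_intros) auto
    qed (use Suc in auto)
    also have "integral {0..t} (\<lambda>s. B * (L * s) ^ n / fact n) = B * L ^ n * t ^ Suc n / fact (Suc n)"
    proof -
      have "((\<lambda>s. B * (L * s) ^ n / fact n) has_integral
          (B * L ^ n * t ^ Suc n / fact (Suc n) - B * L ^ n * 0 ^ Suc n / fact (Suc n))) {0..t}"
      proof (rule fundamental_theorem_of_calculus)
        fix s :: real assume "s \<in> {0..t}"
        have "((\<lambda>s. B * L ^ n * s ^ Suc n / fact (Suc n)) has_real_derivative (B * (L * s) ^ n / fact n)) (at s within {0..t})"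
          using DERIV_cmult[OF DERIV_pow[of "Suc n" s "{0..t}"], of "B * L ^ n / fact (Suc n)"]
          by (simp add: power_mult_distrib fact_Suc field_simps del: of_nat_Suc power_Suc)
        then show "((\<lambda>s. B * L ^ n * s ^ Suc n / fact (Suc n)) has_vector_derivative (B * (L * s) ^ n / fact n)) (at s within {0..t})"
          by (simp add: has_real_derivative_iff_has_vector_derivative)
      qed (use Suc.prems in auto)
      then show ?thesis by (intro integral_unique) simp
    qed
    finally have "norm (X (Suc (Suc n)) t - X (Suc n) t) \<le> L * (B * L ^ n * t ^ Suc n / fact (Suc n))"
      using L by (simp only: mult_left_mono)
    then show ?case by (simp only: power_mult_distrib power_Suc times_divide_eq_right mult_ac)
  qed
  have "uniform_limit {0..T} (\<lambda>n t. \<Sum>i<n. X (Suc i) t - X i t) (\<lambda>t. suminf (\<lambda>i. X (Suc i) t - X i t)) sequentially"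
  proof (rule Weierstrass_m_test)
    show "norm (X (Suc n) t - X n t) \<le> B * ((L * T) ^ n / fact n)" if "t \<in> {0..T}" for n t
    proof -
      have "(L * t) ^ n \<le> (L * T) ^ n" using that L by (intro power_mono mult_left_mono) auto
      then have "B * (L * t) ^ n / fact n \<le> B * (L * T) ^ n / fact n"
        using B0 by (intro divide_right_mono mult_left_mono) auto
      then show ?thesis using bnd[OF that, of n] by simp
    qed
    show "summable (\<lambda>n. B * ((L * T) ^ n / fact n))"
      using summable_exp_generic[of "L * T"] by (intro summable_mult) (simp add: divide_inverse mult.commute)
  qed
  moreover have "(\<Sum>i<n. X (Suc i) t - X i t) = X n t" for n t
    using sum_lessThan_telescope[of "\<lambda>i. X i t" n] by (simp add: X_def)
  ultimately obtain x where lim: "uniform_limit {0..T} X x sequentially" by force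
  have xc: "continuous_on {0..T} x"
    by (rule uniform_limit_theorem[OF _ lim]) (auto simp: Xc)
  have "\<Phi> x t = x t" if t: "t \<in> {0..T}" for t
  proof -
    have "norm (\<Phi> x t - x t) \<le> (L * T + 1) * e" if e: "e > 0" for e
    proof -
      have "\<forall>\<^sub>F n in sequentially. \<forall>s\<in>{0..T}. dist (X n s) (x s) < e"
        using lim e by (auto simp: uniform_limit_iff)
      then obtain N where N: "\<And>n s. n \<ge> N \<Longrightarrow> s \<in> {0..T} \<Longrightarrow> norm (X n s - x s) < e"
        unfolding eventually_sequentially dist_norm by blast
      have "norm (\<Phi> x t - \<Phi> (X N) t) \<le> L * integral {0..t} (\<lambda>s. norm (x s - X N s))"
        by (rule lip[OF xc Xc t])
      also have "integral {0..t} (\<lambda>s. norm (x s - X N s)) \<le> integral {0..t} (\<lambda>s. e)"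
      proof (rule integral_le)
        show "(\<lambda>s. norm (x s - X N s)) integrable_on {0..t}"
          by (rule continuous_on_integrable_sub[OF _ t]) (intro continuous_intros xc Xc)
        show "norm (x s - X N s) \<le> e" if "s \<in> {0..t}" for s
          using N[of N s] that t by (auto simp: norm_minus_commute intro: less_imp_le)
      qed auto
      also have "\<dots> \<le> T * e" using t e by simp
      finally have "norm (\<Phi> x t - \<Phi> (X N) t) \<le> L * (T * e)" using L by (simp add: mult_left_mono)
      moreover have "norm (\<Phi> (X N) t - x t) \<le> e" using N[of "Suc N" t] t by (simp add: XS)
      ultimately show ?thesis
        using norm_triangle_ineq[of "\<Phi> x t - \<Phi> (X N) t" "\<Phi> (X N) t - x t"] by (simp add: algebra_simps)
    qed
    note est = this
    have "norm (\<Phi> x t - x t) \<le> 0 + e" if "e > 0" for e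
    proof -
      have p: "L * T + 1 > 0" using L T by (simp add: add_nonneg_pos)
      show ?thesis using est[of "e / (L * T + 1)"] that p by simp
    qed
    then have "norm (\<Phi> x t - x t) \<le> 0" using field_le_epsilon by blast
    then show ?thesis by simp
  qed
  then show ?thesis using xc by blast
qed

text \<open>
  The form in which the Cauchy property arises from energy estimates: the error of each approximation
  is measured by a null sequence.
\<close>

lemma uniform_limit_of_dist_le:
  fixes X :: "nat \<Rightarrow> 'b \<Rightarrow> 'a::banach"
  assumes "\<And>m n t. t \<in> S \<Longrightarrow> norm (X m t - X n t) \<le> \<epsilon> m + \<epsilon> n" and "\<epsilon> \<longlonglongrightarrow> 0"
  shows "\<exists>x. uniform_limit S X x sequentially"
proof -
  have "uniformly_Cauchy_on S X"
    unfolding uniformly_Cauchy_on_def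
  proof (intro allI impI)
    fix e :: real assume "e > 0"
    then have "\<forall>\<^sub>F n in sequentially. \<epsilon> n < e / 2" using assms(2) by (intro order_tendstoD) auto
    then obtain N where "\<And>n. n \<ge> N \<Longrightarrow> \<epsilon> n < e / 2" by (auto simp: eventually_sequentially)
    then show "\<exists>M. \<forall>x\<in>S. \<forall>m\<ge>M. \<forall>n\<ge>M. dist (X m x) (X n x) < e"
      by (intro exI[of _ N]) (smt (verit) assms(1) dist_norm field_sum_of_halves)
  qed
  then show ?thesis
    using Cauchy_uniformly_convergent uniformly_convergent_on_def by blast
qed

lemma tendsto_integral_uniform:
  fixes f :: "nat \<Rightarrow> real \<Rightarrow> 'a::banach"
  assumes u: "uniform_limit {0..T} f g sequentially"
    and c: "\<And>n. continuous_on {0..T} (f n)" and t: "t \<in> {0..T}"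
  shows "(\<lambda>n. integral {0..t} (f n)) \<longlonglongrightarrow> integral {0..t} g"
proof -
  have u': "uniform_limit {0..t} f g sequentially"
    by (rule uniform_limit_on_subset[OF u]) (use t in auto)
  have c': "continuous_on {0..t} (f n)" for n by (rule continuous_on_subset[OF c]) (use t in auto)
  obtain I J where "\<And>n. (f n has_integral I n) {0..t}" "(g has_integral J) {0..t}" "I \<longlonglongrightarrow> J"
    using uniform_limit_integral[OF u' c'] by auto
  moreover have "integral {0..t} (f n) = I n" for n by (rule integral_unique) fact
  moreover have "integral {0..t} g = J" by (rule integral_unique) fact
  ultimately show ?thesis by simp
qed

section \<open>Evolution equations with a skew-adjoint relation\<close>

definition step :: "nat \<Rightarrow> real" where "step n = 1 / real (Suc n)"

lemma step_pos: "step n > 0" by (simp add: step_def)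
lemma step_nonzero: "step n \<noteq> 0" "- step n \<noteq> 0" using step_pos[of n] by auto
lemma step_tendsto: "step \<longlonglongrightarrow> 0"
  unfolding step_def using LIMSEQ_Suc[OF lim_1_over_n] by simp

lemma subspace_closure_normed:
  fixes S :: "'a::real_normed_vector set"
  assumes S: "subspace S" shows "subspace (closure S)"
  unfolding subspace_def
proof (intro conjI ballI allI)
  show "0 \<in> closure S" using closure_subset subspace_0[OF S] by blast
  fix x y assume "x \<in> closure S" "y \<in> closure S"
  then obtain f g where "\<And>n. f n \<in> S" "f \<longlonglongrightarrow> x" "\<And>n. g n \<in> S" "g \<longlonglongrightarrow> y"
    unfolding closure_sequential by blast
  then have "\<And>n. f n + g n \<in> S" "(\<lambda>n. f n + g n) \<longlonglongrightarrow> x + y"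
    by (auto intro: subspace_add[OF S] tendsto_add)
  then show "x + y \<in> closure S" unfolding closure_sequential by (intro exI[of _ "\<lambda>n. f n + g n"]) auto
next
  fix c x assume "x \<in> closure S"
  then obtain f where "\<And>n. f n \<in> S" "f \<longlonglongrightarrow> x" unfolding closure_sequential by blast
  then have "\<And>n. c *\<^sub>R f n \<in> S" "(\<lambda>n. c *\<^sub>R f n) \<longlonglongrightarrow> c *\<^sub>R x"
    by (auto intro: subspace_scale[OF S] tendsto_scaleR)
  then show "c *\<^sub>R x \<in> closure S" unfolding closure_sequential by (intro exI[of _ "\<lambda>n. c *\<^sub>R f n"]) auto
qed

text \<open>
  A skew-adjoint operator is encoded by its graph \<open>R\<close>, which may be multivalued; this is what happens when
  the domain is not dense.  The range condition for both signs of \<open>\<mu>\<close> expresses equality with the adjoint.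
\<close>

locale skew_relation =
  fixes R :: "('x::{real_inner,banach} \<times> 'x) set"
  assumes sub: "subspace R"
    and skew: "(x, y) \<in> R \<Longrightarrow> (x', y') \<in> R \<Longrightarrow> y \<bullet> x' = - (x \<bullet> y')"
    and range: "\<mu> \<noteq> 0 \<Longrightarrow> \<exists>x y. (x, y) \<in> R \<and> x - \<mu> *\<^sub>R y = f"
begin

lemma skew_self: "(x, y) \<in> R \<Longrightarrow> y \<bullet> x = 0"
  using skew[of x y x y] by (simp add: inner_commute)

lemma R_add: "(x, y) \<in> R \<Longrightarrow> (x', y') \<in> R \<Longrightarrow> (x + x', y + y') \<in> R"
  using subspace_add[OF sub, of "(x,y)" "(x',y')"] by simp

lemma R_diff: "(x, y) \<in> R \<Longrightarrow> (x', y') \<in> R \<Longrightarrow> (x - x', y - y') \<in> R"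
  using subspace_diff[OF sub, of "(x,y)" "(x',y')"] by simp

lemma R_scale: "(x, y) \<in> R \<Longrightarrow> (c *\<^sub>R x, c *\<^sub>R y) \<in> R"
  using subspace_scale[OF sub, of "(x,y)" c] by simp

text \<open>
  The resolvent \<open>(1 - \<mu> R)\<^sup>-\<^sup>1\<close>.
\<close>

definition J :: "real \<Rightarrow> 'x \<Rightarrow> 'x" where
  "J \<mu> f = (SOME x. \<exists>y. (x, y) \<in> R \<and> x - \<mu> *\<^sub>R y = f)"

text \<open>
  The Yosida approximation, a bounded operator with \<open>A \<mu> = R (J \<mu>)\<close>.
\<close>

definition A :: "real \<Rightarrow> 'x \<Rightarrow> 'x" where
  "A \<mu> f = (1 / \<mu>) *\<^sub>R (J \<mu> f - f)"

lemma J_mem: assumes "\<mu> \<noteq> 0" shows "(J \<mu> f, A \<mu> f) \<in> R"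
proof -
  have "\<exists>x y. (x, y) \<in> R \<and> x - \<mu> *\<^sub>R y = f" by (rule range[OF assms])
  then have "\<exists>y. (J \<mu> f, y) \<in> R \<and> J \<mu> f - \<mu> *\<^sub>R y = f" unfolding J_def by (rule someI_ex)
  then obtain y where y: "(J \<mu> f, y) \<in> R" "J \<mu> f - \<mu> *\<^sub>R y = f" by blast
  have "A \<mu> f = (1 / \<mu>) *\<^sub>R (\<mu> *\<^sub>R y)" unfolding A_def using y(2) by (simp add: algebra_simps)
  then show ?thesis using y assms by simp
qed

lemma J_eq: "\<mu> \<noteq> 0 \<Longrightarrow> J \<mu> f = f + \<mu> *\<^sub>R A \<mu> f"
  by (simp add: A_def)

text \<open>
  The difference \<open>u\<close> of two solutions satisfies \<open>u = \<mu> w\<close> with \<open>(u, w) \<in> R\<close>, and skewness gives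
  \<open>u \<bullet> u = \<mu> (w \<bullet> u) = 0\<close>.
\<close>

lemma J_unique:
  assumes l: "\<mu> \<noteq> 0" and R: "(x, y) \<in> R" "x - \<mu> *\<^sub>R y = f"
  shows "J \<mu> f = x" and "A \<mu> f = y"
proof -
  let ?u = "J \<mu> f - x" and ?w = "A \<mu> f - y"
  have m: "(?u, ?w) \<in> R" by (rule R_diff[OF J_mem[OF l] R(1)])
  have e: "?u = \<mu> *\<^sub>R ?w" using J_eq[OF l, of f] R(2) by (simp add: algebra_simps)
  have "?u \<bullet> ?u = \<mu> * (?w \<bullet> ?u)" by (subst (1) e) (simp only: inner_scaleR_left)
  then have "?u = 0" using skew_self[OF m] by simp
  then show "J \<mu> f = x" by simp
  show "A \<mu> f = y" using e \<open>?u = 0\<close> l by simp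
qed

lemma J_add: "\<mu> \<noteq> 0 \<Longrightarrow> J \<mu> (f + g) = J \<mu> f + J \<mu> g"
  by (rule J_unique(1)[OF _ R_add[OF J_mem J_mem]]) (simp_all add: J_eq algebra_simps)

lemma J_scale: "\<mu> \<noteq> 0 \<Longrightarrow> J \<mu> (c *\<^sub>R f) = c *\<^sub>R J \<mu> f"
  by (rule J_unique(1)[OF _ R_scale[OF J_mem]]) (simp_all add: J_eq algebra_simps)

lemma J_inner: assumes "\<mu> \<noteq> 0" shows "J \<mu> f \<bullet> J \<mu> f = f \<bullet> J \<mu> f"
proof -
  have "A \<mu> f \<bullet> J \<mu> f = 0" by (rule skew_self[OF J_mem[OF assms]])
  then show ?thesis using J_eq[OF assms, of f] by (metis add.right_neutral inner_add_left inner_scaleR_left mult_zero_right)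
qed

lemma J_norm: assumes "\<mu> \<noteq> 0" shows "norm (J \<mu> f) \<le> norm f"
proof -
  have "norm (J \<mu> f) * norm (J \<mu> f) = f \<bullet> J \<mu> f"
    using J_inner[OF assms, of f] by (simp add: power2_norm_eq_inner[symmetric] power2_eq_square)
  also have "\<dots> \<le> norm f * norm (J \<mu> f)" by (rule norm_cauchy_schwarz)
  finally show ?thesis
    by (cases "norm (J \<mu> f) = 0") (auto simp: mult_le_cancel_right)
qed

lemma J_linear: "\<mu> \<noteq> 0 \<Longrightarrow> bounded_linear (J \<mu>)"
  by (rule bounded_linear_intro[where K=1]) (simp_all add: J_add J_scale J_norm)

lemma A_linear: "\<mu> \<noteq> 0 \<Longrightarrow> bounded_linear (A \<mu>)"
  unfolding A_def by (intro bounded_linear_intros J_linear)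

lemma J_diff: "\<mu> \<noteq> 0 \<Longrightarrow> J \<mu> (f - g) = J \<mu> f - J \<mu> g"
  by (rule linear_diff[OF bounded_linear.linear[OF J_linear]])

text \<open>
  The adjoint of a resolvent is the resolvent with the opposite sign, by skewness.  This moves the
  regularization from a weak solution to the test vector.
\<close>

lemma J_adjoint: assumes l: "\<mu> \<noteq> 0" shows "J \<mu> f \<bullet> g = f \<bullet> J (- \<mu>) g"
proof -
  have l': "- \<mu> \<noteq> 0" using l by simp
  have s: "A \<mu> f \<bullet> J (-\<mu>) g = - (J \<mu> f \<bullet> A (-\<mu>) g)"
    by (rule skew[OF J_mem[OF l] J_mem[OF l']])
  have f: "f = J \<mu> f - \<mu> *\<^sub>R A \<mu> f" using J_eq[OF l, of f] by simp
  have g: "g = J (-\<mu>) g + \<mu> *\<^sub>R A (-\<mu>) g" using J_eq[OF l', of g] by simp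
  have "J \<mu> f \<bullet> g = J \<mu> f \<bullet> J (-\<mu>) g + \<mu> * (J \<mu> f \<bullet> A (-\<mu>) g)"
    by (subst g) (simp only: inner_add_right inner_scaleR_right)
  moreover have "f \<bullet> J (-\<mu>) g = J \<mu> f \<bullet> J (-\<mu>) g - \<mu> * (A \<mu> f \<bullet> J (-\<mu>) g)"
    by (subst f) (simp only: inner_diff_left inner_scaleR_left)
  ultimately show ?thesis using s by simp
qed

lemma A_dissipative: assumes "\<mu> > 0" shows "A \<mu> f \<bullet> f \<le> 0"
proof -
  have "f = J \<mu> f - \<mu> *\<^sub>R A \<mu> f" using J_eq[of \<mu> f] assms by simp
  then have "A \<mu> f \<bullet> f = A \<mu> f \<bullet> J \<mu> f - \<mu> * (A \<mu> f \<bullet> A \<mu> f)"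
    by (metis inner_diff_right inner_scaleR_right)
  moreover have "A \<mu> f \<bullet> J \<mu> f = 0" by (rule skew_self[OF J_mem]) (use assms in auto)
  ultimately show ?thesis using assms by simp
qed

text \<open>
  The orthogonal complement of the multivalued part of \<open>R\<close>.  It is the closure of the domain
  (\<open>dom_dense\<close>), and the space in which solutions live.
\<close>

definition X0 :: "'x set" where "X0 = {x. \<forall>k. (0, k) \<in> R \<longrightarrow> x \<bullet> k = 0}"

lemma X0_subspace: "subspace X0"
  unfolding X0_def by (auto simp: subspace_def inner_add_left)

lemma X0_closed: "closed X0"
proof -
  have "X0 = (\<Inter>k\<in>{k. (0, k) \<in> R}. {x. x \<bullet> k = 0})" by (auto simp: X0_def)
  moreover have "closed {x. x \<bullet> k = 0}" for k :: 'x
    by (intro closed_Collect_eq continuous_intros)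
  ultimately show ?thesis by (simp add: closed_INT)
qed

lemma dom_X0: "(x, y) \<in> R \<Longrightarrow> x \<in> X0"
  unfolding X0_def using skew[of x y 0] by (auto simp: inner_commute)

lemma J_X0: "\<mu> \<noteq> 0 \<Longrightarrow> J \<mu> f \<in> X0"
  using dom_X0[OF J_mem] .

lemma J_apply_dom: assumes l: "\<mu> \<noteq> 0" and R: "(x, y) \<in> R"
  shows "A \<mu> x = J \<mu> y"
proof -
  have "x = J \<mu> (x - \<mu> *\<^sub>R y)" by (rule J_unique(1)[OF l R, symmetric]) simp
  then have "x = J \<mu> x - \<mu> *\<^sub>R J \<mu> y" by (simp add: J_diff[OF l] J_scale[OF l])
  then have "J \<mu> x - x = \<mu> *\<^sub>R J \<mu> y" by (simp add: algebra_simps)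
  then show ?thesis using l unfolding A_def by simp
qed

text \<open>
  A vector of \<open>X0\<close> minus its projection onto the closure of the domain is the value of some
  \<open>u - w\<close> with \<open>(u, w) \<in> R\<close>; orthogonality and skewness force \<open>u = 0\<close>, so this difference lies in the
  multivalued part, to which it is also orthogonal.
\<close>

lemma dom_dense: assumes x: "x \<in> X0" shows "x \<in> closure (fst ` R)"
proof -
  let ?M = "closure (fst ` R)"
  have "subspace (fst ` R)" by (rule linear_subspace_image[OF linear_fst sub])
  then have M: "subspace ?M" "closed ?M" by (auto intro: subspace_closure_normed)
  from orthogonal_projection_exists[OF M, of x]
  obtain p where p: "p \<in> ?M" "\<And>z. z \<in> ?M \<Longrightarrow> (x - p) \<bullet> z = 0" by blast
  let ?k = "x - p"
  have "1 \<noteq> (0::real)" by simp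
  from range[OF this, of ?k] obtain u w where u: "(u, w) \<in> R" "u - w = ?k" by auto
  have "u \<in> ?M" using u(1) closure_subset by (force simp: image_iff)
  then have "?k \<bullet> u = 0" by (rule p(2))
  moreover have "w \<bullet> u = 0" by (rule skew_self[OF u(1)])
  ultimately have "u \<bullet> u = 0" using u(2) by (metis inner_diff_left diff_zero)
  then have "u = 0" by simp
  then have "(0, - ?k) \<in> R" using u by (metis minus_diff_eq diff_0 diff_minus_eq_add add_0)
  then have "x \<bullet> - ?k = 0" using x unfolding X0_def by blast
  moreover have "?k \<bullet> p = 0" by (rule p(2)[OF p(1)])
  ultimately have "?k \<bullet> ?k = 0" by (simp add: inner_diff_left inner_diff_right inner_commute)
  then show ?thesis using p(1) by simp
qed

text \<open>
  On the domain \<open>|J \<mu> z - z| \<le> \<mu> |y|\<close> for \<open>(z, y) \<in> R\<close>; density and \<open>|J \<mu>| \<le> 1\<close> give the rest.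
\<close>

lemma J_tendsto: assumes x: "x \<in> X0" shows "(\<lambda>n. J (step n) x) \<longlonglongrightarrow> x"
proof (rule LIMSEQ_I)
  fix e :: real assume e: "e > 0"
  obtain z y where z: "(z, y) \<in> R" "dist z x < e / 4"
    using dom_dense[OF x] e unfolding closure_approachable
    by (metis (no_types, lifting) divide_pos_pos fst_conv imageE surj_pair zero_less_numeral)
  have "(\<lambda>n. step n * norm y) \<longlonglongrightarrow> 0 * norm y" by (intro tendsto_intros step_tendsto)
  then have "\<forall>\<^sub>F n in sequentially. step n * norm y < e / 4" using e by (intro order_tendstoD) auto
  then obtain N where N: "\<And>n. n \<ge> N \<Longrightarrow> step n * norm y < e / 4" by (auto simp: eventually_sequentially)
  have "norm (J (step n) x - x) < e" if "n \<ge> N" for n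
  proof -
    have z': "J (step n) z - z = step n *\<^sub>R J (step n) y"
      using J_eq[OF step_nonzero(1), of n z] J_apply_dom[OF step_nonzero(1) z(1), of n] by simp
    have "norm (J (step n) x - x) = norm (J (step n) (x - z) + (z - x) + step n *\<^sub>R J (step n) y)"
      unfolding z'[symmetric] by (simp add: J_diff[OF step_nonzero(1)])
    also have "\<dots> \<le> norm (J (step n) (x - z)) + norm (z - x) + norm (step n *\<^sub>R J (step n) y)"
      by (meson norm_triangle_ineq order_trans add_right_mono)
    also have "\<dots> \<le> norm (x - z) + norm (z - x) + step n * norm y"
      using J_norm[OF step_nonzero(1), of n "x - z"] J_norm[OF step_nonzero(1), of n y] step_pos[of n]
      by (intro add_mono) auto
    also have "\<dots> < e / 4 + e / 4 + e / 4"
      using z(2) N[OF that] by (intro add_strict_mono) (auto simp: dist_norm norm_minus_commute)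
    also have "\<dots> < e" using e by simp
    finally show ?thesis .
  qed
  then show "\<exists>N. \<forall>n\<ge>N. norm (J (step n) x - x) < e" by blast
qed

text \<open>
  Weak solutions of \<open>x' \<in> R x + g\<close>, tested with the domain of \<open>R\<close>; by skewness \<open>R\<close> acts on the test
  vector with a minus sign.
\<close>

definition weak_sol :: "real \<Rightarrow> (real \<Rightarrow> 'x) \<Rightarrow> (real \<Rightarrow> 'x) \<Rightarrow> bool" where
  "weak_sol T g x \<longleftrightarrow> continuous_on {0..T} x \<and> (\<forall>t\<in>{0..T}. x t \<in> X0) \<and>
     (\<forall>y z. (y, z) \<in> R \<longrightarrow> (\<forall>t\<in>{0..T}.
        x t \<bullet> y = x 0 \<bullet> y + integral {0..t} (\<lambda>s. g s \<bullet> y - x s \<bullet> z)))"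

lemma weak_sol_diff:
  assumes "weak_sol T g x" "weak_sol T h y" "continuous_on {0..T} g" "continuous_on {0..T} h"
  shows "weak_sol T (\<lambda>t. g t - h t) (\<lambda>t. x t - y t)"
proof -
  have xc: "continuous_on {0..T} x" and yc: "continuous_on {0..T} y"
    using assms by (auto simp: weak_sol_def)
  have "(x t - y t) \<bullet> p = (x 0 - y 0) \<bullet> p + integral {0..t} (\<lambda>s. (g s - h s) \<bullet> p - (x s - y s) \<bullet> q)"
    if R: "(p, q) \<in> R" and t: "t \<in> {0..T}" for p q t
  proof -
    have i: "(\<lambda>s. g s \<bullet> p - x s \<bullet> q) integrable_on {0..t}" "(\<lambda>s. h s \<bullet> p - y s \<bullet> q) integrable_on {0..t}"
      by (rule continuous_on_integrable_sub[OF _ t], intro continuous_intros assms xc yc)+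
    have "integral {0..t} (\<lambda>s. (g s - h s) \<bullet> p - (x s - y s) \<bullet> q)
        = integral {0..t} (\<lambda>s. (g s \<bullet> p - x s \<bullet> q) - (h s \<bullet> p - y s \<bullet> q))"
      by (simp add: inner_diff_left algebra_simps)
    also have "\<dots> = integral {0..t} (\<lambda>s. g s \<bullet> p - x s \<bullet> q) - integral {0..t} (\<lambda>s. h s \<bullet> p - y s \<bullet> q)"
      by (rule integral_diff[OF i])
    moreover have "x t \<bullet> p = x 0 \<bullet> p + integral {0..t} (\<lambda>s. g s \<bullet> p - x s \<bullet> q)"
      "y t \<bullet> p = y 0 \<bullet> p + integral {0..t} (\<lambda>s. h s \<bullet> p - y s \<bullet> q)"
      using assms(1,2) R t unfolding weak_sol_def by blast+
    ultimately show ?thesis by (simp add: inner_diff_left)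
  qed
  moreover have "x t - y t \<in> X0" if "t \<in> {0..T}" for t
    using assms(1,2) that subspace_diff[OF X0_subspace] by (auto simp: weak_sol_def)
  ultimately show ?thesis unfolding weak_sol_def
    using continuous_on_diff[OF xc yc] by blast
qed

text \<open>
  A weak solution need not be differentiable, but \<open>J \<mu> x\<close> is: testing with \<open>J (- \<mu>) y\<close> shows that it
  satisfies a differential equation with the bounded operator \<open>A \<mu>\<close>.  Its energy identity has no
  contribution from \<open>A \<mu>\<close>, because \<open>A \<mu> x \<bullet> J \<mu> x = 0\<close>, and passes to the limit \<open>\<mu> \<rightarrow> 0\<close>.
\<close>

theorem energy_identity:
  assumes w: "weak_sol T g x" and g: "continuous_on {0..T} g" and gX: "\<And>t. t \<in> {0..T} \<Longrightarrow> g t \<in> X0"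
    and t: "t \<in> {0..T}"
  shows "x t \<bullet> x t = x 0 \<bullet> x 0 + 2 * integral {0..t} (\<lambda>s. g s \<bullet> x s)"
proof -
  have xc: "continuous_on {0..T} x" and xX: "\<And>t. t \<in> {0..T} \<Longrightarrow> x t \<in> X0"
    using w by (auto simp: weak_sol_def)
  have reg: "J l (x t) \<bullet> J l (x t) = J l (x 0) \<bullet> J l (x 0) + 2 * integral {0..t} (\<lambda>s. J l (g s) \<bullet> J l (x s))"
    if l: "l \<noteq> 0" and t: "t \<in> {0..T}" for l t
  proof -
    let ?f = "\<lambda>s. A l (x s) + J l (g s)"
    have l': "- l \<noteq> 0" using l by simp
    have fc: "continuous_on {0..T} ?f"
      by (intro continuous_intros bounded_linear.continuous_on[OF A_linear[OF l]]
          bounded_linear.continuous_on[OF J_linear[OF l]] xc g)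
    have "J l (x t) = J l (x 0) + integral {0..t} ?f" if t: "t \<in> {0..T}" for t
    proof (rule vector_eq_ldot[THEN iffD1], rule allI)
      fix y
      have "y \<bullet> J l (x t) = x t \<bullet> J (-l) y" using J_adjoint[OF l] by (simp add: inner_commute)
      also have "\<dots> = x 0 \<bullet> J (-l) y + integral {0..t} (\<lambda>s. g s \<bullet> J (-l) y - x s \<bullet> A (-l) y)"
        using w J_mem[OF l', of y] t unfolding weak_sol_def by blast
      also have "(\<lambda>s. g s \<bullet> J (-l) y - x s \<bullet> A (-l) y) = (\<lambda>s. ?f s \<bullet> y)"
      proof
        fix s
        have a: "x s \<bullet> A (-l) y = - (A l (x s) \<bullet> y)"
          unfolding A_def using J_adjoint[OF l, of "x s" y]
          by (simp add: inner_diff_left inner_diff_right)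
        show "g s \<bullet> J (-l) y - x s \<bullet> A (-l) y = ?f s \<bullet> y"
          using J_adjoint[OF l, of "g s" y] a by (simp add: inner_add_left)
      qed
      also have "integral {0..t} (\<lambda>s. ?f s \<bullet> y) = integral {0..t} ?f \<bullet> y"
        by (rule integral_inner_left[symmetric, OF continuous_on_integrable_sub[OF fc t]])
      also have "x 0 \<bullet> J (-l) y = y \<bullet> J l (x 0)" using J_adjoint[OF l] by (simp add: inner_commute)
      finally show "y \<bullet> J l (x t) = y \<bullet> (J l (x 0) + integral {0..t} ?f)"
        by (simp add: inner_add_right inner_commute)
    qed
    from inner_self_integral[OF fc this t]
    have "J l (x t) \<bullet> J l (x t) = J l (x 0) \<bullet> J l (x 0) + 2 * integral {0..t} (\<lambda>s. ?f s \<bullet> J l (x s))" .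
    moreover have "(\<lambda>s. ?f s \<bullet> J l (x s)) = (\<lambda>s. J l (g s) \<bullet> J l (x s))"
      using skew_self[OF J_mem[OF l]] by (simp add: inner_add_left)
    ultimately show ?thesis by simp
  qed
  have lim: "(\<lambda>n. integral {0..t} (\<lambda>s. J (step n) (g s) \<bullet> J (step n) (x s))) \<longlonglongrightarrow> integral {0..t} (\<lambda>s. g s \<bullet> x s)"
  proof (rule dominated_convergence(2)[where h="\<lambda>s. norm (g s) * norm (x s)"])
    fix n
    show "(\<lambda>s. J (step n) (g s) \<bullet> J (step n) (x s)) integrable_on {0..t}"
      by (rule continuous_on_integrable_sub[OF _ t])
         (intro continuous_intros bounded_linear.continuous_on[OF J_linear[OF step_nonzero(1)]] xc g)
    fix s assume "s \<in> {0..t}"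
    have "norm (J (step n) (g s) \<bullet> J (step n) (x s)) \<le> norm (J (step n) (g s)) * norm (J (step n) (x s))"
      using Cauchy_Schwarz_ineq2 by simp
    also have "\<dots> \<le> norm (g s) * norm (x s)"
      by (intro mult_mono J_norm step_nonzero) auto
    finally show "norm (J (step n) (g s) \<bullet> J (step n) (x s)) \<le> norm (g s) * norm (x s)" .
  next
    show "(\<lambda>s. norm (g s) * norm (x s)) integrable_on {0..t}"
      by (rule continuous_on_integrable_sub[OF _ t]) (intro continuous_intros xc g)
    fix s assume "s \<in> {0..t}"
    then have "s \<in> {0..T}" using t by auto
    then show "(\<lambda>n. J (step n) (g s) \<bullet> J (step n) (x s)) \<longlonglongrightarrow> g s \<bullet> x s"
      by (intro tendsto_intros J_tendsto xX gX)
  qed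
  have 0: "0 \<in> {0..T}" using t by auto
  have "(\<lambda>n. J (step n) (x 0) \<bullet> J (step n) (x 0) + 2 * integral {0..t} (\<lambda>s. J (step n) (g s) \<bullet> J (step n) (x s)))
     \<longlonglongrightarrow> x 0 \<bullet> x 0 + 2 * integral {0..t} (\<lambda>s. g s \<bullet> x s)"
    by (intro tendsto_intros lim J_tendsto xX 0)
  moreover have "(\<lambda>n. J (step n) (x t) \<bullet> J (step n) (x t)) \<longlonglongrightarrow> x t \<bullet> x t"
    by (intro tendsto_intros J_tendsto xX t)
  ultimately show ?thesis
    unfolding reg[OF step_nonzero(1) t] by (rule LIMSEQ_unique[rotated])
qed

corollary weak_sol_norm_le:
  assumes w: "weak_sol T g x" and g: "continuous_on {0..T} g" and gX: "\<And>t. t \<in> {0..T} \<Longrightarrow> g t \<in> X0"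
    and t: "t \<in> {0..T}"
  shows "norm (x t) \<le> norm (x 0) + 2 * integral {0..t} (\<lambda>s. norm (g s))"
proof (rule norm_le_of_energy_le[OF _ g _ t])
  show "continuous_on {0..T} x" using w by (simp add: weak_sol_def)
  show "x t \<bullet> x t \<le> x 0 \<bullet> x 0 + 2 * integral {0..t} (\<lambda>s. g s \<bullet> x s)" if "t \<in> {0..T}" for t
    using energy_identity[OF w g gX that] by simp
qed

lemma bounded_linear_ode:
  fixes B :: "'x \<Rightarrow> 'x" and g :: "real \<Rightarrow> 'x"
  assumes B: "bounded_linear B" and g: "continuous_on {0..T} g" and T: "T \<ge> 0"
  shows "\<exists>x. continuous_on {0..T} x \<and> (\<forall>t\<in>{0..T}. x t = x0 + integral {0..t} (\<lambda>s. B (x s) + g s))"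
proof -
  obtain K where K: "K > 0" "\<And>x. norm (B x) \<le> K * norm x"
    using bounded_linear.pos_bounded[OF B] by (auto simp: mult.commute)
  let ?\<Phi> = "\<lambda>x t. x0 + integral {0..t} (\<lambda>s. B (x s) + g s)"
  have Bc: "continuous_on {0..T} (\<lambda>s. B (x s) + g s)" if "continuous_on {0..T} x" for x
    by (intro continuous_intros bounded_linear.continuous_on[OF B] that g)
  have "\<exists>x. continuous_on {0..T} x \<and> (\<forall>t\<in>{0..T}. ?\<Phi> x t = x t)"
  proof (rule volterra_fixed_point[OF T, where L=K])
    fix x :: "real \<Rightarrow> 'x" assume x: "continuous_on {0..T} x"
    show "continuous_on {0..T} (?\<Phi> x)"
      by (intro continuous_intros indefinite_integral_continuous_1 integrable_continuous_real Bc x)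
  next
    fix x y :: "real \<Rightarrow> 'x" and t assume x: "continuous_on {0..T} x" and y: "continuous_on {0..T} y" and t: "t \<in> {0..T}"
    have "?\<Phi> x t - ?\<Phi> y t = integral {0..t} (\<lambda>s. B (x s) + g s) - integral {0..t} (\<lambda>s. B (y s) + g s)" by simp
    also have "\<dots> = integral {0..t} (\<lambda>s. (B (x s) + g s) - (B (y s) + g s))"
      by (rule integral_diff[symmetric]) (intro continuous_on_integrable_sub[OF _ t] Bc x y)+
    also have "(\<lambda>s. (B (x s) + g s) - (B (y s) + g s)) = (\<lambda>s. B (x s - y s))"
      by (simp add: linear_diff[OF bounded_linear.linear[OF B]])
    finally have "norm (?\<Phi> x t - ?\<Phi> y t) = norm (integral {0..t} (\<lambda>s. B (x s - y s)))" by simp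
    also have "\<dots> \<le> integral {0..t} (\<lambda>s. K * norm (x s - y s))"
    proof (rule integral_norm_bound_integral)
      show "(\<lambda>s. B (x s - y s)) integrable_on {0..t}"
        by (rule continuous_on_integrable_sub[OF _ t]) (intro continuous_intros bounded_linear.continuous_on[OF B] x y)
      show "(\<lambda>s. K * norm (x s - y s)) integrable_on {0..t}"
        by (rule continuous_on_integrable_sub[OF _ t]) (intro continuous_intros x y)
    qed (rule K(2))
    finally show "norm (?\<Phi> x t - ?\<Phi> y t) \<le> K * integral {0..t} (\<lambda>s. norm (x s - y s))" by simp
  qed (use K in auto)
  then show ?thesis by metis
qed

lemma weak_sol_subinterval:
  assumes "weak_sol T g x" "\<tau> \<in> {0..T}" "\<And>t. t \<in> {0..\<tau>} \<Longrightarrow> g t = h t"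
  shows "weak_sol \<tau> h x"
  unfolding weak_sol_def
proof (intro conjI ballI allI impI)
  have sub: "{0..\<tau>} \<subseteq> {0..T}" using assms(2) by auto
  show "continuous_on {0..\<tau>} x" using assms(1) sub unfolding weak_sol_def by (meson continuous_on_subset)
  show "x t \<in> X0" if "t \<in> {0..\<tau>}" for t using assms(1) sub that unfolding weak_sol_def by blast
  fix y z t assume R: "(y, z) \<in> R" and t: "t \<in> {0..\<tau>}"
  have "x t \<bullet> y = x 0 \<bullet> y + integral {0..t} (\<lambda>s. g s \<bullet> y - x s \<bullet> z)"
    using assms(1) R t sub unfolding weak_sol_def by blast
  also have "integral {0..t} (\<lambda>s. g s \<bullet> y - x s \<bullet> z) = integral {0..t} (\<lambda>s. h s \<bullet> y - x s \<bullet> z)"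
    by (rule integral_cong) (use assms(3) t in auto)
  finally show "x t \<bullet> y = x 0 \<bullet> y + integral {0..t} (\<lambda>s. h s \<bullet> y - x s \<bullet> z)" .
qed

text \<open>
  For data in the domain, let \<open>X n\<close> solve \<open>x' = A (step n) x + g\<close>.  Then \<open>Y n = A (step n) (X n)\<close> is bounded
  independently of \<open>n\<close>, because it solves the same type of equation, with source \<open>A (step n) g = J (step n) h\<close>, and
  \<open>A (step n)\<close> is dissipative.  Skewness applied to the difference of two of them then bounds
  \<open>|X m - X n|\<^sup>2\<close> by a constant times \<open>step m + step n\<close>.
\<close>

lemma weak_sol_exists_regular:
  assumes T: "T \<ge> 0" and x0: "(x0, a) \<in> R"
    and g: "continuous_on {0..T} g" and h: "continuous_on {0..T} h"
    and gh: "\<And>t. t \<in> {0..T} \<Longrightarrow> (g t, h t) \<in> R"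
  shows "\<exists>x. weak_sol T g x \<and> x 0 = x0"
proof -
  let ?B = "\<lambda>n. A (step n)" and ?J = "\<lambda>n. J (step n)"
  note Bl = A_linear[OF step_nonzero(1)] and Jl = J_linear[OF step_nonzero(1)]
  have "\<exists>X. continuous_on {0..T} X \<and> (\<forall>t\<in>{0..T}. X t = x0 + integral {0..t} (\<lambda>s. ?B n (X s) + g s))" for n
    by (rule bounded_linear_ode[OF Bl g T])
  then obtain X where Xc: "\<And>n. continuous_on {0..T} (X n)"
    and X: "\<And>n t. t \<in> {0..T} \<Longrightarrow> X n t = x0 + integral {0..t} (\<lambda>s. ?B n (X n s) + g s)" by metis
  define Y where "Y n t = ?B n (X n t)" for n t
  have Yc: "continuous_on {0..T} (Y n)" for n
    unfolding Y_def by (rule bounded_linear.continuous_on[OF Bl Xc])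
  have zT: "0 \<in> {0..T}" using T by simp
  have X0: "X n 0 = x0" for n using X[OF zT] by simp
  have X': "X n t = x0 + integral {0..t} (\<lambda>s. Y n s + g s)" if "t \<in> {0..T}" for n t
    using X[OF that] by (simp add: Y_def)
  have JXY: "?J n (X n t) = X n t + step n *\<^sub>R Y n t" for n t
    unfolding Y_def by (rule J_eq[OF step_nonzero(1)])
  define C where "C = norm a + 2 * integral {0..T} (\<lambda>s. norm (h s))"
  have hi: "(\<lambda>s. norm (h s)) integrable_on {0..t}" if "t \<in> {0..T}" for t
    by (rule continuous_on_integrable_sub[OF _ that]) (intro continuous_intros h)
  have Yb: "norm (Y n t) \<le> C" if t: "t \<in> {0..T}" for n t
  proof -
    have Bgc: "continuous_on {0..T} (\<lambda>s. ?B n (g s))" by (rule bounded_linear.continuous_on[OF Bl g])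
    have BYc: "continuous_on {0..T} (\<lambda>s. ?B n (Y n s))" by (rule bounded_linear.continuous_on[OF Bl Yc])
    have Yi: "Y n t = ?B n x0 + integral {0..t} (\<lambda>s. ?B n (Y n s) + ?B n (g s))" if t: "t \<in> {0..T}" for t
    proof -
      have "(\<lambda>s. Y n s + g s) integrable_on {0..t}"
        by (rule continuous_on_integrable_sub[OF _ t]) (intro continuous_intros Yc g)
      from integral_linear[OF this Bl]
      have "?B n (integral {0..t} (\<lambda>s. Y n s + g s)) = integral {0..t} (\<lambda>s. ?B n (Y n s) + ?B n (g s))"
        by (simp add: o_def linear_add[OF bounded_linear.linear[OF Bl]])
      then show ?thesis using X'[OF t, of n] unfolding Y_def
        by (simp add: linear_add[OF bounded_linear.linear[OF Bl]])
    qed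
    have Y0: "Y n 0 = ?B n x0" using Yi[OF zT] by simp
    have "norm (Y n t) \<le> norm (Y n 0) + 2 * integral {0..t} (\<lambda>s. norm (?B n (g s)))"
    proof (rule norm_le_of_energy_le[OF Yc Bgc _ t])
      fix t assume t: "t \<in> {0..T}"
      have "Y n t \<bullet> Y n t = Y n 0 \<bullet> Y n 0 + 2 * integral {0..t} (\<lambda>s. (?B n (Y n s) + ?B n (g s)) \<bullet> Y n s)"
        unfolding Y0 by (rule inner_self_integral[OF _ Yi t]) (intro continuous_intros Bgc BYc)
      also have "integral {0..t} (\<lambda>s. (?B n (Y n s) + ?B n (g s)) \<bullet> Y n s) \<le> integral {0..t} (\<lambda>s. ?B n (g s) \<bullet> Y n s)"
      proof (rule integral_le)
        show "(\<lambda>s. (?B n (Y n s) + ?B n (g s)) \<bullet> Y n s) integrable_on {0..t}"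
          "(\<lambda>s. ?B n (g s) \<bullet> Y n s) integrable_on {0..t}"
          by (rule continuous_on_integrable_sub[OF _ t], intro continuous_intros Bgc BYc Yc)+
        show "(?B n (Y n s) + ?B n (g s)) \<bullet> Y n s \<le> ?B n (g s) \<bullet> Y n s" for s
          using A_dissipative[OF step_pos, of n "Y n s"] by (simp add: inner_add_left)
      qed
      finally show "Y n t \<bullet> Y n t \<le> Y n 0 \<bullet> Y n 0 + 2 * integral {0..t} (\<lambda>s. ?B n (g s) \<bullet> Y n s)" by simp
    qed
    also have "norm (Y n 0) \<le> norm a"
      unfolding Y0 J_apply_dom[OF step_nonzero(1) x0] by (rule J_norm[OF step_nonzero(1)])
    also have "integral {0..t} (\<lambda>s. norm (?B n (g s))) \<le> integral {0..t} (\<lambda>s. norm (h s))"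
    proof (rule integral_le[OF _ hi[OF t]])
      show "(\<lambda>s. norm (?B n (g s))) integrable_on {0..t}"
        by (rule continuous_on_integrable_sub[OF _ t]) (intro continuous_intros Bgc)
      fix s assume "s \<in> {0..t}"
      then have "s \<in> {0..T}" using t by auto
      then show "norm (?B n (g s)) \<le> norm (h s)"
        using J_apply_dom[OF step_nonzero(1) gh] J_norm[OF step_nonzero(1)] by metis
    qed
    also have "integral {0..t} (\<lambda>s. norm (h s)) \<le> integral {0..T} (\<lambda>s. norm (h s))"
      by (rule integral_subset_le) (use t hi[OF t] hi[of T] T in auto)
    finally show ?thesis unfolding C_def by simp
  qed
  have C0: "C \<ge> 0" using order_trans[OF norm_ge_zero Yb[OF zT]] .
  have cau: "norm (X m t - X n t) \<le> sqrt (4 * T * C * C * step m) + sqrt (4 * T * C * C * step n)"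
    if t: "t \<in> {0..T}" for m n t
  proof -
    have Zi: "X m t - X n t = 0 + integral {0..t} (\<lambda>s. Y m s - Y n s)" if t: "t \<in> {0..T}" for t
    proof -
      have "integral {0..t} (\<lambda>s. Y m s + g s) - integral {0..t} (\<lambda>s. Y n s + g s)
          = integral {0..t} (\<lambda>s. (Y m s + g s) - (Y n s + g s))"
        by (rule integral_diff[symmetric]) (rule continuous_on_integrable_sub[OF _ t], intro continuous_intros Yc g)+
      then show ?thesis using X'[OF t, of m] X'[OF t, of n] by simp
    qed
    \<comment> \<open>\<open>X n\<close> differs from \<open>J (step n) (X n)\<close> by \<open>step n * Y n\<close>, and for the latter the product vanishes by skewness\<close>
    have pt: "(Y m s - Y n s) \<bullet> (X m s - X n s) \<le> 2 * C * C * (step m + step n)" if s: "s \<in> {0..T}" for s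
    proof -
      let ?y = "Y m s - Y n s"
      have "?y \<bullet> (?J m (X m s) - ?J n (X n s)) = 0"
        unfolding Y_def by (rule skew_self[OF R_diff]) (rule J_mem[OF step_nonzero(1)])+
      then have "?y \<bullet> (X m s - X n s) = - (?y \<bullet> (step m *\<^sub>R Y m s - step n *\<^sub>R Y n s))"
        unfolding JXY by (simp add: inner_diff_right inner_add_right)
      also have "\<dots> \<le> norm ?y * norm (step m *\<^sub>R Y m s - step n *\<^sub>R Y n s)"
        using Cauchy_Schwarz_ineq2[of ?y "step m *\<^sub>R Y m s - step n *\<^sub>R Y n s"] by linarith
      also have "\<dots> \<le> (2 * C) * (step m * C + step n * C)"
      proof (rule mult_mono)
        show "norm ?y \<le> 2 * C"
          using norm_triangle_ineq4[of "Y m s" "Y n s"] Yb[OF s, of m] Yb[OF s, of n] by linarith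
        have "norm (step m *\<^sub>R Y m s) \<le> step m * C" for m
          using Yb[OF s, of m] step_pos[of m] by (simp add: mult_left_mono)
        then show "norm (step m *\<^sub>R Y m s - step n *\<^sub>R Y n s) \<le> step m * C + step n * C"
          using norm_triangle_ineq4[of "step m *\<^sub>R Y m s" "step n *\<^sub>R Y n s"] by (meson add_mono order_trans)
      qed (use C0 in auto)
      finally show ?thesis by (simp add: algebra_simps)
    qed
    have Zc: "continuous_on {0..T} (\<lambda>s. X m s - X n s)" by (intro continuous_intros Xc)
    have Wc: "continuous_on {0..T} (\<lambda>s. Y m s - Y n s)" by (intro continuous_intros Yc)
    have "(X m t - X n t) \<bullet> (X m t - X n t) = (0::'x) \<bullet> 0 + 2 * integral {0..t} (\<lambda>s. (Y m s - Y n s) \<bullet> (X m s - X n s))"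
      by (rule inner_self_integral[where x="\<lambda>t. X m t - X n t", OF Wc Zi t])
    also have "integral {0..t} (\<lambda>s. (Y m s - Y n s) \<bullet> (X m s - X n s)) \<le> integral {0..t} (\<lambda>s. 2 * C * C * (step m + step n))"
    proof (rule integral_le)
      show "(\<lambda>s. (Y m s - Y n s) \<bullet> (X m s - X n s)) integrable_on {0..t}"
        by (rule continuous_on_integrable_sub[OF _ t]) (intro continuous_intros Wc Zc)
    qed (use t pt in auto)
    also have "\<dots> = t * (2 * C * C * (step m + step n))" using t by simp
    also have "\<dots> \<le> T * (2 * C * C * (step m + step n))"
      by (rule mult_right_mono) (use t C0 step_pos[of m] step_pos[of n] in simp_all)
    finally have "(norm (X m t - X n t))\<^sup>2 \<le> 4 * T * C * C * step m + 4 * T * C * C * step n"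
      by (simp add: power2_norm_eq_inner algebra_simps)
    then have "norm (X m t - X n t) \<le> sqrt (4 * T * C * C * step m + 4 * T * C * C * step n)"
      by (rule real_le_rsqrt)
    also have "\<dots> \<le> sqrt (4 * T * C * C * step m) + sqrt (4 * T * C * C * step n)"
      by (rule sqrt_add_le_add_sqrt) (use T C0 step_pos[of m] step_pos[of n] in auto)
    finally show ?thesis .
  qed
  have "(\<lambda>n. sqrt (4 * T * C * C * step n)) \<longlonglongrightarrow> sqrt (4 * T * C * C * 0)"
    by (intro tendsto_intros step_tendsto)
  then have "\<exists>x. uniform_limit {0..T} X x sequentially"
    by (intro uniform_limit_of_dist_le[OF cau]) auto
  then obtain x where lim: "uniform_limit {0..T} X x sequentially" by blast
  have xc: "continuous_on {0..T} x"
    by (rule uniform_limit_theorem[OF _ lim]) (auto simp: Xc)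
  have pw: "(\<lambda>n. X n t) \<longlonglongrightarrow> x t" if "t \<in> {0..T}" for t
    by (rule tendsto_uniform_limitI[OF lim that])
  have stepY: "(\<lambda>n. step n *\<^sub>R Y n t) \<longlonglongrightarrow> 0" if t: "t \<in> {0..T}" for t
  proof (rule Lim_null_comparison)
    show "\<forall>\<^sub>F n in sequentially. norm (step n *\<^sub>R Y n t) \<le> step n * C"
      using Yb[OF t] step_pos by (auto intro!: always_eventually mult_left_mono simp: less_imp_le)
    have "(\<lambda>n. step n * C) \<longlonglongrightarrow> 0 * C" by (intro tendsto_intros step_tendsto)
    then show "(\<lambda>n. step n * C) \<longlonglongrightarrow> 0" by simp
  qed
  have JX: "(\<lambda>n. ?J n (X n t)) \<longlonglongrightarrow> x t" if t: "t \<in> {0..T}" for t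
    using tendsto_add[OF pw[OF t] stepY[OF t]] unfolding JXY by simp
  have xX: "x t \<in> X0" if t: "t \<in> {0..T}" for t
    by (rule closed_sequentially[OF X0_closed _ JX[OF t]]) (rule J_X0[OF step_nonzero(1)])
  have "x t \<bullet> y = x 0 \<bullet> y + integral {0..t} (\<lambda>s. g s \<bullet> y - x s \<bullet> z)" if R: "(y, z) \<in> R" and t: "t \<in> {0..T}" for y z t
  proof -
    have JXc: "continuous_on {0..T} (\<lambda>s. ?J n (X n s))" for n by (rule bounded_linear.continuous_on[OF Jl Xc])
    have e: "X n t \<bullet> y = x0 \<bullet> y + integral {0..t} (\<lambda>s. g s \<bullet> y - ?J n (X n s) \<bullet> z)" for n
    proof -
      have "(\<lambda>s. (Y n s + g s) \<bullet> y) = (\<lambda>s. g s \<bullet> y - ?J n (X n s) \<bullet> z)"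
        unfolding Y_def using skew[OF J_mem[OF step_nonzero(1)] R] by (simp add: inner_add_left)
      moreover have "integral {0..t} (\<lambda>s. Y n s + g s) \<bullet> y = integral {0..t} (\<lambda>s. (Y n s + g s) \<bullet> y)"
        by (rule integral_inner_left[OF continuous_on_integrable_sub[OF _ t]]) (intro continuous_intros Yc g)
      ultimately show ?thesis using X'[OF t, of n] by (simp add: inner_add_left)
    qed
    have tT: "{0..t} \<subseteq> {0..T}" using t by auto
    have "(\<lambda>n. integral {0..t} (\<lambda>s. g s \<bullet> y - ?J n (X n s) \<bullet> z)) \<longlonglongrightarrow> integral {0..t} (\<lambda>s. g s \<bullet> y - x s \<bullet> z)"
    proof (rule tendsto_integral_uniform[OF _ _ t])
      show "continuous_on {0..T} (\<lambda>s. g s \<bullet> y - ?J n (X n s) \<bullet> z)" for n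
        by (intro continuous_intros JXc g)
      have "uniform_limit {0..T} (\<lambda>n s. step n *\<^sub>R Y n s) (\<lambda>_. 0) sequentially"
      proof (rule uniform_limitI)
        fix e :: real assume "e > 0"
        moreover have "(\<lambda>n. step n * C) \<longlonglongrightarrow> 0 * C" by (intro tendsto_intros step_tendsto)
        ultimately have ev: "\<forall>\<^sub>F n in sequentially. step n * C < e" by (intro order_tendstoD) auto
        show "\<forall>\<^sub>F n in sequentially. \<forall>s\<in>{0..T}. dist (step n *\<^sub>R Y n s) 0 < e"
          using ev
        proof eventually_elim
          case (elim n)
          show ?case
          proof
            fix s assume "s \<in> {0..T}"
            then have "step n * norm (Y n s) \<le> step n * C"
              using Yb step_pos[of n] by (intro mult_left_mono) auto
            then have "step n * norm (Y n s) < e" using elim by (rule le_less_trans)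
            then show "dist (step n *\<^sub>R Y n s) 0 < e" using step_pos[of n] by simp
          qed
        qed
      qed
      then have "uniform_limit {0..T} (\<lambda>n s. ?J n (X n s)) (\<lambda>s. x s + 0) sequentially"
        unfolding JXY by (rule uniform_limit_add[OF lim])
      then have "uniform_limit {0..T} (\<lambda>n s. ?J n (X n s) \<bullet> z) (\<lambda>s. (x s + 0) \<bullet> z) sequentially"
        by (rule bounded_linear.uniform_limit[OF bounded_linear_inner_left])
      then show "uniform_limit {0..T} (\<lambda>n s. g s \<bullet> y - ?J n (X n s) \<bullet> z) (\<lambda>s. g s \<bullet> y - x s \<bullet> z) sequentially"
        using uniform_limit_minus[OF uniform_limit_const] by simp
    qed
    then have "(\<lambda>n. X n t \<bullet> y) \<longlonglongrightarrow> x0 \<bullet> y + integral {0..t} (\<lambda>s. g s \<bullet> y - x s \<bullet> z)"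
      unfolding e by (intro tendsto_intros)
    moreover have "(\<lambda>n. X n t \<bullet> y) \<longlonglongrightarrow> x t \<bullet> y" by (intro tendsto_intros pw t)
    moreover have "x 0 = x0" using pw[OF zT] unfolding X0 by (simp add: LIMSEQ_const_iff)
    ultimately show ?thesis using LIMSEQ_unique by auto
  qed
  moreover have "x 0 = x0" using pw[OF zT] unfolding X0 by (simp add: LIMSEQ_const_iff)
  ultimately show ?thesis unfolding weak_sol_def using xc xX by blast
qed

text \<open>
  General data are approximated by their images under \<open>J (step n)\<close>, which lie in the domain; the
  solutions converge by the a priori estimate \<open>weak_sol_norm_le\<close>.
\<close>

theorem weak_sol_exists:
  assumes T: "T \<ge> 0" and x0: "x0 \<in> X0"
    and g: "continuous_on {0..T} g" and gX: "\<And>t. t \<in> {0..T} \<Longrightarrow> g t \<in> X0"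
  shows "\<exists>x. weak_sol T g x \<and> x 0 = x0"
proof -
  let ?J = "\<lambda>n. J (step n)"
  note Jl = J_linear[OF step_nonzero(1)] and Al = A_linear[OF step_nonzero(1)]
  have Jg: "continuous_on {0..T} (\<lambda>t. ?J n (g t))" for n by (rule bounded_linear.continuous_on[OF Jl g])
  have Ag: "continuous_on {0..T} (\<lambda>t. A (step n) (g t))" for n by (rule bounded_linear.continuous_on[OF Al g])
  have "\<exists>x. weak_sol T (\<lambda>t. ?J n (g t)) x \<and> x 0 = ?J n x0" for n
    by (rule weak_sol_exists_regular[OF T J_mem[OF step_nonzero(1)] Jg Ag]) (rule J_mem[OF step_nonzero(1)])
  then obtain X where X: "\<And>n. weak_sol T (\<lambda>t. ?J n (g t)) (X n)" and X0: "\<And>n. X n 0 = ?J n x0" by metis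
  have zT: "0 \<in> {0..T}" "T \<in> {0..T}" using T by auto
  define \<delta> where "\<delta> n = integral {0..T} (\<lambda>s. norm (?J n (g s) - g s))" for n
  have \<delta>: "\<delta> \<longlonglongrightarrow> 0"
  proof -
    have "(\<lambda>n. integral {0..T} (\<lambda>s. norm (?J n (g s) - g s))) \<longlonglongrightarrow> integral {0..T} (\<lambda>s. 0::real)"
    proof (rule dominated_convergence(2)[where h="\<lambda>s. 2 * norm (g s)"])
      show "(\<lambda>s. norm (?J n (g s) - g s)) integrable_on {0..T}" for n
        by (rule continuous_on_integrable_sub[OF _ zT(2)]) (intro continuous_intros Jg g)
      show "(\<lambda>s. 2 * norm (g s)) integrable_on {0..T}"
        by (rule continuous_on_integrable_sub[OF _ zT(2)]) (intro continuous_intros g)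
      show "norm (norm (?J n (g s) - g s)) \<le> 2 * norm (g s)" for n s
        using J_norm[OF step_nonzero(1), of n "g s"] norm_triangle_ineq4[of "?J n (g s)" "g s"] by simp
      fix s assume s: "s \<in> {0..T}"
      have "(\<lambda>n. norm (?J n (g s) - g s)) \<longlonglongrightarrow> norm (g s - g s)"
        by (intro tendsto_intros J_tendsto gX s)
      then show "(\<lambda>n. norm (?J n (g s) - g s)) \<longlonglongrightarrow> 0" by simp
    qed
    then show ?thesis unfolding \<delta>_def by simp
  qed
  have Jint: "integral {0..t} (\<lambda>s. norm (?J m (g s) - ?J n (g s))) \<le> \<delta> m + \<delta> n" if t: "t \<in> {0..T}" for m n t
  proof -
    have i: "(\<lambda>s. norm (?J k (g s) - g s)) integrable_on {0..T}" for k
      by (rule continuous_on_integrable_sub[OF _ zT(2)]) (intro continuous_intros Jg g)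
    have i2: "(\<lambda>s. norm (?J m (g s) - ?J n (g s))) integrable_on {0..t}" if "t \<in> {0..T}" for t
      by (rule continuous_on_integrable_sub[OF _ that]) (intro continuous_intros Jg g)
    have "integral {0..t} (\<lambda>s. norm (?J m (g s) - ?J n (g s))) \<le> integral {0..T} (\<lambda>s. norm (?J m (g s) - ?J n (g s)))"
      by (rule integral_subset_le) (use t i2[OF t] i2[OF zT(2)] in auto)
    also have "\<dots> \<le> integral {0..T} (\<lambda>s. norm (?J m (g s) - g s) + norm (?J n (g s) - g s))"
      by (rule integral_le[OF i2[OF zT(2)] integrable_add[OF i i]])
         (metis norm_minus_commute norm_triangle_sub norm_diff_triangle_ineq diff_diff_eq2 dist_norm dist_triangle2)
    also have "\<dots> = \<delta> m + \<delta> n" unfolding \<delta>_def by (rule integral_add[OF i i])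
    finally show ?thesis .
  qed
  define \<epsilon> where "\<epsilon> n = norm (?J n x0 - x0) + 2 * \<delta> n" for n
  have "\<exists>x. uniform_limit {0..T} X x sequentially"
  proof (rule uniform_limit_of_dist_le)
    show "norm (X m t - X n t) \<le> \<epsilon> m + \<epsilon> n" if t: "t \<in> {0..T}" for m n t
    proof -
      have "norm (X m t - X n t) \<le> norm (X m 0 - X n 0) + 2 * integral {0..t} (\<lambda>s. norm (?J m (g s) - ?J n (g s)))"
        by (rule weak_sol_norm_le[OF weak_sol_diff[OF X X Jg Jg] _ _ t])
           (auto intro!: continuous_intros Jg subspace_diff[OF X0_subspace] J_X0 step_nonzero)
      moreover have "norm (X m 0 - X n 0) \<le> norm (?J m x0 - x0) + norm (?J n x0 - x0)"
        unfolding X0 using dist_triangle2[of "?J m x0" "?J n x0" x0] by (simp add: dist_norm)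
      ultimately show ?thesis using Jint[OF t, of m n] unfolding \<epsilon>_def by linarith
    qed
    have "(\<lambda>n. norm (?J n x0 - x0) + 2 * \<delta> n) \<longlonglongrightarrow> norm (x0 - x0) + 2 * 0"
      by (intro tendsto_intros J_tendsto x0 \<delta>)
    then show "\<epsilon> \<longlonglongrightarrow> 0" unfolding \<epsilon>_def by simp
  qed
  then obtain x where lim: "uniform_limit {0..T} X x sequentially" by blast
  have Xc: "continuous_on {0..T} (X n)" and XX: "\<And>t. t \<in> {0..T} \<Longrightarrow> X n t \<in> X0" for n
    using X[of n] by (auto simp: weak_sol_def)
  have xc: "continuous_on {0..T} x"
    by (rule uniform_limit_theorem[OF _ lim]) (auto simp: Xc)
  have pw: "(\<lambda>n. X n t) \<longlonglongrightarrow> x t" if "t \<in> {0..T}" for t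
    by (rule tendsto_uniform_limitI[OF lim that])
  have x00: "x 0 = x0" using pw[OF zT(1)] J_tendsto[OF x0] unfolding X0 by (rule LIMSEQ_unique)
  have xX: "x t \<in> X0" if t: "t \<in> {0..T}" for t
    by (rule closed_sequentially[OF X0_closed XX[OF t] pw[OF t]])
  have "x t \<bullet> y = x 0 \<bullet> y + integral {0..t} (\<lambda>s. g s \<bullet> y - x s \<bullet> z)" if R: "(y, z) \<in> R" and t: "t \<in> {0..T}" for y z t
  proof -
    have e: "X n t \<bullet> y = X n 0 \<bullet> y + (integral {0..t} (\<lambda>s. ?J n (g s) \<bullet> y) - integral {0..t} (\<lambda>s. X n s \<bullet> z))" for n
    proof -
      have "X n t \<bullet> y = X n 0 \<bullet> y + integral {0..t} (\<lambda>s. ?J n (g s) \<bullet> y - X n s \<bullet> z)"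
        using X[of n] R t unfolding weak_sol_def by blast
      moreover have "integral {0..t} (\<lambda>s. ?J n (g s) \<bullet> y - X n s \<bullet> z)
          = integral {0..t} (\<lambda>s. ?J n (g s) \<bullet> y) - integral {0..t} (\<lambda>s. X n s \<bullet> z)"
        by (rule integral_diff) (rule continuous_on_integrable_sub[OF _ t], intro continuous_intros Jg Xc)+
      ultimately show ?thesis by simp
    qed
    have 1: "(\<lambda>n. integral {0..t} (\<lambda>s. ?J n (g s) \<bullet> y)) \<longlonglongrightarrow> integral {0..t} (\<lambda>s. g s \<bullet> y)"
    proof (rule dominated_convergence(2)[where h="\<lambda>s. norm (g s) * norm y"])
      show "(\<lambda>s. ?J n (g s) \<bullet> y) integrable_on {0..t}" for n
        by (rule continuous_on_integrable_sub[OF _ t]) (intro continuous_intros Jg)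
      show "(\<lambda>s. norm (g s) * norm y) integrable_on {0..t}"
        by (rule continuous_on_integrable_sub[OF _ t]) (intro continuous_intros g)
      show "norm (?J n (g s) \<bullet> y) \<le> norm (g s) * norm y" for n s
      proof -
        have "norm (?J n (g s) \<bullet> y) \<le> norm (?J n (g s)) * norm y" using Cauchy_Schwarz_ineq2 by simp
        also have "\<dots> \<le> norm (g s) * norm y" by (intro mult_right_mono J_norm step_nonzero) auto
        finally show ?thesis .
      qed
      fix s assume "s \<in> {0..t}"
      then have "s \<in> {0..T}" using t by auto
      then show "(\<lambda>n. ?J n (g s) \<bullet> y) \<longlonglongrightarrow> g s \<bullet> y" by (intro tendsto_intros J_tendsto gX)
    qed
    have 2: "(\<lambda>n. integral {0..t} (\<lambda>s. X n s \<bullet> z)) \<longlonglongrightarrow> integral {0..t} (\<lambda>s. x s \<bullet> z)"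
      by (rule tendsto_integral_uniform[OF bounded_linear.uniform_limit[OF bounded_linear_inner_left lim] _ t])
         (intro continuous_intros Xc)
    have "(\<lambda>n. X n t \<bullet> y) \<longlonglongrightarrow> x 0 \<bullet> y + (integral {0..t} (\<lambda>s. g s \<bullet> y) - integral {0..t} (\<lambda>s. x s \<bullet> z))"
      unfolding e by (intro tendsto_intros 1 2 pw zT)
    moreover have "(\<lambda>n. X n t \<bullet> y) \<longlonglongrightarrow> x t \<bullet> y" by (intro tendsto_intros pw t)
    ultimately have "x t \<bullet> y = x 0 \<bullet> y + (integral {0..t} (\<lambda>s. g s \<bullet> y) - integral {0..t} (\<lambda>s. x s \<bullet> z))"
      using LIMSEQ_unique by blast
    also have "integral {0..t} (\<lambda>s. g s \<bullet> y) - integral {0..t} (\<lambda>s. x s \<bullet> z) = integral {0..t} (\<lambda>s. g s \<bullet> y - x s \<bullet> z)"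
      by (rule integral_diff[symmetric]) (rule continuous_on_integrable_sub[OF _ t], intro continuous_intros g xc)+
    finally show ?thesis .
  qed
  then show ?thesis unfolding weak_sol_def using xc xX x00 by blast
qed

text \<open>
  The map sending \<open>x\<close> to the solution with source \<open>G t (x t)\<close> is a Volterra operator by
  \<open>weak_sol_norm_le\<close>.
\<close>

theorem semilinear_exists:
  assumes T: "T \<ge> 0" and x0: "x0 \<in> X0" and L: "L \<ge> 0"
    and Gc: "\<And>x. continuous_on {0..T} x \<Longrightarrow> continuous_on {0..T} (\<lambda>t. G t (x t))"
    and GX: "\<And>t p. t \<in> {0..T} \<Longrightarrow> G t p \<in> X0"
    and lip: "\<And>t p q. t \<in> {0..T} \<Longrightarrow> norm (G t p - G t q) \<le> L * norm (p - q)"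
  shows "\<exists>x. weak_sol T (\<lambda>t. G t (x t)) x \<and> x 0 = x0"
proof -
  define \<Phi> where "\<Phi> x = (SOME y. weak_sol T (\<lambda>t. G t (x t)) y \<and> y 0 = x0)" for x
  have \<Phi>: "weak_sol T (\<lambda>t. G t (x t)) (\<Phi> x)" "\<Phi> x 0 = x0" if "continuous_on {0..T} x" for x
  proof -
    have "\<exists>y. weak_sol T (\<lambda>t. G t (x t)) y \<and> y 0 = x0"
      by (rule weak_sol_exists[OF T x0 Gc[OF that] GX])
    then have "weak_sol T (\<lambda>t. G t (x t)) (\<Phi> x) \<and> \<Phi> x 0 = x0" unfolding \<Phi>_def by (rule someI_ex)
    then show "weak_sol T (\<lambda>t. G t (x t)) (\<Phi> x)" "\<Phi> x 0 = x0" by auto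
  qed
  have "\<exists>x. continuous_on {0..T} x \<and> (\<forall>t\<in>{0..T}. \<Phi> x t = x t)"
  proof (rule volterra_fixed_point[OF T, where L="2 * L"])
    show "continuous_on {0..T} (\<Phi> x)" if "continuous_on {0..T} x" for x
      using \<Phi>(1)[OF that] by (simp add: weak_sol_def)
    fix x y :: "real \<Rightarrow> 'x" and t assume x: "continuous_on {0..T} x" and y: "continuous_on {0..T} y" and t: "t \<in> {0..T}"
    have "norm (\<Phi> x t - \<Phi> y t) \<le> norm (\<Phi> x 0 - \<Phi> y 0) + 2 * integral {0..t} (\<lambda>s. norm (G s (x s) - G s (y s)))"
      by (rule weak_sol_norm_le[OF weak_sol_diff[OF \<Phi>(1)[OF x] \<Phi>(1)[OF y] Gc[OF x] Gc[OF y]] _ _ t])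
         (auto intro!: continuous_intros Gc x y subspace_diff[OF X0_subspace] GX)
    also have "integral {0..t} (\<lambda>s. norm (G s (x s) - G s (y s))) \<le> integral {0..t} (\<lambda>s. L * norm (x s - y s))"
    proof (rule integral_le)
      show "(\<lambda>s. norm (G s (x s) - G s (y s))) integrable_on {0..t}" "(\<lambda>s. L * norm (x s - y s)) integrable_on {0..t}"
        by (rule continuous_on_integrable_sub[OF _ t], intro continuous_intros Gc x y)+
    qed (use lip t in auto)
    finally show "norm (\<Phi> x t - \<Phi> y t) \<le> 2 * L * integral {0..t} (\<lambda>s. norm (x s - y s))"
      by (simp add: \<Phi>(2)[OF x] \<Phi>(2)[OF y])
  qed (use L in auto)
  then obtain x where x: "continuous_on {0..T} x" "\<And>t. t \<in> {0..T} \<Longrightarrow> \<Phi> x t = x t" by blast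
  have zT: "0 \<in> {0..T}" using T by auto
  have "weak_sol T (\<lambda>t. G t (x t)) x"
    unfolding weak_sol_def
  proof (intro conjI ballI allI impI x(1))
    note W = \<Phi>(1)[OF x(1), unfolded weak_sol_def]
    have "\<Phi> x t \<in> X0" if "t \<in> {0..T}" for t using W that by blast
    then show "x t \<in> X0" if "t \<in> {0..T}" for t using x(2)[OF that] that by metis
    fix y z t assume R: "(y, z) \<in> R" and t: "t \<in> {0..T}"
    have "\<Phi> x t \<bullet> y = \<Phi> x 0 \<bullet> y + integral {0..t} (\<lambda>s. G s (x s) \<bullet> y - \<Phi> x s \<bullet> z)"
      using W R t by blast
    moreover have "integral {0..t} (\<lambda>s. G s (x s) \<bullet> y - \<Phi> x s \<bullet> z) = integral {0..t} (\<lambda>s. G s (x s) \<bullet> y - x s \<bullet> z)"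
      by (rule integral_cong) (use x(2) t in auto)
    ultimately show "x t \<bullet> y = x 0 \<bullet> y + integral {0..t} (\<lambda>s. G s (x s) \<bullet> y - x s \<bullet> z)"
      using x(2)[OF t] x(2)[OF zT] by simp
  qed
  moreover have "x 0 = x0" using x(2)[OF zT] \<Phi>(2)[OF x(1)] by simp
  ultimately show ?thesis by blast
qed

end

section \<open>Abstract Kirchhoff equations\<close>

text \<open>
  The formulation of differentiability by difference quotients, as used for curves in the
  seminormed spaces of the plate problem.
\<close>

lemma has_vector_derivative_iff_quotient:
  fixes u :: "real \<Rightarrow> 'a::real_normed_vector"
  shows "(u has_vector_derivative D) (at t within S) \<longleftrightarrow>
    ((\<lambda>s. (1 / (s - t)) *\<^sub>R (u s - u t)) \<longlongrightarrow> D) (at t within S)"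
proof -
  have "(u has_vector_derivative D) (at t within S) \<longleftrightarrow>
     ((\<lambda>s. norm (u s - u t - (s - t) *\<^sub>R D) / norm (s - t)) \<longlongrightarrow> 0) (at t within S)"
    unfolding has_vector_derivative_def has_derivative_iff_norm
    by (auto intro: bounded_linear_scaleR_left)
  also have "\<dots> \<longleftrightarrow> ((\<lambda>s. norm ((1 / (s - t)) *\<^sub>R (u s - u t) - D)) \<longlongrightarrow> 0) (at t within S)"
  proof (rule tendsto_cong)
    have "norm (u s - u t - (s - t) *\<^sub>R D) / norm (s - t) = norm ((1 / (s - t)) *\<^sub>R (u s - u t) - D)"
      if "s \<noteq> t" for s
    proof -
      have "(1 / (s - t)) *\<^sub>R (u s - u t) - D = (1 / (s - t)) *\<^sub>R (u s - u t - (s - t) *\<^sub>R D)"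
        using that by (simp add: scaleR_diff_right[of _ _ "(s - t) *\<^sub>R D"])
      then show ?thesis by simp
    qed
    then show "\<forall>\<^sub>F s in at t within S. norm (u s - u t - (s - t) *\<^sub>R D) / norm (s - t) = norm ((1 / (s - t)) *\<^sub>R (u s - u t) - D)"
      by (auto simp: eventually_at_filter)
  qed
  also have "\<dots> \<longleftrightarrow> ((\<lambda>s. (1 / (s - t)) *\<^sub>R (u s - u t)) \<longlongrightarrow> D) (at t within S)"
    by (simp add: tendsto_norm_zero_iff LIM_zero_iff)
  finally show ?thesis .
qed

lemma orthogonal_projection:
  fixes M :: "'a::{real_inner,banach} set"
  assumes M: "subspace M" "closed M"
  obtains P where "bounded_linear P" "\<And>x. P x \<in> M" "\<And>x z. z \<in> M \<Longrightarrow> P x \<bullet> z = x \<bullet> z" "\<And>x. norm (P x) \<le> norm x"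
proof -
  obtain P where P: "\<And>x. P x \<in> M" "\<And>x z. z \<in> M \<Longrightarrow> (x - P x) \<bullet> z = 0"
    using orthogonal_projection_exists[OF M] by metis
  have P2: "P x \<bullet> z = x \<bullet> z" if "z \<in> M" for x z using P(2)[OF that, of x] by (simp add: inner_diff_left)
  have eq: "P x = y" if y: "y \<in> M" and "\<And>z. z \<in> M \<Longrightarrow> y \<bullet> z = x \<bullet> z" for x y
  proof -
    have "P x - y \<in> M" by (rule subspace_diff[OF M(1) P(1) y])
    then have "(P x - y) \<bullet> (P x - y) = 0" using P2 that(2) by (simp add: inner_diff_left)
    then show ?thesis by simp
  qed
  have n: "norm (P x) \<le> norm x" for x
  proof -
    have "norm (P x) * norm (P x) = x \<bullet> P x" using P2[OF P(1), of x x] by (simp add: power2_norm_eq_inner[symmetric] power2_eq_square)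
    also have "\<dots> \<le> norm x * norm (P x)" by (rule norm_cauchy_schwarz)
    finally show ?thesis by (cases "norm (P x) = 0") (auto simp: mult_le_cancel_right)
  qed
  have "bounded_linear P"
    by (rule bounded_linear_intro[where K=1])
       (auto intro!: eq subspace_add[OF M(1)] subspace_scale[OF M(1)] P(1) simp: inner_add_left P2 n)
  then show ?thesis using that P(1) P2 n by blast
qed

text \<open>
  The graph of a closed operator between Hilbert spaces.
\<close>

locale hilbert_graph =
  fixes \<Gamma> :: "('h::{real_inner,banach} \<times> 'k::{real_inner,banach}) set"
  assumes graph_subspace: "subspace \<Gamma>" and graph_closed: "closed \<Gamma>"
    and single_valued: "(0, w) \<in> \<Gamma> \<Longrightarrow> w = 0"
begin

text \<open>
  The operator \<open>(w, v) \<mapsto> (B v, - B\<^sup>* w)\<close> of a wave equation in first-order form, where \<open>\<Gamma>\<close> is the graph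
  of \<open>B\<close>.  The adjoint is multivalued when the domain of \<open>B\<close> is not dense.
\<close>

definition wave_relation :: "(('k \<times> 'h) \<times> ('k \<times> 'h)) set" where
  "wave_relation = {((w, v), (p, q)). (v, p) \<in> \<Gamma> \<and> (\<forall>(a, z)\<in>\<Gamma>. q \<bullet> a = - (w \<bullet> z))}"

lemma wave_relation_iff:
  "((w, v), (p, q)) \<in> wave_relation \<longleftrightarrow> (v, p) \<in> \<Gamma> \<and> (\<forall>a z. (a, z) \<in> \<Gamma> \<longrightarrow> q \<bullet> a = - (w \<bullet> z))"
  unfolding wave_relation_def by auto

sublocale skew_relation wave_relation
proof
  show "subspace wave_relation"
    unfolding subspace_def
  proof (intro conjI ballI allI)
    show "0 \<in> wave_relation"
      using subspace_0[OF graph_subspace] by (simp add: zero_prod_def wave_relation_iff)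
    fix x y assume a: "x \<in> wave_relation" "y \<in> wave_relation"
    obtain w v p q w' v' p' q' where e: "x = ((w, v), (p, q))" "y = ((w', v'), (p', q'))"
      by (metis surj_pair)
    have "(v + v', p + p') \<in> \<Gamma>"
      using a subspace_add[OF graph_subspace, of "(v, p)" "(v', p')"] by (simp add: e wave_relation_iff)
    moreover have "(q + q') \<bullet> b = - ((w + w') \<bullet> z)" if "(b, z) \<in> \<Gamma>" for b z
    proof -
      have "q \<bullet> b = - (w \<bullet> z)" "q' \<bullet> b = - (w' \<bullet> z)" using a that unfolding e wave_relation_iff by blast+
      then show ?thesis by (simp add: inner_add_left)
    qed
    ultimately show "x + y \<in> wave_relation" by (simp add: e wave_relation_iff)
  next
    fix c x assume a: "x \<in> wave_relation"
    obtain w v p q where e: "x = ((w, v), (p, q))" by (metis surj_pair)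
    have "(c *\<^sub>R v, c *\<^sub>R p) \<in> \<Gamma>"
      using a subspace_scale[OF graph_subspace, of "(v, p)" c] by (simp add: e wave_relation_iff)
    moreover have "(c *\<^sub>R q) \<bullet> b = - ((c *\<^sub>R w) \<bullet> z)" if "(b, z) \<in> \<Gamma>" for b z
    proof -
      have "q \<bullet> b = - (w \<bullet> z)" using a that unfolding e wave_relation_iff by blast
      then show ?thesis by simp
    qed
    ultimately show "c *\<^sub>R x \<in> wave_relation" by (simp add: e wave_relation_iff)
  qed
next
  fix x y x' y' assume a: "(x, y) \<in> wave_relation" "(x', y') \<in> wave_relation"
  obtain w v p q w' v' p' q' where e: "x = (w, v)" "y = (p, q)" "x' = (w', v')" "y' = (p', q')"
    by (metis surj_pair)
  have "q \<bullet> v' = - (w \<bullet> p')" "q' \<bullet> v = - (w' \<bullet> p)" using a unfolding e wave_relation_iff by auto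
  then show "y \<bullet> x' = - (x \<bullet> y')" unfolding e by (simp add: inner_commute)
next
  fix \<mu> :: real and f :: "'k \<times> 'h" assume \<mu>: "\<mu> \<noteq> 0"
  \<comment> \<open>solving \<open>x - \<mu> R x = f\<close> amounts to projecting onto the graph of \<open>\<mu> B\<close>, because
    eliminating \<open>w\<close> gives \<open>(1 + \<mu>\<^sup>2 B\<^sup>* B) v = snd f - \<mu> B\<^sup>* (fst f)\<close>\<close>
  let ?G = "(\<lambda>x. (fst x, (1 / \<mu>) *\<^sub>R snd x)) -` \<Gamma>"
  have lin: "bounded_linear (\<lambda>x :: 'h \<times> 'k. (fst x, (1 / \<mu>) *\<^sub>R snd x))"
    by (intro bounded_linear_intros)
  have G: "subspace ?G" by (rule linear_subspace_vimage[OF bounded_linear.linear[OF lin] graph_subspace])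
  have G': "closed ?G" by (rule closed_vimage[OF graph_closed]) (intro continuous_intros)
  obtain y where y: "y \<in> ?G" "\<And>z. z \<in> ?G \<Longrightarrow> ((snd f, - fst f) - y) \<bullet> z = 0"
    using orthogonal_projection_exists[OF G G', of "(snd f, - fst f)"] by blast
  define v where "v = fst y"
  define p where "p = (1 / \<mu>) *\<^sub>R snd y"
  have vp: "(v, p) \<in> \<Gamma>" using y(1) by (simp add: v_def p_def)
  have yy: "y = (v, \<mu> *\<^sub>R p)" using \<mu> by (simp add: v_def p_def)
  define w where "w = fst f + \<mu> *\<^sub>R p"
  define q where "q = (1 / \<mu>) *\<^sub>R (v - snd f)"
  have "q \<bullet> a = - (w \<bullet> z)" if "(a, z) \<in> \<Gamma>" for a z
  proof -
    have "(a, \<mu> *\<^sub>R z) \<in> ?G" using that \<mu> by simp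
    from y(2)[OF this] have "(snd f - v) \<bullet> a = \<mu> * (w \<bullet> z)"
      unfolding yy w_def by (simp add: inner_diff_left inner_add_left algebra_simps)
    then show ?thesis unfolding q_def using \<mu> by (simp add: inner_diff_left field_simps)
  qed
  then have "((w, v), (p, q)) \<in> wave_relation" using vp by (simp add: wave_relation_iff)
  moreover have "(w, v) - \<mu> *\<^sub>R (p, q) = f" using \<mu> by (simp add: w_def q_def prod_eq_iff)
  ultimately show "\<exists>x y. (x, y) \<in> wave_relation \<and> x - \<mu> *\<^sub>R y = f" by blast
qed

text \<open>
  The closure of the domain, written as a double orthogonal complement.
\<close>

definition H0 :: "'h set" where
  "H0 = {v. \<forall>q. (\<forall>a z. (a, z) \<in> \<Gamma> \<longrightarrow> q \<bullet> a = 0) \<longrightarrow> v \<bullet> q = 0}"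

lemma X0_iff: "(w, v) \<in> X0 \<longleftrightarrow> v \<in> H0"
proof
  assume wv: "(w, v) \<in> X0"
  have "v \<bullet> q = 0" if "\<And>a z. (a, z) \<in> \<Gamma> \<Longrightarrow> q \<bullet> a = 0" for q
  proof -
    have "((0, 0), (0, q)) \<in> wave_relation"
      using that subspace_0[OF graph_subspace] by (auto simp: wave_relation_iff zero_prod_def)
    then have "(w, v) \<bullet> (0, q) = 0" using wv unfolding X0_def zero_prod_def by blast
    then show ?thesis by simp
  qed
  then show "v \<in> H0" unfolding H0_def by blast
next
  assume v: "v \<in> H0"
  show "(w, v) \<in> X0" unfolding X0_def
  proof safe
    fix p q assume "(0, (p, q)) \<in> wave_relation"
    then have "(0, p) \<in> \<Gamma>" "\<forall>a z. (a, z) \<in> \<Gamma> \<longrightarrow> q \<bullet> a = 0"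
      by (auto simp: zero_prod_def wave_relation_iff)
    then have "p = 0" "v \<bullet> q = 0" using single_valued v unfolding H0_def by blast+
    then show "(w, v) \<bullet> (p, q) = 0" by simp
  qed
qed

lemma dom_H0: "(a, z) \<in> \<Gamma> \<Longrightarrow> a \<in> H0"
  unfolding H0_def by (auto simp: inner_commute)

lemma H0_subspace: "subspace H0" and H0_closed: "closed H0"
proof -
  have e: "H0 = (\<lambda>v. (0, v)) -` X0" using X0_iff by auto
  have "linear (\<lambda>v::'h. (0::'k, v))" by (rule bounded_linear.linear, intro bounded_linear_intros)
  then show "subspace H0" unfolding e by (rule linear_subspace_vimage[OF _ X0_subspace])
  show "closed H0" unfolding e by (rule closed_vimage[OF X0_closed]) (intro continuous_intros)
qed

text \<open>
  The premise says that \<open>(u, w)\<close> is orthogonal to the orthogonal complement of \<open>\<Gamma>\<close>.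
\<close>

lemma mem_graph_of_orthogonal:
  assumes "\<And>q y. (\<And>a z. (a, z) \<in> \<Gamma> \<Longrightarrow> q \<bullet> a = - (y \<bullet> z)) \<Longrightarrow> w \<bullet> y = - (u \<bullet> q)"
  shows "(u, w) \<in> \<Gamma>"
proof -
  obtain p where p: "p \<in> \<Gamma>" "\<And>z. z \<in> \<Gamma> \<Longrightarrow> ((u, w) - p) \<bullet> z = 0"
    using orthogonal_projection_exists[OF graph_subspace graph_closed, of "(u, w)"] by blast
  let ?r = "(u, w) - p"
  have "fst ?r \<bullet> a = - (snd ?r \<bullet> z)" if "(a, z) \<in> \<Gamma>" for a z
    using p(2)[OF that] by (simp add: inner_prod_def)
  then have "w \<bullet> snd ?r = - (u \<bullet> fst ?r)" by (rule assms)
  then have "(u, w) \<bullet> ?r = 0" by (simp add: inner_prod_def)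
  moreover have "p \<bullet> ?r = 0" using p(2)[OF p(1)] by (simp add: inner_commute)
  ultimately have "?r \<bullet> ?r = 0" by (subst (1) inner_diff_left) simp
  then have "?r = 0" by (simp only: inner_eq_zero_iff)
  then show ?thesis using p(1) by (simp only: right_minus_eq)
qed

end

text \<open>
  The elements of \<open>\<Gamma>\<close> are states \<open>(u, d, k)\<close>: for the plate, \<open>d = u\<^sub>x\<close>, \<open>k\<close> is the vector of second
  derivatives with \<open>k \<bullet> k = \<parallel>u\<parallel>\<^sub>2\<^sup>2\<close>, and \<open>M k = u\<^sub>x\<^sub>x\<close>.
\<close>

locale kirchhoff =
  fixes \<Gamma> :: "('h::{real_inner,banach} \<times> 'h \<times> 'k::{real_inner,banach}) set"
    and M :: "'k \<Rightarrow> 'h" and S P \<delta> :: real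
  assumes state_subspace: "subspace \<Gamma>" and state_closed: "closed \<Gamma>"
    and state_determined: "(0, d, k) \<in> \<Gamma> \<Longrightarrow> d = 0 \<and> k = 0"
    and M_linear: "bounded_linear M"
    and by_parts: "(u, d, k) \<in> \<Gamma> \<Longrightarrow> (u', d', k') \<in> \<Gamma> \<Longrightarrow> d \<bullet> d' = - (M k \<bullet> u')"
    and S_pos: "S > 0"
begin

abbreviation (input) uc :: "'h \<times> 'h \<times> 'k \<Rightarrow> 'h" where "uc w \<equiv> fst w"
abbreviation (input) dc :: "'h \<times> 'h \<times> 'k \<Rightarrow> 'h" where "dc w \<equiv> fst (snd w)"
abbreviation (input) kc :: "'h \<times> 'h \<times> 'k \<Rightarrow> 'k" where "kc w \<equiv> snd (snd w)"

text \<open>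
  The operator \<open>u \<mapsto> (u, d, k)\<close>.  Keeping \<open>u\<close> and \<open>d\<close> among the components makes the graph norm dominate
  all the quantities that occur in the equation.
\<close>

definition state_graph :: "('h \<times> ('h \<times> 'h \<times> 'k)) set" where
  "state_graph = {(a, w). w \<in> \<Gamma> \<and> a = uc w}"

sublocale hilbert_graph state_graph
proof
  show "subspace state_graph"
    unfolding state_graph_def subspace_def
    using subspace_0[OF state_subspace] subspace_add[OF state_subspace] subspace_scale[OF state_subspace]
    by (auto simp: zero_prod_def)
  have "state_graph = {x. snd x \<in> \<Gamma>} \<inter> {x. fst x = fst (snd x)}"
    unfolding state_graph_def by auto
  moreover have "closed {x :: 'h \<times> 'h \<times> 'h \<times> 'k. snd x \<in> \<Gamma>}"
    using closed_vimage[OF state_closed, of snd] by (simp add: vimage_def continuous_on_snd)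
  moreover have "closed {x :: 'h \<times> 'h \<times> 'h \<times> 'k. fst x = fst (snd x)}"
    by (intro closed_Collect_eq continuous_intros)
  ultimately show "closed state_graph" by auto
  show "w = 0" if "(0, w) \<in> state_graph" for w
    using that state_determined unfolding state_graph_def by (cases w) (auto simp: zero_prod_def)
qed

lemma state_graph_iff: "(a, w) \<in> state_graph \<longleftrightarrow> w \<in> \<Gamma> \<and> a = uc w"
  by (simp add: state_graph_def)

definition phi :: "'h \<Rightarrow> real" where "phi d = - P + S * (d \<bullet> d)"

text \<open>
  The lower order terms once the wave operator is taken with respect to the full inner product of states:
  the contributions of \<open>u\<close> and \<open>d\<close> to that inner product are subtracted again, the second one in the
  form \<open>d \<bullet> d' = - (M k \<bullet> u')\<close> (see \<open>load_inner\<close>).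
\<close>

definition load :: "'h \<times> 'h \<times> 'k \<Rightarrow> 'h" where
  "load w = uc w - M (kc w) + phi (dc w) *\<^sub>R M (kc w)"

text \<open>
  The weak form of \<open>u'' + \<delta> u' + K\<^sup>* K u + \<phi>(u) D\<^sup>* D u = F\<close>, integrated in time, with velocity \<open>v\<close>.
\<close>

definition sol :: "(real \<Rightarrow> 'h) \<Rightarrow> real \<Rightarrow> (real \<Rightarrow> 'h \<times> 'h \<times> 'k) \<Rightarrow> (real \<Rightarrow> 'h) \<Rightarrow> bool" where
  "sol F T w v \<longleftrightarrow> continuous_on {0..T} w \<and> continuous_on {0..T} v \<and>
    (\<forall>t\<in>{0..T}. w t \<in> \<Gamma> \<and> v t \<in> H0 \<and> uc (w t) = uc (w 0) + integral {0..t} v \<and>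
      (\<forall>z\<in>\<Gamma>. v t \<bullet> uc z = v 0 \<bullet> uc z + integral {0..t} (\<lambda>s.
         F s \<bullet> uc z - \<delta> * (v s \<bullet> uc z) - kc (w s) \<bullet> kc z - phi (dc (w s)) * (dc (w s) \<bullet> dc z))))"

definition project :: "'h \<Rightarrow> 'h" where
  "project = (SOME p. bounded_linear p \<and> (\<forall>x. p x \<in> H0) \<and> (\<forall>x. \<forall>z\<in>H0. p x \<bullet> z = x \<bullet> z) \<and> (\<forall>x. norm (p x) \<le> norm x))"

lemma project: "bounded_linear project" "project x \<in> H0" "z \<in> H0 \<Longrightarrow> project x \<bullet> z = x \<bullet> z" "norm (project x) \<le> norm x"
proof -
  have "\<exists>p. bounded_linear p \<and> (\<forall>x. p x \<in> H0) \<and> (\<forall>x. \<forall>z\<in>H0. p x \<bullet> z = x \<bullet> z) \<and> (\<forall>x. norm (p x) \<le> norm x)"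
    by (rule orthogonal_projection[OF H0_subspace H0_closed]) blast
  from someI_ex[OF this, folded project_def]
  show "bounded_linear project" "project x \<in> H0" "z \<in> H0 \<Longrightarrow> project x \<bullet> z = x \<bullet> z" "norm (project x) \<le> norm x" by auto
qed

text \<open>
  The load acts on test vectors of the form \<open>uc z\<close> only, so it may be projected to \<open>H0\<close>; this puts the
  source into the space \<open>X0\<close> in which the energy identity holds.
\<close>

definition force :: "(real \<Rightarrow> 'h) \<Rightarrow> real \<Rightarrow> 'h \<times> 'h \<times> 'k \<Rightarrow> 'h \<Rightarrow> ('h \<times> 'h \<times> 'k) \<times> 'h" where
  "force F t w v = (0, project (load w - \<delta> *\<^sub>R v + F t))"

lemma force_X0: "force F t w v \<in> X0"
  unfolding force_def X0_iff by (rule project(2))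

lemma state_component_bounds: "norm (uc w) \<le> norm w" "norm (dc w) \<le> norm w" "norm (kc w) \<le> norm w"
  for w :: "'h \<times> 'h \<times> 'k"
  using norm_fst_le[of "fst w" "snd w"] norm_snd_le[of "snd w" "fst w"] norm_fst_le[of "fst (snd w)" "snd (snd w)"]
    norm_snd_le[of "snd (snd w)" "fst (snd w)"] by auto

text \<open>
  The product \<open>\<phi>(d) M k\<close> is quadratic in \<open>d\<close> and linear in \<open>k\<close>, hence Lipschitz on balls.
\<close>

lemma load_lipschitz:
  "\<exists>L\<ge>0. \<forall>w w'. norm w \<le> R \<longrightarrow> norm w' \<le> R \<longrightarrow> norm (load w - load w') \<le> L * norm (w - w')"
proof -
  obtain K where K: "K > 0" "\<And>x. norm (M x) \<le> K * norm x"
    using bounded_linear.pos_bounded[OF M_linear] by (auto simp: mult.commute)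
  note Ml = bounded_linear.linear[OF M_linear]
  define L where "L = 1 + K + (\<bar>P\<bar> + S * (R * R)) * K + S * (2 * R) * (K * R)"
  have est: "norm (load w - load w') \<le> L * norm (w - w')" if w: "norm w \<le> R" and w': "norm w' \<le> R" for w w'
  proof -
    have R: "R \<ge> 0" using order_trans[OF norm_ge_zero w] .
    let ?D = "norm (w - w')"
    have c: "norm (uc w - uc w') \<le> ?D" "norm (dc w - dc w') \<le> ?D" "norm (kc w - kc w') \<le> ?D"
      using state_component_bounds[of "w - w'"] by auto
    have dR: "norm (dc w) \<le> R" "norm (dc w') \<le> R" "norm (kc w') \<le> R"
      using state_component_bounds[of w] state_component_bounds[of w'] w w' by auto
    have Md: "norm (M (kc w) - M (kc w')) \<le> K * ?D"
      using order_trans[OF K(2)[of "kc w - kc w'"] mult_left_mono[OF c(3), of K]] K(1) by (simp add: linear_diff[OF Ml])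
    have ph: "\<bar>phi (dc w)\<bar> \<le> \<bar>P\<bar> + S * (R * R)"
    proof -
      have "dc w \<bullet> dc w \<le> R * R"
        using mult_mono[OF dR(1) dR(1)] R by (simp add: power2_norm_eq_inner[symmetric] power2_eq_square)
      then have "S * (dc w \<bullet> dc w) \<le> S * (R * R)" "0 \<le> S * (dc w \<bullet> dc w)" using S_pos by auto
      then show ?thesis unfolding phi_def by linarith
    qed
    have pd: "\<bar>phi (dc w) - phi (dc w')\<bar> \<le> S * (2 * R) * ?D"
    proof -
      have "dc w \<bullet> dc w - dc w' \<bullet> dc w' = (dc w - dc w') \<bullet> (dc w + dc w')"
        by (simp add: inner_diff_left inner_diff_right inner_add_right inner_commute)
      also have "\<bar>\<dots>\<bar> \<le> norm (dc w - dc w') * norm (dc w + dc w')" by (rule Cauchy_Schwarz_ineq2)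
      also have "\<dots> \<le> ?D * (2 * R)"
        using norm_triangle_ineq[of "dc w" "dc w'"] dR by (intro mult_mono c(2)) auto
      finally have "\<bar>dc w \<bullet> dc w - dc w' \<bullet> dc w'\<bar> \<le> ?D * (2 * R)" .
      then have "S * \<bar>dc w \<bullet> dc w - dc w' \<bullet> dc w'\<bar> \<le> S * (?D * (2 * R))" using S_pos by simp
      moreover have "phi (dc w) - phi (dc w') = S * (dc w \<bullet> dc w - dc w' \<bullet> dc w')"
        unfolding phi_def by (simp add: algebra_simps)
      ultimately show ?thesis using S_pos by (simp add: abs_mult mult_ac)
    qed
    have Mb: "norm (M (kc w')) \<le> K * R"
      using order_trans[OF K(2)[of "kc w'"] mult_left_mono[OF dR(3), of K]] K(1) by simp
    have "load w - load w' = (uc w - uc w') - (M (kc w) - M (kc w')) +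
        (phi (dc w) *\<^sub>R (M (kc w) - M (kc w')) + (phi (dc w) - phi (dc w')) *\<^sub>R M (kc w'))"
      unfolding load_def by (simp add: algebra_simps)
    also have "norm \<dots> \<le> (norm (uc w - uc w') + norm (M (kc w) - M (kc w'))) +
        (norm (phi (dc w) *\<^sub>R (M (kc w) - M (kc w'))) + norm ((phi (dc w) - phi (dc w')) *\<^sub>R M (kc w')))"
      by (intro norm_triangle_le add_mono norm_triangle_ineq4 norm_triangle_ineq)
    also have "\<dots> \<le> (?D + K * ?D) + ((\<bar>P\<bar> + S * (R * R)) * (K * ?D) + (S * (2 * R) * ?D) * (K * R))"
      unfolding norm_scaleR
      by (intro add_mono mult_mono c Md ph pd Mb) (use S_pos R K in auto)
    also have "\<dots> = L * ?D" unfolding L_def by (simp add: algebra_simps)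
    finally show ?thesis .
  qed
  show ?thesis
  proof (cases "R \<ge> 0")
    case True
    then have "L \<ge> 0" unfolding L_def using K S_pos by auto
    then show ?thesis using est by blast
  next
    case False
    then have "\<not> norm w \<le> R" for w :: "'h \<times> 'h \<times> 'k" using norm_ge_zero[of w] by linarith
    then show ?thesis by (intro exI[of _ 0]) auto
  qed
qed

lemma load_continuous:
  assumes "continuous_on B w" shows "continuous_on B (\<lambda>t. load (w t))"
  unfolding load_def phi_def
  by (intro continuous_intros assms bounded_linear.continuous_on[OF M_linear])

lemma force_continuous:
  assumes "continuous_on B F" "continuous_on B w" "continuous_on B v"
  shows "continuous_on B (\<lambda>t. force F t (w t) (v t))"
  unfolding force_def
  by (intro continuous_intros bounded_linear.continuous_on[OF project(1)] load_continuous assms)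

lemma load_inner:
  assumes "w \<in> \<Gamma>" "z \<in> \<Gamma>"
  shows "load w \<bullet> uc z - w \<bullet> z = - (kc w \<bullet> kc z) - phi (dc w) * (dc w \<bullet> dc z)"
proof -
  obtain u d k where w: "w = (u, d, k)" by (metis surj_pair)
  obtain u' d' k' where z: "z = (u', d', k')" by (metis surj_pair)
  have "d \<bullet> d' = - (M k \<bullet> u')" using by_parts assms unfolding w z by blast
  then show ?thesis unfolding w z load_def
    by (simp add: inner_diff_left inner_add_left)
qed

lemma sol_imp_weak_sol:
  assumes s: "sol F T w v" and F: "continuous_on {0..T} F"
  shows "weak_sol T (\<lambda>t. force F t (w t) (v t)) (\<lambda>t. (w t, v t))"
  unfolding weak_sol_def
proof (intro conjI ballI allI impI)
  have wc: "continuous_on {0..T} w" and vc: "continuous_on {0..T} v" using s by (auto simp: sol_def)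
  have wG: "\<And>t. t \<in> {0..T} \<Longrightarrow> w t \<in> \<Gamma>" and vH: "\<And>t. t \<in> {0..T} \<Longrightarrow> v t \<in> H0"
    and wi: "\<And>t. t \<in> {0..T} \<Longrightarrow> uc (w t) = uc (w 0) + integral {0..t} v"
    and vi: "\<And>t z. t \<in> {0..T} \<Longrightarrow> z \<in> \<Gamma> \<Longrightarrow> v t \<bullet> uc z = v 0 \<bullet> uc z + integral {0..t} (\<lambda>s.
         F s \<bullet> uc z - \<delta> * (v s \<bullet> uc z) - kc (w s) \<bullet> kc z - phi (dc (w s)) * (dc (w s) \<bullet> dc z))"
    using s unfolding sol_def by blast+
  show "continuous_on {0..T} (\<lambda>t. (w t, v t))" by (intro continuous_intros wc vc)
  show "(w t, v t) \<in> X0" if "t \<in> {0..T}" for t using vH[OF that] by (simp add: X0_iff)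
  fix y x t assume R: "(y, x) \<in> wave_relation" and t: "t \<in> {0..T}"
  obtain y1 y2 p q where e: "y = (y1, y2)" "x = (p, q)" by (metis surj_pair)
  have p: "p \<in> \<Gamma>" "uc p = y2" and q: "\<And>z. z \<in> \<Gamma> \<Longrightarrow> q \<bullet> uc z = - (y1 \<bullet> z)"
    using R unfolding e wave_relation_iff state_graph_iff by auto
  have z: "0 \<in> {0..T}" using t by auto
  have "w t \<bullet> y1 = - (q \<bullet> uc (w t))" using q[OF wG[OF t]] by (simp add: inner_commute)
  also have "\<dots> = - (q \<bullet> uc (w 0)) - integral {0..t} v \<bullet> q"
    unfolding wi[OF t] by (simp add: inner_add_right inner_commute)
  also have "- (q \<bullet> uc (w 0)) = w 0 \<bullet> y1" using q[OF wG[OF z]] by (simp add: inner_commute)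
  also have "integral {0..t} v \<bullet> q = integral {0..t} (\<lambda>s. v s \<bullet> q)"
    by (rule integral_inner_left[OF continuous_on_integrable_sub[OF vc t]])
  finally have 1: "w t \<bullet> y1 = w 0 \<bullet> y1 - integral {0..t} (\<lambda>s. v s \<bullet> q)" .
  have y2: "y2 \<in> H0" using p dom_H0[of y2 p] by (simp add: state_graph_iff)
  have fp: "project (load (w s) - \<delta> *\<^sub>R v s + F s) \<bullet> y2 - w s \<bullet> p =
     F s \<bullet> uc p - \<delta> * (v s \<bullet> uc p) - kc (w s) \<bullet> kc p - phi (dc (w s)) * (dc (w s) \<bullet> dc p)" if "s \<in> {0..T}" for s
    unfolding project(3)[OF y2] using load_inner[OF wG[OF that] p(1)] p(2)
    by (simp add: inner_diff_left inner_add_left)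
  have 2: "v t \<bullet> y2 = v 0 \<bullet> y2 + integral {0..t} (\<lambda>s. project (load (w s) - \<delta> *\<^sub>R v s + F s) \<bullet> y2 - w s \<bullet> p)"
  proof -
    have "integral {0..t} (\<lambda>s. project (load (w s) - \<delta> *\<^sub>R v s + F s) \<bullet> y2 - w s \<bullet> p) = integral {0..t} (\<lambda>s.
         F s \<bullet> uc p - \<delta> * (v s \<bullet> uc p) - kc (w s) \<bullet> kc p - phi (dc (w s)) * (dc (w s) \<bullet> dc p))"
      by (rule integral_cong) (use fp t in auto)
    then show ?thesis using vi[OF t p(1)] p(2) by simp
  qed
  have i1: "(\<lambda>s. v s \<bullet> q) integrable_on {0..t}"
    by (rule continuous_on_integrable_sub[OF _ t]) (intro continuous_intros vc)
  have i2: "(\<lambda>s. project (load (w s) - \<delta> *\<^sub>R v s + F s) \<bullet> y2 - w s \<bullet> p) integrable_on {0..t}"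
    by (rule continuous_on_integrable_sub[OF _ t])
       (intro continuous_intros bounded_linear.continuous_on[OF project(1)] load_continuous wc vc F)
  have "integral {0..t} (\<lambda>s. force F s (w s) (v s) \<bullet> y - (w s, v s) \<bullet> x)
      = integral {0..t} (\<lambda>s. (project (load (w s) - \<delta> *\<^sub>R v s + F s) \<bullet> y2 - w s \<bullet> p) - v s \<bullet> q)"
    unfolding e force_def by (simp add: algebra_simps)
  also have "\<dots> = integral {0..t} (\<lambda>s. project (load (w s) - \<delta> *\<^sub>R v s + F s) \<bullet> y2 - w s \<bullet> p) - integral {0..t} (\<lambda>s. v s \<bullet> q)"
    by (rule integral_diff[OF i2 i1])
  finally show "(w t, v t) \<bullet> y = (w 0, v 0) \<bullet> y + integral {0..t} (\<lambda>s. force F s (w s) (v s) \<bullet> y - (w s, v s) \<bullet> x)"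
    using 1 2 unfolding e by simp
qed

lemma weak_sol_imp_sol:
  assumes s: "weak_sol T (\<lambda>t. force F t (w t) (v t)) (\<lambda>t. (w t, v t))"
    and F: "continuous_on {0..T} F" and w0: "w 0 \<in> \<Gamma>"
  shows "sol F T w v"
proof -
  have c: "continuous_on {0..T} (\<lambda>t. (w t, v t))" and X: "\<And>t. t \<in> {0..T} \<Longrightarrow> v t \<in> H0"
    using s X0_iff unfolding weak_sol_def by auto
  have wc: "continuous_on {0..T} w" using continuous_on_fst[OF c] by simp
  have vc: "continuous_on {0..T} v" using continuous_on_snd[OF c] by simp
  have E: "(w t, v t) \<bullet> y = (w 0, v 0) \<bullet> y + integral {0..t} (\<lambda>s. force F s (w s) (v s) \<bullet> y - (w s, v s) \<bullet> x)"
    if "(y, x) \<in> wave_relation" "t \<in> {0..T}" for y x t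
    using s that unfolding weak_sol_def by blast
  have G: "(integral {0..t} v, w t - w 0) \<in> state_graph" if t: "t \<in> {0..T}" for t
  proof (rule mem_graph_of_orthogonal)
    fix q y assume qy: "\<And>a z. (a, z) \<in> state_graph \<Longrightarrow> q \<bullet> a = - (y \<bullet> z)"
    have "((y, 0), (0, q)) \<in> wave_relation"
      using qy subspace_0[OF state_subspace] by (auto simp: wave_relation_iff state_graph_iff)
    from E[OF this t] have "w t \<bullet> y = w 0 \<bullet> y + integral {0..t} (\<lambda>s. - (v s \<bullet> q))"
      by (simp add: force_def)
    also have "integral {0..t} (\<lambda>s. - (v s \<bullet> q)) = - (integral {0..t} v \<bullet> q)"
      using integral_inner_left[OF continuous_on_integrable_sub[OF vc t], of q] by simp
    finally show "(w t - w 0) \<bullet> y = - (integral {0..t} v \<bullet> q)" by (simp add: inner_diff_left)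
  qed
  have wG: "w t \<in> \<Gamma>" if t: "t \<in> {0..T}" for t
    using G[OF t] subspace_add[OF state_subspace w0, of "w t - w 0"] by (auto simp: state_graph_iff)
  have wi: "uc (w t) = uc (w 0) + integral {0..t} v" if t: "t \<in> {0..T}" for t
    using G[OF t] by (simp add: state_graph_iff)
  have "v t \<bullet> uc z = v 0 \<bullet> uc z + integral {0..t} (\<lambda>s.
         F s \<bullet> uc z - \<delta> * (v s \<bullet> uc z) - kc (w s) \<bullet> kc z - phi (dc (w s)) * (dc (w s) \<bullet> dc z))"
    if t: "t \<in> {0..T}" and z: "z \<in> \<Gamma>" for t z
  proof -
    have "((0, uc z), (z, 0)) \<in> wave_relation" using z by (auto simp: wave_relation_iff state_graph_iff)
    from E[OF this t] have "v t \<bullet> uc z = v 0 \<bullet> uc z + integral {0..t} (\<lambda>s. project (load (w s) - \<delta> *\<^sub>R v s + F s) \<bullet> uc z - w s \<bullet> z)"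
      by (simp add: force_def)
    also have "integral {0..t} (\<lambda>s. project (load (w s) - \<delta> *\<^sub>R v s + F s) \<bullet> uc z - w s \<bullet> z) = integral {0..t} (\<lambda>s.
         F s \<bullet> uc z - \<delta> * (v s \<bullet> uc z) - kc (w s) \<bullet> kc z - phi (dc (w s)) * (dc (w s) \<bullet> dc z))"
    proof (rule integral_cong)
      fix s assume "s \<in> {0..t}"
      then have s: "s \<in> {0..T}" using t by auto
      have "uc z \<in> H0" using z dom_H0[of "uc z" z] by (simp add: state_graph_iff)
      then show "project (load (w s) - \<delta> *\<^sub>R v s + F s) \<bullet> uc z - w s \<bullet> z =
         F s \<bullet> uc z - \<delta> * (v s \<bullet> uc z) - kc (w s) \<bullet> kc z - phi (dc (w s)) * (dc (w s) \<bullet> dc z)"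
        using load_inner[OF wG[OF s] z] by (simp add: project(3) inner_diff_left inner_add_left)
    qed
    finally show ?thesis .
  qed
  then show ?thesis unfolding sol_def using wc vc wG wi X by blast
qed

end

section \<open>Energy, a priori bounds and well-posedness of the abstract equation\<close>

context kirchhoff
begin

definition energy :: "'h \<times> 'h \<times> 'k \<Rightarrow> 'h \<Rightarrow> real" where
  "energy w v = 1/2 * (v \<bullet> v) + 1/2 * (kc w \<bullet> kc w) - P/2 * (dc w \<bullet> dc w) + S/4 * (dc w \<bullet> dc w)\<^sup>2"

lemma sol_parts:
  assumes "sol F T w v"
  shows "continuous_on {0..T} w" "continuous_on {0..T} v"
    "\<And>t. t \<in> {0..T} \<Longrightarrow> w t \<in> \<Gamma>" "\<And>t. t \<in> {0..T} \<Longrightarrow> v t \<in> H0"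
    "\<And>t. t \<in> {0..T} \<Longrightarrow> uc (w t) = uc (w 0) + integral {0..t} v"
  using assms unfolding sol_def by blast+

lemma by_parts_state:
  assumes "w \<in> \<Gamma>" "w' \<in> \<Gamma>"
  shows "dc w \<bullet> dc w' = - (M (kc w) \<bullet> uc w')"
  using assms by_parts by (cases w, cases w') auto

text \<open>
  The curve \<open>d\<close> is only continuous, so \<open>d \<bullet> d\<close> cannot be differentiated by the product rule.  But
  \<open>|d s|\<^sup>2 - |d t|\<^sup>2 = (d s + d t) \<bullet> (d s - d t)\<close>, and integration by parts moves the derivative to the sum, leaving
  the difference quotient of \<open>u\<close>, which converges to \<open>v\<close>.
\<close>

lemma stretch_derivative:
  assumes s: "sol F T w v" and t: "t \<in> {0..T}"
  shows "((\<lambda>t. dc (w t) \<bullet> dc (w t)) has_real_derivative - 2 * (M (kc (w t)) \<bullet> v t)) (at t within {0..T})"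
proof -
  note p = sol_parts[OF s]
  have sq: "(a + b) \<bullet> (a - b) = a \<bullet> a - b \<bullet> b" for a b :: 'h
    by (simp add: inner_add_left inner_diff_right inner_commute[of b a])
  have "((\<lambda>t. uc (w t)) has_vector_derivative v t) (at t within {0..T})"
    by (rule integral_eq_imp_has_vector_derivative[OF p(2) p(5) t])
  then have uq: "((\<lambda>s. (1 / (s - t)) *\<^sub>R (uc (w s) - uc (w t))) \<longlongrightarrow> v t) (at t within {0..T})"
    by (simp add: has_vector_derivative_iff_quotient)
  have Mc: "continuous_on {0..T} (\<lambda>s. M (kc (w s)))"
    by (intro bounded_linear.continuous_on[OF M_linear] continuous_intros p(1))
  then have Ml: "((\<lambda>s. M (kc (w s))) \<longlongrightarrow> M (kc (w t))) (at t within {0..T})"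
    using t by (simp add: continuous_on_def)
  have "((\<lambda>s. - ((M (kc (w s)) + M (kc (w t))) \<bullet> ((1 / (s - t)) *\<^sub>R (uc (w s) - uc (w t))))) \<longlongrightarrow>
      - ((M (kc (w t)) + M (kc (w t))) \<bullet> v t)) (at t within {0..T})"
    by (intro tendsto_intros uq Ml)
  moreover have "\<forall>\<^sub>F s in at t within {0..T}. - ((M (kc (w s)) + M (kc (w t))) \<bullet> ((1 / (s - t)) *\<^sub>R (uc (w s) - uc (w t))))
     = (dc (w s) \<bullet> dc (w s) - dc (w t) \<bullet> dc (w t)) / (s - t)"
    unfolding eventually_at_filter
  proof (rule always_eventually, safe)
    fix s assume "s \<in> {0..T}"
    have "w s + w t \<in> \<Gamma>" "w s - w t \<in> \<Gamma>"
      using subspace_add[OF state_subspace] subspace_diff[OF state_subspace] p(3)[OF \<open>s \<in> {0..T}\<close>] p(3)[OF t] by auto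
    then have "(dc (w s) + dc (w t)) \<bullet> (dc (w s) - dc (w t)) = - (M (kc (w s) + kc (w t)) \<bullet> (uc (w s) - uc (w t)))"
      using by_parts_state[of "w s + w t" "w s - w t"] by simp
    then have "dc (w s) \<bullet> dc (w s) - dc (w t) \<bullet> dc (w t) = - ((M (kc (w s)) + M (kc (w t))) \<bullet> (uc (w s) - uc (w t)))"
      unfolding sq by (simp add: linear_add[OF bounded_linear.linear[OF M_linear]])
    then show "- ((M (kc (w s)) + M (kc (w t))) \<bullet> ((1 / (s - t)) *\<^sub>R (uc (w s) - uc (w t))))
      = (dc (w s) \<bullet> dc (w s) - dc (w t) \<bullet> dc (w t)) / (s - t)" by simp
  qed
  ultimately have "((\<lambda>s. (dc (w s) \<bullet> dc (w s) - dc (w t) \<bullet> dc (w t)) / (s - t)) \<longlongrightarrow>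
      - ((M (kc (w t)) + M (kc (w t))) \<bullet> v t)) (at t within {0..T})"
    by (rule Lim_transform_eventually)
  then show ?thesis by (simp add: has_field_derivative_iff inner_add_left)
qed

text \<open>
  The energy identity of the linear theory produces the square of the full state norm.  The integrals of
  \<open>v \<bullet> u\<close> and of \<open>(1 + P - S q) (M k \<bullet> v)\<close> are explicit, the latter because \<open>q' = - 2 (M k \<bullet> v)\<close>; they exchange the
  contributions of \<open>u\<close> and \<open>d\<close> for the potential energy.
\<close>

theorem sol_energy:
  assumes s: "sol F T w v" and F: "continuous_on {0..T} F" and t: "t \<in> {0..T}"
  shows "energy (w t) (v t) = energy (w 0) (v 0) + integral {0..t} (\<lambda>s. F s \<bullet> v s) - \<delta> * integral {0..t} (\<lambda>s. v s \<bullet> v s)"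
proof -
  note p = sol_parts[OF s]
  define q where "q s = dc (w s) \<bullet> dc (w s)" for s
  \<comment> \<open>along the solution \<open>q' = - 2 m\<close>, so integrals of \<open>m\<close> times a polynomial in \<open>q\<close> are explicit\<close>
  define m where "m s = M (kc (w s)) \<bullet> v s" for s
  have mc: "continuous_on {0..T} m" unfolding m_def
    by (intro continuous_intros bounded_linear.continuous_on[OF M_linear] p)
  have qc: "continuous_on {0..T} q" unfolding q_def by (intro continuous_intros p)
  have qd: "(q has_real_derivative - 2 * m t) (at t within {0..T})" if "t \<in> {0..T}" for t
    using stretch_derivative[OF s that] unfolding q_def m_def by simp
  have e: "(w t, v t) \<bullet> (w t, v t) = (w 0, v 0) \<bullet> (w 0, v 0) + 2 * integral {0..t} (\<lambda>s. force F s (w s) (v s) \<bullet> (w s, v s))"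
    by (rule energy_identity[OF sol_imp_weak_sol[OF s F] force_continuous[OF F p(1,2)] force_X0 t])
  have "integral {0..t} (\<lambda>s. force F s (w s) (v s) \<bullet> (w s, v s)) =
      integral {0..t} (\<lambda>s. (v s \<bullet> uc (w s) + (- 1 + (- P + S * q s)) * m s) + (F s \<bullet> v s - \<delta> * (v s \<bullet> v s)))"
  proof (rule integral_cong)
    fix s assume "s \<in> {0..t}"
    then have "v s \<in> H0" using p(4) t by auto
    then show "force F s (w s) (v s) \<bullet> (w s, v s) = (v s \<bullet> uc (w s) + (- 1 + (- P + S * q s)) * m s) + (F s \<bullet> v s - \<delta> * (v s \<bullet> v s))"
      unfolding force_def load_def phi_def q_def m_def
      by (simp add: project(3) inner_add_left inner_diff_left) (simp add: inner_commute algebra_simps)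
  qed
  also have "\<dots> = integral {0..t} (\<lambda>s. v s \<bullet> uc (w s)) + integral {0..t} (\<lambda>s. (- 1 + (- P + S * q s)) * m s)
      + (integral {0..t} (\<lambda>s. F s \<bullet> v s) - \<delta> * integral {0..t} (\<lambda>s. v s \<bullet> v s))"
  proof -
    have i: "(\<lambda>s. v s \<bullet> uc (w s)) integrable_on {0..t}" "(\<lambda>s. (- 1 + (- P + S * q s)) * m s) integrable_on {0..t}"
      "(\<lambda>s. F s \<bullet> v s) integrable_on {0..t}" "(\<lambda>s. \<delta> * (v s \<bullet> v s)) integrable_on {0..t}"
      by (rule continuous_on_integrable_sub[OF _ t], intro continuous_intros p F mc qc)+
    show ?thesis
      unfolding integral_add[OF integrable_add[OF i(1,2)] integrable_diff[OF i(3,4)]]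
        integral_add[OF i(1,2)] integral_diff[OF i(3,4)] by simp
  qed
  finally have I: "integral {0..t} (\<lambda>s. force F s (w s) (v s) \<bullet> (w s, v s)) = \<dots>" .
  have u: "uc (w t) \<bullet> uc (w t) = uc (w 0) \<bullet> uc (w 0) + 2 * integral {0..t} (\<lambda>s. v s \<bullet> uc (w s))"
    by (rule inner_self_integral[OF p(2) p(5) t])
  have qi: "integral {0..t} (\<lambda>s. (- 1 + (- P + S * q s)) * m s)
      = (1/2 * q t + P/2 * q t - S/4 * (q t)\<^sup>2) - (1/2 * q 0 + P/2 * q 0 - S/4 * (q 0)\<^sup>2)"
  proof (rule integral_of_vector_derivative[where x="\<lambda>t. 1/2 * q t + P/2 * q t - S/4 * (q t)\<^sup>2", OF _ t])
    fix s assume s: "s \<in> {0..T}"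
    have "((\<lambda>t. 1/2 * q t + P/2 * q t - S/4 * (q t)\<^sup>2) has_real_derivative (- 1 + (- P + S * q s)) * m s) (at s within {0..T})"
      by (rule derivative_eq_intros qd[OF s] refl | simp add: algebra_simps)+
    then show "((\<lambda>t. 1/2 * q t + P/2 * q t - S/4 * (q t)\<^sup>2) has_vector_derivative (- 1 + (- P + S * q s)) * m s) (at s within {0..T})"
      by (simp add: has_real_derivative_iff_has_vector_derivative)
  qed
  have "w s \<bullet> w s = uc (w s) \<bullet> uc (w s) + q s + kc (w s) \<bullet> kc (w s)" for s
    by (simp add: inner_prod_def q_def)
  then have e': "uc (w t) \<bullet> uc (w t) + q t + kc (w t) \<bullet> kc (w t) + v t \<bullet> v t =
     uc (w 0) \<bullet> uc (w 0) + q 0 + kc (w 0) \<bullet> kc (w 0) + v 0 \<bullet> v 0 + 2 * integral {0..t} (\<lambda>s. force F s (w s) (v s) \<bullet> (w s, v s))"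
    using e by simp
  show ?thesis using e' u unfolding I qi energy_def q_def[symmetric] by argo
qed

text \<open>
  From \<open>0 \<le> (S q - P)\<^sup>2 / S\<close> the potential energy is bounded below, so \<open>y = |v|\<^sup>2 + |k|\<^sup>2\<close> satisfies a Gronwall
  inequality.  Then \<open>u\<close> is bounded as an integral of \<open>v\<close>, and \<open>d\<close> by \<open>|d|\<^sup>2 = - (M k \<bullet> u)\<close>.  The bound does not depend
  on the length \<open>\<tau> \<le> T\<close> of the interval on which the solution exists.
\<close>

lemma sol_a_priori:
  assumes F: "continuous_on {0..T} F" and T: "T \<ge> 0"
  shows "\<exists>R>0. \<forall>\<tau> w v. \<tau> \<in> {0..T} \<longrightarrow> sol F \<tau> w v \<longrightarrow> w 0 = w0 \<longrightarrow> v 0 = v0 \<longrightarrow> (\<forall>t\<in>{0..\<tau>}. norm (w t) \<le> R)"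
proof -
  obtain K where K: "K > 0" "\<And>x. norm (M x) \<le> K * norm x"
    using bounded_linear.pos_bounded[OF M_linear] by (auto simp: mult.commute)
  define b where "b = 1 + 2 * \<bar>\<delta>\<bar>"
  define a where "a = 2 * energy w0 v0 + P\<^sup>2 / (2 * S) + integral {0..T} (\<lambda>s. F s \<bullet> F s)"
  define Y where "Y = \<bar>a\<bar> * exp (b * T)"
  define U where "U = norm (uc w0) + T * sqrt Y"
  define R where "R = sqrt (U * U + K * sqrt Y * U + Y) + 1"
  have Y0: "Y \<ge> 0" unfolding Y_def by simp
  have U0: "U \<ge> 0" unfolding U_def using T Y0 by simp
  have "norm (w t) \<le> R" if \<tau>: "\<tau> \<in> {0..T}" and s: "sol F \<tau> w v" and w0: "w 0 = w0" and v0: "v 0 = v0"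
    and t: "t \<in> {0..\<tau>}" for \<tau> w v t
  proof -
    note p = sol_parts[OF s]
    have F': "continuous_on {0..\<tau>} F" by (rule continuous_on_subset[OF F]) (use \<tau> in auto)
    define y where "y s = v s \<bullet> v s + kc (w s) \<bullet> kc (w s)" for s
    have yc: "continuous_on {0..\<tau>} y" unfolding y_def by (intro continuous_intros p)
    have yle: "y t \<le> a + b * integral {0..t} y" if t: "t \<in> {0..\<tau>}" for t
    proof -
      let ?q = "dc (w t) \<bullet> dc (w t)"
      have "0 \<le> (S * ?q - P)\<^sup>2 / S" using S_pos by simp
      also have "\<dots> = S * ?q\<^sup>2 - 2 * P * ?q + P\<^sup>2 / S"
        using S_pos by (simp add: power2_eq_square field_simps)
      finally have pot: "- (P\<^sup>2 / S) \<le> S * ?q\<^sup>2 - 2 * P * ?q" by simp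
      have "energy (w t) (v t) = energy w0 v0 + integral {0..t} (\<lambda>s. F s \<bullet> v s) - \<delta> * integral {0..t} (\<lambda>s. v s \<bullet> v s)"
        using sol_energy[OF s F' t] w0 v0 by simp
      moreover have "y t \<le> 2 * energy (w t) (v t) + P\<^sup>2 / (2 * S)"
        using pot unfolding y_def energy_def by (simp add: algebra_simps)
      moreover have "2 * (integral {0..t} (\<lambda>s. F s \<bullet> v s) - \<delta> * integral {0..t} (\<lambda>s. v s \<bullet> v s))
         \<le> integral {0..T} (\<lambda>s. F s \<bullet> F s) + b * integral {0..t} y"
      proof -
        have i: "(\<lambda>s. F s \<bullet> v s) integrable_on {0..t}" "(\<lambda>s. v s \<bullet> v s) integrable_on {0..t}"
          "(\<lambda>s. F s \<bullet> F s) integrable_on {0..t}" "y integrable_on {0..t}"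
          by (rule continuous_on_integrable_sub[OF _ t], intro continuous_intros p F' yc)+
        have i2: "(\<lambda>s. F s \<bullet> F s) integrable_on {0..T}"
          by (rule continuous_on_integrable_sub) (use T in \<open>auto intro!: continuous_intros F\<close>)
        have "2 * (integral {0..t} (\<lambda>s. F s \<bullet> v s) - \<delta> * integral {0..t} (\<lambda>s. v s \<bullet> v s))
          = integral {0..t} (\<lambda>s. 2 * (F s \<bullet> v s - \<delta> * (v s \<bullet> v s)))"
          using i(1,2) by (simp add: integral_diff integrable_on_mult_right)
        also have "\<dots> \<le> integral {0..t} (\<lambda>s. F s \<bullet> F s + b * y s)"
        proof (rule integral_le)
          show "(\<lambda>s. 2 * (F s \<bullet> v s - \<delta> * (v s \<bullet> v s))) integrable_on {0..t}"
            using i by (intro integrable_on_mult_right integrable_diff) auto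
          show "(\<lambda>s. F s \<bullet> F s + b * y s) integrable_on {0..t}"
            using i by (intro integrable_on_mult_right integrable_add) auto
          fix s
          have "0 \<le> (F s - v s) \<bullet> (F s - v s)" by simp
          then have 1: "2 * (F s \<bullet> v s) \<le> F s \<bullet> F s + v s \<bullet> v s"
            by (simp add: inner_diff_left inner_diff_right inner_commute)
          have 2: "- \<delta> * (v s \<bullet> v s) \<le> \<bar>\<delta>\<bar> * (v s \<bullet> v s)" by (intro mult_right_mono) auto
          have 3: "b * (v s \<bullet> v s) \<le> b * y s" unfolding y_def b_def by (intro mult_left_mono) auto
          show "2 * (F s \<bullet> v s - \<delta> * (v s \<bullet> v s)) \<le> F s \<bullet> F s + b * y s"
            using 1 2 3 unfolding b_def by (simp add: algebra_simps)
        qed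
        also have "\<dots> = integral {0..t} (\<lambda>s. F s \<bullet> F s) + b * integral {0..t} y"
          using i by (simp add: integral_add integrable_on_mult_right)
        also have "integral {0..t} (\<lambda>s. F s \<bullet> F s) \<le> integral {0..T} (\<lambda>s. F s \<bullet> F s)"
          by (rule integral_subset_le) (use t \<tau> i i2 in auto)
        finally show ?thesis by simp
      qed
      ultimately show ?thesis unfolding a_def by argo
    qed
    have yY: "y t \<le> Y" if t: "t \<in> {0..\<tau>}" for t
    proof -
      have "y t \<le> a * exp (b * t)"
        by (rule gronwall[OF yc _ yle t]) (simp add: b_def)
      also have "\<dots> \<le> \<bar>a\<bar> * exp (b * T)"
        using t \<tau> by (intro mult_mono) (auto simp: b_def mult_left_mono)
      finally show ?thesis unfolding Y_def .
    qed
    have vY: "norm (v t) \<le> sqrt Y" and kY: "norm (kc (w t)) \<le> sqrt Y" if "t \<in> {0..\<tau>}" for t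
      using yY[OF that] unfolding y_def power2_norm_eq_inner[symmetric]
      by (auto intro!: real_le_rsqrt intro: order_trans[rotated])
    have uU: "norm (uc (w t)) \<le> U"
    proof -
      have "norm (integral {0..t} v) \<le> sqrt Y * (t - 0)"
        by (rule integral_bound) (use t p(2) vY in \<open>auto intro: continuous_on_subset\<close>)
      also have "\<dots> \<le> T * sqrt Y" using t \<tau> Y0 by (auto simp: mult.commute[of "sqrt Y"] intro!: mult_right_mono)
      finally show ?thesis unfolding U_def p(5)[OF t] w0 using norm_triangle_ineq[of "uc w0" "integral {0..t} v"] by linarith
    qed
    have dD: "dc (w t) \<bullet> dc (w t) \<le> K * sqrt Y * U"
    proof -
      have "dc (w t) \<bullet> dc (w t) = - (M (kc (w t)) \<bullet> uc (w t))"
        using by_parts_state[OF p(3)[OF t] p(3)[OF t]] .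
      also have "\<dots> \<le> norm (M (kc (w t))) * norm (uc (w t))"
        using Cauchy_Schwarz_ineq2[of "M (kc (w t))" "uc (w t)"] by linarith
      also have "\<dots> \<le> (K * sqrt Y) * U"
        using order_trans[OF K(2) mult_left_mono[OF kY[OF t], of K]] K(1) Y0 by (intro mult_mono uU) auto
      finally show ?thesis .
    qed
    have "(norm (w t))\<^sup>2 = (norm (uc (w t)))\<^sup>2 + (dc (w t) \<bullet> dc (w t) + kc (w t) \<bullet> kc (w t))"
      by (simp add: power2_norm_eq_inner inner_prod_def)
    also have "\<dots> \<le> U\<^sup>2 + (K * sqrt Y * U + Y)"
      using yY[OF t] power_mono[OF uU norm_ge_zero, of 2] dD inner_ge_zero[of "v t"] unfolding y_def
      by (intro add_mono) linarith+
    finally have "norm (w t) \<le> sqrt (U\<^sup>2 + (K * sqrt Y * U + Y))" by (rule real_le_rsqrt)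
    then show ?thesis unfolding R_def by (simp add: power2_eq_square add.assoc)
  qed
  moreover have "R > 0" unfolding R_def
    using U0 Y0 K(1) by (intro add_nonneg_pos real_sqrt_ge_zero add_nonneg_nonneg mult_nonneg_nonneg) auto
  ultimately show ?thesis by blast
qed

definition truncate :: "real \<Rightarrow> 'h \<times> 'h \<times> 'k \<Rightarrow> 'h \<times> 'h \<times> 'k" where
  "truncate R w = (R / max R (norm w)) *\<^sub>R w"

lemma truncate_id: "R > 0 \<Longrightarrow> norm w \<le> R \<Longrightarrow> truncate R w = w"
  by (simp add: truncate_def max_def)

lemma truncate_norm: "R > 0 \<Longrightarrow> norm (truncate R w) \<le> R"
  unfolding truncate_def by (simp add: divide_le_eq max_def)

lemma truncate_lipschitz: assumes R: "R > 0" shows "norm (truncate R x - truncate R y) \<le> 2 * norm (x - y)"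
proof -
  let ?a = "max R (norm x)" and ?b = "max R (norm y)"
  have a: "?a > 0" "?b > 0" "R \<le> ?a" "norm y \<le> ?b" using R by auto
  have "truncate R x - truncate R y = (R / ?a) *\<^sub>R (x - y) + (R / ?a - R / ?b) *\<^sub>R y"
    unfolding truncate_def by (simp add: algebra_simps)
  also have "norm \<dots> \<le> (R / ?a) * norm (x - y) + \<bar>R / ?a - R / ?b\<bar> * norm y"
    using norm_triangle_ineq[of "(R / ?a) *\<^sub>R (x - y)" "(R / ?a - R / ?b) *\<^sub>R y"] R a by simp
  also have "(R / ?a) * norm (x - y) \<le> 1 * norm (x - y)"
    using a by (intro mult_right_mono) auto
  also have "\<bar>R / ?a - R / ?b\<bar> * norm y \<le> norm (x - y)"
  proof -
    have "R / ?a - R / ?b = (R / ?a) * ((?b - ?a) / ?b)" using a by (simp add: field_simps)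
    then have "\<bar>R / ?a - R / ?b\<bar> * norm y = (R / ?a) * (\<bar>?b - ?a\<bar> * (norm y / ?b))"
      using a R by (simp add: abs_mult)
    also have "\<dots> \<le> 1 * (\<bar>?b - ?a\<bar> * 1)"
      using a by (intro mult_mono) auto
    also have "\<dots> \<le> \<bar>norm y - norm x\<bar>" by (simp add: max_def)
    also have "\<dots> \<le> norm (x - y)" using norm_triangle_ineq3[of x y] by linarith
    finally show ?thesis .
  qed
  finally show ?thesis by simp
qed

lemma force_truncate_lipschitz:
  assumes R: "R > 0"
  shows "\<exists>L\<ge>0. \<forall>t w v w' v'. norm (force F t (truncate R w) v - force F t (truncate R w') v') \<le> L * norm ((w, v) - (w', v'))"
proof -
  obtain L where L: "L \<ge> 0" "\<And>w w'. norm w \<le> R \<Longrightarrow> norm w' \<le> R \<Longrightarrow> norm (load w - load w') \<le> L * norm (w - w')"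
    using load_lipschitz[of R] by blast
  have "norm (force F t (truncate R w) v - force F t (truncate R w') v') \<le> (L * 2 + \<bar>\<delta>\<bar>) * norm ((w, v) - (w', v'))" for t w v w' v'
  proof -
    have "force F t (truncate R w) v - force F t (truncate R w') v'
      = (0, project ((load (truncate R w) - load (truncate R w')) - \<delta> *\<^sub>R (v - v')))"
      unfolding force_def by (simp add: linear_diff[OF bounded_linear.linear[OF project(1)], symmetric] algebra_simps)
    then have "norm (force F t (truncate R w) v - force F t (truncate R w') v') \<le>
       norm ((load (truncate R w) - load (truncate R w')) - \<delta> *\<^sub>R (v - v'))"
      using project(4) by (simp add: norm_Pair)
    also have "\<dots> \<le> norm (load (truncate R w) - load (truncate R w')) + \<bar>\<delta>\<bar> * norm (v - v')"
      using norm_triangle_ineq4[of "load (truncate R w) - load (truncate R w')" "\<delta> *\<^sub>R (v - v')"] by simp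
    also have "norm (load (truncate R w) - load (truncate R w')) \<le> L * (2 * norm (w - w'))"
      using L(2)[OF truncate_norm[OF R] truncate_norm[OF R]] mult_left_mono[OF truncate_lipschitz[OF R] L(1)] order_trans by blast
    also have "L * (2 * norm (w - w')) + \<bar>\<delta>\<bar> * norm (v - v') \<le>
        L * (2 * norm ((w, v) - (w', v'))) + \<bar>\<delta>\<bar> * norm ((w, v) - (w', v'))"
      using norm_fst_le[of "w - w'" "v - v'"] norm_snd_le[of "v - v'" "w - w'"] L(1)
      by (intro add_mono mult_left_mono) auto
    finally show ?thesis by (simp add: algebra_simps)
  qed
  then show ?thesis using L(1) by (intro exI[of _ "L * 2 + \<bar>\<delta>\<bar>"]) auto
qed

lemma truncate_continuous: "continuous_on B w \<Longrightarrow> R > 0 \<Longrightarrow> continuous_on B (\<lambda>t. truncate R (w t))"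
  unfolding truncate_def by (intro continuous_intros) (auto simp: max_def)

text \<open>
  Solve with the state truncated at a radius \<open>R\<close> larger than the a priori bound.  Up to the first time
  at which \<open>|w|\<close> reaches \<open>R\<close> the truncation is inactive, so the a priori bound applies there and shows
  that this time does not exist.
\<close>

theorem sol_exists:
  assumes F: "continuous_on {0..T} F" and T: "T \<ge> 0" and w0: "w0 \<in> \<Gamma>" and v0: "v0 \<in> H0"
  shows "\<exists>w v. sol F T w v \<and> w 0 = w0 \<and> v 0 = v0"
proof -
  obtain R0 where R0: "R0 > 0" and apr: "\<And>\<tau> w v t. \<tau> \<in> {0..T} \<Longrightarrow> sol F \<tau> w v \<Longrightarrow> w 0 = w0 \<Longrightarrow> v 0 = v0 \<Longrightarrow> t \<in> {0..\<tau>} \<Longrightarrow> norm (w t) \<le> R0"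
    using sol_a_priori[OF F T, of w0 v0] by blast
  define R where "R = R0 + norm w0 + 1"
  have R: "R > 0" "R0 < R" "norm w0 < R" using R0 norm_ge_zero[of w0] unfolding R_def by linarith+
  obtain L where L: "L \<ge> 0" "\<And>t w v w' v'. norm (force F t (truncate R w) v - force F t (truncate R w') v') \<le> L * norm ((w, v) - (w', v'))"
    using force_truncate_lipschitz[OF R(1), of F] by blast
  have "\<exists>x. weak_sol T (\<lambda>t. force F t (truncate R (fst (x t))) (snd (x t))) x \<and> x 0 = (w0, v0)"
  proof (rule semilinear_exists[OF T _ L(1)])
    show "(w0, v0) \<in> X0" using v0 by (simp add: X0_iff)
    show "continuous_on {0..T} (\<lambda>t. force F t (truncate R (fst (x t))) (snd (x t)))" if "continuous_on {0..T} x" for x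
      by (intro force_continuous truncate_continuous continuous_intros that F R)
    show "force F t (truncate R (fst p)) (snd p) \<in> X0" for t p by (rule force_X0)
    show "norm (force F t (truncate R (fst p)) (snd p) - force F t (truncate R (fst q)) (snd q)) \<le> L * norm (p - q)" for t p q
      using L(2)[of t "fst p" "snd p" "fst q" "snd q"] by simp
  qed
  then obtain x where x: "weak_sol T (\<lambda>t. force F t (truncate R (fst (x t))) (snd (x t))) x" "x 0 = (w0, v0)" by blast
  define w where "w t = fst (x t)" for t
  define v where "v t = snd (x t)" for t
  have xe: "x = (\<lambda>t. (w t, v t))" unfolding w_def v_def by simp
  have W: "weak_sol T (\<lambda>t. force F t (truncate R (w t)) (v t)) (\<lambda>t. (w t, v t))"
    using x(1) unfolding w_def v_def by simp
  have i0: "w 0 = w0" "v 0 = v0" using x(2) by (auto simp: w_def v_def)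
  have xc: "continuous_on {0..T} x" using x(1) by (simp add: weak_sol_def)
  have wc: "continuous_on {0..T} (\<lambda>t. norm (w t))" unfolding w_def by (intro continuous_intros xc)
  have sub: "sol F \<tau> w v" if \<tau>: "\<tau> \<in> {0..T}" and b: "\<And>t. t \<in> {0..\<tau>} \<Longrightarrow> norm (w t) \<le> R" for \<tau>
  proof (rule weak_sol_imp_sol)
    show "weak_sol \<tau> (\<lambda>t. force F t (w t) (v t)) (\<lambda>t. (w t, v t))"
      by (rule weak_sol_subinterval[OF W \<tau>]) (simp add: truncate_id[OF R(1) b])
    show "continuous_on {0..\<tau>} F" by (rule continuous_on_subset[OF F]) (use \<tau> in auto)
    show "w 0 \<in> \<Gamma>" using i0 w0 by simp
  qed
  have "norm (w t) < R" if t: "t \<in> {0..T}" for t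
  proof (rule ccontr)
    assume "\<not> norm (w t) < R"
    \<comment> \<open>the first time at which the truncation could become active is the infimum of \<open>Z\<close>\<close>
    define Z where "Z = {s \<in> {0..T}. norm (w s) = R}"
    have ivt: "\<exists>s\<in>{0..r}. norm (w s) = R" if r: "r \<in> {0..T}" "norm (w r) \<ge> R" for r
    proof -
      have "continuous_on {0..r} (\<lambda>t. norm (w t))" by (rule continuous_on_subset[OF wc]) (use r in auto)
      then show ?thesis
        using IVT'[of "\<lambda>t. norm (w t)" 0 R r] r i0 R by auto
    qed
    have "Z \<noteq> {}" using ivt[OF t] t \<open>\<not> norm (w t) < R\<close> unfolding Z_def by force
    moreover have "closed Z"
      using continuous_closed_preimage[OF wc, of "{R}"] unfolding Z_def vimage_def by (simp add: Int_def)
    moreover have "bdd_below Z" unfolding Z_def by (rule bdd_belowI[of _ 0]) auto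
    ultimately have \<tau>: "Inf Z \<in> Z" by (intro closed_contains_Inf)
    let ?\<tau> = "Inf Z"
    have \<tau>T: "?\<tau> \<in> {0..T}" "norm (w ?\<tau>) = R" using \<tau> unfolding Z_def by auto
    have "norm (w s) \<le> R" if s: "s \<in> {0..?\<tau>}" for s
    proof (rule ccontr)
      assume n: "\<not> norm (w s) \<le> R"
      then obtain r where r: "r \<in> {0..s}" "norm (w r) = R" using ivt[of s] s \<tau>T by force
      then have "r \<in> Z" using s \<tau>T unfolding Z_def by auto
      then have "?\<tau> \<le> r" using \<open>bdd_below Z\<close> by (rule cInf_lower)
      then have "r = s" using r s by auto
      then show False using r n by simp
    qed
    then have "norm (w ?\<tau>) \<le> R0"
      by (intro apr[OF \<tau>T(1) sub[OF \<tau>T(1)] i0]) (use \<tau>T in auto)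
    then show False using \<tau>T R by simp
  qed
  then have "sol F T w v" by (intro sub) (use T in \<open>auto simp: less_imp_le\<close>)
  then show ?thesis using i0 by blast
qed

theorem sol_unique:
  assumes s1: "sol F T w v" and s2: "sol F T w' v'" and F: "continuous_on {0..T} F"
    and eq: "w 0 = w' 0" "v 0 = v' 0" and t: "t \<in> {0..T}"
  shows "w t = w' t \<and> v t = v' t"
proof -
  note p = sol_parts[OF s1] and p' = sol_parts[OF s2]
  have T: "T \<ge> 0" using t by auto
  obtain R0 where R0: "R0 > 0" and apr: "\<And>\<tau> w v t. \<tau> \<in> {0..T} \<Longrightarrow> sol F \<tau> w v \<Longrightarrow> w 0 = w' 0 \<Longrightarrow> v 0 = v' 0 \<Longrightarrow> t \<in> {0..\<tau>} \<Longrightarrow> norm (w t) \<le> R0"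
    using sol_a_priori[OF F T, of "w' 0" "v' 0"] by blast
  have b: "norm (w s) \<le> R0" "norm (w' s) \<le> R0" if "s \<in> {0..T}" for s
    using apr[OF _ s1 eq that] apr[OF _ s2 refl refl that] T by auto
  obtain L where L: "L \<ge> 0" "\<And>t w v w' v'. norm (force F t (truncate R0 w) v - force F t (truncate R0 w') v') \<le> L * norm ((w, v) - (w', v'))"
    using force_truncate_lipschitz[OF R0, of F] by blast
  let ?x = "\<lambda>t. (w t, v t) - (w' t, v' t)"
  have xc: "continuous_on {0..T} (\<lambda>t. norm (?x t))" by (intro continuous_intros p p')
  note fc = force_continuous[OF F p(1,2)] and fc' = force_continuous[OF F p'(1,2)]
  have est: "norm (?x t) \<le> 0 + (2 * L) * integral {0..t} (\<lambda>s. norm (?x s))" if t: "t \<in> {0..T}" for t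
  proof -
    have "norm (?x t) \<le> norm (?x 0) + 2 * integral {0..t} (\<lambda>s. norm (force F s (w s) (v s) - force F s (w' s) (v' s)))"
      by (rule weak_sol_norm_le[OF weak_sol_diff[OF sol_imp_weak_sol[OF s1 F] sol_imp_weak_sol[OF s2 F] fc fc'] _ _ t])
         (auto intro!: continuous_intros fc fc' subspace_diff[OF X0_subspace] force_X0)
    also have "integral {0..t} (\<lambda>s. norm (force F s (w s) (v s) - force F s (w' s) (v' s))) \<le> integral {0..t} (\<lambda>s. L * norm (?x s))"
    proof (rule integral_le)
      show "(\<lambda>s. norm (force F s (w s) (v s) - force F s (w' s) (v' s))) integrable_on {0..t}"
        "(\<lambda>s. L * norm (?x s)) integrable_on {0..t}"
        by (rule continuous_on_integrable_sub[OF _ t], intro continuous_intros fc fc' p p')+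
      fix s assume "s \<in> {0..t}"
      then have "s \<in> {0..T}" using t by auto
      from b[OF this] show "norm (force F s (w s) (v s) - force F s (w' s) (v' s)) \<le> L * norm (?x s)"
        using L(2)[of s "w s" "v s" "w' s" "v' s"] by (simp only: truncate_id[OF R0])
    qed
    finally show ?thesis using eq by simp
  qed
  have "norm (?x t) \<le> 0 * exp (2 * L * t)"
    by (rule gronwall[OF xc _ est t]) (use L in auto)
  then have "?x t = 0" by simp
  then show ?thesis by (simp add: prod_eq_iff)
qed

end

section \<open>The Hilbert space of square-integrable functions\<close>

text \<open>
  Everything is taken with respect to Lebesgue measure on the whole space; functions on a domain are
  extended by zero.
\<close>

definition sq_int :: "('a::euclidean_space \<Rightarrow> real) \<Rightarrow> bool" where
  "sq_int f \<longleftrightarrow> f \<in> borel_measurable lebesgue \<and> integrable lebesgue (\<lambda>x. (f x)\<^sup>2)"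

lemma sq_int_mult:
  assumes "sq_int f" "sq_int g" shows "integrable lebesgue (\<lambda>x. f x * g x)"
proof (rule Bochner_Integration.integrable_bound[where f="\<lambda>x. (f x)\<^sup>2 + (g x)\<^sup>2"])
  show "integrable lebesgue (\<lambda>x. (f x)\<^sup>2 + (g x)\<^sup>2)"
    using assms unfolding sq_int_def by (intro Bochner_Integration.integrable_add) auto
  show "(\<lambda>x. f x * g x) \<in> borel_measurable lebesgue"
    using assms unfolding sq_int_def by (intro borel_measurable_times) auto
  have "\<bar>a * b\<bar> \<le> a\<^sup>2 + b\<^sup>2" for a b :: real
  proof -
    have "0 \<le> (\<bar>a\<bar> - \<bar>b\<bar>)\<^sup>2" by simp
    then have "2 * (\<bar>a\<bar> * \<bar>b\<bar>) \<le> a\<^sup>2 + b\<^sup>2" by (simp add: power2_diff)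
    moreover have "0 \<le> \<bar>a\<bar> * \<bar>b\<bar>" by simp
    ultimately show ?thesis unfolding abs_mult by linarith
  qed
  then show "AE x in lebesgue. norm (f x * g x) \<le> norm ((f x)\<^sup>2 + (g x)\<^sup>2)" by simp
qed

lemma sq_int_add:
  assumes "sq_int f" "sq_int g" shows "sq_int (\<lambda>x. f x + g x)"
proof -
  have "integrable lebesgue (\<lambda>x. (f x)\<^sup>2 + (g x)\<^sup>2 + 2 * (f x * g x))"
    using assms sq_int_mult[OF assms] unfolding sq_int_def by auto
  then have "integrable lebesgue (\<lambda>x. (f x + g x)\<^sup>2)" by (simp add: power2_sum algebra_simps)
  then show ?thesis using assms unfolding sq_int_def by (auto intro: borel_measurable_add)
qed

lemma sq_int_scale: "sq_int f \<Longrightarrow> sq_int (\<lambda>x. c * f x)"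
  by (auto simp: sq_int_def power_mult_distrib)

lemma sq_int_zero: "sq_int (\<lambda>x. 0)" by (simp add: sq_int_def)

lemma sq_int_uminus: "sq_int f \<Longrightarrow> sq_int (\<lambda>x. - f x)"
  using sq_int_scale[of f "-1"] by simp

lemma sq_int_diff: "sq_int f \<Longrightarrow> sq_int g \<Longrightarrow> sq_int (\<lambda>x. f x - g x)"
  using sq_int_add[of f "\<lambda>x. - g x"] sq_int_uminus[of g] by simp

quotient_type (overloaded) 'a l2 = "'a::euclidean_space \<Rightarrow> real" /
  partial: "\<lambda>f g. sq_int f \<and> sq_int g \<and> (AE x in lebesgue. f x = g x)"
proof (rule part_equivpI)
  show "\<exists>f :: 'a \<Rightarrow> real. sq_int f \<and> sq_int f \<and> (AE x in lebesgue. f x = f x)"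
    using sq_int_zero by (intro exI[of _ "\<lambda>x. 0"]) auto
  show "symp (\<lambda>f g :: 'a \<Rightarrow> real. sq_int f \<and> sq_int g \<and> (AE x in lebesgue. f x = g x))"
    unfolding symp_def by (auto elim: AE_mp)
  show "transp (\<lambda>f g :: 'a \<Rightarrow> real. sq_int f \<and> sq_int g \<and> (AE x in lebesgue. f x = g x))"
    unfolding transp_def by (auto elim: AE_mp)
qed

instantiation l2 :: (euclidean_space) real_vector
begin

lift_definition zero_l2 :: "'a l2" is "\<lambda>x. 0" by (simp add: sq_int_zero)
lift_definition plus_l2 :: "'a l2 \<Rightarrow> 'a l2 \<Rightarrow> 'a l2" is "\<lambda>f g x. f x + g x"
  by (auto intro: sq_int_add)
lift_definition uminus_l2 :: "'a l2 \<Rightarrow> 'a l2" is "\<lambda>f x. - f x"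
  by (auto intro: sq_int_uminus)
lift_definition minus_l2 :: "'a l2 \<Rightarrow> 'a l2 \<Rightarrow> 'a l2" is "\<lambda>f g x. f x - g x"
  by (auto intro: sq_int_diff)
lift_definition scaleR_l2 :: "real \<Rightarrow> 'a l2 \<Rightarrow> 'a l2" is "\<lambda>c f x. c * f x"
  by (auto intro: sq_int_scale)
instance
proof
  fix a b c :: "'a l2" and r s :: real
  show "a + b + c = a + (b + c)" by transfer (auto intro!: sq_int_add simp: algebra_simps)
  show "a + b = b + a" by transfer (auto intro!: sq_int_add simp: algebra_simps)
  show "0 + a = a" by transfer auto
  show "- a + a = 0" by transfer (auto simp: sq_int_zero)
  show "a - b = a + - b" by transfer (auto intro: sq_int_diff)
  show "r *\<^sub>R (a + b) = r *\<^sub>R a + r *\<^sub>R b"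
    by transfer (auto intro!: sq_int_add sq_int_scale simp: distrib_left)
  show "(r + s) *\<^sub>R a = r *\<^sub>R a + s *\<^sub>R a"
    by transfer (use sq_int_scale in \<open>fastforce intro!: sq_int_add simp: distrib_right\<close>)
  show "r *\<^sub>R s *\<^sub>R a = (r * s) *\<^sub>R a"
    by transfer (auto intro!: sq_int_scale simp: mult.assoc)
  show "1 *\<^sub>R a = a" by transfer auto
qed

end

instantiation l2 :: (euclidean_space) real_inner
begin

lift_definition inner_l2 :: "'a l2 \<Rightarrow> 'a l2 \<Rightarrow> real" is "\<lambda>f g. LINT x|lebesgue. f x * g x"
proof -
  fix f f' g g' :: "'a \<Rightarrow> real"
  assume a: "sq_int f \<and> sq_int f' \<and> (AE x in lebesgue. f x = f' x)"
    "sq_int g \<and> sq_int g' \<and> (AE x in lebesgue. g x = g' x)"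
  then have "AE x in lebesgue. f x * g x = f' x * g' x" by auto
  with a show "(LINT x|lebesgue. f x * g x) = (LINT x|lebesgue. f' x * g' x)"
    by (intro integral_cong_AE) (auto simp: sq_int_def)
qed

definition norm_l2 :: "'a l2 \<Rightarrow> real" where "norm_l2 x = sqrt (x \<bullet> x)"
definition dist_l2 :: "'a l2 \<Rightarrow> 'a l2 \<Rightarrow> real" where "dist_l2 x y = norm (x - y)"
definition sgn_l2 :: "'a l2 \<Rightarrow> 'a l2" where "sgn_l2 x = x /\<^sub>R norm x"
definition uniformity_l2 :: "('a l2 \<times> 'a l2) filter" where
  "uniformity_l2 = (INF e\<in>{0<..}. principal {(x, y). dist x y < e})"
definition open_l2 :: "'a l2 set \<Rightarrow> bool" where
  "open_l2 U \<longleftrightarrow> (\<forall>x\<in>U. eventually (\<lambda>(x', y). x' = x \<longrightarrow> y \<in> U) uniformity)"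

instance
proof
  show "dist x y = norm (x - y)" for x y :: "'a l2" by (rule dist_l2_def)
  show "uniformity = (INF e\<in>{0<..}. principal {(x::'a l2, y). dist x y < e})" by (rule uniformity_l2_def)
  show "open U \<longleftrightarrow> (\<forall>x\<in>U. \<forall>\<^sub>F (x', y) in uniformity. x' = x \<longrightarrow> y \<in> U)" for U :: "'a l2 set"
    by (rule open_l2_def)
  show "sgn x = x /\<^sub>R norm x" for x :: "'a l2" by (rule sgn_l2_def)
  show "norm x = sqrt (x \<bullet> x)" for x :: "'a l2" by (rule norm_l2_def)
  fix a b c :: "'a l2" and r :: real
  show "a \<bullet> b = b \<bullet> a" by transfer (simp add: mult.commute)
  show "(a + b) \<bullet> c = a \<bullet> c + b \<bullet> c"
    by transfer (simp add: distrib_right sq_int_mult)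
  show "(r *\<^sub>R a) \<bullet> b = r * (a \<bullet> b)"
    by transfer (simp add: mult.assoc)
  show "0 \<le> a \<bullet> a" by transfer simp
  show "a \<bullet> a = 0 \<longleftrightarrow> a = 0"
  proof transfer
    fix f :: "'a \<Rightarrow> real" assume "sq_int f \<and> sq_int f \<and> (AE x in lebesgue. f x = f x)"
    then have f: "sq_int f" by simp
    have "(LINT x|lebesgue. f x * f x) = 0 \<longleftrightarrow> (AE x in lebesgue. f x * f x = 0)"
      using sq_int_mult[OF f f] by (intro integral_nonneg_eq_0_iff_AE) auto
    then show "(LINT x|lebesgue. f x * f x) = 0 \<longleftrightarrow> sq_int f \<and> sq_int (\<lambda>x. 0 :: real) \<and> (AE x in lebesgue. f x = 0)"
      using f by (simp add: sq_int_zero)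
  qed
qed

end

lift_definition l2_of :: "('a::euclidean_space \<Rightarrow> real) \<Rightarrow> 'a l2" is
  "\<lambda>f. if sq_int f then f else (\<lambda>x. 0)" by (simp add: sq_int_zero)

lemma l2_of_eq_iff: "sq_int f \<Longrightarrow> sq_int g \<Longrightarrow> l2_of f = l2_of g \<longleftrightarrow> (AE x in lebesgue. f x = g x)"
  by transfer auto

lemma l2_cases: obtains f where "sq_int f" "x = l2_of f"
proof -
  have "\<exists>f. sq_int f \<and> x = l2_of f" by transfer auto
  then show ?thesis using that by blast
qed

lemma l2_of_add: "sq_int f \<Longrightarrow> sq_int g \<Longrightarrow> l2_of f + l2_of g = l2_of (\<lambda>x. f x + g x)"
  by transfer (auto simp: sq_int_add)
lemma l2_of_diff: "sq_int f \<Longrightarrow> sq_int g \<Longrightarrow> l2_of f - l2_of g = l2_of (\<lambda>x. f x - g x)"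
  by transfer (auto simp: sq_int_diff)
lemma l2_of_scale: "sq_int f \<Longrightarrow> c *\<^sub>R l2_of f = l2_of (\<lambda>x. c * f x)"
  by transfer (auto simp: sq_int_scale)
lemma l2_of_inner: "sq_int f \<Longrightarrow> sq_int g \<Longrightarrow> l2_of f \<bullet> l2_of g = (LINT x|lebesgue. f x * g x)"
  by transfer auto

lemma l2_of_norm: "sq_int f \<Longrightarrow> (norm (l2_of f))\<^sup>2 = (LINT x|lebesgue. (f x)\<^sup>2)"
  unfolding power2_norm_eq_inner by (simp only: l2_of_inner power2_eq_square)

lemma l2_of_nn_norm: assumes "sq_int f" shows "(\<integral>\<^sup>+x. ennreal ((f x)\<^sup>2) \<partial>lebesgue) = ennreal ((norm (l2_of f))\<^sup>2)"
  using assms unfolding l2_of_norm[OF assms] by (intro nn_integral_eq_integral) (auto simp: sq_int_def)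

text \<open>
  Classes of square-integrable functions modulo equality almost everywhere.
\<close>

instance l2 :: (euclidean_space) banach
proof
  fix X :: "nat \<Rightarrow> 'a l2" assume X: "Cauchy X"
  have "\<exists>r. \<forall>n. (\<forall>m\<ge>r n. \<forall>m'\<ge>r n. norm (X m - X m') < (1/2)^n) \<and> r n < r (Suc n)"
  proof (rule dependent_nat_choice)
    show "\<exists>k. \<forall>m\<ge>k. \<forall>m'\<ge>k. norm (X m - X m') < (1/2)^0"
      using CauchyD[OF X, of 1] by simp
    fix k n
    obtain K where "\<forall>m\<ge>K. \<forall>m'\<ge>K. norm (X m - X m') < (1/2)^Suc n"
      using CauchyD[OF X, of "(1/2)^Suc n"] by auto
    then show "\<exists>k'. (\<forall>m\<ge>k'. \<forall>m'\<ge>k'. norm (X m - X m') < (1/2)^Suc n) \<and> k < k'"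
      by (intro exI[of _ "max K (Suc k)"]) auto
  qed
  then obtain r where r: "\<And>n m m'. m \<ge> r n \<Longrightarrow> m' \<ge> r n \<Longrightarrow> norm (X m - X m') < (1/2)^n"
    and rs: "strict_mono r" by (auto simp: strict_mono_Suc_iff)
  have "\<exists>f. \<forall>n. sq_int (f n) \<and> X (r n) = l2_of (f n)"
    by (rule choice) (metis l2_cases)
  then obtain f where f: "\<And>n. sq_int (f n)" "\<And>n. X (r n) = l2_of (f n)" by blast
  have fm: "f n \<in> borel_measurable lebesgue" for n using f(1) by (simp add: sq_int_def)
  have rmono: "r n \<le> r m" if "n \<le> m" for n m using rs that by (simp add: strict_mono_less_eq)
  have fd: "(\<integral>\<^sup>+x. ennreal ((f m x - f n x)\<^sup>2) \<partial>lebesgue) \<le> ennreal (((1/2)^k)\<^sup>2)" if "m \<ge> k" "n \<ge> k" for m n k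
  proof -
    have "norm (X (r m) - X (r n)) < (1/2)^k" using r[of k "r m" "r n"] rmono that by simp
    then have "(norm (X (r m) - X (r n)))\<^sup>2 \<le> ((1/2)^k)\<^sup>2" by (intro power_mono) auto
    then show ?thesis
      unfolding f(2) l2_of_diff[OF f(1) f(1)] l2_of_nn_norm[OF sq_int_diff[OF f(1) f(1)]]
      by (intro ennreal_leI)
  qed
  \<comment> \<open>along a rapidly Cauchy subsequence the increments are summable almost everywhere; on balls
    this follows from \<open>d \<le> 2\<^sup>-\<^sup>n + 2\<^sup>n d\<^sup>2\<close> and the integrability of constants\<close>
  define d where "d n x = \<bar>f (Suc n) x - f n x\<bar>" for n x
  have dm: "d n \<in> borel_measurable lebesgue" for n unfolding d_def using fm by measurable
  have fin: "AE x in lebesgue. x \<in> ball 0 (real k) \<longrightarrow> (\<Sum>n. ennreal (d n x)) \<noteq> \<infinity>" for k :: nat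
  proof -
    let ?B = "ball (0::'a) (real k)"
    define b where "b = measure lebesgue ?B"
    have B: "?B \<in> sets lebesgue" "emeasure lebesgue ?B = ennreal b"
      unfolding b_def using emeasure_bounded_finite[of ?B]
      by (auto intro!: emeasure_eq_ennreal_measure)
    have 1: "(\<integral>\<^sup>+x. ennreal (d n x) * indicator ?B x \<partial>lebesgue) \<le> ennreal (b + 1) * ennreal ((1/2)^n)" for n
    proof -
      have "ennreal (d n x) * indicator ?B x \<le> ennreal ((1/2)^n) * indicator ?B x + ennreal (2^n) * ennreal ((f (Suc n) x - f n x)\<^sup>2)" for x
      proof -
        have "0 \<le> (2^n * d n x - 1)\<^sup>2" by simp
        also have "\<dots> = 2^n * (2^n * (d n x)\<^sup>2 - 2 * d n x + (1/2)^n)"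
          by (simp add: power2_diff power_mult_distrib algebra_simps power2_eq_square power_one_over)
        finally have "2^n * 0 \<le> 2^n * (2^n * (d n x)\<^sup>2 - 2 * d n x + (1/2)^n)" by simp
        then have "0 \<le> 2^n * (d n x)\<^sup>2 - 2 * d n x + (1/2)^n"
          by (subst (asm) mult_le_cancel_left_pos) auto
        moreover have "d n x \<ge> 0" by (simp add: d_def)
        ultimately have "d n x \<le> (1/2)^n + 2^n * (d n x)\<^sup>2" by linarith
        then have "ennreal (d n x) \<le> ennreal ((1/2)^n) + ennreal (2^n) * ennreal ((d n x)\<^sup>2)"
          by (simp add: ennreal_plus[symmetric] ennreal_mult[symmetric] del: ennreal_plus)
        then show ?thesis unfolding d_def by (auto simp: indicator_def)
      qed
      then have "(\<integral>\<^sup>+x. ennreal (d n x) * indicator ?B x \<partial>lebesgue) \<le>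
         (\<integral>\<^sup>+x. ennreal ((1/2)^n) * indicator ?B x + ennreal (2^n) * ennreal ((f (Suc n) x - f n x)\<^sup>2) \<partial>lebesgue)"
        by (intro nn_integral_mono) auto
      also have "\<dots> = ennreal ((1/2)^n) * ennreal b + ennreal (2^n) * (\<integral>\<^sup>+x. ennreal ((f (Suc n) x - f n x)\<^sup>2) \<partial>lebesgue)"
      proof -
        have i1: "(\<lambda>x. ennreal ((1/2)^n) * indicator ?B x) \<in> borel_measurable lebesgue"
          by (intro borel_measurable_times_ennreal borel_measurable_const borel_measurable_indicator B(1))
        have i2: "(\<lambda>x. ennreal ((f (Suc n) x - f n x)\<^sup>2)) \<in> borel_measurable lebesgue"
          using fm by measurable
        have i3: "(\<lambda>x. ennreal (2^n) * ennreal ((f (Suc n) x - f n x)\<^sup>2)) \<in> borel_measurable lebesgue"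
          using i2 by (intro borel_measurable_times_ennreal borel_measurable_const)
        show ?thesis
          unfolding nn_integral_add[OF i1 i3] nn_integral_cmult[OF i2] nn_integral_cmult_indicator[OF B(1)] B(2) ..
      qed
      also have "\<dots> \<le> ennreal ((1/2)^n) * ennreal b + ennreal (2^n) * ennreal (((1/2)^n)\<^sup>2)"
        by (intro add_left_mono mult_left_mono fd) auto
      also have "\<dots> = ennreal (b + 1) * ennreal ((1/2)^n)"
        by (simp add: ennreal_mult[symmetric] ennreal_plus[symmetric] b_def power2_eq_square power_one_over algebra_simps del: ennreal_plus)
      finally show ?thesis .
    qed
    have db: "(\<lambda>x. ennreal (d n x) * indicator ?B x) \<in> borel_measurable lebesgue" for n
      by (intro borel_measurable_times_ennreal measurable_compose[OF dm measurable_ennreal] borel_measurable_indicator B(1))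
    have "(\<integral>\<^sup>+x. (\<Sum>n. ennreal (d n x) * indicator ?B x) \<partial>lebesgue) = (\<Sum>n. \<integral>\<^sup>+x. ennreal (d n x) * indicator ?B x \<partial>lebesgue)"
      by (rule nn_integral_suminf[OF db])
    also have "\<dots> \<le> (\<Sum>n. ennreal (b + 1) * ennreal ((1/2)^n))"
      by (intro suminf_le 1) auto
    also have "\<dots> = ennreal (b + 1) * (\<Sum>n. ennreal ((1/2)^n))" by simp
    also have "(\<Sum>n. ennreal ((1/2)^n)) = ennreal 2"
      using geometric_sums[of "1/2::real"] by (intro suminf_ennreal_eq) auto
    also have "ennreal (b + 1) * ennreal 2 < \<infinity>" by (simp add: ennreal_mult_less_top)
    finally have "(\<integral>\<^sup>+x. (\<Sum>n. ennreal (d n x) * indicator ?B x) \<partial>lebesgue) \<noteq> \<infinity>" by simp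
    then have "AE x in lebesgue. (\<Sum>n. ennreal (d n x) * indicator ?B x) \<noteq> \<infinity>"
      by (intro nn_integral_PInf_AE borel_measurable_suminf_order db)
    then show ?thesis by eventually_elim auto
  qed
  have "AE x in lebesgue. \<forall>k. x \<in> ball 0 (real k) \<longrightarrow> (\<Sum>n. ennreal (d n x)) \<noteq> \<infinity>"
    unfolding AE_all_countable using fin by blast
  then have conv: "AE x in lebesgue. convergent (\<lambda>n. f n x)"
  proof eventually_elim
    case (elim x)
    obtain k :: nat where "norm x < real k" using reals_Archimedean2 by blast
    then have "(\<Sum>n. ennreal (d n x)) \<noteq> \<infinity>" using elim by auto
    then have "summable (\<lambda>n. d n x)"
      by (intro summable_suminf_not_top) (auto simp: d_def)
    then have "summable (\<lambda>n. f (Suc n) x - f n x)"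
      unfolding d_def by (rule summable_rabs_cancel)
    then have "convergent (\<lambda>n. \<Sum>i<n. f (Suc i) x - f i x)" by (simp add: summable_iff_convergent)
    moreover have "(\<Sum>i<n. f (Suc i) x - f i x) = f n x - f 0 x" for n
      using sum_lessThan_telescope[of "\<lambda>i. f i x" n] .
    ultimately have "convergent (\<lambda>n. f n x - f 0 x)" by simp
    then have "convergent (\<lambda>n. (f n x - f 0 x) + f 0 x)" by (intro convergent_add convergent_const)
    then show ?case by simp
  qed
  define g where "g x = lim (\<lambda>n. f n x)" for x
  have gm: "g \<in> borel_measurable lebesgue" unfolding g_def by (rule borel_measurable_lim_metric[OF fm])
  have gf: "(\<integral>\<^sup>+x. ennreal ((g x - f n x)\<^sup>2) \<partial>lebesgue) \<le> ennreal (((1/2)^n)\<^sup>2)" for n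
  proof -
    \<comment> \<open>Fatou: the pointwise limit is also the limit in \<open>L\<^sup>2\<close>\<close>
    have "(\<integral>\<^sup>+x. ennreal ((g x - f n x)\<^sup>2) \<partial>lebesgue) = (\<integral>\<^sup>+x. liminf (\<lambda>m. ennreal ((f m x - f n x)\<^sup>2)) \<partial>lebesgue)"
    proof (rule nn_integral_cong_AE)
      show "AE x in lebesgue. ennreal ((g x - f n x)\<^sup>2) = liminf (\<lambda>m. ennreal ((f m x - f n x)\<^sup>2))"
        using conv
      proof eventually_elim
        case (elim x)
        then have "(\<lambda>m. f m x) \<longlonglongrightarrow> g x" unfolding g_def by (simp add: convergent_LIMSEQ_iff)
        then have "(\<lambda>m. ennreal ((f m x - f n x)\<^sup>2)) \<longlonglongrightarrow> ennreal ((g x - f n x)\<^sup>2)"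
          by (intro tendsto_intros)
        then have "liminf (\<lambda>m. ennreal ((f m x - f n x)\<^sup>2)) = ennreal ((g x - f n x)\<^sup>2)"
          by (rule lim_imp_Liminf[OF sequentially_bot])
        then show ?case by (rule sym)
      qed
    qed
    also have "\<dots> \<le> liminf (\<lambda>m. \<integral>\<^sup>+x. ennreal ((f m x - f n x)\<^sup>2) \<partial>lebesgue)"
      using fm by (intro nn_integral_liminf) auto
    also have "\<dots> \<le> limsup (\<lambda>m. \<integral>\<^sup>+x. ennreal ((f m x - f n x)\<^sup>2) \<partial>lebesgue)"
      by (intro Liminf_le_Limsup) auto
    also have "\<dots> \<le> ennreal (((1/2)^n)\<^sup>2)"
      by (rule Limsup_bounded) (auto intro!: fd simp: eventually_sequentially)
    finally show ?thesis .
  qed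
  have gfs: "sq_int (\<lambda>x. g x - f n x)" for n
    unfolding sq_int_def
  proof
    show "(\<lambda>x. g x - f n x) \<in> borel_measurable lebesgue" using gm fm by measurable
    show "integrable lebesgue (\<lambda>x. (g x - f n x)\<^sup>2)"
      using gm fm le_less_trans[OF gf[of n] ennreal_less_top] by (intro integrableI_nonneg) auto
  qed
  have gs: "sq_int g" using sq_int_add[OF gfs[of 0] f(1)[of 0]] by simp
  have near: "norm (l2_of g - X (r n)) \<le> (1/2)^n" for n
  proof -
    have "ennreal ((norm (l2_of (\<lambda>x. g x - f n x)))\<^sup>2) \<le> ennreal (((1/2)^n)\<^sup>2)"
      using gf[of n] unfolding l2_of_nn_norm[OF gfs] .
    then have "(norm (l2_of (\<lambda>x. g x - f n x)))\<^sup>2 \<le> ((1/2)^n)\<^sup>2"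
      by (subst (asm) ennreal_le_iff) auto
    then show ?thesis unfolding f(2) l2_of_diff[OF gs f(1)] by (rule power2_le_imp_le) simp
  qed
  have "X \<longlonglongrightarrow> l2_of g"
  proof (rule LIMSEQ_I)
    fix e :: real assume e: "e > 0"
    obtain n where n: "(1/2)^n < e / 2" using real_arch_pow_inv[of "e / 2" "1/2"] e by auto
    have "norm (X m - l2_of g) < e" if "m \<ge> r n" for m
    proof -
      have "norm (X m - l2_of g) \<le> norm (X m - X (r n)) + norm (l2_of g - X (r n))"
        using dist_triangle2[of "X m" "l2_of g" "X (r n)"] by (simp add: dist_norm)
      also have "\<dots> < e" using r[of n m "r n"] that near[of n] n by linarith
      finally show ?thesis .
    qed
    then show "\<exists>k. \<forall>m\<ge>k. norm (X m - l2_of g) < e" by blast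
  qed
  then show "convergent X" by (rule convergentI)
qed

section \<open>Square-integrable functions on a subset of the plane\<close>

text \<open>
  Isometric on \<open>L2 D\<close>, with the seminorm \<open>norm0 D\<close> becoming a norm.
\<close>

definition emb :: "(real \<times> real) set \<Rightarrow> field \<Rightarrow> (real \<times> real) l2" where
  "emb D f = l2_of (\<lambda>p. if p \<in> D then f p else 0)"

context
  fixes D :: "(real \<times> real) set"
  assumes D: "D \<in> sets lebesgue"
begin

lemma if_indicator: "(\<lambda>p. if p \<in> D then f p else 0) = (\<lambda>p. indicator D p *\<^sub>R (f p :: real))"
  by auto

lemma integrable_on_D: "integrable (lebesgue_on D) f \<longleftrightarrow> integrable lebesgue (\<lambda>p. if p \<in> D then f p else (0::real))"
  unfolding if_indicator by (rule integrable_restrict_space) (use D in simp)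

lemma integral_on_D: "integral\<^sup>L (lebesgue_on D) f = (LINT p|lebesgue. (if p \<in> D then f p else (0::real)))"
  unfolding if_indicator by (rule integral_restrict_space) (use D in simp)

lemma measurable_on_D: "f \<in> borel_measurable (lebesgue_on D) \<longleftrightarrow> (\<lambda>p. if p \<in> D then f p else (0::real)) \<in> borel_measurable lebesgue"
  unfolding if_indicator by (rule borel_measurable_restrict_space_iff) (use D in simp)

lemma L2_iff_sq_int: "f \<in> L2 D \<longleftrightarrow> sq_int (\<lambda>p. if p \<in> D then f p else 0)"
proof -
  have "(\<lambda>p. (if p \<in> D then f p else 0)\<^sup>2) = (\<lambda>p. if p \<in> D then (f p)\<^sup>2 else 0)" by auto
  then show ?thesis unfolding L2_def sq_int_def by (simp add: measurable_on_D integrable_on_D)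
qed

lemma L2_lin: "f \<in> L2 D \<Longrightarrow> g \<in> L2 D \<Longrightarrow> (\<lambda>p. a * f p + b * g p) \<in> L2 D"
proof -
  assume "f \<in> L2 D" "g \<in> L2 D"
  then have "sq_int (\<lambda>p. a * (if p \<in> D then f p else 0) + b * (if p \<in> D then g p else 0))"
    unfolding L2_iff_sq_int by (intro sq_int_add sq_int_scale)
  moreover have "(\<lambda>p. a * (if p \<in> D then f p else 0) + b * (if p \<in> D then g p else 0))
     = (\<lambda>p. if p \<in> D then a * f p + b * g p else 0)" by auto
  ultimately show ?thesis unfolding L2_iff_sq_int by simp
qed

lemma L2_add: "f \<in> L2 D \<Longrightarrow> g \<in> L2 D \<Longrightarrow> (\<lambda>p. f p + g p) \<in> L2 D"
  using L2_lin[of f g 1 1] by simp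
lemma L2_diff: "f \<in> L2 D \<Longrightarrow> g \<in> L2 D \<Longrightarrow> (\<lambda>p. f p - g p) \<in> L2 D"
  using L2_lin[of f g 1 "-1"] by simp
lemma L2_scale: "f \<in> L2 D \<Longrightarrow> (\<lambda>p. c * f p) \<in> L2 D"
  using L2_lin[of f f c 0] by simp
lemma L2_zero: "(\<lambda>p. 0) \<in> L2 D" by (simp add: L2_def)

lemma emb_inner: "f \<in> L2 D \<Longrightarrow> g \<in> L2 D \<Longrightarrow> emb D f \<bullet> emb D g = inner0 D f g"
proof -
  assume "f \<in> L2 D" "g \<in> L2 D"
  then have "emb D f \<bullet> emb D g = (LINT p|lebesgue. (if p \<in> D then f p else 0) * (if p \<in> D then g p else 0))"
    unfolding emb_def L2_iff_sq_int by (rule l2_of_inner)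
  also have "\<dots> = (LINT p|lebesgue. (if p \<in> D then f p * g p else 0))"
    by (rule Bochner_Integration.integral_cong) auto
  also have "\<dots> = inner0 D f g" unfolding inner0_def integral_on_D ..
  finally show ?thesis .
qed

lemma emb_norm: "f \<in> L2 D \<Longrightarrow> norm (emb D f) = norm0 D f"
  by (simp add: norm_eq_sqrt_inner norm0_def emb_inner)

lemma AE_D: "(AE p in lebesgue_on D. Q p) \<longleftrightarrow> (AE p in lebesgue. p \<in> D \<longrightarrow> Q p)"
  by (rule AE_restrict_space_iff) (use D in simp)

lemma emb_eq_iff: "f \<in> L2 D \<Longrightarrow> g \<in> L2 D \<Longrightarrow> emb D f = emb D g \<longleftrightarrow> (AE p in lebesgue_on D. f p = g p)"
  unfolding emb_def L2_iff_sq_int AE_D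
  by (subst l2_of_eq_iff) (auto elim!: AE_mp)

lemma emb_lin: "f \<in> L2 D \<Longrightarrow> g \<in> L2 D \<Longrightarrow> emb D (\<lambda>p. a * f p + b * g p) = a *\<^sub>R emb D f + b *\<^sub>R emb D g"
proof -
  assume f: "f \<in> L2 D" and g: "g \<in> L2 D"
  have e: "(\<lambda>p. a * (if p \<in> D then f p else 0) + b * (if p \<in> D then g p else 0))
     = (\<lambda>p. if p \<in> D then a * f p + b * g p else 0)" by auto
  show ?thesis
    using f g unfolding emb_def L2_iff_sq_int e[symmetric]
    by (simp add: l2_of_scale l2_of_add sq_int_scale)
qed

lemma emb_add: "f \<in> L2 D \<Longrightarrow> g \<in> L2 D \<Longrightarrow> emb D (\<lambda>p. f p + g p) = emb D f + emb D g"
  using emb_lin[of f g 1 1] by simp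
lemma emb_diff: "f \<in> L2 D \<Longrightarrow> g \<in> L2 D \<Longrightarrow> emb D (\<lambda>p. f p - g p) = emb D f - emb D g"
  using emb_lin[of f g 1 "-1"] by simp
lemma emb_scale: "f \<in> L2 D \<Longrightarrow> emb D (\<lambda>p. c * f p) = c *\<^sub>R emb D f"
  using emb_lin[of f f c 0] by simp
lemma emb_zero: "emb D (\<lambda>p. 0) = 0"
  using emb_lin[OF L2_zero L2_zero, of 0 0] by simp

lemma inner0_integrable: "f \<in> L2 D \<Longrightarrow> g \<in> L2 D \<Longrightarrow> integrable (lebesgue_on D) (\<lambda>p. f p * g p)"
proof -
  assume "f \<in> L2 D" "g \<in> L2 D"
  then have "integrable lebesgue (\<lambda>p. (if p \<in> D then f p else 0) * (if p \<in> D then g p else 0))"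
    unfolding L2_iff_sq_int by (rule sq_int_mult)
  moreover have "(\<lambda>p. (if p \<in> D then f p else 0) * (if p \<in> D then g p else 0)) = (\<lambda>p. if p \<in> D then f p * g p else 0)"
    by auto
  ultimately show ?thesis unfolding integrable_on_D by simp
qed

text \<open>
  A limit \<open>z\<close> of classes supported in \<open>D\<close> is at least as close to its own restriction to \<open>D\<close> as to any of
  the approximants.
\<close>

lemma emb_range_closed: "closed (emb D ` L2 D)"
  unfolding closed_sequential_limits
proof (intro allI impI)
  fix x z assume a: "(\<forall>n. x n \<in> emb D ` L2 D) \<and> x \<longlonglongrightarrow> z"
  then have "\<forall>n. \<exists>f. f \<in> L2 D \<and> x n = emb D f" by (auto simp: image_iff)
  from choice[OF this] obtain f where f: "\<And>n. f n \<in> L2 D" "\<And>n. x n = emb D (f n)" by blast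
  obtain g where g: "sq_int g" "z = l2_of g" by (rule l2_cases)
  have gD: "g \<in> L2 D"
    unfolding L2_iff_sq_int sq_int_def
  proof
    show m: "(\<lambda>p. if p \<in> D then g p else 0) \<in> borel_measurable lebesgue"
      using g(1) unfolding sq_int_def if_indicator
      by (intro borel_measurable_scaleR borel_measurable_indicator D) auto
    show "integrable lebesgue (\<lambda>p. (if p \<in> D then g p else 0)\<^sup>2)"
      by (rule Bochner_Integration.integrable_bound[where f="\<lambda>p. (g p)\<^sup>2"]) (use m g(1) in \<open>auto simp: sq_int_def\<close>)
  qed
  have "norm (z - emb D g) \<le> norm (z - x n)" for n
  proof (rule power2_le_imp_le)
    have s: "sq_int (\<lambda>p. g p - (if p \<in> D then g p else 0))" "sq_int (\<lambda>p. g p - (if p \<in> D then f n p else 0))"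
      using g(1) gD f(1)[of n] unfolding L2_iff_sq_int by (auto intro: sq_int_diff)
    have "(norm (z - emb D g))\<^sup>2 = (LINT p|lebesgue. (g p - (if p \<in> D then g p else 0))\<^sup>2)"
      using g(1) gD unfolding L2_iff_sq_int g(2) emb_def by (simp only: l2_of_diff l2_of_norm[OF s(1)])
    also have "\<dots> \<le> (LINT p|lebesgue. (g p - (if p \<in> D then f n p else 0))\<^sup>2)"
      using s unfolding sq_int_def by (intro integral_mono) auto
    also have "\<dots> = (norm (z - x n))\<^sup>2"
      using g(1) f(1)[of n] unfolding L2_iff_sq_int g(2) f(2) emb_def by (simp only: l2_of_diff l2_of_norm[OF s(2)])
    finally show "(norm (z - emb D g))\<^sup>2 \<le> (norm (z - x n))\<^sup>2" .
  qed simp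
  moreover have "(\<lambda>n. norm (z - x n)) \<longlonglongrightarrow> norm (z - z)" using a by (intro tendsto_intros) auto
  ultimately have "norm (z - emb D g) \<le> norm (z - z)"
    by (intro LIMSEQ_le_const) auto
  then show "z \<in> emb D ` L2 D" using gD by auto
qed

lemma emb_range_subspace: "subspace (emb D ` L2 D)"
  unfolding subspace_def
proof (intro conjI ballI allI)
  show "0 \<in> emb D ` L2 D" using emb_zero L2_zero by (metis image_eqI)
  fix x y assume "x \<in> emb D ` L2 D" "y \<in> emb D ` L2 D"
  then show "x + y \<in> emb D ` L2 D" by (auto simp: emb_add[symmetric] L2_add)
next
  fix c x assume "x \<in> emb D ` L2 D"
  then show "c *\<^sub>R x \<in> emb D ` L2 D" by (auto simp: emb_scale[symmetric] L2_scale)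
qed

end

lemma L2_bounded_measurable:
  assumes D: "D \<in> lmeasurable" and m: "f \<in> borel_measurable (lebesgue_on D)"
    and b: "\<And>p. p \<in> D \<Longrightarrow> \<bar>f p\<bar> \<le> C"
  shows "f \<in> L2 D"
proof -
  have "finite_measure (lebesgue_on D)" by (rule finite_measure_lebesgue_on[OF D])
  moreover have "(f p)\<^sup>2 \<le> C\<^sup>2" if "p \<in> D" for p using power_mono[OF b[OF that], of 2] by simp
  ultimately have "integrable (lebesgue_on D) (\<lambda>p. (f p)\<^sup>2)"
    using m by (intro finite_measure.integrable_const_bound[where B="C\<^sup>2"]) auto
  then show ?thesis using m by (simp add: L2_def)
qed

lemma Omega_sets: "Omega l \<in> sets lebesgue" "Omega l \<in> lmeasurable" "Omega l \<in> sets borel" "open (Omega l)" "bounded (Omega l)"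
proof -
  show o: "open (Omega l)" unfolding Omega_def by (intro open_Times) auto
  show b: "bounded (Omega l)" unfolding Omega_def by (intro bounded_Times) auto
  show "Omega l \<in> lmeasurable" using o b by (simp add: lmeasurable_open)
  then show "Omega l \<in> sets lebesgue" by auto
  show "Omega l \<in> sets borel" using o by auto
qed

lemma closure_Omega: "l > 0 \<Longrightarrow> closure (Omega l) = {0..pi} \<times> {-l..l}"
  unfolding Omega_def closure_Times using closure_greaterThanLessThan[of 0 pi] closure_greaterThanLessThan[of "-l" l] pi_gt_zero
  by simp

section \<open>Smooth test functions\<close>

text \<open>
  The class of functions \<open>p(1/x) exp (-1/x)\<close>, extended by \<open>0\<close> to \<open>x \<le> 0\<close>, is closed under differentiation;
  \<open>flat 1\<close> is the usual smooth function that is positive exactly for \<open>x > 0\<close>.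
\<close>

definition flat :: "real poly \<Rightarrow> real \<Rightarrow> real" where
  "flat p x = (if x > 0 then poly p (1 / x) * exp (- (1 / x)) else 0)"

lemma poly_exp_tendsto: "((\<lambda>y. poly p y * exp (- y)) \<longlongrightarrow> 0) at_top" for p :: "real poly"
proof -
  have "((\<lambda>y. \<Sum>i\<le>degree p. coeff p i * (y ^ i / exp y)) \<longlongrightarrow> (\<Sum>i\<le>degree p. coeff p i * 0)) at_top"
    by (intro tendsto_intros tendsto_power_div_exp_0)
  moreover have "(\<Sum>i\<le>degree p. coeff p i * (y ^ i / exp y)) = poly p y * exp (- y)" for y
    by (simp add: poly_altdef sum_distrib_right exp_minus divide_inverse mult.assoc)
  ultimately show ?thesis by simp
qed

lemma flat_deriv: "(flat p has_real_derivative flat (monom 1 2 * (p - pderiv p)) x) (at x)"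
proof -
  let ?q = "monom 1 2 * (p - pderiv p)"
  consider "x > 0" | "x < 0" | "x = 0" by linarith
  then show ?thesis
  proof cases
    case 1
    have "((\<lambda>x. poly p (1 / x) * exp (- (1 / x))) has_real_derivative flat ?q x) (at x)"
    proof -
      have i: "((\<lambda>x::real. 1 / x) has_real_derivative - (1 / x\<^sup>2)) (at x)"
        using 1 by (auto intro!: derivative_eq_intros simp: power2_eq_square)
      have e: "((\<lambda>x. exp (- (1 / x))) has_real_derivative exp (- (1 / x)) * (1 / x\<^sup>2)) (at x)"
        using DERIV_chain2[OF DERIV_exp DERIV_minus[OF i]] by simp
      show ?thesis
        by (rule DERIV_cong[OF DERIV_mult[OF DERIV_chain2[OF poly_DERIV i] e]])
           (use 1 in \<open>simp add: flat_def poly_monom power2_eq_square field_simps\<close>)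
    qed
    then show ?thesis
      by (rule has_field_derivative_transform_within_open[where S="{0<..}"])
         (use 1 in \<open>auto simp: flat_def\<close>)
  next
    case 2
    have "((\<lambda>x. 0) has_real_derivative flat ?q x) (at x)" using 2 by (simp add: flat_def)
    then show ?thesis
      by (rule has_field_derivative_transform_within_open[where S="{..<0}"])
         (use 2 in \<open>auto simp: flat_def\<close>)
  next
    case 3
    have "((\<lambda>h. flat p h / h) \<longlongrightarrow> 0) (at_right 0)"
    proof -
      have l: "((\<lambda>h::real. poly ([:0, 1:] * p) (1 / h) * exp (- (1 / h))) \<longlongrightarrow> 0) (at_right 0)"
        using filterlim_compose[OF poly_exp_tendsto[of "[:0, 1:] * p"] filterlim_inverse_at_top_right]
        by (simp add: divide_inverse)
      show ?thesis
        by (rule Lim_transform_eventually[OF l])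
           (auto simp: eventually_at_right_field flat_def intro!: exI[of _ 1])
    qed
    moreover have "((\<lambda>h. flat p h / h) \<longlongrightarrow> 0) (at_left 0)"
      by (rule Lim_transform_eventually[OF tendsto_const])
         (auto simp: eventually_at_left_field flat_def intro!: exI[of _ "-1"])
    ultimately have "((\<lambda>h. flat p h / h) \<longlongrightarrow> 0) (at 0)" by (rule filterlim_split_at[rotated])
    then show ?thesis using 3 by (simp add: has_field_derivative_iff flat_def)
  qed
qed

text \<open>
  A class of smooth functions generated by closure rules, large enough for the test functions needed and
  closed under \<open>deriv\<close>.  The last rule makes primitives of test functions available as test functions.
\<close>

inductive smooth_fun :: "(real \<Rightarrow> real) \<Rightarrow> bool" where
  flat: "smooth_fun (flat p)"
| const: "smooth_fun (\<lambda>x. c)"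
| ident: "smooth_fun (\<lambda>x. x)"
| add: "smooth_fun f \<Longrightarrow> smooth_fun g \<Longrightarrow> smooth_fun (\<lambda>x. f x + g x)"
| mult: "smooth_fun f \<Longrightarrow> smooth_fun g \<Longrightarrow> smooth_fun (\<lambda>x. f x * g x)"
| comp: "smooth_fun f \<Longrightarrow> smooth_fun g \<Longrightarrow> smooth_fun (\<lambda>x. f (g x))"
| primitive: "smooth_fun f \<Longrightarrow> (\<And>x. (F has_real_derivative f x) (at x)) \<Longrightarrow> smooth_fun F"

lemma smooth_fun_has_deriv:
  assumes "smooth_fun f" shows "\<exists>f'. smooth_fun f' \<and> (\<forall>x. (f has_real_derivative f' x) (at x))"
  using assms
proof induction
  case (flat p)
  show ?case using flat_deriv smooth_fun.flat by blast
next
  case (const c)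
  show ?case by (intro exI[of _ "\<lambda>x. 0"]) (auto intro: smooth_fun.const)
next
  case ident
  show ?case by (intro exI[of _ "\<lambda>x. 1"]) (auto intro: smooth_fun.const)
next
  case (add f g)
  then obtain f' g' where "smooth_fun f'" "\<forall>x. (f has_real_derivative f' x) (at x)"
    "smooth_fun g'" "\<forall>x. (g has_real_derivative g' x) (at x)" by blast
  then show ?case by (intro exI[of _ "\<lambda>x. f' x + g' x"]) (auto intro: smooth_fun.add DERIV_add)
next
  case (mult f g)
  then obtain f' g' where h: "smooth_fun f'" "\<forall>x. (f has_real_derivative f' x) (at x)"
    "smooth_fun g'" "\<forall>x. (g has_real_derivative g' x) (at x)" by blast
  have "((\<lambda>x. f x * g x) has_real_derivative f' x * g x + g' x * f x) (at x)" for x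
    using DERIV_mult[of f "f' x" x UNIV g "g' x"] h(2,4) by simp
  moreover have "smooth_fun (\<lambda>x. f' x * g x + g' x * f x)"
    by (intro smooth_fun.add smooth_fun.mult h mult)
  ultimately show ?case by blast
next
  case (comp f g)
  then obtain f' g' where h: "smooth_fun f'" "\<forall>x. (f has_real_derivative f' x) (at x)"
    "smooth_fun g'" "\<forall>x. (g has_real_derivative g' x) (at x)" by blast
  have "((\<lambda>x. f (g x)) has_real_derivative f' (g x) * g' x) (at x)" for x
    using DERIV_chain2[of f "f' (g x)" g x "g' x" UNIV] h(2,4) by simp
  moreover have "smooth_fun (\<lambda>x. f' (g x) * g' x)"
    by (rule smooth_fun.mult[OF smooth_fun.comp[OF h(1) comp.hyps(2)] h(3)])
  ultimately show ?case by blast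
qed blast

lemma smooth_fun_deriv: "smooth_fun f \<Longrightarrow> smooth_fun (deriv f)"
  and smooth_fun_DERIV: "smooth_fun f \<Longrightarrow> (f has_real_derivative deriv f x) (at x)"
proof -
  assume "smooth_fun f"
  then obtain f' where f': "smooth_fun f'" "\<And>x. (f has_real_derivative f' x) (at x)"
    using smooth_fun_has_deriv by blast
  then have "deriv f = f'" by (auto intro: DERIV_imp_deriv)
  then show "smooth_fun (deriv f)" "(f has_real_derivative deriv f x) (at x)" using f' by auto
qed

lemma smooth_fun_isCont: "smooth_fun f \<Longrightarrow> isCont f x"
  using smooth_fun_DERIV DERIV_isCont by blast

lemma smooth_fun_continuous: "smooth_fun f \<Longrightarrow> continuous_on A f"
  using smooth_fun_isCont continuous_at_imp_continuous_on by blast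

lemma smooth_fun_diff: "smooth_fun f \<Longrightarrow> smooth_fun g \<Longrightarrow> smooth_fun (\<lambda>x. f x - g x)"
  using smooth_fun.add[OF _ smooth_fun.mult[OF smooth_fun.const[of "-1"]], of f g] by simp

text \<open>
  A smooth function supported in \<open>[a + 1/n, b - 1/n]\<close> which converges to the indicator of \<open>(a, b)\<close>.
\<close>

definition bump :: "real \<Rightarrow> real \<Rightarrow> nat \<Rightarrow> real \<Rightarrow> real" where
  "bump a b n x = flat 1 (real n * (x - a) - 1) * flat 1 (real n * (b - x) - 1)"

lemma flat_one: "0 \<le> flat 1 x" "flat 1 x \<le> 1" "x \<le> 0 \<Longrightarrow> flat 1 x = 0" "x > 0 \<Longrightarrow> flat 1 x > 0"
  by (auto simp: flat_def)

lemma flat_one_tendsto: "((\<lambda>n. flat 1 (real n * y - 1)) \<longlonglongrightarrow> 1)" if "y > 0"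
proof -
  have "filterlim (\<lambda>n. - 1 + y * real n) at_top sequentially"
    by (intro filterlim_tendsto_add_at_top[OF tendsto_const]
        filterlim_tendsto_pos_mult_at_top[OF tendsto_const that filterlim_real_sequentially])
  then have t: "filterlim (\<lambda>n. real n * y - 1) at_top sequentially" by (simp add: mult.commute)
  have "((\<lambda>x. exp (- (1 / x))) \<longlongrightarrow> exp (- 0)) (at_top :: real filter)"
    by (intro tendsto_intros tendsto_divide_0[OF tendsto_const] filterlim_at_top_imp_at_infinity filterlim_ident)
  then have "((\<lambda>x. exp (- (1 / x))) \<longlongrightarrow> 1) (at_top :: real filter)" by simp
  then have "((\<lambda>x::real. flat 1 x) \<longlongrightarrow> 1) at_top"
    by (rule Lim_transform_eventually)
       (auto simp: flat_def eventually_at_top_dense intro!: exI[of _ 0])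
  from filterlim_compose[OF this t] show ?thesis .
qed

lemma bump_smooth: "smooth_fun (bump a b n)"
proof -
  have 1: "smooth_fun (\<lambda>x. real n * (x - a) - 1)"
    by (rule smooth_fun_diff[OF smooth_fun.mult[OF smooth_fun.const[of "real n"] smooth_fun_diff[OF smooth_fun.ident smooth_fun.const[of a]]] smooth_fun.const[of 1]])
  have 2: "smooth_fun (\<lambda>x. real n * (b - x) - 1)"
    by (rule smooth_fun_diff[OF smooth_fun.mult[OF smooth_fun.const[of "real n"] smooth_fun_diff[OF smooth_fun.const[of b] smooth_fun.ident]] smooth_fun.const[of 1]])
  have "bump a b n = (\<lambda>x. flat 1 (real n * (x - a) - 1) * flat 1 (real n * (b - x) - 1))"
    by (rule ext) (simp add: bump_def)
  then show ?thesis
    using smooth_fun.mult[OF smooth_fun.comp[OF smooth_fun.flat 1] smooth_fun.comp[OF smooth_fun.flat 2]] by simp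
qed

lemma bump_bounds: "0 \<le> bump a b n x" "bump a b n x \<le> 1"
  unfolding bump_def using flat_one by (auto intro: mult_le_one)

lemma bump_outside: "x \<notin> {a + 1 / real n .. b - 1 / real n} \<Longrightarrow> bump a b n x = 0"
proof (cases "n = 0")
  case False
  assume "x \<notin> {a + 1 / real n .. b - 1 / real n}"
  then have "real n * (x - a) - 1 \<le> 0 \<or> real n * (b - x) - 1 \<le> 0"
    using False by (auto simp: field_simps)
  then show ?thesis unfolding bump_def using flat_one(3) by auto
qed (simp add: bump_def flat_def)

lemma bump_tendsto: "(\<lambda>n. bump a b n x) \<longlonglongrightarrow> (if a < x \<and> x < b then 1 else 0)"
proof (cases "a < x \<and> x < b")
  case True
  then have "(\<lambda>n. bump a b n x) \<longlonglongrightarrow> 1 * 1"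
    unfolding bump_def by (intro tendsto_mult flat_one_tendsto) auto
  then show ?thesis using True by simp
next
  case False
  have "bump a b n x = 0" for n
  proof -
    have "real n * (x - a) - 1 \<le> 0 \<or> real n * (b - x) - 1 \<le> 0"
      using False mult_nonneg_nonpos[of "real n" "x - a"] mult_nonneg_nonpos[of "real n" "b - x"] by force
    then show ?thesis unfolding bump_def using flat_one(3) by auto
  qed
  then show ?thesis by (subst if_not_P[OF False]) simp
qed

text \<open>
  Test functions of one variable.
\<close>

definition Cc :: "real \<Rightarrow> real \<Rightarrow> (real \<Rightarrow> real) set" where
  "Cc a b = {f. smooth_fun f \<and> (\<exists>\<alpha> \<beta>. a < \<alpha> \<and> \<beta> < b \<and> (\<forall>x. x \<notin> {\<alpha>..\<beta>} \<longrightarrow> f x = 0))}"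

lemma Cc_smooth: "f \<in> Cc a b \<Longrightarrow> smooth_fun f" by (simp add: Cc_def)

lemma Cc_outside: "f \<in> Cc a b \<Longrightarrow> x \<notin> {a<..<b} \<Longrightarrow> f x = 0"
  unfolding Cc_def by force

lemma bump_Cc: assumes "a \<le> \<alpha>" "\<beta> \<le> b" shows "bump \<alpha> \<beta> n \<in> Cc a b"
proof (cases "n = 0")
  case True
  then have "bump \<alpha> \<beta> n x = 0" for x by (simp add: bump_def flat_def)
  then have "a < a + 1 \<and> b - 1 < b \<and> (\<forall>x. x \<notin> {a + 1..b - 1} \<longrightarrow> bump \<alpha> \<beta> n x = 0)" by simp
  then show ?thesis unfolding Cc_def using bump_smooth by blast
next
  case False
  then have "a < \<alpha> + 1 / real n" "\<beta> - 1 / real n < b"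
    using assms by (smt (verit) of_nat_0_less_iff zero_less_divide_1_iff gr0I)+
  then show ?thesis unfolding Cc_def using bump_smooth bump_outside by blast
qed

lemma Cc_deriv: assumes "f \<in> Cc a b" shows "deriv f \<in> Cc a b"
proof -
  obtain \<alpha> \<beta> where ab: "a < \<alpha>" "\<beta> < b" "\<And>x. x \<notin> {\<alpha>..\<beta>} \<Longrightarrow> f x = 0" using assms unfolding Cc_def by blast
  have "deriv f x = 0" if "x \<notin> {\<alpha>..\<beta>}" for x
  proof -
    have "((\<lambda>x. 0) has_real_derivative 0) (at x)" by simp
    then have "(f has_real_derivative 0) (at x)"
      by (rule has_field_derivative_transform_within_open[where S="- {\<alpha>..\<beta>}"]) (use that ab(3) in auto)
    then show ?thesis by (rule DERIV_imp_deriv)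
  qed
  then show ?thesis unfolding Cc_def using smooth_fun_deriv[OF Cc_smooth[OF assms]] ab by blast
qed

lemma Cc_lin: assumes "f \<in> Cc a b" "g \<in> Cc a b" shows "(\<lambda>x. c * f x + d * g x) \<in> Cc a b"
proof -
  obtain \<alpha> \<beta> where f: "a < \<alpha>" "\<beta> < b" "\<And>x. x \<notin> {\<alpha>..\<beta>} \<Longrightarrow> f x = 0" using assms(1) unfolding Cc_def by blast
  obtain \<alpha>' \<beta>' where g: "a < \<alpha>'" "\<beta>' < b" "\<And>x. x \<notin> {\<alpha>'..\<beta>'} \<Longrightarrow> g x = 0" using assms(2) unfolding Cc_def by blast
  have "c * f x + d * g x = 0" if "x \<notin> {min \<alpha> \<alpha>'..max \<beta> \<beta>'}" for x
  proof -
    have "x \<notin> {\<alpha>..\<beta>}" "x \<notin> {\<alpha>'..\<beta>'}" using that by auto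
    then show ?thesis using f(3) g(3) by simp
  qed
  moreover have "smooth_fun (\<lambda>x. c * f x + d * g x)"
    using assms by (intro smooth_fun.add smooth_fun.mult smooth_fun.const) (auto simp: Cc_def)
  moreover have "a < min \<alpha> \<alpha>'" "max \<beta> \<beta>' < b" using f g by auto
  ultimately show ?thesis unfolding Cc_def by blast
qed

lemma Cc_bounded: assumes "f \<in> Cc a b" shows "\<exists>C. \<forall>x. \<bar>f x\<bar> \<le> C"
proof -
  have "compact (f ` {a..b})"
    by (intro compact_continuous_image smooth_fun_continuous Cc_smooth[OF assms]) auto
  then obtain C where C: "\<And>x. x \<in> {a..b} \<Longrightarrow> \<bar>f x\<bar> \<le> C"
    by (meson bounded_real compact_imp_bounded imageI)
  have "\<bar>f x\<bar> \<le> \<bar>C\<bar>" for x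
    using C[of x] Cc_outside[OF assms, of x] by (cases "x \<in> {a..b}") (auto intro: order_trans)
  then show ?thesis by blast
qed

text \<open>
  Products of test functions of one variable suffice to test functions on a rectangle, and they reduce
  questions about partial derivatives to one variable.
\<close>

definition tensor :: "(real \<Rightarrow> real) \<Rightarrow> (real \<Rightarrow> real) \<Rightarrow> field" where
  "tensor a b = (\<lambda>p. a (fst p) * b (snd p))"

lemma dx_tensor: "smooth_fun a \<Longrightarrow> dx (tensor a b) = tensor (deriv a) b"
proof
  fix p assume a: "smooth_fun a"
  have "((\<lambda>s. a s * b (snd p)) has_real_derivative deriv a (fst p) * b (snd p)) (at (fst p))"
    using DERIV_cmult_right[OF smooth_fun_DERIV[OF a]] by blast
  then show "dx (tensor a b) p = tensor (deriv a) b p"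
    by (auto simp: dx_def tensor_def case_prod_beta dest: DERIV_imp_deriv)
qed

lemma dy_tensor: "smooth_fun b \<Longrightarrow> dy (tensor a b) = tensor a (deriv b)"
proof
  fix p assume b: "smooth_fun b"
  have "((\<lambda>s. a (fst p) * b s) has_real_derivative a (fst p) * deriv b (snd p)) (at (snd p))"
    using DERIV_cmult[OF smooth_fun_DERIV[OF b]] by blast
  then show "dy (tensor a b) p = tensor a (deriv b) p"
    by (auto simp: dy_def tensor_def case_prod_beta dest: DERIV_imp_deriv)
qed

lemma C_k_tensor: "smooth_fun a \<Longrightarrow> smooth_fun b \<Longrightarrow> C_k k (tensor a b)"
proof (induction k arbitrary: a b)
  case 0
  have c: "continuous_on UNIV (\<lambda>p. a (fst p))" "continuous_on UNIV (\<lambda>p. b (snd p))"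
    by (rule continuous_on_compose2[OF smooth_fun_continuous[OF 0(1), of UNIV] continuous_on_fst[OF continuous_on_id]], simp,
        rule continuous_on_compose2[OF smooth_fun_continuous[OF 0(2), of UNIV] continuous_on_snd[OF continuous_on_id]], simp)
  show ?case unfolding tensor_def C_k.simps by (rule continuous_on_mult[OF c])
next
  case (Suc k)
  have "(tensor a b) differentiable (at p)" for p
  proof -
    have "a differentiable (at (fst p))" "b differentiable (at (snd p))"
      using smooth_fun_DERIV[OF Suc.prems(1)] smooth_fun_DERIV[OF Suc.prems(2)]
      by (auto simp: has_field_derivative_def differentiable_def)
    then have "(\<lambda>p. a (fst p)) differentiable (at p)" "(\<lambda>p. b (snd p)) differentiable (at p)"
      using differentiable_compose[of a fst p UNIV] differentiable_compose[of b snd p UNIV]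
        bounded_linear_imp_differentiable[OF bounded_linear_fst] bounded_linear_imp_differentiable[OF bounded_linear_snd]
      by auto
    then show ?thesis unfolding tensor_def by (rule differentiable_mult)
  qed
  then have "tensor a b differentiable_on UNIV"
    by (simp add: differentiable_on_def differentiable_at_withinI)
  then show ?case
    using Suc.IH Suc.prems by (simp add: dx_tensor dy_tensor smooth_fun_deriv)
qed

lemma tensor_test:
  assumes a: "a \<in> Cc 0 pi" and b: "b \<in> Cc (-l) l" shows "tensor a b \<in> test_functions (Omega l)"
proof -
  obtain \<alpha> \<beta> where f: "0 < \<alpha>" "\<beta> < pi" "\<And>x. x \<notin> {\<alpha>..\<beta>} \<Longrightarrow> a x = 0" using a unfolding Cc_def by blast
  obtain \<alpha>' \<beta>' where g: "- l < \<alpha>'" "\<beta>' < l" "\<And>x. x \<notin> {\<alpha>'..\<beta>'} \<Longrightarrow> b x = 0" using b unfolding Cc_def by blast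
  let ?K = "{\<alpha>..\<beta>} \<times> {\<alpha>'..\<beta>'}"
  have K: "compact ?K" by (intro compact_Times) auto
  have "{p. tensor a b p \<noteq> 0} \<subseteq> ?K"
  proof
    fix p assume "p \<in> {p. tensor a b p \<noteq> 0}"
    then have "a (fst p) \<noteq> 0" "b (snd p) \<noteq> 0" by (auto simp: tensor_def)
    then have "fst p \<in> {\<alpha>..\<beta>}" "snd p \<in> {\<alpha>'..\<beta>'}" using f(3) g(3) by blast+
    then show "p \<in> ?K" by (cases p) auto
  qed
  then have c: "closure {p. tensor a b p \<noteq> 0} \<subseteq> ?K"
    using K by (intro closure_minimal compact_imp_closed)
  then have "compact (closure {p. tensor a b p \<noteq> 0})"
    using K by (meson closed_closure closed_subset compact_Int_closed compact_closure compact_imp_bounded bounded_subset bounded_closure_image closure_subset order_trans)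
  moreover have "?K \<subseteq> Omega l" using f g by (auto simp: Omega_def)
  ultimately show ?thesis unfolding test_functions_def
    using c C_k_tensor[OF Cc_smooth[OF a] Cc_smooth[OF b]] by blast
qed

lemma Cc_derivs: "f \<in> Cc a b \<Longrightarrow> (deriv ^^ i) f \<in> Cc a b"
  by (induction i) (auto intro: Cc_deriv)

lemma derivs_tensor:
  assumes "a \<in> Cc 0 pi" "b \<in> Cc (-l) l"
  shows "(dx ^^ i) ((dy ^^ j) (tensor a b)) = tensor ((deriv ^^ i) a) ((deriv ^^ j) b)"
proof -
  have j: "(dy ^^ j) (tensor a b) = tensor a ((deriv ^^ j) b)" for a
    by (induction j) (simp_all add: dy_tensor[OF Cc_smooth[OF Cc_derivs[OF assms(2)]]])
  have "(dx ^^ i) (tensor a b) = tensor ((deriv ^^ i) a) b" for b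
    by (induction i) (simp_all add: dx_tensor[OF Cc_smooth[OF Cc_derivs[OF assms(1)]]])
  then show ?thesis by (simp add: j)
qed

lemma weak_deriv_tensor:
  assumes "is_weak_deriv (Omega l) i j f g" "a \<in> Cc 0 pi" "b \<in> Cc (-l) l"
  shows "(LINT p|lebesgue_on (Omega l). f p * tensor ((deriv ^^ i) a) ((deriv ^^ j) b) p)
     = (- 1) ^ (i + j) * (LINT p|lebesgue_on (Omega l). g p * tensor a b p)"
  using assms(1) tensor_test[OF assms(2,3)] unfolding is_weak_deriv_def derivs_tensor[OF assms(2,3), symmetric] by blast

section \<open>Fubini arguments on the plane\<close>

lemma fst_snd_borel [measurable]:
  "fst \<in> borel_measurable (borel :: (real \<times> real) measure)" "snd \<in> borel_measurable (borel :: (real \<times> real) measure)"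
  by (intro borel_measurable_continuous_onI continuous_intros)+

lemma borel_measurable_if_le:
  fixes u v :: "'a::topological_space \<Rightarrow> real" and g :: "'a \<Rightarrow> real"
  assumes "continuous_on UNIV u" "continuous_on UNIV v" "g \<in> borel_measurable borel"
  shows "(\<lambda>x. if u x \<le> v x then g x else 0) \<in> borel_measurable borel"
proof (rule measurable_If[OF assms(3) measurable_const])
  have "closed {x. u x \<le> v x}" by (rule closed_Collect_le[OF assms(1,2)])
  then show "{x \<in> space borel. u x \<le> v x} \<in> sets borel" by simp
qed simp

abbreviation (input) leb2 :: "(real \<times> real) measure" where "leb2 \<equiv> lborel"

definition flip :: "(real \<times> real \<Rightarrow> 'a) \<Rightarrow> real \<times> real \<Rightarrow> 'a" where "flip f = (\<lambda>p. f (snd p, fst p))"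

lemma flip_simps [simp]: "flip f (x, y) = f (y, x)" "flip (flip f) = f" by (auto simp: flip_def)

lemma case_prod_pair: "(\<lambda>(x, y). h (x, y)) = h" by auto

lemma flip_case_prod: "(\<lambda>(x, y). f (y, x)) = flip f" by (auto simp: flip_def)

lemma swap_measurable: "(\<lambda>p::real \<times> real. (snd p, fst p)) \<in> borel_measurable borel"
  by (intro borel_measurable_continuous_onI continuous_intros)

lemma flip_integrable: fixes h :: field assumes "integrable leb2 h" shows "integrable leb2 (flip h)"
  using lborel_pair.integrable_product_swap[of h] assms by (simp add: lborel_prod flip_case_prod)

lemma flip_measurable: fixes h :: field assumes "h \<in> borel_measurable borel" shows "flip h \<in> borel_measurable borel"
  unfolding flip_def by (rule measurable_compose[OF swap_measurable assms])

lemma flip_integral: fixes h :: field assumes "h \<in> borel_measurable borel"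
  shows "(LINT p|leb2. flip h p) = (LINT p|leb2. h p)"
  using lborel_pair.integral_product_swap[of h] assms by (simp add: lborel_prod flip_case_prod)

lemma flip_AE: assumes "AE p in leb2. Q p" shows "AE p in leb2. Q (snd p, fst p)"
proof -
  have m: "(\<lambda>(x, y). (y, x)) \<in> measurable leb2 leb2"
    using swap_measurable by (simp add: case_prod_beta)
  have d: "leb2 = distr leb2 leb2 (\<lambda>(x, y). (y, x))"
    using lborel_pair.distr_pair_swap unfolding lborel_prod .
  have "AE p in distr leb2 leb2 (\<lambda>(x, y). (y, x)). Q p" using assms by (subst (asm) d)
  from AE_distrD[OF m this] show ?thesis by (simp add: case_prod_beta)
qed

lemma slice_integrable:
  fixes h :: field
  assumes "integrable leb2 h"
  shows "AE y in lborel. integrable lborel (\<lambda>x. h (x, y))" "integrable lborel (\<lambda>y. LINT x|lborel. h (x, y))"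
    "(LINT y|lborel. LINT x|lborel. h (x, y)) = (LINT p|leb2. h p)"
proof -
  have "integrable (lborel \<Otimes>\<^sub>M lborel) (case_prod (\<lambda>x y. h (x, y)))"
    using assms by (simp add: lborel_prod case_prod_pair)
  from lborel_pair.AE_integrable_snd[OF this] lborel_pair.integrable_snd[OF this] lborel_pair.integral_snd[OF this]
  show "AE y in lborel. integrable lborel (\<lambda>x. h (x, y))" "integrable lborel (\<lambda>y. LINT x|lborel. h (x, y))"
    "(LINT y|lborel. LINT x|lborel. h (x, y)) = (LINT p|leb2. h p)"
    by (simp_all add: lborel_prod case_prod_pair)
qed

lemma slice_AE: assumes "AE p in leb2. Q p" shows "AE y in lborel. AE x in lborel. Q (x, y)"
proof -
  have "AE p in lborel \<Otimes>\<^sub>M lborel. Q (snd p, fst p)" using flip_AE[OF assms] unfolding lborel_prod .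
  from lborel_pair.AE_pair[OF this] show ?thesis by simp
qed

lemma slice_measurable: fixes h :: field assumes [measurable]: "h \<in> borel_measurable borel" shows "(\<lambda>x. h (x, y)) \<in> borel_measurable borel"
  by measurable

lemma product_integrable:
  fixes u v :: "real \<Rightarrow> real"
  assumes u: "integrable lborel u" and v: "integrable lborel v"
  shows "integrable leb2 (\<lambda>p. u (fst p) * v (snd p))"
    "(LINT p|leb2. u (fst p) * v (snd p)) = (LINT x|lborel. u x) * (LINT y|lborel. v y)"
proof -
  have [measurable]: "u \<in> borel_measurable borel" "v \<in> borel_measurable borel" using u v by (auto dest: borel_measurable_integrable)
  have "integrable (lborel \<Otimes>\<^sub>M lborel) (\<lambda>p. u (fst p) * v (snd p))"
  proof (rule lborel_pair.Fubini_integrable)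
    show "(\<lambda>p. u (fst p) * v (snd p)) \<in> borel_measurable (lborel \<Otimes>\<^sub>M lborel)" by measurable
    have "(\<lambda>x. LINT y|lborel. norm (u (fst (x, y)) * v (snd (x, y)))) = (\<lambda>x. \<bar>u x\<bar> * (LINT y|lborel. \<bar>v y\<bar>))"
      by (simp add: abs_mult)
    then show "integrable lborel (\<lambda>x. LINT y|lborel. norm (u (fst (x, y)) * v (snd (x, y))))" using u by simp
    show "AE x in lborel. integrable lborel (\<lambda>y. u (fst (x, y)) * v (snd (x, y)))" using v by simp
  qed
  then show i: "integrable leb2 (\<lambda>p. u (fst p) * v (snd p))" by (simp add: lborel_prod)
  show "(LINT p|leb2. u (fst p) * v (snd p)) = (LINT x|lborel. u x) * (LINT y|lborel. v y)"
    using slice_integrable(3)[OF i] by simp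
qed

text \<open>
  Both sides are the integral of \<open>u s * v x\<close> over \<open>s \<le> x\<close>.
\<close>

lemma primitive_exchange:
  fixes u v :: "real \<Rightarrow> real"
  assumes u: "integrable lborel u" and v: "integrable lborel v"
  shows "(LINT s|lborel. u s * (LINT x|lborel. (if s \<le> x then v x else 0)))
       = (LINT x|lborel. (LINT s|lborel. (if s \<le> x then u s else 0)) * v x)"
proof -
  have [measurable]: "u \<in> borel_measurable borel" "v \<in> borel_measurable borel" using u v by (auto dest: borel_measurable_integrable)
  define h where "h = (\<lambda>s x. if s \<le> x then u s * v x else 0)"
  have "integrable leb2 (\<lambda>p. if fst p \<le> snd p then u (fst p) * v (snd p) else 0)"
    by (rule Bochner_Integration.integrable_bound[OF product_integrable(1)[OF u v]])
       (auto intro!: borel_measurable_if_le continuous_intros)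
  moreover have "(\<lambda>p. if fst p \<le> snd p then u (fst p) * v (snd p) else 0) = case_prod h"
    by (auto simp: h_def fun_eq_iff)
  ultimately have "integrable (lborel \<Otimes>\<^sub>M lborel) (case_prod h)" by (simp add: lborel_prod)
  from lborel_pair.Fubini_integral[OF this]
  have "(LINT x|lborel. LINT s|lborel. h s x) = (LINT s|lborel. LINT x|lborel. h s x)" .
  moreover have "(LINT s|lborel. h s x) = (LINT s|lborel. (if s \<le> x then u s else 0)) * v x" for x
  proof -
    have "(LINT s|lborel. h s x) = (LINT s|lborel. (if s \<le> x then u s else 0) * v x)"
      unfolding h_def by (rule Bochner_Integration.integral_cong) auto
    then show ?thesis by simp
  qed
  moreover have "(LINT x|lborel. h s x) = u s * (LINT x|lborel. (if s \<le> x then v x else 0))" for s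
  proof -
    have "(LINT x|lborel. h s x) = (LINT x|lborel. u s * (if s \<le> x then v x else 0))"
      unfolding h_def by (rule Bochner_Integration.integral_cong) auto
    then show ?thesis by simp
  qed
  ultimately show ?thesis by simp
qed

lemma primitive_complement:
  fixes v :: "real \<Rightarrow> real"
  assumes v: "integrable lborel v"
  shows "(LINT x|lborel. (if s \<le> x then v x else 0)) = (LINT x|lborel. v x) - (LINT x|lborel. (if x \<le> s then v x else 0))"
proof -
  have [measurable]: "v \<in> borel_measurable borel" using v by (auto dest: borel_measurable_integrable)
  have i: "integrable lborel (\<lambda>x. if x \<le> s then v x else 0)" "integrable lborel (\<lambda>x. if s \<le> x then v x else 0)"
    by (rule Bochner_Integration.integrable_bound[OF v]; auto)+
  have "(LINT x|lborel. v x) = (LINT x|lborel. (if x \<le> s then v x else 0) + (if s \<le> x then v x else 0))"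
  proof (rule integral_cong_AE)
    show "AE x in lborel. v x = (if x \<le> s then v x else 0) + (if s \<le> x then v x else 0)"
      using AE_lborel_singleton[of s] by eventually_elim auto
  qed auto
  also have "\<dots> = (LINT x|lborel. (if x \<le> s then v x else 0)) + (LINT x|lborel. (if s \<le> x then v x else 0))"
    by (rule Bochner_Integration.integral_add[OF i])
  finally show ?thesis by simp
qed

text \<open>
  The primitive in the first variable that vanishes on the far left.
\<close>

definition prim1 :: "field \<Rightarrow> field" where
  "prim1 g p = (LINT s|lborel. (if s \<le> fst p then g (s, snd p) else 0))"

lemma prim1_measurable: assumes [measurable]: "g \<in> borel_measurable borel" shows "prim1 g \<in> borel_measurable borel"
proof -
  have "(\<lambda>x. if snd x \<le> fst (fst x) then g (snd x, snd (fst x)) else 0) \<in> borel_measurable (borel :: ((real \<times> real) \<times> real) measure)"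
    by (intro borel_measurable_if_le continuous_intros measurable_compose[OF borel_measurable_continuous_onI assms])
  then have "case_prod (\<lambda>p s. if s \<le> fst p then g (s, snd p) else 0) \<in> borel_measurable (leb2 \<Otimes>\<^sub>M lborel)"
    by (simp add: lborel_prod case_prod_beta')
  from lborel.borel_measurable_lebesgue_integral[OF this] show ?thesis by (simp add: prim1_def[abs_def])
qed

lemma prim1_bound: "\<bar>prim1 g p\<bar> \<le> (LINT s|lborel. \<bar>g (s, snd p)\<bar>)" if "integrable lborel (\<lambda>s. g (s, snd p))"
proof -
  have [measurable]: "(\<lambda>s. g (s, snd p)) \<in> borel_measurable borel" using that by (auto dest: borel_measurable_integrable)
  have "\<bar>prim1 g p\<bar> \<le> (LINT s|lborel. \<bar>if s \<le> fst p then g (s, snd p) else 0\<bar>)"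
    unfolding prim1_def by (rule integral_abs_bound)
  also have "\<dots> \<le> (LINT s|lborel. \<bar>g (s, snd p)\<bar>)"
    by (rule integral_mono) (use that in \<open>auto intro!: Bochner_Integration.integrable_bound[OF that]\<close>)
  finally show ?thesis .
qed

text \<open>
  Open boxes form an intersection-stable generator of the Borel sets, so \<open>h\<close> has integral zero over
  every Borel set.
\<close>

lemma integral_boxes_zero_imp_AE_zero:
  fixes h :: "'a::euclidean_space \<Rightarrow> real"
  assumes h: "integrable lborel h" and box: "\<And>a b. (LINT p|lborel. indicator (box a b) p * h p) = 0"
  shows "AE p in lborel. h p = 0"
proof (rule density_unique_real[OF h])
  show "integrable lborel (\<lambda>p::'a. 0::real)" by simp
  fix A :: "'a set" assume "A \<in> sets lborel"
  then have A: "A \<in> sigma_sets UNIV (range (\<lambda>(a, b). box a b))"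
    by (simp add: borel_eq_box)
  have sets: "B \<in> sets lborel" if "B \<in> sigma_sets UNIV (range (\<lambda>(a, b). box a b))" for B :: "'a set"
    using that by (simp add: borel_eq_box)
  have whole: "(LINT p|lborel. h p) = 0"
  proof -
    let ?B = "\<lambda>n::nat. box (- real n *\<^sub>R One) (real n *\<^sub>R (One :: 'a))"
    have "(\<lambda>n. LINT p|lborel. indicator (?B n) p * h p) \<longlonglongrightarrow> (LINT p|lborel. h p)"
    proof (rule integral_dominated_convergence[where w="\<lambda>p. \<bar>h p\<bar>"])
      show "AE p in lborel. (\<lambda>n. indicator (?B n) p * h p) \<longlonglongrightarrow> h p"
      proof (rule AE_I2, rule tendsto_eventually)
        fix p :: 'a
        obtain N :: nat where N: "norm p < real N" using reals_Archimedean2 by blast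
        have "p \<in> ?B n" if "n \<ge> N" for n
        proof -
          have "- real n < p \<bullet> i \<and> p \<bullet> i < real n" if "i \<in> Basis" for i
            using Basis_le_norm[OF that, of p] N \<open>n \<ge> N\<close> by linarith
          then show ?thesis by (auto simp: mem_box)
        qed
        then show "\<forall>\<^sub>F n in sequentially. indicator (?B n) p * h p = h p"
          by (auto simp: eventually_sequentially intro!: exI[of _ N])
      qed
      show "AE p in lborel. norm (indicator (?B n) p * h p) \<le> \<bar>h p\<bar>" for n
        by (rule AE_I2) (auto simp: indicator_def)
    qed (use h in auto)
    moreover have "(\<lambda>n. LINT p|lborel. indicator (?B n) p * h p) = (\<lambda>n. 0)" using box by simp
    ultimately show ?thesis by (simp add: LIMSEQ_const_iff)
  qed
  have "Int_stable (range (\<lambda>(a, b). box a b) :: 'a set set)"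
    unfolding Int_stable_def by (auto simp: box_Int_box)
  moreover have "range (\<lambda>(a, b). box a b) \<subseteq> Pow (UNIV :: 'a set)" by simp
  ultimately have "(LINT p:A|lborel. h p) = 0" using A
  proof (induction A rule: sigma_sets_induct_disjoint)
    case (basic A)
    then show ?case using box by (auto simp: set_lebesgue_integral_def)
  next
    case empty
    show ?case by (simp add: set_lebesgue_integral_def)
  next
    case (compl A)
    have i: "set_integrable lborel A h" unfolding set_integrable_def
      using sets[OF compl(1)] h by (intro integrable_mult_indicator) auto
    have "(LINT p:(UNIV - A)|lborel. h p) = (LINT p|lborel. h p - indicator A p *\<^sub>R h p)"
      unfolding set_lebesgue_integral_def by (rule Bochner_Integration.integral_cong) (auto simp: indicator_def)
    also have "\<dots> = (LINT p|lborel. h p) - (LINT p:A|lborel. h p)"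
      using i h unfolding set_lebesgue_integral_def set_integrable_def by (intro Bochner_Integration.integral_diff)
    finally show ?case using whole compl(2) by simp
  next
    case (union A)
    have m: "A i \<in> sets lborel" for i using sets union(2) by blast
    have "(LINT p:(\<Union>i. A i)|lborel. h p) = (\<Sum>i. (LINT p:(A i)|lborel. h p))"
    proof (rule lebesgue_integral_countable_add[OF m])
      show "A i \<inter> A j = {}" if "i \<noteq> j" for i j using union(1) that by (auto simp: disjoint_family_on_def)
      show "set_integrable lborel (\<Union>i. A i) h" unfolding set_integrable_def
        using m h by (intro integrable_mult_indicator) auto
    qed
    then show ?case using union(3) by simp
  qed
  then show "(LINT p:A|lborel. h p) = (LINT p:A|lborel. 0)" by (simp add: set_lebesgue_integral_def)
qed

text \<open>
  Bump functions approximate indicators of boxes, so \<open>h\<close> has integral zero over every box.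
\<close>

lemma tested_zero_imp_AE_zero:
  fixes h :: field
  assumes h: "integrable leb2 h" and off: "\<And>p. p \<notin> {a<..<b} \<times> {c<..<d} \<Longrightarrow> h p = 0"
    and test: "\<And>\<alpha> \<beta>. \<alpha> \<in> Cc a b \<Longrightarrow> \<beta> \<in> Cc c d \<Longrightarrow> (LINT p|leb2. h p * (\<alpha> (fst p) * \<beta> (snd p))) = 0"
  shows "AE p in leb2. h p = 0"
proof (rule integral_boxes_zero_imp_AE_zero[OF h])
  fix l r :: "real \<times> real"
  define x0 where "x0 = max a (fst l)"
  define x1 where "x1 = min b (fst r)"
  define y0 where "y0 = max c (snd l)"
  define y1 where "y1 = min d (snd r)"
  have [measurable]: "h \<in> borel_measurable borel" using h by (auto dest: borel_measurable_integrable)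
  have [measurable]: "bump s t n \<in> borel_measurable borel" for s t n
    by (intro borel_measurable_continuous_onI smooth_fun_continuous bump_smooth)
  have "(\<lambda>n. LINT p|leb2. h p * (bump x0 x1 n (fst p) * bump y0 y1 n (snd p))) \<longlonglongrightarrow> (LINT p|leb2. indicator (box l r) p * h p)"
  proof (rule integral_dominated_convergence[where w="\<lambda>p. \<bar>h p\<bar>"])
    show "AE p in leb2. (\<lambda>n. h p * (bump x0 x1 n (fst p) * bump y0 y1 n (snd p))) \<longlonglongrightarrow> indicator (box l r) p * h p"
    proof (rule AE_I2)
      fix p :: "real \<times> real"
      have "(\<lambda>n. h p * (bump x0 x1 n (fst p) * bump y0 y1 n (snd p))) \<longlonglongrightarrow>
          h p * ((if x0 < fst p \<and> fst p < x1 then 1 else 0) * (if y0 < snd p \<and> snd p < y1 then 1 else 0))"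
        by (intro tendsto_intros bump_tendsto)
      moreover have "h p * ((if x0 < fst p \<and> fst p < x1 then 1 else 0) * (if y0 < snd p \<and> snd p < y1 then 1 else 0))
          = indicator (box l r) p * h p"
      proof (cases "p \<in> {a<..<b} \<times> {c<..<d}")
        case True
        have "p \<in> box l r \<longleftrightarrow> fst l < fst p \<and> fst p < fst r \<and> snd l < snd p \<and> snd p < snd r"
          by (cases p, cases l, cases r) (auto simp: mem_box Basis_prod_def)
        then show ?thesis using True by (auto simp: x0_def x1_def y0_def y1_def indicator_def)
      qed (simp add: off)
      ultimately show "(\<lambda>n. h p * (bump x0 x1 n (fst p) * bump y0 y1 n (snd p))) \<longlonglongrightarrow> indicator (box l r) p * h p"
        by simp
    qed
    have "\<bar>bump x0 x1 n x * bump y0 y1 n y\<bar> \<le> 1" for n x y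
      using bump_bounds[of x0 x1 n x] bump_bounds[of y0 y1 n y] by (simp add: abs_mult mult_le_one)
    then show "AE p in leb2. norm (h p * (bump x0 x1 n (fst p) * bump y0 y1 n (snd p))) \<le> \<bar>h p\<bar>" for n
      by (intro AE_I2) (simp add: abs_mult[of "h _"] mult_left_le)
  qed (use h in auto)
  moreover have "(LINT p|leb2. h p * (bump x0 x1 n (fst p) * bump y0 y1 n (snd p))) = 0" for n
    by (rule test) (auto intro!: bump_Cc simp: x0_def x1_def y0_def y1_def)
  ultimately show "(LINT p|leb2. indicator (box l r) p * h p) = 0" by (simp add: LIMSEQ_const_iff)
qed

lemma Cc_support: "\<phi> \<in> Cc a b \<Longrightarrow> \<phi> x \<noteq> 0 \<Longrightarrow> a < x \<and> x < b"
  using Cc_outside[of \<phi> a b x] by auto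

lemma Cc_integrable: assumes "\<phi> \<in> Cc a b" shows "integrable lborel \<phi>"
proof -
  have "integrable lborel (\<lambda>x. indicator {a..b} x *\<^sub>R \<phi> x)"
    by (rule borel_integrable_compact) (auto intro: smooth_fun_continuous Cc_smooth[OF assms])
  moreover have "(\<lambda>x. indicator {a..b} x *\<^sub>R \<phi> x) = \<phi>"
    using Cc_support[OF assms] by (fastforce simp: indicator_def fun_eq_iff)
  ultimately show ?thesis by simp
qed

lemma Cc_measurable: assumes "\<phi> \<in> Cc a b" shows "\<phi> \<in> borel_measurable borel"
  by (intro borel_measurable_continuous_onI smooth_fun_continuous Cc_smooth[OF assms])

text \<open>
  The vanishing integral makes the antiderivative that is zero on the left also zero on the right.  It is
  written with integrals over right tails because these arise in \<open>primitive_exchange\<close>.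
\<close>

lemma Cc_primitive:
  assumes \<phi>: "\<phi> \<in> Cc a b" and ab: "a < b" and 0: "(LINT x|lborel. \<phi> x) = 0"
  shows "\<exists>A\<in>Cc a b. deriv A = \<phi> \<and> (\<forall>s. A s = - (LINT x|lborel. (if s \<le> x then \<phi> x else 0)))"
proof -
  have sm: "smooth_fun \<phi>" by (rule Cc_smooth[OF \<phi>])
  have "\<exists>F. \<forall>x :: real. - \<infinity> < ereal x \<longrightarrow> ereal x < \<infinity> \<longrightarrow> (F has_vector_derivative \<phi> x) (at x)"
    by (rule einterval_antiderivative) (auto intro: smooth_fun_isCont[OF sm])
  then obtain F where F: "\<And>x. (F has_real_derivative \<phi> x) (at x)"
    by (auto simp: has_real_derivative_iff_has_vector_derivative)
  obtain \<alpha> \<beta> where ab': "a < \<alpha>" "\<beta> < b" "\<And>x. x \<notin> {\<alpha>..\<beta>} \<Longrightarrow> \<phi> x = 0" using \<phi> unfolding Cc_def by blast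
  have ftc: "(LINT x|lborel. \<phi> x * indicator {u..v} x) = F v - F u" if "u \<le> v" for u v
    by (rule integral_FTC_Icc_real[OF that F smooth_fun_isCont[OF sm]])
  have up: "(LINT x|lborel. (if s \<le> x then \<phi> x else 0)) = F (max s b) - F s" for s
  proof -
    have "(LINT x|lborel. (if s \<le> x then \<phi> x else 0)) = (LINT x|lborel. \<phi> x * indicator {s..max s b} x)"
      by (rule Bochner_Integration.integral_cong) (use Cc_support[OF \<phi>] in \<open>fastforce simp: indicator_def\<close>)+
    then show ?thesis using ftc[of s "max s b"] by simp
  qed
  define A where "A s = - (LINT x|lborel. (if s \<le> x then \<phi> x else 0))" for s
  have const: "F v = F u" if "u \<le> v" "b \<le> u" for u v
  proof -
    have "(\<lambda>x. \<phi> x * indicator {u..v} x) = (\<lambda>x. 0)"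
      using Cc_support[OF \<phi>] that by (force simp: indicator_def fun_eq_iff)
    then show ?thesis using ftc[OF that(1)] by simp
  qed
  have AF: "A s = F s - F b" for s
    unfolding A_def up using const[of b s] by (simp add: max_def)
  have "(A has_real_derivative \<phi> x) (at x)" for x
    unfolding AF[abs_def] using DERIV_diff[OF F[of x] DERIV_const[of "F b"]] by simp
  note dA = this
  have "A s = 0" if "s \<notin> {\<alpha>..\<beta>}" for s
  proof (cases "s < \<alpha>")
    case True
    have "(LINT x|lborel. (if s \<le> x then \<phi> x else 0)) = (LINT x|lborel. \<phi> x)"
      by (rule Bochner_Integration.integral_cong) (use ab'(3) True in auto)
    then show ?thesis using 0 by (simp add: A_def)
  next
    case False
    then have "s > \<beta>" using that by auto
    then have "(\<lambda>x. if s \<le> x then \<phi> x else 0) = (\<lambda>x. 0)" using ab'(3) by (auto simp: fun_eq_iff)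
    then show ?thesis by (simp add: A_def)
  qed
  then have "A \<in> Cc a b" unfolding Cc_def using smooth_fun.primitive[OF sm dA] ab'(1,2) by blast
  moreover have "deriv A = \<phi>" using dA by (auto intro: DERIV_imp_deriv)
  ultimately show ?thesis by (intro bexI[of _ A]) (auto simp: A_def)
qed

lemma Cc_normalized: assumes "a < b" shows "\<exists>\<theta>\<in>Cc a b. (LINT x|lborel. \<theta> x) = 1"
proof -
  have "(\<lambda>n. LINT x|lborel. bump a b n x) \<longlonglongrightarrow> (LINT x|lborel. (if a < x \<and> x < b then 1 else 0))"
  proof (rule integral_dominated_convergence[where w="indicator {a..b}"])
    show "AE x in lborel. norm (bump a b n x) \<le> indicat_real {a..b} x" for n
    proof (rule AE_I2)
      fix x
      have "bump a b n x = 0" if "x \<notin> {a..b}"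
        using Cc_outside[OF bump_Cc[of a a b b n], of x] that by auto
      then show "norm (bump a b n x) \<le> indicat_real {a..b} x"
        using bump_bounds[of a b n x] by (auto simp: indicator_def)
    qed
    show "bump a b n \<in> borel_measurable lborel" for n
      using Cc_measurable[OF bump_Cc[of a a b b n]] by simp
    show "AE x in lborel. (\<lambda>n. bump a b n x) \<longlonglongrightarrow> (if a < x \<and> x < b then 1 else 0)"
      by (rule AE_I2, rule bump_tendsto)
    show "integrable lborel (indicat_real {a..b})" by (rule integrable_real_indicator) (auto simp: emeasure_lborel_Icc_eq)
  qed auto
  moreover have "(LINT x|lborel. (if a < x \<and> x < b then 1 else 0 :: real)) = (LINT x|lborel. indicator {a<..<b} x)"
    by (rule Bochner_Integration.integral_cong) (auto simp: indicator_def)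
  moreover have "(LINT x|lborel. indicat_real {a<..<b} x) = b - a" using assms by simp
  ultimately have "(\<lambda>n. LINT x|lborel. bump a b n x) \<longlonglongrightarrow> b - a" by simp
  then have "\<forall>\<^sub>F n in sequentially. (LINT x|lborel. bump a b n x) > 0" using assms by (intro order_tendstoD) auto
  then obtain n where n: "(LINT x|lborel. bump a b n x) > 0" by (auto simp: eventually_sequentially)
  let ?I = "LINT x|lborel. bump a b n x"
  have "(\<lambda>x. (1 / ?I) * bump a b n x + 0 * bump a b n x) \<in> Cc a b" by (intro Cc_lin bump_Cc) auto
  moreover have "(LINT x|lborel. (1 / ?I) * bump a b n x + 0 * bump a b n x) = 1" using n by simp
  ultimately show ?thesis by blast
qed

section \<open>Weak derivatives along lines\<close>

lemma prim1_pair: "prim1 g (x, y) = (LINT s|lborel. (if s \<le> x then g (s, y) else 0))"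
  by (simp only: prim1_def fst_conv snd_conv)

lemma bounded_factors_integrable:
  fixes h :: field and \<alpha> \<beta> :: "real \<Rightarrow> real"
  assumes h: "integrable leb2 h" and m: "\<alpha> \<in> borel_measurable borel" "\<beta> \<in> borel_measurable borel"
    and b: "\<exists>A. \<forall>x. \<bar>\<alpha> x\<bar> \<le> A" "\<exists>B. \<forall>x. \<bar>\<beta> x\<bar> \<le> B"
  shows "integrable leb2 (\<lambda>p. h p * (\<alpha> (fst p) * \<beta> (snd p)))"
proof -
  obtain A B where AB: "\<And>x. \<bar>\<alpha> x\<bar> \<le> A" "\<And>x. \<bar>\<beta> x\<bar> \<le> B" using b by blast
  have [measurable]: "h \<in> borel_measurable borel" using h by (auto dest: borel_measurable_integrable)
  note [measurable] = m
  show ?thesis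
  proof (rule Bochner_Integration.integrable_bound[where f="\<lambda>p. (A * B) * h p"])
    have A0: "A \<ge> 0" using AB(1)[of 0] by linarith
    have "norm (h p * (\<alpha> (fst p) * \<beta> (snd p))) \<le> norm ((A * B) * h p)" for p
    proof -
      have "\<bar>\<alpha> (fst p)\<bar> * \<bar>\<beta> (snd p)\<bar> \<le> A * B" using AB A0 by (intro mult_mono) auto
      then have "\<bar>h p\<bar> * (\<bar>\<alpha> (fst p)\<bar> * \<bar>\<beta> (snd p)\<bar>) \<le> \<bar>h p\<bar> * (A * B)" by (intro mult_left_mono) auto
      also have "\<dots> \<le> \<bar>h p\<bar> * \<bar>A * B\<bar>" by (intro mult_left_mono) auto
      finally show ?thesis by (simp add: abs_mult mult_ac)
    qed
    then show "AE p in leb2. norm (h p * (\<alpha> (fst p) * \<beta> (snd p))) \<le> norm ((A * B) * h p)" by simp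
  qed (use h in auto)
qed

lemma test_integrable:
  assumes h: "integrable leb2 h" and \<alpha>: "\<alpha> \<in> Cc a b" and \<beta>: "\<beta> \<in> Cc c d"
  shows "integrable leb2 (\<lambda>p. h p * (\<alpha> (fst p) * \<beta> (snd p)))"
  by (rule bounded_factors_integrable[OF h Cc_measurable[OF \<alpha>] Cc_measurable[OF \<beta>] Cc_bounded[OF \<alpha>] Cc_bounded[OF \<beta>]])

text \<open>
  Put \<open>h = f - prim1 g\<close> on the rectangle.  Exchanging the primitive with the test function shows that \<open>h\<close> is
  orthogonal to all \<open>\<phi>(x) \<beta>(y)\<close> where \<open>\<phi>\<close> is the derivative of a test function, that is, has integral zero.
  Subtracting from an arbitrary \<open>\<alpha>\<close> a multiple of a fixed normalized \<open>\<theta>\<close> reduces to this case, and shows that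
  \<open>h\<close> equals its \<open>\<theta>\<close>-average over \<open>x\<close>, which depends on \<open>y\<close> alone.
\<close>

lemma weak_derivative_primitive:
  fixes f g :: field
  assumes ab: "a < b" and f: "integrable leb2 f" and g: "integrable leb2 g"
    and f0: "\<And>p. p \<notin> {a<..<b} \<times> {c<..<d} \<Longrightarrow> f p = 0"
    and weak: "\<And>\<alpha> \<beta>. \<alpha> \<in> Cc a b \<Longrightarrow> \<beta> \<in> Cc c d \<Longrightarrow>
      (LINT p|leb2. f p * (deriv \<alpha> (fst p) * \<beta> (snd p))) = - (LINT p|leb2. g p * (\<alpha> (fst p) * \<beta> (snd p)))"
  shows "\<exists>C. integrable lborel C \<and> (AE p in leb2. p \<in> {a<..<b} \<times> {c<..<d} \<longrightarrow> f p = C (snd p) + prim1 g p)"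
proof -
  let ?Q = "{a<..<b} \<times> {c<..<d}"
  have [measurable]: "f \<in> borel_measurable borel" "g \<in> borel_measurable borel"
    using f g by (auto dest: borel_measurable_integrable)
  have [measurable]: "prim1 g \<in> borel_measurable borel" by (rule prim1_measurable) measurable
  have Qs [measurable]: "?Q \<in> sets borel" by (intro borel_open open_Times) auto
  define G where "G p = indicator ?Q p * prim1 g p" for p
  have Gm [measurable]: "G \<in> borel_measurable borel" unfolding G_def by measurable
  have sl: "AE y in lborel. integrable lborel (\<lambda>s. g (s, y))" by (rule slice_integrable(1)[OF g])
  have G: "integrable leb2 G"
  proof (rule Bochner_Integration.integrable_bound)
    have "integrable leb2 (\<lambda>p. \<bar>g p\<bar>)" using g by simp
    from slice_integrable(2)[OF this] have N: "integrable lborel (\<lambda>y. LINT s|lborel. \<bar>g (s, y)\<bar>)" .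
    have I: "integrable lborel (indicat_real {a..b})" by (rule integrable_real_indicator) (auto simp: emeasure_lborel_Icc_eq)
    show "integrable leb2 (\<lambda>p. indicat_real {a..b} (fst p) * (LINT s|lborel. \<bar>g (s, snd p)\<bar>))"
      by (rule product_integrable(1)[OF I N])
    have "AE p in leb2. integrable lborel (\<lambda>s. g (s, snd p))"
    proof -
      have s: "{x \<in> space (lborel \<Otimes>\<^sub>M lborel). integrable lborel (\<lambda>s. g (s, fst x))} \<in> sets (lborel \<Otimes>\<^sub>M (lborel :: real measure))"
      proof -
        have "Measurable.pred lborel (\<lambda>y. integrable lborel (\<lambda>s. g (s, y)))"
          by (rule lborel.borel_measurable_lebesgue_integrable[of "\<lambda>y s. g (s, y)"])
             (use flip_measurable[of g] in \<open>simp add: lborel_prod flip_case_prod\<close>)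
        from measurable_compose[OF measurable_fst this] show ?thesis
          unfolding pred_def .
      qed
      have "AE x in lborel \<Otimes>\<^sub>M (lborel :: real measure). integrable lborel (\<lambda>s. g (s, fst x))"
      proof (rule lborel_pair.AE_pair_measure[OF s])
        show "AE x in lborel. AE y in lborel. integrable lborel (\<lambda>s. g (s, fst (x, y)))"
          using sl by eventually_elim simp
      qed
      then have "AE p in leb2. integrable lborel (\<lambda>s. g (s, fst p))" unfolding lborel_prod .
      from flip_AE[OF this] show ?thesis by simp
    qed
    then show "AE p in leb2. norm (G p) \<le> norm (indicat_real {a..b} (fst p) * (LINT s|lborel. \<bar>g (s, snd p)\<bar>))"
    proof eventually_elim
      case (elim p)
      have "(LINT s|lborel. \<bar>g (s, snd p)\<bar>) \<ge> 0" by simp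
      then show ?case using prim1_bound[OF elim] by (auto simp: G_def indicator_def)
    qed
  qed measurable
  note test_int = test_integrable
  define h where "h p = f p - G p" for p
  have h: "integrable leb2 h" unfolding h_def using f G by simp
  have h0: "h p = 0" if "p \<notin> ?Q" for p using f0[OF that] that by (simp add: h_def G_def)
  have key: "(LINT p|leb2. h p * (\<phi> (fst p) * \<beta> (snd p))) = 0"
    if \<phi>: "\<phi> \<in> Cc a b" and \<phi>0: "(LINT x|lborel. \<phi> x) = 0" and \<beta>: "\<beta> \<in> Cc c d" for \<phi> \<beta>
  proof -
    obtain A where A: "A \<in> Cc a b" "deriv A = \<phi>" "\<And>s. A s = - (LINT x|lborel. (if s \<le> x then \<phi> x else 0))"
      using Cc_primitive[OF \<phi> ab \<phi>0] by blast
    have "(LINT p|leb2. f p * (\<phi> (fst p) * \<beta> (snd p))) = - (LINT p|leb2. g p * (A (fst p) * \<beta> (snd p)))"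
      using weak[OF A(1) \<beta>] A(2) by simp
    also have "(LINT p|leb2. g p * (A (fst p) * \<beta> (snd p))) = (LINT y|lborel. LINT s|lborel. g (s, y) * (A s * \<beta> y))"
      using slice_integrable(3)[OF test_int[OF g A(1) \<beta>]] by simp
    also have "\<dots> = (LINT y|lborel. LINT x|lborel. - (G (x, y) * (\<phi> x * \<beta> y)))"
    proof (rule integral_cong_AE)
      show "(\<lambda>y. LINT s|lborel. g (s, y) * (A s * \<beta> y)) \<in> borel_measurable lborel"
        using slice_integrable(2)[OF test_int[OF g A(1) \<beta>]] by (auto dest: borel_measurable_integrable)
      show "(\<lambda>y. LINT x|lborel. - (G (x, y) * (\<phi> x * \<beta> y))) \<in> borel_measurable lborel"
        using slice_integrable(2)[OF test_int[OF G \<phi> \<beta>]] by (auto dest: borel_measurable_integrable)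
      show "AE y in lborel. (LINT s|lborel. g (s, y) * (A s * \<beta> y)) = (LINT x|lborel. - (G (x, y) * (\<phi> x * \<beta> y)))"
        using sl
      proof eventually_elim
        case (elim y)
        have "(LINT s|lborel. g (s, y) * (A s * \<beta> y)) = (LINT s|lborel. - \<beta> y * (g (s, y) * (LINT x|lborel. (if s \<le> x then \<phi> x else 0))))"
          by (rule Bochner_Integration.integral_cong) (simp_all add: A(3))
        also have "\<dots> = - \<beta> y * (LINT s|lborel. g (s, y) * (LINT x|lborel. (if s \<le> x then \<phi> x else 0)))" by simp
        also have "(LINT s|lborel. g (s, y) * (LINT x|lborel. (if s \<le> x then \<phi> x else 0)))
           = (LINT x|lborel. (LINT s|lborel. (if s \<le> x then g (s, y) else 0)) * \<phi> x)"
          by (rule primitive_exchange[OF elim Cc_integrable[OF \<phi>]])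
        also have "- \<beta> y * \<dots> = (LINT x|lborel. - \<beta> y * ((LINT s|lborel. (if s \<le> x then g (s, y) else 0)) * \<phi> x))" by simp
        also have "\<dots> = (LINT x|lborel. - (G (x, y) * (\<phi> x * \<beta> y)))"
        proof (rule Bochner_Integration.integral_cong)
          fix x
          show "- \<beta> y * ((LINT s|lborel. (if s \<le> x then g (s, y) else 0)) * \<phi> x) = - (G (x, y) * (\<phi> x * \<beta> y))"
            using Cc_support[OF \<phi>, of x] Cc_support[OF \<beta>, of y]
            by (cases "\<phi> x = 0"; cases "\<beta> y = 0") (auto simp: G_def prim1_pair)
        qed simp
        finally show ?case .
      qed
    qed
    also have "\<dots> = - (LINT y|lborel. LINT x|lborel. G (x, y) * (\<phi> x * \<beta> y))" by simp
    also have "(LINT y|lborel. LINT x|lborel. G (x, y) * (\<phi> x * \<beta> y)) = (LINT p|leb2. G p * (\<phi> (fst p) * \<beta> (snd p)))"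
      using slice_integrable(3)[OF test_int[OF G \<phi> \<beta>]] by simp
    finally have "(LINT p|leb2. f p * (\<phi> (fst p) * \<beta> (snd p))) = (LINT p|leb2. G p * (\<phi> (fst p) * \<beta> (snd p)))" by simp
    then show ?thesis
      unfolding h_def left_diff_distrib
      using Bochner_Integration.integral_diff[OF test_int[OF f \<phi> \<beta>] test_int[OF G \<phi> \<beta>]] by simp
  qed
  obtain \<theta> where \<theta>: "\<theta> \<in> Cc a b" "(LINT x|lborel. \<theta> x) = 1" using Cc_normalized[OF ab] by blast
  obtain B where B: "\<And>x. \<bar>\<theta> x\<bar> \<le> B" using Cc_bounded[OF \<theta>(1)] by blast
  have [measurable]: "\<theta> \<in> borel_measurable borel" by (rule Cc_measurable[OF \<theta>(1)])
  have h\<theta>: "integrable leb2 (\<lambda>p. h p * \<theta> (fst p))"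
  proof (rule Bochner_Integration.integrable_bound[where f="\<lambda>p. B * h p"])
    have "norm (h p * \<theta> (fst p)) \<le> norm (B * h p)" for p
    proof -
      have "\<bar>h p\<bar> * \<bar>\<theta> (fst p)\<bar> \<le> \<bar>h p\<bar> * \<bar>B\<bar>" using B[of "fst p"] by (intro mult_left_mono) auto
      then show ?thesis by (simp add: abs_mult mult.commute)
    qed
    then show "AE p in leb2. norm (h p * \<theta> (fst p)) \<le> norm (B * h p)" by simp
    show "(\<lambda>p. h p * \<theta> (fst p)) \<in> borel_measurable leb2" unfolding h_def by measurable
  qed (use h in auto)
  define C where "C y = (LINT x|lborel. h (x, y) * \<theta> x)" for y
  have C: "integrable lborel C" unfolding C_def using slice_integrable(2)[OF h\<theta>] by simp
  have [measurable]: "C \<in> borel_measurable borel" using C by (auto dest: borel_measurable_integrable)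
  define H where "H p = h p - indicator ?Q p * C (snd p)" for p
  have IC: "integrable leb2 (\<lambda>p. indicator ?Q p * C (snd p))"
  proof (rule Bochner_Integration.integrable_bound)
    have I: "integrable lborel (indicat_real {a..b})" by (rule integrable_real_indicator) (auto simp: emeasure_lborel_Icc_eq)
    show "integrable leb2 (\<lambda>p. indicat_real {a..b} (fst p) * C (snd p))" by (rule product_integrable(1)[OF I C])
    show "AE p in leb2. norm (indicator ?Q p * C (snd p)) \<le> norm (indicat_real {a..b} (fst p) * C (snd p))"
      by (rule AE_I2) (auto simp: indicator_def)
  qed measurable
  have H: "integrable leb2 H" unfolding H_def using h IC by simp
  have "AE p in leb2. H p = 0"
  proof (rule tested_zero_imp_AE_zero[OF H])
    show "H p = 0" if "p \<notin> ?Q" for p using h0[OF that] that by (simp add: H_def)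
    fix \<alpha> \<beta> assume \<alpha>: "\<alpha> \<in> Cc a b" and \<beta>: "\<beta> \<in> Cc c d"
    define c0 where "c0 = (LINT x|lborel. \<alpha> x)"
    define \<phi> where "\<phi> x = 1 * \<alpha> x + (- c0) * \<theta> x" for x
    have \<phi>: "\<phi> \<in> Cc a b" unfolding \<phi>_def by (rule Cc_lin[OF \<alpha> \<theta>(1)])
    have \<phi>0: "(LINT x|lborel. \<phi> x) = 0"
      unfolding \<phi>_def using Cc_integrable[OF \<alpha>] Cc_integrable[OF \<theta>(1)] \<theta>(2) by (simp add: c0_def)
    have "(LINT p|leb2. h p * (\<alpha> (fst p) * \<beta> (snd p))) = (LINT p|leb2. h p * (\<phi> (fst p) * \<beta> (snd p)) + c0 * (h p * (\<theta> (fst p) * \<beta> (snd p))))"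
      by (rule Bochner_Integration.integral_cong) (auto simp: \<phi>_def algebra_simps)
    also have "\<dots> = (LINT p|leb2. h p * (\<phi> (fst p) * \<beta> (snd p))) + c0 * (LINT p|leb2. h p * (\<theta> (fst p) * \<beta> (snd p)))"
      using test_int[OF h \<phi> \<beta>] test_int[OF h \<theta>(1) \<beta>] by simp
    also have "(LINT p|leb2. h p * (\<phi> (fst p) * \<beta> (snd p))) = 0" by (rule key[OF \<phi> \<phi>0 \<beta>])
    also have "(LINT p|leb2. h p * (\<theta> (fst p) * \<beta> (snd p))) = (LINT y|lborel. C y * \<beta> y)"
    proof -
      have "(LINT x|lborel. h (x, y) * (\<theta> x * \<beta> y)) = C y * \<beta> y" for y
      proof -
        have "(LINT x|lborel. h (x, y) * (\<theta> x * \<beta> y)) = (LINT x|lborel. (h (x, y) * \<theta> x) * \<beta> y)"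
          by (simp add: mult.assoc)
        then show ?thesis by (simp add: C_def)
      qed
      then show ?thesis using slice_integrable(3)[OF test_int[OF h \<theta>(1) \<beta>]] by simp
    qed
    finally have 1: "(LINT p|leb2. h p * (\<alpha> (fst p) * \<beta> (snd p))) = c0 * (LINT y|lborel. C y * \<beta> y)" by simp
    have "(LINT p|leb2. (indicator ?Q p * C (snd p)) * (\<alpha> (fst p) * \<beta> (snd p))) = (LINT p|leb2. \<alpha> (fst p) * (C (snd p) * \<beta> (snd p)))"
    proof (rule Bochner_Integration.integral_cong)
      fix p
      show "(indicator ?Q p * C (snd p)) * (\<alpha> (fst p) * \<beta> (snd p)) = \<alpha> (fst p) * (C (snd p) * \<beta> (snd p))"
        using Cc_support[OF \<alpha>, of "fst p"] Cc_support[OF \<beta>, of "snd p"]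
        by (cases "\<alpha> (fst p) = 0"; cases "\<beta> (snd p) = 0") (auto simp: indicator_def mem_Times_iff)
    qed simp
    also have "\<dots> = (LINT x|lborel. \<alpha> x) * (LINT y|lborel. C y * \<beta> y)"
    proof (rule product_integrable(2)[OF Cc_integrable[OF \<alpha>]])
      obtain B' where B': "\<And>x. \<bar>\<beta> x\<bar> \<le> B'" using Cc_bounded[OF \<beta>] by blast
      show "integrable lborel (\<lambda>y. C y * \<beta> y)"
      proof (rule Bochner_Integration.integrable_bound[where f="\<lambda>y. B' * C y"])
        have [measurable]: "\<beta> \<in> borel_measurable borel" by (rule Cc_measurable[OF \<beta>])
        show "(\<lambda>y. C y * \<beta> y) \<in> borel_measurable lborel" by measurable
        have "norm (C y * \<beta> y) \<le> norm (B' * C y)" for y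
        proof -
          have "\<bar>C y\<bar> * \<bar>\<beta> y\<bar> \<le> \<bar>C y\<bar> * \<bar>B'\<bar>" using B'[of y] by (intro mult_left_mono) auto
          then show ?thesis by (simp add: abs_mult mult.commute)
        qed
        then show "AE y in lborel. norm (C y * \<beta> y) \<le> norm (B' * C y)" by simp
      qed (use C in auto)
    qed
    finally have 2: "(LINT p|leb2. (indicator ?Q p * C (snd p)) * (\<alpha> (fst p) * \<beta> (snd p))) = c0 * (LINT y|lborel. C y * \<beta> y)"
      by (simp add: c0_def)
    show "(LINT p|leb2. H p * (\<alpha> (fst p) * \<beta> (snd p))) = 0"
      unfolding H_def left_diff_distrib
      using Bochner_Integration.integral_diff[OF test_int[OF h \<alpha> \<beta>] test_int[OF IC \<alpha> \<beta>]] 1 2 by simp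
  qed
  then have "AE p in leb2. p \<in> ?Q \<longrightarrow> f p = C (snd p) + prim1 g p"
    by eventually_elim (auto simp: H_def h_def G_def)
  then show ?thesis using C by blast
qed

text \<open>
  On almost every horizontal line \<open>f\<close> and \<open>B\<close> are primitives of \<open>g\<close> and \<open>B'\<close>; since \<open>B'\<close> has mean zero there,
  the constant in \<open>f\<close> does not contribute and \<open>primitive_exchange\<close> gives the formula without boundary terms.
\<close>

lemma integration_by_parts_slices:
  fixes f g B B' :: field
  assumes g: "integrable leb2 g" and B': "integrable leb2 B'"
    and fB': "integrable leb2 (\<lambda>p. f p * B' p)" and gB: "integrable leb2 (\<lambda>p. g p * B p)"
    and f: "AE p in leb2. p \<in> Q \<longrightarrow> f p = C (snd p) + prim1 g p"
    and B: "AE p in leb2. p \<in> Q \<longrightarrow> B p = prim1 B' p"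
    and g0: "\<And>p. p \<notin> Q \<Longrightarrow> g p = 0" and B'0: "\<And>p. p \<notin> Q \<Longrightarrow> B' p = 0"
    and mean: "AE y in lborel. (LINT x|lborel. B' (x, y)) = 0"
    and fm: "f \<in> borel_measurable borel" and Bm: "B \<in> borel_measurable borel"
  shows "(LINT p|leb2. f p * B' p) = - (LINT p|leb2. g p * B p)"
proof -
  have [measurable]: "g \<in> borel_measurable borel" "B' \<in> borel_measurable borel"
    using g B' by (auto dest: borel_measurable_integrable)
  have Pm [measurable]: "prim1 g \<in> borel_measurable borel" "prim1 B' \<in> borel_measurable borel" by (rule prim1_measurable, measurable)+
  note [measurable] = fm Bm
  have "(LINT p|leb2. f p * B' p) = (LINT y|lborel. LINT x|lborel. f (x, y) * B' (x, y))"
    using slice_integrable(3)[OF fB'] by simp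
  also have "\<dots> = (LINT y|lborel. LINT x|lborel. - (g (x, y) * B (x, y)))"
  proof (rule integral_cong_AE)
    show "(\<lambda>y. LINT x|lborel. f (x, y) * B' (x, y)) \<in> borel_measurable lborel"
      using slice_integrable(2)[OF fB'] by (auto dest: borel_measurable_integrable)
    show "(\<lambda>y. LINT x|lborel. - (g (x, y) * B (x, y))) \<in> borel_measurable lborel"
      using slice_integrable(2)[OF gB] by (auto dest: borel_measurable_integrable)
    show "AE y in lborel. (LINT x|lborel. f (x, y) * B' (x, y)) = (LINT x|lborel. - (g (x, y) * B (x, y)))"
      using slice_integrable(1)[OF g] slice_integrable(1)[OF B'] slice_integrable(1)[OF fB'] slice_AE[OF f] slice_AE[OF B] mean
    proof eventually_elim
      case (elim y)
      let ?G = "\<lambda>x. LINT s|lborel. (if s \<le> x then g (s, y) else 0)"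
      have Gm: "?G \<in> borel_measurable borel"
        using slice_measurable[OF Pm(1), of y] by (simp add: prim1_def[abs_def])
      have GB: "(LINT s|lborel. g (s, y) * (LINT x|lborel. (if s \<le> x then B' (x, y) else 0))) = (LINT x|lborel. ?G x * B' (x, y))"
        by (rule primitive_exchange[OF elim(1,2)])
      have ae: "AE x in lborel. f (x, y) * B' (x, y) = C y * B' (x, y) + ?G x * B' (x, y)"
        using elim(4)
      proof eventually_elim
        case (elim x)
        then show ?case using B'0[of "(x, y)"] by (cases "(x, y) \<in> Q") (auto simp: prim1_pair algebra_simps)
      qed
      have [measurable]: "(\<lambda>x. B' (x, y)) \<in> borel_measurable borel" "(\<lambda>x. f (x, y)) \<in> borel_measurable borel"
        by (intro slice_measurable; measurable)+
      note [measurable] = Gm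
      have iC: "integrable lborel (\<lambda>x. C y * B' (x, y) + ?G x * B' (x, y))"
      proof (rule integrable_cong_AE_imp[OF elim(3)])
        show "(\<lambda>x. C y * B' (x, y) + ?G x * B' (x, y)) \<in> borel_measurable lborel" by measurable
        show "AE x in lborel. f (x, y) * B' (x, y) = C y * B' (x, y) + ?G x * B' (x, y)" by (rule ae)
      qed
      then have iG: "integrable lborel (\<lambda>x. ?G x * B' (x, y))"
        using Bochner_Integration.integrable_diff[OF iC integrable_mult_right[OF elim(2), of "C y"]] by simp
      have "(LINT x|lborel. f (x, y) * B' (x, y)) = (LINT x|lborel. C y * B' (x, y) + ?G x * B' (x, y))"
      proof (rule integral_cong_AE[OF _ _ ae])
        show "(\<lambda>x. f (x, y) * B' (x, y)) \<in> borel_measurable lborel" by measurable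
        show "(\<lambda>x. C y * B' (x, y) + ?G x * B' (x, y)) \<in> borel_measurable lborel" by measurable
      qed
      also have "\<dots> = C y * (LINT x|lborel. B' (x, y)) + (LINT x|lborel. ?G x * B' (x, y))"
        using elim(2) iG by simp
      also have "\<dots> = (LINT s|lborel. g (s, y) * (LINT x|lborel. (if s \<le> x then B' (x, y) else 0)))"
        using elim(6) GB by simp
      also have "\<dots> = (LINT s|lborel. g (s, y) * - (prim1 B' (s, y)))"
        by (simp add: primitive_complement[OF elim(2)] elim(6) prim1_pair)
      also have "\<dots> = (LINT s|lborel. - (g (s, y) * B (s, y)))"
      proof (rule integral_cong_AE)
        show "AE s in lborel. g (s, y) * - prim1 B' (s, y) = - (g (s, y) * B (s, y))"
          using elim(5)
        proof eventually_elim
          case (elim x)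
          then show ?case using g0[of "(x, y)"] by (cases "(x, y) \<in> Q") auto
        qed
        show "(\<lambda>s. g (s, y) * - prim1 B' (s, y)) \<in> borel_measurable lborel"
          using slice_measurable[of "\<lambda>p. g p * - prim1 B' p" y] by simp
        show "(\<lambda>s. - (g (s, y) * B (s, y))) \<in> borel_measurable lborel"
          using slice_measurable[of "\<lambda>p. - (g p * B p)" y] by simp
      qed
      finally show ?case .
    qed
  qed
  also have "\<dots> = - (LINT y|lborel. LINT x|lborel. g (x, y) * B (x, y))" by simp
  also have "(LINT y|lborel. LINT x|lborel. g (x, y) * B (x, y)) = (LINT p|leb2. g p * B p)"
    using slice_integrable(3)[OF gB] by simp
  finally show ?thesis .
qed

lemma primitive_continuous:
  fixes u :: "real \<Rightarrow> real"
  assumes u: "integrable lborel u"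
  shows "continuous_on UNIV (\<lambda>x. LINT s|lborel. (if s \<le> x then u s else 0))"
  unfolding continuous_on_sequentially
proof (intro allI ballI impI)
  fix X :: "nat \<Rightarrow> real" and x assume X: "(\<forall>n. X n \<in> UNIV) \<and> X \<longlonglongrightarrow> x"
  have [measurable]: "u \<in> borel_measurable borel" using u by (auto dest: borel_measurable_integrable)
  have "(\<lambda>n. LINT s|lborel. (if s \<le> X n then u s else 0)) \<longlonglongrightarrow> (LINT s|lborel. (if s \<le> x then u s else 0))"
  proof (rule integral_dominated_convergence[where w="\<lambda>s. \<bar>u s\<bar>"])
    show "AE s in lborel. (\<lambda>n. if s \<le> X n then u s else 0) \<longlonglongrightarrow> (if s \<le> x then u s else 0)"
      using AE_lborel_singleton[of x]
    proof eventually_elim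
      case (elim s)
      then consider "s < x" | "s > x" by linarith
      then show ?case
      proof cases
        case 1
        then have "\<forall>\<^sub>F n in sequentially. s < X n" using X by (intro order_tendstoD) auto
        then have "\<forall>\<^sub>F n in sequentially. (if s \<le> X n then u s else 0) = (if s \<le> x then u s else 0)"
          by eventually_elim (use 1 in auto)
        then show ?thesis by (rule tendsto_eventually)
      next
        case 2
        then have "\<forall>\<^sub>F n in sequentially. X n < s" using X by (intro order_tendstoD) auto
        then have "\<forall>\<^sub>F n in sequentially. (if s \<le> X n then u s else 0) = (if s \<le> x then u s else 0)"
          by eventually_elim (use 2 in auto)
        then show ?thesis by (rule tendsto_eventually)
      qed
    qed
  qed (use u in auto)
  then show "((\<lambda>x. LINT s|lborel. (if s \<le> x then u s else 0)) \<circ> X) \<longlonglongrightarrow> (LINT s|lborel. (if s \<le> x then u s else 0))"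
    by (simp add: o_def)
qed

text \<open>
  Two continuous functions that agree almost everywhere agree everywhere, in particular at the end points,
  where the primitive takes the values \<open>0\<close> and \<open>\<integral> u\<close>.
\<close>

lemma primitive_of_vanishing:
  fixes u w :: "real \<Rightarrow> real"
  assumes ab: "a < b" and u: "integrable lborel u" and u0: "\<And>s. s \<notin> {a<..<b} \<Longrightarrow> u s = 0"
    and w: "continuous_on {a..b} w" "w a = 0" "w b = 0"
    and ae: "AE x in lborel. x \<in> {a<..<b} \<longrightarrow> w x = c + (LINT s|lborel. (if s \<le> x then u s else 0))"
  shows "c = 0" "(LINT s|lborel. u s) = 0"
    "\<And>x. x \<in> {a..b} \<Longrightarrow> w x = (LINT s|lborel. (if s \<le> x then u s else 0))"
proof -
  let ?G = "\<lambda>x. LINT s|lborel. (if s \<le> x then u s else 0)"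
  have hc: "continuous_on {a..b} (\<lambda>x. w x - (c + ?G x))"
    by (intro continuous_intros w continuous_on_subset[OF primitive_continuous[OF u]]) auto
  have eq: "w x - (c + ?G x) = 0" if x: "x \<in> {a..b}" for x
  proof (rule ccontr)
    assume n: "w x - (c + ?G x) \<noteq> 0"
    let ?h = "\<lambda>x. w x - (c + ?G x)"
    have "(?h \<longlongrightarrow> ?h x) (at x within {a..b})"
      using hc x by (auto simp: continuous_on_def)
    then have "\<forall>\<^sub>F y in at x within {a..b}. ?h y \<noteq> 0" using n by (intro tendsto_imp_eventually_ne)
    then obtain d where d: "d > 0" "\<And>y. y \<in> {a..b} \<Longrightarrow> y \<noteq> x \<Longrightarrow> dist y x < d \<Longrightarrow> ?h y \<noteq> 0"
      unfolding eventually_at by blast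
    define l where "l = max a (x - d)"
    define r where "r = min b (x + d)"
    have lr: "l < r" using x d ab by (auto simp: l_def r_def)
    have "AE y in lborel. y \<notin> {l<..<r}"
      using ae AE_lborel_singleton[of x]
    proof eventually_elim
      case (elim y)
      show ?case
      proof
        assume y: "y \<in> {l<..<r}"
        then have "y \<in> {a<..<b}" "dist y x < d" by (auto simp: l_def r_def dist_real_def)
        then show False using d(2)[of y] elim by auto
      qed
    qed
    then have "{l<..<r} \<in> null_sets lborel"
      by (subst (asm) AE_iff_null_sets[symmetric]) auto
    then have "emeasure lborel {l<..<r} = 0" by auto
    then show False using lr by simp
  qed
  have "(\<lambda>s. if s \<le> a then u s else 0) = (\<lambda>s. 0)" using u0 by (auto simp: fun_eq_iff)
  then have Ga: "?G a = 0" by simp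
  then show c: "c = 0" using eq[of a] w(2) ab by simp
  then show "\<And>x. x \<in> {a..b} \<Longrightarrow> w x = ?G x" using eq by simp
  have "?G b = (LINT s|lborel. u s)" by (rule Bochner_Integration.integral_cong) (use u0 in auto)
  then show "(LINT s|lborel. u s) = 0" using eq[of b] w(3) c ab by simp
qed

section \<open>Weak derivatives on the rectangle\<close>

lemma AE_snd: assumes "AE y in lborel. P (y::real)" shows "AE p in leb2. P (snd p)"
proof -
  obtain N where N: "{y \<in> space lborel. \<not> P y} \<subseteq> N" "N \<in> sets lborel" "emeasure lborel N = 0"
    using AE_E[OF assms] by metis
  have "AE y in lborel. y \<notin> N" using N by (intro AE_not_in) auto
  moreover have "{p \<in> space (lborel \<Otimes>\<^sub>M (lborel :: real measure)). fst p \<notin> N} \<in> sets (lborel \<Otimes>\<^sub>M (lborel :: real measure))"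
    using N(2) by measurable
  ultimately have "AE p in lborel \<Otimes>\<^sub>M (lborel :: real measure). fst p \<notin> N"
    by (intro lborel_pair.AE_pair_measure) auto
  then have "AE p in leb2. fst p \<notin> N" unfolding lborel_prod .
  from flip_AE[OF this] show ?thesis using N(1) by (auto elim!: eventually_mono)
qed

text \<open>
  Cauchy-Schwarz, from the nonnegativity of \<open>\<integral> (|f| - c)\<^sup>2\<close> over \<open>D\<close> for all \<open>c\<close>.
\<close>

lemma L1_le_L2:
  fixes f :: "'a::euclidean_space \<Rightarrow> real"
  assumes f: "integrable lborel f" and f2: "integrable lborel (\<lambda>x. (f x)\<^sup>2)"
    and D: "D \<in> sets borel" "emeasure lborel D < \<infinity>" and off: "\<And>x. x \<notin> D \<Longrightarrow> f x = 0"
  shows "(LINT x|lborel. \<bar>f x\<bar>)\<^sup>2 \<le> measure lborel D * (LINT x|lborel. (f x)\<^sup>2)"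
proof -
  let ?I = "LINT x|lborel. \<bar>f x\<bar>" and ?m = "measure lborel D" and ?R = "LINT x|lborel. (f x)\<^sup>2"
  have i: "integrable lborel (indicat_real D)" using D by (intro integrable_real_indicator) auto
  have I: "(LINT x|lborel. indicat_real D x) = ?m" using D by simp
  have q: "0 \<le> ?R - 2 * c * ?I + c\<^sup>2 * ?m" for c
  proof -
    have "0 \<le> (LINT x|lborel. (\<bar>f x\<bar> - c * indicator D x)\<^sup>2)" by simp
    also have "\<dots> = (LINT x|lborel. (f x)\<^sup>2 - 2 * c * \<bar>f x\<bar> + c\<^sup>2 * indicator D x)"
      by (rule Bochner_Integration.integral_cong) (use off in \<open>auto simp: indicator_def power2_diff\<close>)
    also have "\<dots> = ?R - 2 * c * ?I + c\<^sup>2 * ?m"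
      using f f2 i I by simp
    finally show ?thesis .
  qed
  show ?thesis
  proof (cases "?m = 0")
    case True
    have "?I = 0"
    proof (rule ccontr)
      assume n: "?I \<noteq> 0"
      have "0 \<le> ?R - 2 * ((?R + 1) / ?I) * ?I" using q[of "(?R + 1) / ?I"] True by simp
      then have "0 \<le> ?R - 2 * (?R + 1)" using n by simp
      moreover have "?R \<ge> 0" by simp
      ultimately show False by argo
    qed
    then show ?thesis by simp
  next
    case False
    then have m: "?m > 0" by (simp add: zero_less_measure_iff)
    have "0 \<le> ?R - 2 * (?I / ?m) * ?I + (?I / ?m)\<^sup>2 * ?m" by (rule q)
    then have "0 \<le> ?m * (?R - 2 * (?I / ?m) * ?I + (?I / ?m)\<^sup>2 * ?m)" using m by simp
    also have "\<dots> = ?m * ?R - ?I\<^sup>2" using m by (simp add: field_simps power2_eq_square)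
    finally show ?thesis by simp
  qed
qed

text \<open>
  A Borel representative that is exactly zero outside the rectangle.  With Lebesgue measurable
  representatives the slices of a function need not be measurable, so Fubini arguments are carried out for
  these.
\<close>

definition bor :: "real \<Rightarrow> field \<Rightarrow> field" where
  "bor l f = (SOME h. h \<in> borel_measurable borel \<and> (\<forall>p. p \<notin> Omega l \<longrightarrow> h p = 0) \<and>
     (AE p in leb2. p \<in> Omega l \<longrightarrow> h p = f p))"

lemma Omega_borel [measurable]: "Omega l \<in> sets borel" by (rule Omega_sets)

lemma bor:
  assumes f: "f \<in> L2 (Omega l)"
  shows bor_measurable: "bor l f \<in> borel_measurable borel"
    and bor_off: "p \<notin> Omega l \<Longrightarrow> bor l f p = 0"
    and bor_AE: "AE p in leb2. p \<in> Omega l \<longrightarrow> bor l f p = f p"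
proof -
  have "(\<lambda>p. if p \<in> Omega l then f p else 0) \<in> borel_measurable (completion leb2)"
    using f by (simp add: L2_iff_sq_int[OF Omega_sets(1)] sq_int_def)
  from completion_ex_borel_measurable_real[OF this]
  obtain h where h: "h \<in> borel_measurable borel" "AE p in leb2. (if p \<in> Omega l then f p else 0) = h p" by auto
  have "\<exists>h. h \<in> borel_measurable borel \<and> (\<forall>p. p \<notin> Omega l \<longrightarrow> h p = 0) \<and> (AE p in leb2. p \<in> Omega l \<longrightarrow> h p = f p)"
  proof (intro exI conjI allI impI)
    show "(\<lambda>p. indicator (Omega l) p * h p) \<in> borel_measurable borel" using h(1) by measurable
    show "AE p in leb2. p \<in> Omega l \<longrightarrow> indicator (Omega l) p * h p = f p"
      using h(2) by eventually_elim auto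
  qed auto
  from someI_ex[OF this, folded bor_def]
  have "bor l f \<in> borel_measurable borel \<and> (\<forall>p. p \<notin> Omega l \<longrightarrow> bor l f p = 0) \<and>
     (AE p in leb2. p \<in> Omega l \<longrightarrow> bor l f p = f p)" .
  then show "bor l f \<in> borel_measurable borel" "p \<notin> Omega l \<Longrightarrow> bor l f p = 0"
    "AE p in leb2. p \<in> Omega l \<longrightarrow> bor l f p = f p" by blast+
qed

lemma AE_lebesgue_iff: "(AE p in lebesgue. Q p) \<longleftrightarrow> (AE p in (lborel :: 'a::euclidean_space measure). Q p)"
  by (rule AE_completion_iff)

lemma AE_Omega_iff: "(AE p in lebesgue_on (Omega l). Q p) \<longleftrightarrow> (AE p in leb2. p \<in> Omega l \<longrightarrow> Q p)"
  by (simp add: AE_D[OF Omega_sets(1)] AE_lebesgue_iff)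

lemma integral_bor:
  assumes f: "f \<in> L2 (Omega l)" and k: "k \<in> borel_measurable borel"
    and kk: "AE p in leb2. p \<in> Omega l \<longrightarrow> k p = k' p" and k'm: "k' \<in> borel_measurable (lebesgue_on (Omega l))"
  shows "(LINT p|lebesgue_on (Omega l). f p * k' p) = (LINT p|leb2. bor l f p * k p)"
proof -
  have [measurable]: "bor l f \<in> borel_measurable borel" by (rule bor_measurable[OF f])
  note [measurable] = k
  have fm: "f \<in> borel_measurable (lebesgue_on (Omega l))" using f by (simp add: L2_def)
  have "(LINT p|lebesgue_on (Omega l). f p * k' p) = (LINT p|lebesgue. (if p \<in> Omega l then f p * k' p else 0))"
    by (rule integral_on_D[OF Omega_sets(1)])
  also have "\<dots> = (LINT p|lebesgue. bor l f p * k p)"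
  proof (rule integral_cong_AE)
    show "(\<lambda>p. if p \<in> Omega l then f p * k' p else 0) \<in> borel_measurable lebesgue"
      using fm k'm by (subst measurable_on_D[OF Omega_sets(1), symmetric]) (intro borel_measurable_times)
    show "(\<lambda>p. bor l f p * k p) \<in> borel_measurable lebesgue"
      by (intro measurable_completion) measurable
    show "AE p in lebesgue. (if p \<in> Omega l then f p * k' p else 0) = bor l f p * k p"
      unfolding AE_lebesgue_iff using bor_AE[OF f] kk
    proof eventually_elim
      case (elim p)
      then show ?case using bor_off[OF f, of p] by auto
    qed
  qed
  also have "\<dots> = (LINT p|leb2. bor l f p * k p)" by (rule integral_completion) measurable
  finally show ?thesis .
qed

lemma integral_bor_borel:
  assumes "f \<in> L2 (Omega l)" "k \<in> borel_measurable borel"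
  shows "(LINT p|lebesgue_on (Omega l). f p * k p) = (LINT p|leb2. bor l f p * k p)"
proof (rule integral_bor[OF assms])
  show "k \<in> borel_measurable (lebesgue_on (Omega l))"
    by (rule measurable_restrict_space1, rule measurable_completion) (use assms in simp)
qed simp

lemma inner0_bor:
  assumes "f \<in> L2 (Omega l)" "g \<in> L2 (Omega l)"
  shows "inner0 (Omega l) f g = (LINT p|leb2. bor l f p * bor l g p)"
  unfolding inner0_def
  by (rule integral_bor[OF assms(1) bor_measurable[OF assms(2)] bor_AE[OF assms(2)]])
     (use assms in \<open>simp add: L2_def\<close>)

lemma bor_product_integrable:
  assumes f: "f \<in> L2 (Omega l)" and g: "g \<in> L2 (Omega l)"
  shows "integrable leb2 (\<lambda>p. bor l f p * bor l g p)"
proof -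
  have [measurable]: "bor l f \<in> borel_measurable borel" "bor l g \<in> borel_measurable borel"
    by (rule bor_measurable[OF f], rule bor_measurable[OF g])
  have "integrable (lebesgue_on (Omega l)) (\<lambda>p. f p * g p)" by (rule inner0_integrable[OF Omega_sets(1) f g])
  then have "integrable lebesgue (\<lambda>p. if p \<in> Omega l then f p * g p else 0)"
    by (simp add: integrable_on_D[OF Omega_sets(1)])
  then have "integrable lebesgue (\<lambda>p. bor l f p * bor l g p)"
  proof (rule integrable_cong_AE_imp)
    show "(\<lambda>p. bor l f p * bor l g p) \<in> borel_measurable lebesgue"
      by (intro measurable_completion) measurable
    show "AE p in lebesgue. (if p \<in> Omega l then f p * g p else 0) = bor l f p * bor l g p"
      unfolding AE_lebesgue_iff using bor_AE[OF f] bor_AE[OF g]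
    proof eventually_elim
      case (elim p)
      then show ?case using bor_off[OF f, of p] by auto
    qed
  qed
  then show ?thesis by (subst (asm) integrable_completion) auto
qed

lemma bor_square_integrable: "f \<in> L2 (Omega l) \<Longrightarrow> integrable leb2 (\<lambda>p. (bor l f p)\<^sup>2)"
  using bor_product_integrable[of f l f] by (simp add: power2_eq_square)

lemma Omega_finite: "emeasure lborel (Omega l) < \<infinity>"
  using emeasure_bounded_finite[OF Omega_sets(5)] by simp

lemma square_integrable_imp_integrable:
  fixes k :: field
  assumes m: "k \<in> borel_measurable borel" and off: "\<And>p. p \<notin> Omega l \<Longrightarrow> k p = 0" and i: "integrable leb2 (\<lambda>p. (k p)\<^sup>2)"
  shows "integrable leb2 k"
proof (rule Bochner_Integration.integrable_bound)
  show "integrable leb2 (\<lambda>p. indicator (Omega l) p + (k p)\<^sup>2)"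
    using i Omega_finite by (intro Bochner_Integration.integrable_add integrable_real_indicator) auto
  have "\<bar>x\<bar> \<le> 1 + x\<^sup>2" for x :: real
  proof -
    have "0 \<le> (\<bar>x\<bar> - 1)\<^sup>2" by simp
    then have "2 * \<bar>x\<bar> \<le> 1 + x\<^sup>2" by (simp add: power2_diff)
    then show ?thesis by linarith
  qed
  then have "norm (k p) \<le> norm (indicator (Omega l) p + (k p)\<^sup>2)" for p
    using off[of p] by (cases "p \<in> Omega l") auto
  then show "AE p in leb2. norm (k p) \<le> norm (indicator (Omega l) p + (k p)\<^sup>2)" by simp
qed (use m in simp)

lemma bor_integrable: "f \<in> L2 (Omega l) \<Longrightarrow> integrable leb2 (bor l f)"
  by (rule square_integrable_imp_integrable[OF bor_measurable bor_off bor_square_integrable])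

lemma bor_L1_le: assumes f: "f \<in> L2 (Omega l)"
  shows "(LINT p|leb2. \<bar>bor l f p\<bar>) \<le> sqrt (measure lborel (Omega l)) * norm0 (Omega l) f"
proof -
  have "(LINT p|leb2. \<bar>bor l f p\<bar>)\<^sup>2 \<le> measure lborel (Omega l) * (LINT p|leb2. (bor l f p)\<^sup>2)"
    by (rule L1_le_L2[OF bor_integrable[OF f] bor_square_integrable[OF f] Omega_sets(3) Omega_finite bor_off[OF f]])
  then have "(LINT p|leb2. \<bar>bor l f p\<bar>) \<le> sqrt (measure lborel (Omega l) * (LINT p|leb2. (bor l f p)\<^sup>2))"
    by (rule real_le_rsqrt)
  then show ?thesis unfolding norm0_def inner0_bor[OF f f] by (simp add: real_sqrt_mult power2_eq_square)
qed

lemma bor_tensor: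
  assumes f: "f \<in> L2 (Omega l)" and \<alpha>: "\<alpha> \<in> Cc 0 pi" and \<beta>: "\<beta> \<in> Cc (-l) l"
  shows "(LINT p|lebesgue_on (Omega l). f p * tensor \<alpha> \<beta> p) = (LINT p|leb2. bor l f p * (\<alpha> (fst p) * \<beta> (snd p)))"
proof -
  have [measurable]: "\<alpha> \<in> borel_measurable borel" "\<beta> \<in> borel_measurable borel" using Cc_measurable \<alpha> \<beta> by auto
  show ?thesis unfolding tensor_def by (rule integral_bor_borel[OF f]) measurable
qed

lemma weak_deriv_bor:
  assumes f: "f \<in> L2 (Omega l)" and g: "g \<in> L2 (Omega l)" and w: "is_weak_deriv (Omega l) i j f g"
    and \<alpha>: "\<alpha> \<in> Cc 0 pi" and \<beta>: "\<beta> \<in> Cc (-l) l"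
  shows "(LINT p|leb2. bor l f p * ((deriv ^^ i) \<alpha> (fst p) * (deriv ^^ j) \<beta> (snd p)))
     = (- 1) ^ (i + j) * (LINT p|leb2. bor l g p * (\<alpha> (fst p) * \<beta> (snd p)))"
  using weak_deriv_tensor[OF w \<alpha> \<beta>]
  by (simp add: bor_tensor[OF f Cc_derivs[OF \<alpha>] Cc_derivs[OF \<beta>]] bor_tensor[OF g \<alpha> \<beta>])

lemma tested_equal_imp_AE_equal:
  assumes f: "integrable leb2 f" and g: "integrable leb2 g"
    and off: "\<And>p. p \<notin> Omega l \<Longrightarrow> f p = 0" "\<And>p. p \<notin> Omega l \<Longrightarrow> g p = 0"
    and test: "\<And>\<alpha> \<beta>. \<alpha> \<in> Cc 0 pi \<Longrightarrow> \<beta> \<in> Cc (-l) l \<Longrightarrow>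
      (LINT p|leb2. f p * (\<alpha> (fst p) * \<beta> (snd p))) = (LINT p|leb2. g p * (\<alpha> (fst p) * \<beta> (snd p)))"
  shows "AE p in leb2. f p = g p"
proof -
  have "AE p in leb2. f p - g p = 0"
  proof (rule tested_zero_imp_AE_zero[where a=0 and b=pi and c="-l" and d=l])
    show "integrable leb2 (\<lambda>p. f p - g p)" using f g by simp
    show "f p - g p = 0" if "p \<notin> {0<..<pi} \<times> {-l<..<l}" for p using off that by (simp add: Omega_def)
    fix \<alpha> \<beta> assume \<alpha>: "\<alpha> \<in> Cc 0 pi" and \<beta>: "\<beta> \<in> Cc (-l) l"
    have ti: "integrable leb2 (\<lambda>p. h p * (\<alpha> (fst p) * \<beta> (snd p)))" if h: "integrable leb2 h" for h
      by (rule test_integrable[OF h \<alpha> \<beta>])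
    show "(LINT p|leb2. (f p - g p) * (\<alpha> (fst p) * \<beta> (snd p))) = 0"
      unfolding left_diff_distrib using Bochner_Integration.integral_diff[OF ti[OF f] ti[OF g]] test[OF \<alpha> \<beta>] by simp
  qed
  then show ?thesis by eventually_elim simp
qed

text \<open>
  This makes the choice of a representative in \<open>wd\<close> harmless.
\<close>

lemma weak_deriv_unique:
  assumes f: "f \<in> L2 (Omega l)" and g: "g \<in> L2 (Omega l)" "g' \<in> L2 (Omega l)"
    and w: "is_weak_deriv (Omega l) i j f g" "is_weak_deriv (Omega l) i j f g'"
  shows "AE p in lebesgue_on (Omega l). g p = g' p"
proof -
  have "AE p in leb2. bor l g p = bor l g' p"
  proof (rule tested_equal_imp_AE_equal[OF bor_integrable[OF g(1)] bor_integrable[OF g(2)] bor_off[OF g(1)] bor_off[OF g(2)]])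
    fix \<alpha> \<beta> assume \<alpha>: "\<alpha> \<in> Cc 0 pi" and \<beta>: "\<beta> \<in> Cc (-l) l"
    have "(- 1) ^ (i + j) * (LINT p|leb2. bor l g p * (\<alpha> (fst p) * \<beta> (snd p))) = (- 1) ^ (i + j) * (LINT p|leb2. bor l g' p * (\<alpha> (fst p) * \<beta> (snd p)))"
      using weak_deriv_bor[OF f g(1) w(1) \<alpha> \<beta>] weak_deriv_bor[OF f g(2) w(2) \<alpha> \<beta>] by simp
    then show "(LINT p|leb2. bor l g p * (\<alpha> (fst p) * \<beta> (snd p))) = (LINT p|leb2. bor l g' p * (\<alpha> (fst p) * \<beta> (snd p)))"
      by simp
  qed
  then show ?thesis unfolding AE_Omega_iff using bor_AE[OF g(1)] bor_AE[OF g(2)]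
    by eventually_elim auto
qed

lemma wd_props:
  assumes "f \<in> H2 (Omega l)" "i + j \<le> 2"
  shows wd_L2: "wd (Omega l) i j f \<in> L2 (Omega l)" and wd_weak: "is_weak_deriv (Omega l) i j f (wd (Omega l) i j f)"
proof -
  have "\<exists>g. g \<in> L2 (Omega l) \<and> is_weak_deriv (Omega l) i j f g" using assms unfolding H2_def by auto
  from someI_ex[OF this, folded wd_def]
  show "wd (Omega l) i j f \<in> L2 (Omega l)" "is_weak_deriv (Omega l) i j f (wd (Omega l) i j f)" by auto
qed

lemma H2_L2: "f \<in> H2 D \<Longrightarrow> f \<in> L2 D" by (simp add: H2_def)

context
  fixes l :: real and U :: field
  assumes l: "l > 0" and U: "U \<in> H2 (Omega l)"
begin

abbreviation (input) "\<Omega> \<equiv> Omega l"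
abbreviation (input) "u0 \<equiv> bor l U"
abbreviation (input) "ux \<equiv> bor l (wd \<Omega> 1 0 U)"
abbreviation (input) "uy \<equiv> bor l (wd \<Omega> 0 1 U)"
abbreviation (input) "uxx \<equiv> bor l (wd \<Omega> 2 0 U)"
abbreviation (input) "uxy \<equiv> bor l (wd \<Omega> 1 1 U)"

text \<open>
  The last two lines say that \<open>U\<^sub>x\<^sub>x\<close> and \<open>U\<^sub>x\<^sub>y\<close> are the weak derivatives of the function \<open>U\<^sub>x\<close>, although \<open>wd\<close>
  defines them as second derivatives of \<open>U\<close>: use derivatives of test functions as test functions.
\<close>

lemma H2_test:
  assumes \<alpha>: "\<alpha> \<in> Cc 0 pi" and \<beta>: "\<beta> \<in> Cc (-l) l"
  shows "(LINT p|leb2. u0 p * (deriv \<alpha> (fst p) * \<beta> (snd p))) = - (LINT p|leb2. ux p * (\<alpha> (fst p) * \<beta> (snd p)))"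
    "(LINT p|leb2. u0 p * (\<alpha> (fst p) * deriv \<beta> (snd p))) = - (LINT p|leb2. uy p * (\<alpha> (fst p) * \<beta> (snd p)))"
    "(LINT p|leb2. ux p * (deriv \<alpha> (fst p) * \<beta> (snd p))) = - (LINT p|leb2. uxx p * (\<alpha> (fst p) * \<beta> (snd p)))"
    "(LINT p|leb2. ux p * (\<alpha> (fst p) * deriv \<beta> (snd p))) = - (LINT p|leb2. uxy p * (\<alpha> (fst p) * \<beta> (snd p)))"
proof -
  note U0 = H2_L2[OF U]
  note W = weak_deriv_bor[OF U0 wd_L2[OF U] wd_weak[OF U]]
  show "(LINT p|leb2. u0 p * (deriv \<alpha> (fst p) * \<beta> (snd p))) = - (LINT p|leb2. ux p * (\<alpha> (fst p) * \<beta> (snd p)))"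
    using W[of 1 0 \<alpha> \<beta>] \<alpha> \<beta> by simp
  show "(LINT p|leb2. u0 p * (\<alpha> (fst p) * deriv \<beta> (snd p))) = - (LINT p|leb2. uy p * (\<alpha> (fst p) * \<beta> (snd p)))"
    using W[of 0 1 \<alpha> \<beta>] \<alpha> \<beta> by simp
  show "(LINT p|leb2. ux p * (deriv \<alpha> (fst p) * \<beta> (snd p))) = - (LINT p|leb2. uxx p * (\<alpha> (fst p) * \<beta> (snd p)))"
    using W[of 2 0 \<alpha> \<beta>] W[of 1 0 "deriv \<alpha>" \<beta>] \<alpha> \<beta> Cc_deriv[OF \<alpha>] by (simp add: numeral_2_eq_2)
  show "(LINT p|leb2. ux p * (\<alpha> (fst p) * deriv \<beta> (snd p))) = - (LINT p|leb2. uxy p * (\<alpha> (fst p) * \<beta> (snd p)))"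
    using W[of 1 1 \<alpha> \<beta>] W[of 1 0 \<alpha> "deriv \<beta>"] \<alpha> \<beta> Cc_deriv[OF \<beta>] by simp
qed

lemma U_parts: "U \<in> L2 \<Omega>" "wd \<Omega> 1 0 U \<in> L2 \<Omega>" "wd \<Omega> 0 1 U \<in> L2 \<Omega>" "wd \<Omega> 2 0 U \<in> L2 \<Omega>"
  "wd \<Omega> 1 1 U \<in> L2 \<Omega>" "wd \<Omega> 0 2 U \<in> L2 \<Omega>"
  using H2_L2[OF U] wd_L2[OF U] by auto

lemma H2_u_primitive_x: "\<exists>C. integrable lborel C \<and> (AE p in leb2. p \<in> \<Omega> \<longrightarrow> u0 p = C (snd p) + prim1 ux p)"
  unfolding Omega_def
  by (rule weak_derivative_primitive[OF pi_gt_zero bor_integrable[OF U_parts(1), unfolded Omega_def] bor_integrable[OF U_parts(2), unfolded Omega_def]])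
     (use bor_off[OF U_parts(1)] H2_test(1) in \<open>auto simp: Omega_def\<close>)

lemma H2_ux_primitive_x: "\<exists>C. integrable lborel C \<and> (AE p in leb2. p \<in> \<Omega> \<longrightarrow> ux p = C (snd p) + prim1 uxx p)"
  unfolding Omega_def
  by (rule weak_derivative_primitive[OF pi_gt_zero bor_integrable[OF U_parts(2), unfolded Omega_def] bor_integrable[OF U_parts(4), unfolded Omega_def]])
     (use bor_off[OF U_parts(2)] H2_test(3) in \<open>auto simp: Omega_def\<close>)

lemma H2_ux_primitive_y: "\<exists>E. integrable lborel E \<and> (AE p in leb2. p \<in> \<Omega> \<longrightarrow> ux p = E (fst p) + prim1 (flip uxy) (snd p, fst p))"
proof -
  have "\<exists>E. integrable lborel E \<and> (AE p in leb2. p \<in> {-l<..<l} \<times> {0<..<pi} \<longrightarrow> flip ux p = E (snd p) + prim1 (flip uxy) p)"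
  proof (rule weak_derivative_primitive)
    show "- l < l" using l by simp
    show "integrable leb2 (flip ux)" "integrable leb2 (flip uxy)" by (rule flip_integrable[OF bor_integrable[OF U_parts(2)]], rule flip_integrable[OF bor_integrable[OF U_parts(5)]])
    show "flip ux p = 0" if "p \<notin> {-l<..<l} \<times> {0<..<pi}" for p
      using that bor_off[OF U_parts(2), of "(snd p, fst p)"] by (cases p) (auto simp: flip_def Omega_def)
    fix \<beta> \<alpha> assume \<beta>: "\<beta> \<in> Cc (-l) l" and \<alpha>: "\<alpha> \<in> Cc 0 pi"
    have [measurable]: "\<alpha> \<in> borel_measurable borel" "\<beta> \<in> borel_measurable borel" "deriv \<beta> \<in> borel_measurable borel"
      "ux \<in> borel_measurable borel" "uxy \<in> borel_measurable borel"
      using Cc_measurable \<alpha> \<beta> Cc_deriv[OF \<beta>] bor_measurable U_parts by auto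
    have "(LINT p|leb2. flip ux p * (deriv \<beta> (fst p) * \<alpha> (snd p))) = (LINT p|leb2. flip (\<lambda>p. ux p * (\<alpha> (fst p) * deriv \<beta> (snd p))) p)"
      by (simp add: flip_def mult.commute)
    also have "\<dots> = (LINT p|leb2. ux p * (\<alpha> (fst p) * deriv \<beta> (snd p)))" by (rule flip_integral) measurable
    also have "\<dots> = - (LINT p|leb2. uxy p * (\<alpha> (fst p) * \<beta> (snd p)))" by (rule H2_test(4)[OF \<alpha> \<beta>])
    also have "(LINT p|leb2. uxy p * (\<alpha> (fst p) * \<beta> (snd p))) = (LINT p|leb2. flip (\<lambda>p. uxy p * (\<alpha> (fst p) * \<beta> (snd p))) p)"
      by (rule flip_integral[symmetric]) measurable
    also have "\<dots> = (LINT p|leb2. flip uxy p * (\<beta> (fst p) * \<alpha> (snd p)))" by (simp add: flip_def mult.commute)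
    finally show "(LINT p|leb2. flip ux p * (deriv \<beta> (fst p) * \<alpha> (snd p))) = - (LINT p|leb2. flip uxy p * (\<beta> (fst p) * \<alpha> (snd p)))" .
  qed
  then obtain E where E: "integrable lborel E" "AE p in leb2. p \<in> {-l<..<l} \<times> {0<..<pi} \<longrightarrow> flip ux p = E (snd p) + prim1 (flip uxy) p" by blast
  have "AE p in leb2. p \<in> \<Omega> \<longrightarrow> ux p = E (fst p) + prim1 (flip uxy) (snd p, fst p)"
    using flip_AE[OF E(2)] by eventually_elim (auto simp: Omega_def)
  then show ?thesis using E(1) by blast
qed

end

section \<open>Functions vanishing on the vertical sides\<close>

lemma AE_fst: assumes "AE x in lborel. P (x::real)" shows "AE p in leb2. P (fst p)"
  using flip_AE[OF AE_snd[OF assms]] by simp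

text \<open>
  The exceptional set is relatively open, and a nonempty open set is not negligible.
\<close>

lemma AE_bound_closure:
  fixes w :: "'a::euclidean_space \<Rightarrow> real"
  assumes S: "open S" and w: "continuous_on (closure S) w"
    and ae: "AE p in lborel. p \<in> S \<longrightarrow> \<bar>w p\<bar> \<le> K" and p: "p \<in> closure S"
  shows "\<bar>w p\<bar> \<le> K"
proof -
  let ?Z = "{p \<in> closure S. \<bar>w p\<bar> \<le> K}"
  have Z: "closed ?Z"
    by (intro continuous_closed_preimage_constant continuous_on_closed_Collect_le continuous_intros w) auto
  have "open (S - ?Z)" using S Z by (rule open_Diff)
  moreover have "negligible (S - ?Z)"
  proof -
    have "AE p in lborel. p \<notin> S - ?Z" using ae by eventually_elim (use closure_subset in auto)
    then have "AE p in lebesgue. p \<notin> S - ?Z" by (rule AE_completion)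
    then have "S - ?Z \<in> null_sets lebesgue"
      using AE_iff_null_sets[of "S - ?Z" lebesgue] \<open>open (S - ?Z)\<close> by auto
    then show ?thesis by (simp add: negligible_iff_null_sets)
  qed
  ultimately have "S - ?Z = {}" using open_not_negligible by blast
  then have "S \<subseteq> ?Z" by blast
  then have "closure S \<subseteq> ?Z" using Z by (rule closure_minimal)
  then show ?thesis using p by blast
qed

text \<open>
  Minus an antiderivative of \<open>\<alpha>\<close>.  It is constant to the left of the support of \<open>\<alpha>\<close> and so not itself a
  test function unless \<open>\<alpha>\<close> has mean zero.
\<close>

definition tail_integral :: "(real \<Rightarrow> real) \<Rightarrow> real \<Rightarrow> real" where
  "tail_integral \<alpha> s = (LINT x|lborel. (if s \<le> x then \<alpha> x else 0))"

lemma tail_integral_measurable: assumes "\<alpha> \<in> Cc a b" shows "tail_integral \<alpha> \<in> borel_measurable borel"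
proof -
  note i = Cc_integrable[OF assms]
  have "continuous_on UNIV (tail_integral \<alpha>)"
    unfolding tail_integral_def primitive_complement[OF i]
    by (intro continuous_intros primitive_continuous[OF i])
  then show ?thesis by (rule borel_measurable_continuous_onI)
qed

lemma tail_integral_bounded: assumes "\<alpha> \<in> Cc a b" shows "\<exists>B. \<forall>s. \<bar>tail_integral \<alpha> s\<bar> \<le> B"
proof (intro exI allI)
  fix s
  note i = Cc_integrable[OF assms]
  have [measurable]: "\<alpha> \<in> borel_measurable borel" by (rule Cc_measurable[OF assms])
  have "\<bar>tail_integral \<alpha> s\<bar> \<le> (LINT x|lborel. \<bar>if s \<le> x then \<alpha> x else 0\<bar>)"
    unfolding tail_integral_def by (rule integral_abs_bound)
  also have "\<dots> \<le> (LINT x|lborel. \<bar>\<alpha> x\<bar>)"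
    by (rule integral_mono) (use i in \<open>auto intro!: Bochner_Integration.integrable_bound[OF i]\<close>)
  finally show "\<bar>tail_integral \<alpha> s\<bar> \<le> (LINT x|lborel. \<bar>\<alpha> x\<bar>)" .
qed

lemma tail_test_integrable:
  assumes h: "integrable leb2 h" and \<alpha>: "\<alpha> \<in> Cc a b" and \<beta>: "\<beta> \<in> Cc c d"
  shows "integrable leb2 (\<lambda>p. h p * (tail_integral \<alpha> (fst p) * \<beta> (snd p)))"
  by (rule bounded_factors_integrable[OF h tail_integral_measurable[OF \<alpha>] Cc_measurable[OF \<beta>]
        tail_integral_bounded[OF \<alpha>] Cc_bounded[OF \<beta>]])

lemma prim1_test_exchange:
  assumes r: "integrable leb2 r" and \<alpha>: "\<alpha> \<in> Cc 0 pi" and \<beta>: "\<beta> \<in> Cc (-l) l"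
    and G: "integrable leb2 (\<lambda>p. indicator (Omega l) p * prim1 r p)"
  shows "(LINT p|leb2. r p * (tail_integral \<alpha> (fst p) * \<beta> (snd p)))
       = (LINT p|leb2. (indicator (Omega l) p * prim1 r p) * (\<alpha> (fst p) * \<beta> (snd p)))"
proof -
  let ?G = "\<lambda>p. indicator (Omega l) p * prim1 r p"
  have "(LINT p|leb2. r p * (tail_integral \<alpha> (fst p) * \<beta> (snd p))) = (LINT y|lborel. LINT s|lborel. r (s, y) * (tail_integral \<alpha> s * \<beta> y))"
    using slice_integrable(3)[OF tail_test_integrable[OF r \<alpha> \<beta>]] by simp
  also have "\<dots> = (LINT y|lborel. LINT x|lborel. ?G (x, y) * (\<alpha> x * \<beta> y))"
  proof (rule integral_cong_AE)
    show "(\<lambda>y. LINT s|lborel. r (s, y) * (tail_integral \<alpha> s * \<beta> y)) \<in> borel_measurable lborel"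
      using slice_integrable(2)[OF tail_test_integrable[OF r \<alpha> \<beta>]] by (auto dest: borel_measurable_integrable)
    show "(\<lambda>y. LINT x|lborel. ?G (x, y) * (\<alpha> x * \<beta> y)) \<in> borel_measurable lborel"
      using slice_integrable(2)[OF test_integrable[OF G \<alpha> \<beta>]] by (auto dest: borel_measurable_integrable)
    show "AE y in lborel. (LINT s|lborel. r (s, y) * (tail_integral \<alpha> s * \<beta> y)) = (LINT x|lborel. ?G (x, y) * (\<alpha> x * \<beta> y))"
      using slice_integrable(1)[OF r]
    proof eventually_elim
      case (elim y)
      have "(LINT s|lborel. r (s, y) * (tail_integral \<alpha> s * \<beta> y)) = \<beta> y * (LINT s|lborel. r (s, y) * tail_integral \<alpha> s)"
        by (simp add: mult.assoc[symmetric] mult.commute[of "\<beta> y"])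
      also have "(LINT s|lborel. r (s, y) * tail_integral \<alpha> s) = (LINT x|lborel. (LINT s|lborel. (if s \<le> x then r (s, y) else 0)) * \<alpha> x)"
        unfolding tail_integral_def by (rule primitive_exchange[OF elim Cc_integrable[OF \<alpha>]])
      also have "\<beta> y * \<dots> = (LINT x|lborel. \<beta> y * ((LINT s|lborel. (if s \<le> x then r (s, y) else 0)) * \<alpha> x))" by simp
      also have "\<dots> = (LINT x|lborel. ?G (x, y) * (\<alpha> x * \<beta> y))"
      proof (rule Bochner_Integration.integral_cong)
        fix x
        show "\<beta> y * ((LINT s|lborel. (if s \<le> x then r (s, y) else 0)) * \<alpha> x) = ?G (x, y) * (\<alpha> x * \<beta> y)"
          using Cc_support[OF \<alpha>, of x] Cc_support[OF \<beta>, of y]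
          by (cases "\<alpha> x = 0"; cases "\<beta> y = 0") (auto simp: prim1_pair Omega_def)
      qed simp
      finally show ?case .
    qed
  qed
  also have "\<dots> = (LINT p|leb2. ?G p * (\<alpha> (fst p) * \<beta> (snd p)))"
    using slice_integrable(3)[OF test_integrable[OF G \<alpha> \<beta>]] by simp
  finally show ?thesis .
qed

lemma prim1_square:
  assumes r: "integrable leb2 r" and r2: "integrable leb2 (\<lambda>p. (r p)\<^sup>2)" and off: "\<And>p. p \<notin> Omega l \<Longrightarrow> r p = 0"
  shows "integrable leb2 (\<lambda>p. (indicator (Omega l) p * prim1 r p)\<^sup>2)"
    "(LINT p|leb2. (indicator (Omega l) p * prim1 r p)\<^sup>2) \<le> pi\<^sup>2 * (LINT p|leb2. (r p)\<^sup>2)"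
    "integrable leb2 (\<lambda>p. indicator (Omega l) p * prim1 r p)"
proof -
  let ?G = "\<lambda>p. indicator (Omega l) p * prim1 r p"
  have [measurable]: "r \<in> borel_measurable borel" using r by (auto dest: borel_measurable_integrable)
  have [measurable]: "prim1 r \<in> borel_measurable borel" by (rule prim1_measurable) measurable
  define R where "R y = (LINT s|lborel. (r (s, y))\<^sup>2)" for y
  have R: "integrable lborel R" "(LINT y|lborel. R y) = (LINT p|leb2. (r p)\<^sup>2)"
    unfolding R_def using slice_integrable(2,3)[OF r2] by simp_all
  have I: "integrable lborel (\<lambda>x. pi * indicat_real {0<..<pi} x)" by (intro integrable_mult_right integrable_real_indicator) auto
  have ae: "AE p in leb2. (?G p)\<^sup>2 \<le> (pi * indicat_real {0<..<pi} (fst p)) * R (snd p)"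
    using AE_snd[OF slice_integrable(1)[OF r]] AE_snd[OF slice_integrable(1)[OF r2]]
  proof eventually_elim
    case (elim p)
    show ?case
    proof (cases "p \<in> Omega l")
      case True
      have "\<bar>prim1 r p\<bar> \<le> (LINT s|lborel. \<bar>r (s, snd p)\<bar>)" by (rule prim1_bound[OF elim(1)])
      then have "\<bar>prim1 r p\<bar>\<^sup>2 \<le> (LINT s|lborel. \<bar>r (s, snd p)\<bar>)\<^sup>2" by (rule power_mono) simp
      also have "\<dots> \<le> measure lborel {0<..<pi} * (LINT s|lborel. (r (s, snd p))\<^sup>2)"
        by (rule L1_le_L2[OF elim]) (use off in \<open>auto simp: Omega_def\<close>)
      also have "\<dots> = pi * R (snd p)" by (simp add: R_def)
      finally show ?thesis using True by (auto simp: Omega_def)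
    next
      case False
      have "R (snd p) \<ge> 0" by (simp add: R_def)
      then show ?thesis using False by simp
    qed
  qed
  note PI = product_integrable[OF I R(1)]
  show i: "integrable leb2 (\<lambda>p. (?G p)\<^sup>2)"
  proof (rule Bochner_Integration.integrable_bound[OF PI(1)])
    show "AE p in leb2. norm ((?G p)\<^sup>2) \<le> norm ((pi * indicat_real {0<..<pi} (fst p)) * R (snd p))"
      using ae by eventually_elim (smt (verit) real_norm_def zero_le_power2)
  qed measurable
  have "(LINT p|leb2. (?G p)\<^sup>2) \<le> (LINT p|leb2. (pi * indicat_real {0<..<pi} (fst p)) * R (snd p))"
    by (rule integral_mono_AE[OF i PI(1) ae])
  also have "\<dots> = pi\<^sup>2 * (LINT p|leb2. (r p)\<^sup>2)"
    unfolding PI(2) R(2) by (simp add: power2_eq_square)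
  finally show "(LINT p|leb2. (?G p)\<^sup>2) \<le> pi\<^sup>2 * (LINT p|leb2. (r p)\<^sup>2)" .
  have "?G \<in> borel_measurable borel" by measurable
  then show "integrable leb2 ?G" by (rule square_integrable_imp_integrable[OF _ _ i, of l]) simp
qed

lemma mem_Omega: "(x, y) \<in> Omega l \<longleftrightarrow> 0 < x \<and> x < pi \<and> - l < y \<and> y < l"
  by (auto simp: Omega_def)

lemma H2_star_H2: "U \<in> H2_star l \<Longrightarrow> U \<in> H2 (Omega l)" by (simp add: H2_star_def)

text \<open>
  On almost every horizontal line the continuous representative is a constant plus a primitive of \<open>U\<^sub>x\<close>, and it
  vanishes at both ends.
\<close>

lemma H2_star_trace:
  assumes l: "l > 0" and U: "U \<in> H2 (Omega l)" and w: "continuous_on (closure (Omega l)) w"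
    and wU: "AE p in lebesgue_on (Omega l). w p = U p" and w0: "\<forall>p\<in>{0, pi} \<times> {-l..l}. w p = 0"
  shows "AE y in lborel. y \<in> {-l<..<l} \<longrightarrow> (LINT s|lborel. bor l (wd (Omega l) 1 0 U) (s, y)) = 0 \<and>
      (\<forall>x\<in>{0..pi}. w (x, y) = prim1 (bor l (wd (Omega l) 1 0 U)) (x, y))"
proof -
  let ?ux = "bor l (wd (Omega l) 1 0 U)" and ?u = "bor l U"
  note P = U_parts[OF l U]
  obtain C where C: "AE p in leb2. p \<in> Omega l \<longrightarrow> ?u p = C (snd p) + prim1 ?ux p"
    using H2_u_primitive_x[OF l U] by blast
  have "AE p in leb2. p \<in> Omega l \<longrightarrow> w p = C (snd p) + prim1 ?ux p"
    using C bor_AE[OF P(1)] wU[unfolded AE_Omega_iff] by eventually_elim auto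
  from slice_AE[OF this] slice_integrable(1)[OF bor_integrable[OF P(2)]]
  show ?thesis
  proof eventually_elim
    case (elim y)
    show ?case
    proof
      assume y: "y \<in> {-l<..<l}"
      have c: "continuous_on {0..pi} (\<lambda>x. w (x, y))"
        by (rule continuous_on_compose2[OF w])
           (use y in \<open>auto simp: closure_Omega[OF l] intro!: continuous_intros\<close>)
      have off: "?ux (s, y) = 0" if "s \<notin> {0<..<pi}" for s
        using bor_off[OF P(2), of "(s, y)"] that by (auto simp: Omega_def)
      have ae: "AE x in lborel. x \<in> {0<..<pi} \<longrightarrow> w (x, y) = C y + (LINT s|lborel. (if s \<le> x then ?ux (s, y) else 0))"
        using elim(1) by eventually_elim (use y in \<open>auto simp: mem_Omega prim1_pair simp del: One_nat_def\<close>)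
      have "w (0, y) = 0" "w (pi, y) = 0" using w0 y by auto
      from primitive_of_vanishing[OF pi_gt_zero elim(2) off c this ae]
      show "(LINT s|lborel. ?ux (s, y)) = 0 \<and> (\<forall>x\<in>{0..pi}. w (x, y) = prim1 ?ux (x, y))"
        by (auto simp: prim1_pair simp del: One_nat_def)
    qed
  qed
qed

lemma H2_star_primitive:
  assumes l: "l > 0" and U: "U \<in> H2_star l"
  shows "AE p in leb2. p \<in> Omega l \<longrightarrow> bor l U p = prim1 (bor l (wd (Omega l) 1 0 U)) p"
    "AE y in lborel. (LINT s|lborel. bor l (wd (Omega l) 1 0 U) (s, y)) = 0"
proof -
  note U' = H2_star_H2[OF U]
  note P = U_parts[OF l U']
  obtain w where w: "continuous_on (closure (Omega l)) w" "AE p in lebesgue_on (Omega l). w p = U p"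
    "\<forall>p\<in>{0, pi} \<times> {-l..l}. w p = 0" using U unfolding H2_star_def by blast
  note T = H2_star_trace[OF l U' w]
  show "AE p in leb2. p \<in> Omega l \<longrightarrow> bor l U p = prim1 (bor l (wd (Omega l) 1 0 U)) p"
    using AE_snd[OF T] bor_AE[OF P(1)] w(2)[unfolded AE_Omega_iff]
    by eventually_elim (auto simp: Omega_def)
  show "AE y in lborel. (LINT s|lborel. bor l (wd (Omega l) 1 0 U) (s, y)) = 0"
    using T
  proof eventually_elim
    case (elim y)
    show ?case
    proof (cases "y \<in> {-l<..<l}")
      case False
      then have "bor l (wd (Omega l) 1 0 U) (s, y) = 0" for s
        using bor_off[OF P(2), of "(s, y)"] by (auto simp: Omega_def)
      then show ?thesis by simp
    qed (use elim in auto)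
  qed
qed

text \<open>
  The boundary values of \<open>V\<close> enter only through \<open>V = prim1 V\<^sub>x\<close> and the vanishing mean of \<open>V\<^sub>x\<close>.
\<close>

lemma H2_star_by_parts:
  assumes l: "l > 0" and U: "U \<in> H2_star l" and V: "V \<in> H2_star l"
  shows "inner0 (Omega l) (wd (Omega l) 1 0 U) (wd (Omega l) 1 0 V) = - inner0 (Omega l) (wd (Omega l) 2 0 U) V"
proof -
  note P = U_parts[OF l H2_star_H2[OF U]] and Q = U_parts[OF l H2_star_H2[OF V]]
  obtain C where C: "AE p in leb2. p \<in> Omega l \<longrightarrow> bor l (wd (Omega l) 1 0 U) p = C (snd p) + prim1 (bor l (wd (Omega l) 2 0 U)) p"
    using H2_ux_primitive_x[OF l H2_star_H2[OF U]] by blast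
  show ?thesis
    unfolding inner0_bor[OF P(2) Q(2)] inner0_bor[OF P(4) Q(1)]
    by (rule integration_by_parts_slices[OF bor_integrable[OF P(4)] bor_integrable[OF Q(2)]
          bor_product_integrable[OF P(2) Q(2)] bor_product_integrable[OF P(4) Q(1)] C H2_star_primitive(1)[OF l V]
          bor_off[OF P(4)] bor_off[OF Q(2)] H2_star_primitive(2)[OF l V] bor_measurable[OF P(2)] bor_measurable[OF Q(1)]])
qed

text \<open>
  By \<open>H2_star_trace\<close> it is enough to bound \<open>\<integral> |U\<^sub>x| dx\<close> on each horizontal line.  Write \<open>U\<^sub>x(x, y) = E(x) + \<integral> U\<^sub>x\<^sub>y dy\<close>: the
  second term is at most \<open>N(x) = \<integral> |U\<^sub>x\<^sub>y(x, \<eta>)| d\<eta>\<close>, and averaging \<open>|E| \<le> |U\<^sub>x| + N\<close> over \<open>y\<close> bounds the integral of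
  \<open>|E|\<close>.
\<close>

lemma H2_star_sup_bound:
  assumes l: "l > 0" and U: "U \<in> H2 (Omega l)" and w: "continuous_on (closure (Omega l)) w"
    and wU: "AE p in lebesgue_on (Omega l). w p = U p" and w0: "\<forall>p\<in>{0, pi} \<times> {-l..l}. w p = 0"
    and p: "p \<in> closure (Omega l)"
  shows "\<bar>w p\<bar> \<le> (LINT p|leb2. \<bar>bor l (wd (Omega l) 1 0 U) p\<bar>) / (2 * l) + 2 * (LINT p|leb2. \<bar>bor l (wd (Omega l) 1 1 U) p\<bar>)"
proof -
  let ?ux = "bor l (wd (Omega l) 1 0 U)" and ?uxy = "bor l (wd (Omega l) 1 1 U)"
  note P = U_parts[OF l U]
  have uxi: "integrable leb2 ?ux" and uxyi: "integrable leb2 ?uxy"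
    by (rule bor_integrable[OF P(2)], rule bor_integrable[OF P(5)])
  have [measurable]: "?ux \<in> borel_measurable borel" "?uxy \<in> borel_measurable borel" using P bor_measurable by auto
  obtain E where E: "integrable lborel E" "AE p in leb2. p \<in> Omega l \<longrightarrow> ?ux p = E (fst p) + prim1 (flip ?uxy) (snd p, fst p)"
    using H2_ux_primitive_y[OF l U] by blast
  define N where "N s = (LINT \<eta>|lborel. \<bar>flip ?uxy (\<eta>, s)\<bar>)" for s
  have swi: "integrable leb2 (flip ?uxy)" by (rule flip_integrable[OF uxyi])
  have N: "integrable lborel N" "(LINT s|lborel. N s) = (LINT p|leb2. \<bar>?uxy p\<bar>)"
  proof -
    have "integrable leb2 (\<lambda>p. \<bar>flip ?uxy p\<bar>)" using swi by simp
    note S = slice_integrable(2,3)[OF this]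
    show "integrable lborel N" using S(1) by (simp add: N_def[abs_def])
    have "(LINT p|leb2. \<bar>flip ?uxy p\<bar>) = (LINT p|leb2. flip (\<lambda>p. \<bar>?uxy p\<bar>) p)" by (simp add: flip_def)
    also have "\<dots> = (LINT p|leb2. \<bar>?uxy p\<bar>)" by (rule flip_integral) measurable
    finally show "(LINT s|lborel. N s) = (LINT p|leb2. \<bar>?uxy p\<bar>)" using S(2) by (simp add: N_def)
  qed
  have N0: "N s \<ge> 0" for s by (simp add: N_def)
  have pb: "AE p in leb2. \<bar>prim1 (flip ?uxy) (snd p, fst p)\<bar> \<le> N (fst p)"
    using AE_fst[OF slice_integrable(1)[OF swi]]
  proof eventually_elim
    case (elim p)
    then have "integrable lborel (\<lambda>s. flip ?uxy (s, snd (snd p, fst p)))" by simp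
    from prim1_bound[OF this] show ?case by (simp add: N_def)
  qed
  define e where "e = (LINT s|lborel. indicator {0<..<pi} s * \<bar>E s\<bar>)"
  define n where "n = (LINT s|lborel. N s)"
  have Ei: "integrable lborel (\<lambda>s. indicat_real {0<..<pi} s * \<bar>E s\<bar>)"
  proof -
    have "integrable lborel (\<lambda>s. indicat_real {0<..<pi} s *\<^sub>R \<bar>E s\<bar>)"
      by (rule integrable_mult_indicator) (use E(1) in auto)
    then show ?thesis by simp
  qed
  have yi: "integrable lborel (indicat_real {-l<..<l})" by (rule integrable_real_indicator) (use l in auto)
  have yI: "(LINT y|lborel. indicat_real {-l<..<l} y) = 2 * l" using l by simp
  have le: "2 * l * e \<le> (LINT p|leb2. \<bar>?ux p\<bar>) + 2 * l * n"
  proof -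
    note PE = product_integrable[OF Ei yi] and PN = product_integrable[OF N(1) yi]
    have "2 * l * e = (LINT p|leb2. (indicator {0<..<pi} (fst p) * \<bar>E (fst p)\<bar>) * indicat_real {-l<..<l} (snd p))"
      unfolding PE(2) yI e_def by simp
    also have "\<dots> \<le> (LINT p|leb2. \<bar>?ux p\<bar> + N (fst p) * indicat_real {-l<..<l} (snd p))"
    proof (rule integral_mono_AE[OF PE(1)])
      show "integrable leb2 (\<lambda>p. \<bar>?ux p\<bar> + N (fst p) * indicat_real {-l<..<l} (snd p))"
        by (intro Bochner_Integration.integrable_add PN(1)) (use uxi in simp)
      show "AE p in leb2. (indicator {0<..<pi} (fst p) * \<bar>E (fst p)\<bar>) * indicat_real {-l<..<l} (snd p) \<le> \<bar>?ux p\<bar> + N (fst p) * indicat_real {-l<..<l} (snd p)"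
        using E(2) pb
      proof eventually_elim
        case (elim p)
        show ?case
        proof (cases "p \<in> Omega l")
          case True
          then have "\<bar>E (fst p)\<bar> \<le> \<bar>?ux p\<bar> + N (fst p)" using elim by auto
          then show ?thesis using True by (auto simp: Omega_def)
        next
          case False
          then have "fst p \<notin> {0<..<pi} \<or> snd p \<notin> {-l<..<l}" by (cases p) (auto simp: Omega_def)
          then show ?thesis using N0[of "fst p"] by (auto simp: indicator_def)
        qed
      qed
    qed
    also have "\<dots> = (LINT p|leb2. \<bar>?ux p\<bar>) + (LINT p|leb2. N (fst p) * indicat_real {-l<..<l} (snd p))"
      by (rule Bochner_Integration.integral_add) (use uxi PN(1) in auto)
    also have "(LINT p|leb2. N (fst p) * indicat_real {-l<..<l} (snd p)) = 2 * l * n"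
      unfolding PN(2) yI n_def by simp
    finally show ?thesis .
  qed
  have ub: "AE p in leb2. \<bar>?ux p\<bar> \<le> indicator {0<..<pi} (fst p) * \<bar>E (fst p)\<bar> + N (fst p)"
    using E(2) pb
  proof eventually_elim
    case (elim p)
    show ?case
    proof (cases "p \<in> Omega l")
      case True
      then show ?thesis using elim by (auto simp: Omega_def)
    next
      case False
      then show ?thesis using bor_off[OF P(2) False] N0[of "fst p"] by (auto simp: indicator_def)
    qed
  qed
  have wb: "AE y in lborel. y \<in> {-l<..<l} \<longrightarrow> (\<forall>x\<in>{0..pi}. \<bar>w (x, y)\<bar> \<le> e + n)"
    using H2_star_trace[OF l U w wU w0] slice_integrable(1)[OF uxi] slice_AE[OF ub]
  proof eventually_elim
    case (elim y)
    have "(LINT s|lborel. \<bar>?ux (s, y)\<bar>) \<le> (LINT s|lborel. indicator {0<..<pi} s * \<bar>E s\<bar> + N s)"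
      by (rule integral_mono_AE) (use elim(2,3) Ei N(1) in auto)
    also have "\<dots> = e + n" unfolding e_def n_def by (rule Bochner_Integration.integral_add[OF Ei N(1)])
    finally have b: "(LINT s|lborel. \<bar>?ux (s, y)\<bar>) \<le> e + n" .
    show ?case
    proof (intro impI ballI)
      fix x assume y: "y \<in> {-l<..<l}" and x: "x \<in> {0..pi}"
      have "w (x, y) = prim1 ?ux (x, y)" using elim(1) y x by blast
      moreover have "\<bar>prim1 ?ux (x, y)\<bar> \<le> (LINT s|lborel. \<bar>?ux (s, y)\<bar>)"
        using prim1_bound[of ?ux "(x, y)"] elim(2) by simp
      ultimately show "\<bar>w (x, y)\<bar> \<le> e + n" using b by simp
    qed
  qed
  have "AE p in leb2. p \<in> Omega l \<longrightarrow> \<bar>w p\<bar> \<le> e + n"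
    using AE_snd[OF wb] by eventually_elim (auto simp: Omega_def)
  then have "\<bar>w p\<bar> \<le> e + n" by (rule AE_bound_closure[OF Omega_sets(4) w _ p])
  moreover have "e \<le> (LINT p|leb2. \<bar>?ux p\<bar>) / (2 * l) + n"
    using le l by (simp add: field_simps)
  ultimately show ?thesis using N(2) by (simp add: n_def)
qed

text \<open>
  Formally, differentiate \<open>U = prim1 U\<^sub>x\<close> with respect to \<open>y\<close>.  Against a test function \<open>\<alpha>(x) \<beta>(y)\<close> the primitive moves to
  \<open>\<alpha>\<close>, and then \<open>U\<^sub>x\<close> is integrated by parts in \<open>y\<close>.  As \<open>tail_integral \<alpha>\<close> is not a test function, the definition
  of the weak derivative does not apply; integration by parts on vertical lines does.
\<close>

lemma H2_star_uy:
  assumes l: "l > 0" and U: "U \<in> H2_star l"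
  shows "AE p in leb2. bor l (wd (Omega l) 0 1 U) p = indicator (Omega l) p * prim1 (bor l (wd (Omega l) 1 1 U)) p"
proof -
  note U' = H2_star_H2[OF U]
  note P = U_parts[OF l U']
  let ?u = "bor l U" and ?ux = "bor l (wd (Omega l) 1 0 U)" and ?uxy = "bor l (wd (Omega l) 1 1 U)" and ?uy = "bor l (wd (Omega l) 0 1 U)"
  have Gx: "integrable leb2 (\<lambda>p. indicator (Omega l) p * prim1 ?ux p)"
    by (rule prim1_square(3)[OF bor_integrable[OF P(2)] bor_square_integrable[OF P(2)] bor_off[OF P(2)]])
  have Gxy: "integrable leb2 (\<lambda>p. indicator (Omega l) p * prim1 ?uxy p)"
    by (rule prim1_square(3)[OF bor_integrable[OF P(5)] bor_square_integrable[OF P(5)] bor_off[OF P(5)]])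
  have [measurable]: "?ux \<in> borel_measurable borel" "?uxy \<in> borel_measurable borel" "?u \<in> borel_measurable borel" using P bor_measurable by auto
  have [measurable]: "prim1 ?ux \<in> borel_measurable borel" by (rule prim1_measurable) measurable
  obtain E where E: "AE p in leb2. p \<in> Omega l \<longrightarrow> ?ux p = E (fst p) + prim1 (flip ?uxy) (snd p, fst p)"
    using H2_ux_primitive_y[OF l U'] by blast
  show ?thesis
  proof (rule tested_equal_imp_AE_equal[OF bor_integrable[OF P(3)] Gxy bor_off[OF P(3)]])
    fix \<alpha> \<beta> assume \<alpha>: "\<alpha> \<in> Cc 0 pi" and \<beta>: "\<beta> \<in> Cc (-l) l"
    note \<beta>' = Cc_deriv[OF \<beta>]
    have [measurable]: "\<alpha> \<in> borel_measurable borel" "\<beta> \<in> borel_measurable borel" "deriv \<beta> \<in> borel_measurable borel" "tail_integral \<alpha> \<in> borel_measurable borel"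
      using Cc_measurable \<alpha> \<beta> \<beta>' tail_integral_measurable by auto
    have "(LINT p|leb2. ?uy p * (\<alpha> (fst p) * \<beta> (snd p))) = - (LINT p|leb2. ?u p * (\<alpha> (fst p) * deriv \<beta> (snd p)))"
      using H2_test(2)[OF l U' \<alpha> \<beta>] by simp
    also have "(LINT p|leb2. ?u p * (\<alpha> (fst p) * deriv \<beta> (snd p))) = (LINT p|leb2. (indicator (Omega l) p * prim1 ?ux p) * (\<alpha> (fst p) * deriv \<beta> (snd p)))"
    proof (rule integral_cong_AE)
      show "AE p in leb2. ?u p * (\<alpha> (fst p) * deriv \<beta> (snd p)) = (indicator (Omega l) p * prim1 ?ux p) * (\<alpha> (fst p) * deriv \<beta> (snd p))"
        using H2_star_primitive(1)[OF l U]
      proof eventually_elim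
        case (elim p)
        then show ?case using bor_off[OF P(1), of p] by (cases "p \<in> Omega l") auto
      qed
    qed measurable
    also have "\<dots> = (LINT p|leb2. ?ux p * (tail_integral \<alpha> (fst p) * deriv \<beta> (snd p)))"
      by (rule prim1_test_exchange[OF bor_integrable[OF P(2)] \<alpha> \<beta>' Gx, symmetric])
    also have "\<dots> = - (LINT p|leb2. ?uxy p * (tail_integral \<alpha> (fst p) * \<beta> (snd p)))"
    proof -
      \<comment> \<open>with the variables exchanged, \<open>b\<close> is the primitive of \<open>b'\<close> on every line, so that
        \<open>integration_by_parts_slices\<close> applies; the indicator makes \<open>b'\<close> integrable\<close>
      define b where "b p = indicator {0<..<pi} (snd p) * tail_integral \<alpha> (snd p) * \<beta> (fst p)" for p :: "real \<times> real"
      define b' where "b' p = indicator {0<..<pi} (snd p) * tail_integral \<alpha> (snd p) * deriv \<beta> (fst p)" for p :: "real \<times> real"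
      have bm [measurable]: "b \<in> borel_measurable borel" "b' \<in> borel_measurable borel" unfolding b_def b'_def by measurable
      have swm: "flip ?ux \<in> borel_measurable borel" by (rule flip_measurable) measurable
      have x1: "flip (\<lambda>p. ?ux p * (tail_integral \<alpha> (fst p) * deriv \<beta> (snd p))) p = flip ?ux p * b' p" for p
        using bor_off[OF P(2), of "(snd p, fst p)"] by (cases "snd p \<in> {0<..<pi}") (auto simp: flip_def b'_def Omega_def)
      have x2: "flip (\<lambda>p. ?uxy p * (tail_integral \<alpha> (fst p) * \<beta> (snd p))) p = flip ?uxy p * b p" for p
        using bor_off[OF P(5), of "(snd p, fst p)"] by (cases "snd p \<in> {0<..<pi}") (auto simp: flip_def b_def Omega_def)
      have ftc: "(LINT s|lborel. (if s \<le> y then deriv \<beta> s else 0)) = \<beta> y" for y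
      proof -
        \<comment> \<open>a point that is at most \<open>y\<close> and where \<open>\<beta>\<close> vanishes\<close>
        define m where "m = min (-l) y"
        have "(LINT s|lborel. (if s \<le> y then deriv \<beta> s else 0)) = (LINT s|lborel. deriv \<beta> s * indicator {m..y} s)"
        proof (rule Bochner_Integration.integral_cong)
          fix s show "(if s \<le> y then deriv \<beta> s else 0) = deriv \<beta> s * indicator {m..y} s"
            using Cc_support[OF \<beta>', of s] by (cases "deriv \<beta> s = 0") (auto simp: indicator_def m_def)
        qed simp
        also have "\<dots> = \<beta> y - \<beta> m"
          by (rule integral_FTC_Icc_real) (auto simp: m_def intro: smooth_fun_DERIV[OF Cc_smooth[OF \<beta>]] smooth_fun_isCont[OF Cc_smooth[OF \<beta>']])
        also have "\<beta> m = 0" by (rule Cc_outside[OF \<beta>]) (auto simp: m_def)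
        finally show ?thesis by simp
      qed
      have mean: "(LINT s|lborel. deriv \<beta> s) = 0"
      proof -
        have "(LINT s|lborel. deriv \<beta> s) = (LINT s|lborel. (if s \<le> l then deriv \<beta> s else 0))"
        proof (rule Bochner_Integration.integral_cong)
          fix s show "deriv \<beta> s = (if s \<le> l then deriv \<beta> s else 0)"
            using Cc_support[OF \<beta>', of s] by (cases "deriv \<beta> s = 0") auto
        qed simp
        then show ?thesis using ftc[of l] Cc_outside[OF \<beta>, of l] by simp
      qed
      have pb: "prim1 b' (y, s) = b (y, s)" for y s
      proof -
        have "prim1 b' (y, s) = (LINT t|lborel. (indicator {0<..<pi} s * tail_integral \<alpha> s) * (if t \<le> y then deriv \<beta> t else 0))"
          unfolding prim1_pair b'_def by (rule Bochner_Integration.integral_cong) auto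
        also have "\<dots> = (indicator {0<..<pi} s * tail_integral \<alpha> s) * \<beta> y" by (simp add: ftc)
        finally show ?thesis by (simp add: b_def)
      qed
      have ti: "integrable lborel (\<lambda>s. indicat_real {0<..<pi} s * tail_integral \<alpha> s)"
      proof -
        obtain B where B: "\<And>s. \<bar>tail_integral \<alpha> s\<bar> \<le> B" using tail_integral_bounded[OF \<alpha>] by blast
        show ?thesis
        proof (rule Bochner_Integration.integrable_bound[where f="\<lambda>s. B * indicat_real {0<..<pi} s"])
          show "integrable lborel (\<lambda>s. B * indicat_real {0<..<pi} s)" by (intro integrable_mult_right integrable_real_indicator) auto
          show "AE s in lborel. norm (indicat_real {0<..<pi} s * tail_integral \<alpha> s) \<le> norm (B * indicat_real {0<..<pi} s)"
            by (rule AE_I2) (auto simp: indicator_def intro: order_trans[OF B abs_ge_self])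
        qed measurable
      qed
      have mx: "(\<lambda>p. ?ux p * (tail_integral \<alpha> (fst p) * deriv \<beta> (snd p))) \<in> borel_measurable borel"
        and mxy: "(\<lambda>p. ?uxy p * (tail_integral \<alpha> (fst p) * \<beta> (snd p))) \<in> borel_measurable borel" by measurable
      have b'i: "integrable leb2 b'"
        using product_integrable(1)[OF Cc_integrable[OF \<beta>'] ti] by (simp add: b'_def[abs_def] mult_ac)
      have "(LINT p|leb2. ?ux p * (tail_integral \<alpha> (fst p) * deriv \<beta> (snd p))) = (LINT p|leb2. flip ?ux p * b' p)"
        using flip_integral[OF mx] x1 by simp
      also have "\<dots> = - (LINT p|leb2. flip ?uxy p * b p)"
      proof (rule integration_by_parts_slices[where Q="{-l<..<l} \<times> {0<..<pi}"])
        show "integrable leb2 (flip ?uxy)" by (rule flip_integrable[OF bor_integrable[OF P(5)]])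
        show "integrable leb2 b'" by (rule b'i)
        show "integrable leb2 (\<lambda>p. flip ?ux p * b' p)"
          using flip_integrable[OF tail_test_integrable[OF bor_integrable[OF P(2)] \<alpha> \<beta>']]
          unfolding ext[of "flip (\<lambda>p. ?ux p * (tail_integral \<alpha> (fst p) * deriv \<beta> (snd p)))", OF x1] .
        show "integrable leb2 (\<lambda>p. flip ?uxy p * b p)"
          using flip_integrable[OF tail_test_integrable[OF bor_integrable[OF P(5)] \<alpha> \<beta>]]
          unfolding ext[of "flip (\<lambda>p. ?uxy p * (tail_integral \<alpha> (fst p) * \<beta> (snd p)))", OF x2] .
        show "AE p in leb2. p \<in> {-l<..<l} \<times> {0<..<pi} \<longrightarrow> flip ?ux p = E (snd p) + prim1 (flip ?uxy) p"
          using flip_AE[OF E] by eventually_elim (auto simp: Omega_def)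
        show "AE p in leb2. p \<in> {-l<..<l} \<times> {0<..<pi} \<longrightarrow> b p = prim1 b' p"
          by (rule AE_I2) (auto simp: pb)
        show "flip ?uxy p = 0" if "p \<notin> {-l<..<l} \<times> {0<..<pi}" for p
          using that bor_off[OF P(5), of "(snd p, fst p)"] by (cases p) (auto simp: Omega_def)
        show "b' p = 0" if "p \<notin> {-l<..<l} \<times> {0<..<pi}" for p
          using that Cc_support[OF \<beta>', of "fst p"] by (cases p, cases "deriv \<beta> (fst p) = 0") (auto simp: b'_def)
        show "AE y in lborel. (LINT x|lborel. b' (x, y)) = 0"
          by (rule AE_I2) (simp add: b'_def mean)
        show "flip ?ux \<in> borel_measurable borel" "b \<in> borel_measurable borel" by (rule swm, rule bm)
      qed
      also have "(LINT p|leb2. flip ?uxy p * b p) = (LINT p|leb2. ?uxy p * (tail_integral \<alpha> (fst p) * \<beta> (snd p)))"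
        using flip_integral[OF mxy] x2 by simp
      finally show ?thesis .
    qed
    also have "(LINT p|leb2. ?uxy p * (tail_integral \<alpha> (fst p) * \<beta> (snd p))) = (LINT p|leb2. (indicator (Omega l) p * prim1 ?uxy p) * (\<alpha> (fst p) * \<beta> (snd p)))"
      by (rule prim1_test_exchange[OF bor_integrable[OF P(5)] \<alpha> \<beta> Gxy])
    finally show "(LINT p|leb2. ?uy p * (\<alpha> (fst p) * \<beta> (snd p))) = (LINT p|leb2. (indicator (Omega l) p * prim1 ?uxy p) * (\<alpha> (fst p) * \<beta> (snd p)))"
      by simp
  qed auto
qed

text \<open>
  The derivative \<open>U\<^sub>y\<close> does not occur in \<open>\<parallel>\<cdot>\<parallel>\<^sub>2\<close>, so closedness of the set of states needs this estimate.
\<close>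

lemma H2_star_uy_bound:
  assumes l: "l > 0" and U: "U \<in> H2_star l"
  shows "norm0 (Omega l) (wd (Omega l) 0 1 U) \<le> pi * norm0 (Omega l) (wd (Omega l) 1 1 U)"
proof -
  note P = U_parts[OF l H2_star_H2[OF U]]
  let ?uxy = "bor l (wd (Omega l) 1 1 U)" and ?uy = "bor l (wd (Omega l) 0 1 U)"
  note S = prim1_square[OF bor_integrable[OF P(5)] bor_square_integrable[OF P(5)] bor_off[OF P(5)]]
  have "(LINT p|leb2. (?uy p)\<^sup>2) = (LINT p|leb2. (indicator (Omega l) p * prim1 ?uxy p)\<^sup>2)"
    by (rule integral_cong_AE)
       (use bor_square_integrable[OF P(3)] S(1) H2_star_uy[OF l U] in \<open>auto dest: borel_measurable_integrable elim: eventually_mono\<close>)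
  also have "\<dots> \<le> pi\<^sup>2 * (LINT p|leb2. (?uxy p)\<^sup>2)" by (rule S(2))
  finally have "sqrt (LINT p|leb2. (?uy p)\<^sup>2) \<le> sqrt (pi\<^sup>2 * (LINT p|leb2. (?uxy p)\<^sup>2))" by simp
  then show ?thesis unfolding norm0_def inner0_bor[OF P(3) P(3)] inner0_bor[OF P(5) P(5)]
    by (simp add: real_sqrt_mult power2_eq_square)
qed

section \<open>The space of states\<close>

lemma norm_diff_le_through: "norm (x - y) \<le> norm (x - z) + norm (y - z)" for x y z :: "'a::real_normed_vector"
  using dist_triangle2[of x y z] by (simp add: dist_norm)

lemma norm_Pair_le: "norm (x, y) \<le> norm x + norm y" for x :: "'a::real_normed_vector" and y :: "'b::real_normed_vector"
  unfolding norm_Pair by (rule order_trans[OF sqrt_add_le_add_sqrt]) auto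

lemma test_C_k: "v \<in> test_functions D \<Longrightarrow> C_k k v" by (simp add: test_functions_def)

lemma C_k_derivs: "(\<And>k. C_k k v) \<Longrightarrow> C_k k ((dx ^^ i) ((dy ^^ j) v))"
proof -
  assume v: "\<And>k. C_k k v"
  have j: "C_k k ((dy ^^ j) v)" for k
  proof (induction j arbitrary: k)
    case (Suc j)
    have "C_k (Suc k) ((dy ^^ j) v)" by (rule Suc)
    then show ?case by simp
  qed (use v in simp)
  show ?thesis
  proof (induction i arbitrary: k)
    case (Suc i)
    have "C_k (Suc k) ((dx ^^ i) ((dy ^^ j) v))" by (rule Suc)
    then show ?case by simp
  qed (use j in simp)
qed

lemma continuous_L2:
  assumes f: "continuous_on (closure (Omega l)) f" shows "f \<in> L2 (Omega l)"
proof -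
  have "compact (closure (Omega l))" using Omega_sets(5) by simp
  then have "bounded (f ` closure (Omega l))" by (intro compact_imp_bounded compact_continuous_image f)
  then obtain C where C: "\<And>p. p \<in> closure (Omega l) \<Longrightarrow> \<bar>f p\<bar> \<le> C" by (auto simp: bounded_iff)
  have "continuous_on (Omega l) f" by (rule continuous_on_subset[OF f closure_subset])
  then have "f \<in> borel_measurable (lebesgue_on (Omega l))"
    by (rule continuous_imp_measurable_on_sets_lebesgue) (rule Omega_sets(1))
  then show ?thesis
    by (rule L2_bounded_measurable[OF Omega_sets(2)]) (use C closure_subset in blast)
qed

lemma test_L2: "v \<in> test_functions (Omega l) \<Longrightarrow> (dx ^^ i) ((dy ^^ j) v) \<in> L2 (Omega l)"
  by (rule continuous_L2[OF continuous_on_subset[OF _ subset_UNIV]]) (use C_k_derivs[OF test_C_k, of v _ 0 i j] in simp)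

lemma weak_iff:
  assumes "f \<in> L2 (Omega l)" "g \<in> L2 (Omega l)"
  shows "is_weak_deriv (Omega l) i j f g \<longleftrightarrow> (\<forall>v\<in>test_functions (Omega l).
    emb (Omega l) f \<bullet> emb (Omega l) ((dx ^^ i) ((dy ^^ j) v)) = (- 1) ^ (i + j) * (emb (Omega l) g \<bullet> emb (Omega l) v))"
proof -
  have "v \<in> test_functions (Omega l) \<Longrightarrow> v \<in> L2 (Omega l)" for v using test_L2[of v l 0 0] by simp
  then show ?thesis unfolding is_weak_deriv_def
    by (intro ball_cong refl) (simp add: emb_inner[OF Omega_sets(1)] assms test_L2 inner0_def)
qed

text \<open>
  The class of a weak derivative.  Here linearity holds exactly, not only almost everywhere.
\<close>

definition ew :: "real \<Rightarrow> nat \<Rightarrow> nat \<Rightarrow> field \<Rightarrow> (real \<times> real) l2" where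
  "ew l i j U = emb (Omega l) (wd (Omega l) i j U)"

lemma ew_eqI:
  assumes U: "U \<in> H2 (Omega l)" and ij: "i + j \<le> 2" and g: "g \<in> L2 (Omega l)" and w: "is_weak_deriv (Omega l) i j U g"
  shows "ew l i j U = emb (Omega l) g"
  unfolding ew_def
  using weak_deriv_unique[OF H2_L2[OF U] wd_L2[OF U ij] g wd_weak[OF U ij] w] wd_L2[OF U ij] g
  by (simp add: emb_eq_iff[OF Omega_sets(1)])

lemma ew_weak:
  assumes U: "U \<in> H2 (Omega l)" and ij: "i + j \<le> 2" and v: "v \<in> test_functions (Omega l)"
  shows "emb (Omega l) U \<bullet> emb (Omega l) ((dx ^^ i) ((dy ^^ j) v)) = (- 1) ^ (i + j) * (ew l i j U \<bullet> emb (Omega l) v)"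
  using wd_weak[OF U ij] v unfolding ew_def weak_iff[OF H2_L2[OF U] wd_L2[OF U ij]] by blast

lemma H2_lin:
  assumes U: "U \<in> H2 (Omega l)" and V: "V \<in> H2 (Omega l)"
  shows "(\<lambda>p. a * U p + b * V p) \<in> H2 (Omega l)"
    "i + j \<le> 2 \<Longrightarrow> ew l i j (\<lambda>p. a * U p + b * V p) = a *\<^sub>R ew l i j U + b *\<^sub>R ew l i j V"
proof -
  let ?W = "\<lambda>p. a * U p + b * V p" and ?e = "emb (Omega l)"
  note lin = L2_lin[OF Omega_sets(1)] and elin = emb_lin[OF Omega_sets(1)]
  have W: "?W \<in> L2 (Omega l)" by (rule lin[OF H2_L2[OF U] H2_L2[OF V]])
  have g: "(\<lambda>p. a * wd (Omega l) i j U p + b * wd (Omega l) i j V p) \<in> L2 (Omega l)"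
    and w: "is_weak_deriv (Omega l) i j ?W (\<lambda>p. a * wd (Omega l) i j U p + b * wd (Omega l) i j V p)"
    if ij: "i + j \<le> 2" for i j
  proof -
    show g: "(\<lambda>p. a * wd (Omega l) i j U p + b * wd (Omega l) i j V p) \<in> L2 (Omega l)"
      by (rule lin[OF wd_L2[OF U ij] wd_L2[OF V ij]])
    show "is_weak_deriv (Omega l) i j ?W (\<lambda>p. a * wd (Omega l) i j U p + b * wd (Omega l) i j V p)"
      unfolding weak_iff[OF W g] elin[OF H2_L2[OF U] H2_L2[OF V]] elin[OF wd_L2[OF U ij] wd_L2[OF V ij]]
      using ew_weak[OF U ij] ew_weak[OF V ij] unfolding ew_def
      by (simp add: inner_add_left algebra_simps)
  qed
  show H: "?W \<in> H2 (Omega l)" unfolding H2_def using W g w by blast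
  show "ew l i j ?W = a *\<^sub>R ew l i j U + b *\<^sub>R ew l i j V" if ij: "i + j \<le> 2"
    using ew_eqI[OF H ij g[OF ij] w[OF ij]] elin[OF wd_L2[OF U ij] wd_L2[OF V ij]] by (simp add: ew_def)
qed

lemma H2_star_lin:
  assumes U: "U \<in> H2_star l" and V: "V \<in> H2_star l"
  shows "(\<lambda>p. a * U p + b * V p) \<in> H2_star l"
proof -
  obtain w w' where w: "continuous_on (closure (Omega l)) w" "AE p in lebesgue_on (Omega l). w p = U p" "\<forall>p\<in>{0, pi} \<times> {-l..l}. w p = 0"
    and w': "continuous_on (closure (Omega l)) w'" "AE p in lebesgue_on (Omega l). w' p = V p" "\<forall>p\<in>{0, pi} \<times> {-l..l}. w' p = 0"
    using U V unfolding H2_star_def by blast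
  have "continuous_on (closure (Omega l)) (\<lambda>p. a * w p + b * w' p)" by (intro continuous_intros w w')
  moreover have "AE p in lebesgue_on (Omega l). a * w p + b * w' p = a * U p + b * V p"
    using w(2) w'(2) by eventually_elim simp
  moreover have "\<forall>p\<in>{0, pi} \<times> {-l..l}. a * w p + b * w' p = 0" using w(3) w'(3) by auto
  ultimately show ?thesis
    using H2_lin(1)[OF H2_star_H2[OF U] H2_star_H2[OF V]] unfolding H2_star_def by blast
qed

lemma H2_star_zero: "(\<lambda>p. 0) \<in> H2_star l"
proof -
  have "(\<lambda>p. 0) \<in> H2 (Omega l)"
  proof -
    have "is_weak_deriv (Omega l) i j (\<lambda>p. 0) (\<lambda>p. 0)" for i j by (simp add: is_weak_deriv_def)
    then show ?thesis unfolding H2_def using L2_zero[OF Omega_sets(1), of l] by blast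
  qed
  then show ?thesis unfolding H2_star_def by (auto intro!: exI[of _ "\<lambda>p. 0"])
qed

text \<open>
  The weights are chosen so that the inner product is \<open>inner2\<close>, using
  \<open>\<Delta>U \<Delta>V - (1 - \<sigma>) (U\<^sub>x\<^sub>x V\<^sub>y\<^sub>y + U\<^sub>y\<^sub>y V\<^sub>x\<^sub>x) = (1 + \<sigma>)/2 (U\<^sub>x\<^sub>x + U\<^sub>y\<^sub>y) (V\<^sub>x\<^sub>x + V\<^sub>y\<^sub>y) + (1 - \<sigma>)/2 (U\<^sub>x\<^sub>x - U\<^sub>y\<^sub>y) (V\<^sub>x\<^sub>x - V\<^sub>y\<^sub>y)\<close>.
\<close>

definition stiff :: "real \<Rightarrow> real \<Rightarrow> field \<Rightarrow> (real \<times> real) l2 \<times> (real \<times> real) l2 \<times> (real \<times> real) l2" where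
  "stiff \<sigma> l U = (sqrt ((1 + \<sigma>) / 2) *\<^sub>R (ew l 2 0 U + ew l 0 2 U),
     sqrt ((1 - \<sigma>) / 2) *\<^sub>R (ew l 2 0 U - ew l 0 2 U), sqrt (2 * (1 - \<sigma>)) *\<^sub>R ew l 1 1 U)"

definition state where "state \<sigma> l U = (emb (Omega l) U, ew l 1 0 U, stiff \<sigma> l U)"

text \<open>
  A left inverse: it recovers \<open>U\<^sub>x\<^sub>x\<close> from \<open>stiff\<close>.
\<close>

definition recover_xx where
  "recover_xx \<sigma> k = (1 / 2) *\<^sub>R ((1 / sqrt ((1 + \<sigma>) / 2)) *\<^sub>R fst k + (1 / sqrt ((1 - \<sigma>) / 2)) *\<^sub>R fst (snd k))"
  for k :: "(real \<times> real) l2 \<times> (real \<times> real) l2 \<times> (real \<times> real) l2"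

lemma recover_xx_linear: "bounded_linear (recover_xx \<sigma>)"
  unfolding recover_xx_def by (intro bounded_linear_intros)

lemma ew_inner:
  assumes "U \<in> H2 (Omega l)" "V \<in> H2 (Omega l)" "i + j \<le> 2" "i' + j' \<le> 2"
  shows "ew l i j U \<bullet> ew l i' j' V = inner0 (Omega l) (wd (Omega l) i j U) (wd (Omega l) i' j' V)"
  unfolding ew_def by (rule emb_inner[OF Omega_sets(1)]) (use assms wd_L2 in auto)

context
  fixes \<sigma> l :: real
  assumes \<sigma>: "0 < \<sigma>" "\<sigma> < 1/2" and l: "l > 0"
begin

lemma recover_xx_stiff: "recover_xx \<sigma> (stiff \<sigma> l U) = ew l 2 0 U"
  unfolding recover_xx_def stiff_def using \<sigma> by (simp add: scaleR_add_right[symmetric] scaleR_2[symmetric])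

lemma stiff_inner:
  assumes U: "U \<in> H2 (Omega l)" and V: "V \<in> H2 (Omega l)"
  shows "stiff \<sigma> l U \<bullet> stiff \<sigma> l V = inner2 \<sigma> l U V"
proof -
  let ?D = "Omega l"
  let ?w = "wd (Omega l)"
  have I: "integrable (lebesgue_on ?D) (\<lambda>p. ?w i j U p * ?w i' j' V p)" if "i + j \<le> 2" "i' + j' \<le> 2" for i j i' j'
    by (rule inner0_integrable[OF Omega_sets(1) wd_L2[OF U that(1)] wd_L2[OF V that(2)]])
  have E: "ew l i j U \<bullet> ew l i' j' V = (LINT p|lebesgue_on ?D. ?w i j U p * ?w i' j' V p)" if "i + j \<le> 2" "i' + j' \<le> 2" for i j i' j'
    using ew_inner[OF U V that] by (simp add: inner0_def)
  have "inner2 \<sigma> l U V = (LINT p|lebesgue_on ?D.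
       (?w 2 0 U p * ?w 2 0 V p + ?w 0 2 U p * ?w 0 2 V p) + \<sigma> * (?w 2 0 U p * ?w 0 2 V p + ?w 0 2 U p * ?w 2 0 V p)
        + 2 * (1 - \<sigma>) * (?w 1 1 U p * ?w 1 1 V p))"
    unfolding inner2_def laplacian_def by (rule Bochner_Integration.integral_cong) (auto simp: algebra_simps)
  also have "\<dots> = (ew l 2 0 U \<bullet> ew l 2 0 V + ew l 0 2 U \<bullet> ew l 0 2 V) + \<sigma> * (ew l 2 0 U \<bullet> ew l 0 2 V + ew l 0 2 U \<bullet> ew l 2 0 V)
       + 2 * (1 - \<sigma>) * (ew l 1 1 U \<bullet> ew l 1 1 V)"
    by (simp add: E I)
  also have "\<dots> = stiff \<sigma> l U \<bullet> stiff \<sigma> l V"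
  proof -
    have s: "sqrt ((1 + \<sigma>) / 2) * sqrt ((1 + \<sigma>) / 2) = (1 + \<sigma>) / 2" "sqrt ((1 - \<sigma>) / 2) * sqrt ((1 - \<sigma>) / 2) = (1 - \<sigma>) / 2"
      "sqrt (2 * (1 - \<sigma>)) * sqrt (2 * (1 - \<sigma>)) = 2 * (1 - \<sigma>)" using \<sigma> by auto
    have "stiff \<sigma> l U \<bullet> stiff \<sigma> l V =
       (sqrt ((1 + \<sigma>) / 2) * sqrt ((1 + \<sigma>) / 2)) * ((ew l 2 0 U + ew l 0 2 U) \<bullet> (ew l 2 0 V + ew l 0 2 V))
       + (sqrt ((1 - \<sigma>) / 2) * sqrt ((1 - \<sigma>) / 2)) * ((ew l 2 0 U - ew l 0 2 U) \<bullet> (ew l 2 0 V - ew l 0 2 V))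
       + (sqrt (2 * (1 - \<sigma>)) * sqrt (2 * (1 - \<sigma>))) * (ew l 1 1 U \<bullet> ew l 1 1 V)"
      unfolding stiff_def by (simp only: inner_Pair inner_scaleR_left inner_scaleR_right mult.assoc add.assoc)
    then show ?thesis unfolding s
      by (simp add: inner_add_left inner_add_right inner_diff_left inner_diff_right field_simps)
  qed
  finally show ?thesis by simp
qed

lemma stiff_norm: assumes U: "U \<in> H2 (Omega l)" shows "norm (stiff \<sigma> l U) = norm2 \<sigma> l U"
  unfolding norm2_def stiff_inner[OF U U, symmetric] by (rule norm_eq_sqrt_inner)

lemma state_lin:
  assumes U: "U \<in> H2 (Omega l)" and V: "V \<in> H2 (Omega l)"
  shows "state \<sigma> l (\<lambda>p. a * U p + b * V p) = a *\<^sub>R state \<sigma> l U + b *\<^sub>R state \<sigma> l V"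
  unfolding state_def stiff_def
  by (simp add: H2_lin(2)[OF U V] emb_lin[OF Omega_sets(1) H2_L2[OF U] H2_L2[OF V]] algebra_simps)

lemma state_diff:
  assumes U: "U \<in> H2 (Omega l)" and V: "V \<in> H2 (Omega l)"
  shows "state \<sigma> l (\<lambda>p. U p - V p) = state \<sigma> l U - state \<sigma> l V"
  using state_lin[OF U V, of 1 "-1"] by simp

definition states where "states = state \<sigma> l ` H2_star l"

lemma states_subspace: "subspace states"
  unfolding subspace_def
proof (intro conjI ballI allI)
  have "state \<sigma> l (\<lambda>p. 0) = 0"
    using state_lin[OF H2_star_H2[OF H2_star_zero] H2_star_H2[OF H2_star_zero], of 0 0] by simp
  then show "0 \<in> states" unfolding states_def using H2_star_zero by (metis image_eqI)
  fix x y assume "x \<in> states" "y \<in> states"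
  then obtain U V where "U \<in> H2_star l" "V \<in> H2_star l" "x = state \<sigma> l U" "y = state \<sigma> l V" unfolding states_def by auto
  then have "x + y = state \<sigma> l (\<lambda>p. 1 * U p + 1 * V p)" "(\<lambda>p. 1 * U p + 1 * V p) \<in> H2_star l"
    using state_lin[OF H2_star_H2 H2_star_H2, of U V 1 1] H2_star_lin[of U l V 1 1] by simp_all
  then show "x + y \<in> states" unfolding states_def by blast
next
  fix c x assume "x \<in> states"
  then obtain U where "U \<in> H2_star l" "x = state \<sigma> l U" unfolding states_def by auto
  then have "c *\<^sub>R x = state \<sigma> l (\<lambda>p. c * U p + 0 * U p)" "(\<lambda>p. c * U p + 0 * U p) \<in> H2_star l"
    using state_lin[OF H2_star_H2 H2_star_H2, of U U c 0] H2_star_lin[of U l U c 0] by simp_all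
  then show "c *\<^sub>R x \<in> states" unfolding states_def by blast
qed

lemma states_determined: assumes "(0, d, k) \<in> states" shows "d = 0 \<and> k = 0"
proof -
  obtain U where U: "U \<in> H2_star l" "(0, d, k) = state \<sigma> l U" using assms unfolding states_def by auto
  note U' = H2_star_H2[OF U(1)]
  have e0: "emb (Omega l) U = 0" using U(2) by (simp add: state_def)
  have "ew l i j U = 0" if ij: "i + j \<le> 2" for i j
  proof -
    have "is_weak_deriv (Omega l) i j U (\<lambda>p. 0)"
      unfolding weak_iff[OF H2_L2[OF U'] L2_zero[OF Omega_sets(1)]] by (simp add: e0 emb_zero[OF Omega_sets(1)])
    from ew_eqI[OF U' ij L2_zero[OF Omega_sets(1)] this] show ?thesis by (simp add: emb_zero[OF Omega_sets(1)])
  qed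
  then show ?thesis using U(2) by (simp add: state_def stiff_def zero_prod_def)
qed

lemma states_by_parts:
  assumes "(u, d, k) \<in> states" "(u', d', k') \<in> states" shows "d \<bullet> d' = - (recover_xx \<sigma> k \<bullet> u')"
proof -
  obtain U V where U: "U \<in> H2_star l" "(u, d, k) = state \<sigma> l U" and V: "V \<in> H2_star l" "(u', d', k') = state \<sigma> l V"
    using assms unfolding states_def by auto
  have "d \<bullet> d' = inner0 (Omega l) (wd (Omega l) 1 0 U) (wd (Omega l) 1 0 V)"
    using U(2) V(2) ew_inner[OF H2_star_H2[OF U(1)] H2_star_H2[OF V(1)], of 1 0 1 0] by (simp add: state_def)
  also have "\<dots> = - inner0 (Omega l) (wd (Omega l) 2 0 U) V" by (rule H2_star_by_parts[OF l U(1) V(1)])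
  also have "inner0 (Omega l) (wd (Omega l) 2 0 U) V = ew l 2 0 U \<bullet> emb (Omega l) V"
    unfolding ew_def by (rule emb_inner[OF Omega_sets(1), symmetric])
      (use U_parts[OF l H2_star_H2[OF U(1)]] U_parts[OF l H2_star_H2[OF V(1)]] in auto)
  finally show ?thesis using U(2) V(2) by (simp add: state_def recover_xx_stiff)
qed

lemma sup_bound:
  assumes U: "U \<in> H2 (Omega l)" and w: "continuous_on (closure (Omega l)) w"
    and wU: "AE p in lebesgue_on (Omega l). w p = U p" and w0: "\<forall>p\<in>{0, pi} \<times> {-l..l}. w p = 0"
    and p: "p \<in> closure (Omega l)"
  shows "\<bar>w p\<bar> \<le> sqrt (measure lborel (Omega l)) * (1 / (2 * l) + 2) * (norm (ew l 1 0 U) + norm (ew l 1 1 U))"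
proof -
  note P = U_parts[OF l U]
  let ?s = "sqrt (measure lborel (Omega l))"
  have n: "norm (ew l 1 0 U) = norm0 (Omega l) (wd (Omega l) 1 0 U)" "norm (ew l 1 1 U) = norm0 (Omega l) (wd (Omega l) 1 1 U)"
    unfolding ew_def using P by (simp_all add: emb_norm[OF Omega_sets(1)])
  have "\<bar>w p\<bar> \<le> (LINT p|leb2. \<bar>bor l (wd (Omega l) 1 0 U) p\<bar>) / (2 * l) + 2 * (LINT p|leb2. \<bar>bor l (wd (Omega l) 1 1 U) p\<bar>)"
    by (rule H2_star_sup_bound[OF l U w wU w0 p])
  also have "\<dots> \<le> (?s * norm (ew l 1 0 U)) / (2 * l) + 2 * (?s * norm (ew l 1 1 U))"
    unfolding n using bor_L1_le[OF P(2)] bor_L1_le[OF P(5)] l by (intro add_mono divide_right_mono mult_left_mono) auto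
  also have "\<dots> = ?s * ((1 / (2 * l)) * norm (ew l 1 0 U) + 2 * norm (ew l 1 1 U))" by (simp add: algebra_simps)
  also have "\<dots> \<le> ?s * ((1 / (2 * l) + 2) * norm (ew l 1 0 U) + (1 / (2 * l) + 2) * norm (ew l 1 1 U))"
    using l by (intro mult_left_mono add_mono mult_right_mono) auto
  finally show ?thesis by (simp add: algebra_simps)
qed

lemma norm_le_sup:
  assumes f: "f \<in> L2 (Omega l)" and b: "AE p in lebesgue_on (Omega l). \<bar>f p\<bar> \<le> K" and K: "K \<ge> 0"
  shows "norm (emb (Omega l) f) \<le> sqrt (measure lborel (Omega l)) * K"
proof -
  have "(LINT p|leb2. (bor l f p)\<^sup>2) \<le> (LINT p|leb2. K\<^sup>2 * indicator (Omega l) p)"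
  proof (rule integral_mono_AE[OF bor_square_integrable[OF f]])
    show "integrable leb2 (\<lambda>p. K\<^sup>2 * indicat_real (Omega l) p)"
      using Omega_finite by (intro integrable_mult_right integrable_real_indicator) auto
    show "AE p in leb2. (bor l f p)\<^sup>2 \<le> K\<^sup>2 * indicat_real (Omega l) p"
      using bor_AE[OF f] b[unfolded AE_Omega_iff]
    proof eventually_elim
      case (elim p)
      show ?case
      proof (cases "p \<in> Omega l")
        case True
        then have "\<bar>bor l f p\<bar> \<le> K" using elim by simp
        then have "\<bar>bor l f p\<bar>\<^sup>2 \<le> K\<^sup>2" by (rule power_mono) simp
        then show ?thesis using True by simp
      qed (simp add: bor_off[OF f])
    qed
  qed
  also have "\<dots> = K\<^sup>2 * measure lborel (Omega l)" by simp
  finally have "(norm (emb (Omega l) f))\<^sup>2 \<le> K\<^sup>2 * measure lborel (Omega l)"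
    unfolding emb_norm[OF Omega_sets(1) f] norm0_def inner0_bor[OF f f]
    by (simp add: power2_eq_square)
  then have "norm (emb (Omega l) f) \<le> sqrt (K\<^sup>2 * measure lborel (Omega l))" by (rule real_le_rsqrt)
  then show ?thesis using K by (simp add: real_sqrt_mult mult.commute)
qed

text \<open>
  Put \<open>x = \<parallel>U\<^sub>x\<parallel>\<^sub>0\<close> and \<open>k = \<parallel>U\<parallel>\<^sub>2\<close>.  The supremum bound gives \<open>\<parallel>U\<parallel>\<^sub>0 \<le> A (x + k / c)\<close>, and integration by parts
  \<open>x\<^sup>2 = - (U\<^sub>x\<^sub>x, U)\<^sub>0 \<le> K k \<parallel>U\<parallel>\<^sub>0\<close>.  This quadratic inequality for \<open>x\<close> bounds it by a multiple of \<open>k\<close>.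
\<close>

lemma coercive: "\<exists>C\<ge>0. \<forall>U\<in>H2_star l. norm (state \<sigma> l U) \<le> C * norm2 \<sigma> l U"
proof -
  obtain K where K: "K > 0" "\<And>x. norm (recover_xx \<sigma> x) \<le> K * norm x"
    using bounded_linear.pos_bounded[OF recover_xx_linear[of \<sigma>]] by (auto simp: mult.commute)
  let ?s = "sqrt (measure lborel (Omega l))"
  define A where "A = ?s * (?s * (1 / (2 * l) + 2))"
  define c where "c = sqrt (2 * (1 - \<sigma>))"
  have c: "c > 0" using \<sigma> by (simp add: c_def)
  have A: "A \<ge> 0" unfolding A_def using l by simp
  define B where "B = K * A + K * A / c + 1"
  have B: "B \<ge> 1" unfolding B_def using K(1) A c by simp
  have est: "norm (state \<sigma> l U) \<le> (A * (B + 1 / c) + (B + 1)) * norm2 \<sigma> l U" if U: "U \<in> H2_star l" for U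
  proof -
    note U' = H2_star_H2[OF U]
    note P = U_parts[OF l U']
    let ?k = "norm2 \<sigma> l U"
    have k: "norm (stiff \<sigma> l U) = ?k" by (rule stiff_norm[OF U'])
    have k0: "?k \<ge> 0" unfolding k[symmetric] by simp
    have n20: "norm (ew l 2 0 U) \<le> K * ?k" using K(2)[of "stiff \<sigma> l U"] by (simp add: recover_xx_stiff k)
    have n11: "norm (ew l 1 1 U) \<le> ?k / c"
    proof -
      have "norm (snd (snd (stiff \<sigma> l U))) \<le> ?k"
        unfolding k[symmetric] using norm_snd_le[of "snd (stiff \<sigma> l U)" "fst (stiff \<sigma> l U)"] norm_snd_le[of "snd (snd (stiff \<sigma> l U))" "fst (snd (stiff \<sigma> l U))"] by simp
      then have "c * norm (ew l 1 1 U) \<le> ?k" using c by (simp add: stiff_def c_def)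
      then show ?thesis using c by (simp add: field_simps)
    qed
    obtain w where w: "continuous_on (closure (Omega l)) w" "AE p in lebesgue_on (Omega l). w p = U p" "\<forall>p\<in>{0, pi} \<times> {-l..l}. w p = 0"
      using U unfolding H2_star_def by blast
    let ?x = "norm (ew l 1 0 U)"
    have "norm (emb (Omega l) U) \<le> ?s * (?s * (1 / (2 * l) + 2) * (?x + norm (ew l 1 1 U)))"
    proof (rule norm_le_sup[OF P(1)])
      have "AE p in lebesgue_on (Omega l). p \<in> Omega l" by (rule AE_I2) (simp add: space_restrict_space)
      then show "AE p in lebesgue_on (Omega l). \<bar>U p\<bar> \<le> ?s * (1 / (2 * l) + 2) * (?x + norm (ew l 1 1 U))"
        using w(2)
      proof eventually_elim
        case (elim p)
        then show ?case using sup_bound[OF U' w, of p] closure_subset by auto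
      qed
    qed (use l in simp)
    then have nu: "norm (emb (Omega l) U) \<le> A * (?x + norm (ew l 1 1 U))" by (simp add: A_def mult.assoc)
    also have "\<dots> \<le> A * (?x + ?k / c)" using n11 A by (intro mult_left_mono) auto
    finally have nu': "norm (emb (Omega l) U) \<le> A * (?x + ?k / c)" .
    have xx: "?x * ?x \<le> K * A * ?k * ?x + (K * A / c) * ?k * ?k"
    proof -
      have "(emb (Omega l) U, ew l 1 0 U, stiff \<sigma> l U) \<in> states" using U by (auto simp: states_def state_def)
      from states_by_parts[OF this this] have "?x * ?x = - (ew l 2 0 U \<bullet> emb (Omega l) U)"
        by (simp add: recover_xx_stiff power2_norm_eq_inner[symmetric] power2_eq_square)
      also have "\<dots> \<le> norm (ew l 2 0 U) * norm (emb (Omega l) U)"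
        using Cauchy_Schwarz_ineq2[of "ew l 2 0 U" "emb (Omega l) U"] by linarith
      also have "\<dots> \<le> (K * ?k) * (A * (?x + ?k / c))"
        using n20 nu' K(1) k0 by (intro mult_mono) auto
      finally show ?thesis by (simp add: algebra_simps)
    qed
    have x: "?x \<le> B * ?k"
    proof (rule ccontr)
      assume "\<not> ?x \<le> B * ?k"
      then have g: "B * ?k < ?x" by simp
      have "?k \<le> B * ?k" using mult_right_mono[OF B k0] by simp
      then have kx: "?k \<le> ?x" "0 < ?x" using g k0 by linarith+
      have "B * ?k * ?x < ?x * ?x" using g kx(2) by simp
      also have "\<dots> \<le> K * A * ?k * ?x + (K * A / c) * ?k * ?k" by (rule xx)
      also have "(K * A / c) * ?k * ?k \<le> (K * A / c) * ?k * ?x"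
        using kx k0 K(1) A c by (intro mult_left_mono) auto
      also have "K * A * ?k * ?x + (K * A / c) * ?k * ?x = (B - 1) * ?k * ?x" by (simp add: B_def algebra_simps)
      finally have "?k * ?x < 0" by (simp add: algebra_simps)
      then show False using k0 kx(2) by (simp add: mult_less_0_iff)
    qed
    have "norm (state \<sigma> l U) \<le> norm (emb (Omega l) U) + (?x + ?k)"
      unfolding state_def k[symmetric]
      using norm_Pair_le[of "emb (Omega l) U" "(ew l 1 0 U, stiff \<sigma> l U)"] norm_Pair_le[of "ew l 1 0 U" "stiff \<sigma> l U"] by linarith
    also have "\<dots> \<le> A * (B * ?k + ?k / c) + (B * ?k + ?k)"
      using nu' x mult_left_mono[OF add_right_mono[OF x, of "?k / c"] A] by linarith
    also have "\<dots> = (A * (B + 1 / c) + (B + 1)) * ?k" by (simp add: algebra_simps)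
    finally show ?thesis .
  qed
  have "A * (B + 1 / c) + (B + 1) \<ge> 0" using A B c by simp
  then show ?thesis using est by blast
qed

text \<open>
  Convergence of states gives convergence in \<open>L\<^sup>2\<close> of \<open>U\<close>, \<open>U\<^sub>x\<close> and all second derivatives; \<open>U\<^sub>y\<close> converges by
  \<open>H2_star_uy_bound\<close>.  So the limit is in \<open>H\<^sup>2(\<Omega>)\<close>.  By the supremum bound the continuous representatives converge
  uniformly, which preserves the boundary condition.
\<close>

lemma states_closed: "closed states"
  unfolding closed_sequential_limits
proof (intro allI impI)
  fix x z assume xz: "(\<forall>n. x n \<in> states) \<and> x \<longlonglongrightarrow> z"
  let ?D = "Omega l"
  note S = Omega_sets(1)[of l]
  have "\<forall>n. \<exists>U. U \<in> H2_star l \<and> x n = state \<sigma> l U" using xz unfolding states_def by auto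
  from choice[OF this] obtain U where U: "\<And>n. U n \<in> H2_star l" "\<And>n. x n = state \<sigma> l (U n)" by blast
  note U' = H2_star_H2[OF U(1)]
  have lu: "(\<lambda>n. emb ?D (U n)) \<longlonglongrightarrow> fst z" using xz tendsto_fst[of x z] by (simp add: U(2) state_def)
  have l10: "(\<lambda>n. ew l 1 0 (U n)) \<longlonglongrightarrow> fst (snd z)" using xz tendsto_fst[OF tendsto_snd[of x z]] by (simp add: U(2) state_def)
  have lk: "(\<lambda>n. stiff \<sigma> l (U n)) \<longlonglongrightarrow> snd (snd z)" using xz tendsto_snd[OF tendsto_snd[of x z]] by (simp add: U(2) state_def)
  have l20: "(\<lambda>n. ew l 2 0 (U n)) \<longlonglongrightarrow> recover_xx \<sigma> (snd (snd z))"
    using bounded_linear.tendsto[OF recover_xx_linear[of \<sigma>] lk] by (simp add: recover_xx_stiff)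
  have l02: "\<exists>y. (\<lambda>n. ew l 0 2 (U n)) \<longlonglongrightarrow> y"
  proof -
    have "(\<lambda>n. (1 / sqrt ((1 + \<sigma>) / 2)) *\<^sub>R fst (stiff \<sigma> l (U n)) - ew l 2 0 (U n)) \<longlonglongrightarrow> (1 / sqrt ((1 + \<sigma>) / 2)) *\<^sub>R fst (snd (snd z)) - recover_xx \<sigma> (snd (snd z))"
      by (intro tendsto_intros lk l20)
    moreover have "(1 / sqrt ((1 + \<sigma>) / 2)) *\<^sub>R fst (stiff \<sigma> l V) - ew l 2 0 V = ew l 0 2 V" for V
      using \<sigma> by (simp add: stiff_def)
    ultimately show ?thesis by auto
  qed
  have l11: "\<exists>y. (\<lambda>n. ew l 1 1 (U n)) \<longlonglongrightarrow> y"
  proof -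
    have "(\<lambda>n. (1 / sqrt (2 * (1 - \<sigma>))) *\<^sub>R snd (snd (stiff \<sigma> l (U n)))) \<longlonglongrightarrow> (1 / sqrt (2 * (1 - \<sigma>))) *\<^sub>R snd (snd (snd (snd z)))"
      by (intro tendsto_intros lk)
    moreover have "(1 / sqrt (2 * (1 - \<sigma>))) *\<^sub>R snd (snd (stiff \<sigma> l V)) = ew l 1 1 V" for V
      using \<sigma> by (simp add: stiff_def)
    ultimately show ?thesis by auto
  qed
  have ewd: "ew l i j (\<lambda>p. U m p - U n p) = ew l i j (U m) - ew l i j (U n)" if "i + j \<le> 2" for i j m n
    using H2_lin(2)[OF U' U' that, of 1 m "-1" n] by simp
  have dm: "(\<lambda>p. U m p - U n p) \<in> H2_star l" for m n using H2_star_lin[OF U(1) U(1), of 1 m "-1" n] by simp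
  have l01: "\<exists>y. (\<lambda>n. ew l 0 1 (U n)) \<longlonglongrightarrow> y"
  proof -
    obtain y where y: "(\<lambda>n. ew l 1 1 (U n)) \<longlonglongrightarrow> y" using l11 by blast
    have "Cauchy (\<lambda>n. ew l 0 1 (U n))"
    proof (rule metric_CauchyI)
      fix e :: real assume "e > 0"
      then obtain N where N: "\<And>m n. m \<ge> N \<Longrightarrow> n \<ge> N \<Longrightarrow> dist (ew l 1 1 (U m)) (ew l 1 1 (U n)) < e / pi"
        using metric_CauchyD[OF LIMSEQ_imp_Cauchy[OF y], of "e / pi"] by auto
      have "dist (ew l 0 1 (U m)) (ew l 0 1 (U n)) < e" if "m \<ge> N" "n \<ge> N" for m n
      proof -
        note Q = U_parts[OF l H2_star_H2[OF dm[of m n]]]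
        have "norm (ew l 0 1 (\<lambda>p. U m p - U n p)) \<le> pi * norm (ew l 1 1 (\<lambda>p. U m p - U n p))"
          using H2_star_uy_bound[OF l dm[of m n]] Q unfolding ew_def by (simp add: emb_norm[OF S])
        then have "dist (ew l 0 1 (U m)) (ew l 0 1 (U n)) \<le> pi * dist (ew l 1 1 (U m)) (ew l 1 1 (U n))"
          by (simp add: ewd dist_norm)
        also have "\<dots> < pi * (e / pi)" using N[OF that] by (intro mult_strict_left_mono) auto
        finally show ?thesis by simp
      qed
      then show "\<exists>M. \<forall>m\<ge>M. \<forall>n\<ge>M. dist (ew l 0 1 (U m)) (ew l 0 1 (U n)) < e" by blast
    qed
    then show ?thesis using Cauchy_convergent convergent_def by blast
  qed
  have rng: "\<exists>g\<in>L2 ?D. y = emb ?D g" if "(\<lambda>n. emb ?D (f n)) \<longlonglongrightarrow> y" "\<And>n. f n \<in> L2 ?D" for f y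
  proof -
    have "y \<in> emb ?D ` L2 ?D" by (rule closed_sequentially[OF emb_range_closed[OF S] _ that(1)]) (use that(2) in auto)
    then show ?thesis by auto
  qed
  obtain W where W: "W \<in> L2 ?D" "fst z = emb ?D W" using rng[OF lu] H2_L2[OF U'] by blast
  have lim_weak: "\<exists>g\<in>L2 ?D. is_weak_deriv ?D i j W g \<and> (\<lambda>n. ew l i j (U n)) \<longlonglongrightarrow> emb ?D g"
    if ij: "i + j \<le> 2" and y: "\<exists>y. (\<lambda>n. ew l i j (U n)) \<longlonglongrightarrow> y" for i j
  proof -
    obtain y where y: "(\<lambda>n. ew l i j (U n)) \<longlonglongrightarrow> y" using y by blast
    obtain g where g: "g \<in> L2 ?D" "y = emb ?D g" using rng[OF y[unfolded ew_def] wd_L2[OF U' ij]] by blast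
    have "emb ?D W \<bullet> emb ?D ((dx ^^ i) ((dy ^^ j) v)) = (- 1) ^ (i + j) * (emb ?D g \<bullet> emb ?D v)"
      if v: "v \<in> test_functions ?D" for v
    proof (rule LIMSEQ_unique)
      show "(\<lambda>n. emb ?D (U n) \<bullet> emb ?D ((dx ^^ i) ((dy ^^ j) v))) \<longlonglongrightarrow> emb ?D W \<bullet> emb ?D ((dx ^^ i) ((dy ^^ j) v))"
        using lu unfolding W(2) by (intro tendsto_intros)
      show "(\<lambda>n. emb ?D (U n) \<bullet> emb ?D ((dx ^^ i) ((dy ^^ j) v))) \<longlonglongrightarrow> (- 1) ^ (i + j) * (emb ?D g \<bullet> emb ?D v)"
        unfolding ew_weak[OF U' ij v] g(2)[symmetric] by (intro tendsto_intros y)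
    qed
    then show ?thesis using g y unfolding weak_iff[OF W(1) g(1), symmetric] by (metis weak_iff[OF W(1) g(1)])
  qed
  have cases: "(i, j) \<in> {(0,0), (0,1), (0,2), (1,0), (1,1), (2,0)}" if "i + j \<le> 2" for i j :: nat
    using that by (cases i; cases j) (auto simp: numeral_2_eq_2)
  have l00: "\<exists>y. (\<lambda>n. ew l 0 0 (U n)) \<longlonglongrightarrow> y"
  proof -
    have "ew l 0 0 (U n) = emb ?D (U n)" for n
      by (rule ew_eqI[OF U' _ H2_L2[OF U']]) (simp_all add: is_weak_deriv_def)
    then show ?thesis using lu by auto
  qed
  have conv: "\<exists>y. (\<lambda>n. ew l i j (U n)) \<longlonglongrightarrow> y" if "i + j \<le> 2" for i j
    using cases[OF that] l00 l01 l02 l10 l11 l20 by auto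
  have WH: "W \<in> H2 ?D" unfolding H2_def using W(1) lim_weak[OF _ conv] by blast
  have ewlim: "(\<lambda>n. ew l i j (U n)) \<longlonglongrightarrow> ew l i j W" if ij: "i + j \<le> 2" for i j
  proof -
    obtain g where "g \<in> L2 ?D" "is_weak_deriv ?D i j W g" "(\<lambda>n. ew l i j (U n)) \<longlonglongrightarrow> emb ?D g"
      using lim_weak[OF ij conv[OF ij]] by blast
    then show ?thesis using ew_eqI[OF WH ij] by simp
  qed
  have zW: "z = state \<sigma> l W"
  proof -
    have "stiff \<sigma> l W = snd (snd z)"
    proof (rule LIMSEQ_unique[OF _ lk])
      show "(\<lambda>n. stiff \<sigma> l (U n)) \<longlonglongrightarrow> stiff \<sigma> l W"
        unfolding stiff_def by (intro tendsto_intros ewlim) auto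
    qed
    moreover have "ew l 1 0 W = fst (snd z)" using LIMSEQ_unique[OF ewlim l10] by simp
    ultimately show ?thesis using W(2) by (simp add: state_def prod_eq_iff)
  qed
  have "\<forall>n. \<exists>w. continuous_on (closure ?D) w \<and> (AE p in lebesgue_on ?D. w p = U n p) \<and> (\<forall>p\<in>{0, pi} \<times> {-l..l}. w p = 0)"
    using U(1) unfolding H2_star_def by blast
  from choice[OF this] obtain w where w: "\<And>n. continuous_on (closure ?D) (w n)" "\<And>n. AE p in lebesgue_on ?D. w n p = U n p"
    "\<And>n. \<forall>p\<in>{0, pi} \<times> {-l..l}. w n p = 0" by blast
  define \<kappa> where "\<kappa> = sqrt (measure lborel ?D) * (1 / (2 * l) + 2)"
  have \<kappa>: "\<kappa> \<ge> 0" unfolding \<kappa>_def using l by simp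
  define \<epsilon> where "\<epsilon> n = \<kappa> * (norm (ew l 1 0 (U n) - ew l 1 0 W) + norm (ew l 1 1 (U n) - ew l 1 1 W))" for n
  have "\<exists>w'. uniform_limit (closure ?D) w w' sequentially"
  proof (rule uniform_limit_of_dist_le)
    fix m n p assume p: "p \<in> closure ?D"
    have "AE p in lebesgue_on ?D. w m p - w n p = U m p - U n p"
      using w(2)[of m] w(2)[of n] by eventually_elim simp
    moreover have "\<forall>p\<in>{0, pi} \<times> {-l..l}. w m p - w n p = 0" using w(3)[of m] w(3)[of n] by auto
    ultimately have "\<bar>w m p - w n p\<bar> \<le> \<kappa> * (norm (ew l 1 0 (\<lambda>p. U m p - U n p)) + norm (ew l 1 1 (\<lambda>p. U m p - U n p)))"
      unfolding \<kappa>_def by (intro sup_bound[OF H2_star_H2[OF dm] _ _ _ p] continuous_intros w(1))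
    also have "\<dots> = \<kappa> * (norm (ew l 1 0 (U m) - ew l 1 0 (U n)) + norm (ew l 1 1 (U m) - ew l 1 1 (U n)))"
      by (simp add: ewd)
    also have "\<dots> \<le> \<kappa> * ((norm (ew l 1 0 (U m) - ew l 1 0 W) + norm (ew l 1 0 (U n) - ew l 1 0 W))
        + (norm (ew l 1 1 (U m) - ew l 1 1 W) + norm (ew l 1 1 (U n) - ew l 1 1 W)))"
      using \<kappa> by (intro mult_left_mono add_mono norm_diff_le_through)
    finally show "norm (w m p - w n p) \<le> \<epsilon> m + \<epsilon> n" by (simp add: \<epsilon>_def algebra_simps)
  next
    have "\<epsilon> \<longlonglongrightarrow> \<kappa> * (norm (ew l 1 0 W - ew l 1 0 W) + norm (ew l 1 1 W - ew l 1 1 W))"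
      unfolding \<epsilon>_def by (intro tendsto_intros ewlim) auto
    then show "\<epsilon> \<longlonglongrightarrow> 0" by simp
  qed
  then obtain w' where w': "uniform_limit (closure ?D) w w' sequentially" by blast
  have w'c: "continuous_on (closure ?D) w'" by (rule uniform_limit_theorem[OF _ w']) (auto simp: w(1))
  have pw: "(\<lambda>n. w n p) \<longlonglongrightarrow> w' p" if "p \<in> closure ?D" for p by (rule tendsto_uniform_limitI[OF w' that])
  have w'0: "\<forall>p\<in>{0, pi} \<times> {-l..l}. w' p = 0"
  proof
    fix p assume p: "p \<in> {0, pi} \<times> {-l..l}"
    then have "p \<in> closure ?D" by (auto simp: closure_Omega[OF l])
    from pw[OF this] w(3) p show "w' p = 0" by (simp add: LIMSEQ_const_iff)
  qed
  note cL2 = continuous_L2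
  have "(\<lambda>n. emb ?D (w n)) \<longlonglongrightarrow> emb ?D w'"
  proof (rule LIMSEQ_I)
    fix e :: real assume e: "e > 0"
    let ?s = "sqrt (measure lborel ?D)"
    have s: "?s + 1 > 0" by (simp add: add_nonneg_pos)
    have "\<forall>\<^sub>F n in sequentially. \<forall>p\<in>closure ?D. dist (w n p) (w' p) < e / (?s + 1)"
      using w' e s by (simp add: uniform_limit_iff)
    then obtain N where N: "\<And>n p. n \<ge> N \<Longrightarrow> p \<in> closure ?D \<Longrightarrow> \<bar>w n p - w' p\<bar> < e / (?s + 1)"
      unfolding eventually_sequentially dist_real_def by blast
    have "norm (emb ?D (w n) - emb ?D w') < e" if n: "n \<ge> N" for n
    proof -
      have "norm (emb ?D (\<lambda>p. w n p - w' p)) \<le> ?s * (e / (?s + 1))"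
      proof (rule norm_le_sup)
        show "(\<lambda>p. w n p - w' p) \<in> L2 ?D" by (rule L2_diff[OF S cL2[OF w(1)] cL2[OF w'c]])
        show "AE p in lebesgue_on ?D. \<bar>w n p - w' p\<bar> \<le> e / (?s + 1)"
          by (rule AE_I2) (use N[OF n] closure_subset in \<open>force simp: space_restrict_space\<close>)
      qed (use e s in simp)
      also have "\<dots> < e" using e s by (simp add: field_simps)
      finally show ?thesis by (simp add: emb_diff[OF S cL2[OF w(1)] cL2[OF w'c]])
    qed
    then show "\<exists>no. \<forall>n\<ge>no. norm (emb ?D (w n) - emb ?D w') < e" by blast
  qed
  moreover have "emb ?D (w n) = emb ?D (U n)" for n
    using w(2)[of n] cL2[OF w(1)] H2_L2[OF U'] by (simp add: emb_eq_iff[OF S])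
  ultimately have "emb ?D w' = emb ?D W" using lu W(2) LIMSEQ_unique by auto
  then have "AE p in lebesgue_on ?D. w' p = W p" by (simp add: emb_eq_iff[OF S cL2[OF w'c] W(1)])
  then have "W \<in> H2_star l" unfolding H2_star_def using WH w'c w'0 by blast
  then show "z \<in> states" unfolding states_def zW by blast
qed

end

section \<open>Density of the energy space\<close>

lemma continuous_box_integrable:
  fixes h :: field
  assumes h: "continuous_on UNIV h" and off: "\<And>p. p \<notin> {a..b} \<times> {c..d} \<Longrightarrow> h p = 0"
  shows "integrable leb2 h"
proof -
  have "integrable leb2 (\<lambda>p. indicator ({a..b} \<times> {c..d}) p *\<^sub>R h p)"
    by (rule borel_integrable_compact) (auto intro: compact_Times continuous_on_subset[OF h])
  moreover have "(\<lambda>p. indicator ({a..b} \<times> {c..d}) p *\<^sub>R h p) = h"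
  proof
    show "indicator ({a..b} \<times> {c..d}) p *\<^sub>R h p = h p" for p using off[of p] by (cases "p \<in> {a..b} \<times> {c..d}") auto
  qed
  ultimately show ?thesis by simp
qed

lemma tensor_continuous:
  assumes \<alpha>: "\<alpha> \<in> Cc a b" and \<beta>: "\<beta> \<in> Cc c d" shows "continuous_on UNIV (tensor \<alpha> \<beta>)"
proof -
  have "continuous_on UNIV (\<lambda>p::real \<times> real. \<alpha> (fst p))" "continuous_on UNIV (\<lambda>p::real \<times> real. \<beta> (snd p))"
    by (rule continuous_on_compose2[OF smooth_fun_continuous[OF Cc_smooth[OF \<alpha>], of UNIV]], auto intro: continuous_intros)
      (rule continuous_on_compose2[OF smooth_fun_continuous[OF Cc_smooth[OF \<beta>], of UNIV]], auto intro: continuous_intros)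
  then show ?thesis unfolding tensor_def by (rule continuous_on_mult)
qed

lemma tensor_off: "\<alpha> \<in> Cc a b \<Longrightarrow> \<beta> \<in> Cc c d \<Longrightarrow> p \<notin> {a..b} \<times> {c..d} \<Longrightarrow> tensor \<alpha> \<beta> p = 0"
  using Cc_outside[of \<alpha> a b "fst p"] Cc_outside[of \<beta> c d "snd p"] by (auto simp: tensor_def mem_Times_iff)

lemma tensor_times_integrable:
  assumes "\<alpha> \<in> Cc a b" "\<beta> \<in> Cc c d" "continuous_on UNIV u"
  shows "integrable leb2 (\<lambda>p. tensor \<alpha> \<beta> p * u p)"
proof (rule continuous_box_integrable[of _ a b c d])
  show "continuous_on UNIV (\<lambda>p. tensor \<alpha> \<beta> p * u p)"
    by (rule continuous_on_mult[OF tensor_continuous[OF assms(1,2)] assms(3)])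
qed (simp add: tensor_off[OF assms(1,2)])

text \<open>
  The integrand on the left plus that on the right (without its sign) is the \<open>x\<close>-derivative of a
  function with compact support.
\<close>

lemma tensor_by_parts:
  fixes u u' :: field
  assumes ab: "a < b" and \<alpha>: "\<alpha> \<in> Cc a b" and \<beta>: "\<beta> \<in> Cc c d"
    and u: "continuous_on UNIV u" "continuous_on UNIV u'"
    and d: "\<And>x y. ((\<lambda>s. u (s, y)) has_real_derivative u' (x, y)) (at x)"
  shows "(LINT p|leb2. tensor \<alpha> \<beta> p * u' p) = - (LINT p|leb2. tensor (deriv \<alpha>) \<beta> p * u p)"
proof -
  note \<alpha>' = Cc_deriv[OF \<alpha>]
  have I: "integrable leb2 (\<lambda>p. tensor \<alpha> \<beta> p * u' p)" "integrable leb2 (\<lambda>p. tensor (deriv \<alpha>) \<beta> p * u p)"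
    by (rule tensor_times_integrable[OF \<alpha> \<beta> u(2)], rule tensor_times_integrable[OF \<alpha>' \<beta> u(1)])
  let ?G = "\<lambda>p. tensor \<alpha> \<beta> p * u' p + tensor (deriv \<alpha>) \<beta> p * u p"
  have slice: "(LINT x|lborel. ?G (x, y)) = 0" for y
  proof -
    have "has_bochner_integral lborel (\<lambda>x. ?G (x, y) * indicator {a..b} x) (\<beta> y * (\<alpha> b * u (b, y)) - \<beta> y * (\<alpha> a * u (a, y)))"
    proof (rule has_bochner_integral_FTC_Icc_real)
      show "((\<lambda>x. \<beta> y * (\<alpha> x * u (x, y))) has_real_derivative ?G (x, y)) (at x)" for x
        by (rule derivative_eq_intros smooth_fun_DERIV[OF Cc_smooth[OF \<alpha>]] d refl)+ (simp add: tensor_def algebra_simps)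
      have "continuous_on UNIV ?G"
        by (intro continuous_on_add continuous_on_mult tensor_continuous[OF \<alpha> \<beta>] tensor_continuous[OF \<alpha>' \<beta>] u)
      then have "continuous_on UNIV (\<lambda>x. ?G (x, y))" by (rule continuous_on_compose2) (auto intro!: continuous_intros)
      then show "isCont (\<lambda>x. ?G (x, y)) x" for x by (simp add: continuous_on_eq_continuous_at)
    qed (use ab in simp)
    moreover have "\<alpha> a = 0" "\<alpha> b = 0" using Cc_outside[OF \<alpha>] by auto
    moreover have "?G (x, y) * indicator {a..b} x = ?G (x, y)" for x
      using Cc_outside[OF \<alpha>, of x] Cc_outside[OF \<alpha>', of x] by (cases "x \<in> {a..b}") (auto simp: tensor_def)
    ultimately have "has_bochner_integral lborel (\<lambda>x. ?G (x, y)) 0" by (simp only:) simp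
    then show ?thesis by (rule has_bochner_integral_integral_eq)
  qed
  have "(LINT p|leb2. ?G p) = 0"
    using slice_integrable(3)[OF Bochner_Integration.integrable_add[OF I]] by (simp only: slice) simp
  then show ?thesis using I by simp
qed

lemma C_k_partials:
  assumes "C_k (Suc 0) v"
  shows "continuous_on UNIV v" "continuous_on UNIV (dx v)" "continuous_on UNIV (dy v)"
    "((\<lambda>s. v (s, y)) has_real_derivative dx v (x, y)) (at x)"
    "((\<lambda>s. v (x, s)) has_real_derivative dy v (x, y)) (at y)"
proof -
  have D: "v differentiable (at p)" for p using assms by (cases p) (simp add: differentiable_on_def)
  then show "continuous_on UNIV v" by (simp add: differentiable_imp_continuous_on differentiable_on_def)
  show "continuous_on UNIV (dx v)" "continuous_on UNIV (dy v)" using assms by auto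
  have "(\<lambda>s. v (s, y)) differentiable (at x)"
    using differentiable_chain_at[of "\<lambda>s. (s, y)" x v] D by (auto simp: o_def intro!: differentiable_Pair)
  then show "((\<lambda>s. v (s, y)) has_real_derivative dx v (x, y)) (at x)"
    by (auto simp: dx_def real_differentiable_def DERIV_imp_deriv)
  have "(\<lambda>s. v (x, s)) differentiable (at y)"
    using differentiable_chain_at[of "\<lambda>s. (x, s)" y v] D by (auto simp: o_def intro!: differentiable_Pair)
  then show "((\<lambda>s. v (x, s)) has_real_derivative dy v (x, y)) (at y)"
    by (auto simp: dy_def real_differentiable_def DERIV_imp_deriv)
qed

lemma flip_continuous: fixes u :: field shows "continuous_on UNIV u \<Longrightarrow> continuous_on UNIV (flip u)"
  unfolding flip_def by (rule continuous_on_compose2[of UNIV u]) (auto intro!: continuous_intros)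

lemma tensor_by_parts_dx:
  assumes ab: "a < b" and \<alpha>: "\<alpha> \<in> Cc a b" and \<beta>: "\<beta> \<in> Cc c d" and v: "C_k (Suc 0) v"
  shows "(LINT p|leb2. tensor \<alpha> \<beta> p * dx v p) = - (LINT p|leb2. tensor (deriv \<alpha>) \<beta> p * v p)"
  using C_k_partials[OF v] by (intro tensor_by_parts[OF ab \<alpha> \<beta>]) auto

lemma tensor_by_parts_dy:
  assumes cd: "c < d" and \<alpha>: "\<alpha> \<in> Cc a b" and \<beta>: "\<beta> \<in> Cc c d" and v: "C_k (Suc 0) v"
  shows "(LINT p|leb2. tensor \<alpha> \<beta> p * dy v p) = - (LINT p|leb2. tensor \<alpha> (deriv \<beta>) p * v p)"
proof -
  note P = C_k_partials[OF v]
  have m: "(\<lambda>p. tensor \<mu> \<nu> p * h p) \<in> borel_measurable borel" if "\<mu> \<in> Cc a b" "\<nu> \<in> Cc c d" "continuous_on UNIV h" for \<mu> \<nu> h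
    by (intro borel_measurable_continuous_onI continuous_on_mult tensor_continuous[OF that(1,2)] that(3))
  have s: "(LINT p|leb2. tensor \<nu> \<mu> p * flip h p) = (LINT p|leb2. tensor \<mu> \<nu> p * h p)"
    if "\<mu> \<in> Cc a b" "\<nu> \<in> Cc c d" "continuous_on UNIV h" for \<mu> \<nu> h
  proof -
    have "flip (\<lambda>p. tensor \<mu> \<nu> p * h p) = (\<lambda>p. tensor \<nu> \<mu> p * flip h p)" by (auto simp: flip_def tensor_def fun_eq_iff)
    then show ?thesis using flip_integral[OF m[OF that]] by simp
  qed
  have "(LINT p|leb2. tensor \<beta> \<alpha> p * flip (dy v) p) = - (LINT p|leb2. tensor (deriv \<beta>) \<alpha> p * flip v p)"
    by (rule tensor_by_parts[OF cd \<beta> \<alpha>]) (use P in \<open>auto intro!: flip_continuous\<close>)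
  then show ?thesis using s[OF \<alpha> \<beta> P(3)] s[OF \<alpha> Cc_deriv[OF \<beta>] P(1)] by simp
qed

lemma tensor_by_parts_iterated:
  assumes ab: "a < b" and cd: "c < d" and v: "\<And>k. C_k k v"
  shows "\<alpha> \<in> Cc a b \<Longrightarrow> \<beta> \<in> Cc c d \<Longrightarrow> (LINT p|leb2. tensor \<alpha> \<beta> p * (dx ^^ i) ((dy ^^ j) v) p)
    = (- 1) ^ (i + j) * (LINT p|leb2. tensor ((deriv ^^ i) \<alpha>) ((deriv ^^ j) \<beta>) p * v p)"
proof (induction i arbitrary: \<alpha>)
  case 0
  then show ?case
  proof (induction j arbitrary: \<beta>)
    case (Suc j)
    have "C_k (Suc 0) ((dx ^^ 0) ((dy ^^ j) v))" by (rule C_k_derivs[OF v])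
    then have "(LINT p|leb2. tensor \<alpha> \<beta> p * dy ((dy ^^ j) v) p) = - (LINT p|leb2. tensor \<alpha> (deriv \<beta>) p * (dy ^^ j) v p)"
      by (intro tensor_by_parts_dy[OF cd Suc(2,3)]) simp
    then show ?case using Suc(1)[OF Suc(2) Cc_deriv[OF Suc(3)]] by (simp add: funpow_swap1)
  qed simp
next
  case (Suc i)
  have "(LINT p|leb2. tensor \<alpha> \<beta> p * dx ((dx ^^ i) ((dy ^^ j) v)) p) = - (LINT p|leb2. tensor (deriv \<alpha>) \<beta> p * (dx ^^ i) ((dy ^^ j) v) p)"
    by (intro tensor_by_parts_dx[OF ab Suc(2,3)] C_k_derivs v)
  then show ?case using Suc(1)[OF Cc_deriv[OF Suc(2)] Suc(3)] by (simp add: funpow_swap1)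
qed

lemma tensor_Omega_integral:
  assumes \<alpha>: "\<alpha> \<in> Cc 0 pi" and \<beta>: "\<beta> \<in> Cc (-l) l" and u: "continuous_on UNIV u"
  shows "(LINT p|lebesgue_on (Omega l). tensor \<alpha> \<beta> p * u p) = (LINT p|leb2. tensor \<alpha> \<beta> p * u p)"
proof -
  have "(LINT p|lebesgue_on (Omega l). tensor \<alpha> \<beta> p * u p) = (LINT p|lebesgue. tensor \<alpha> \<beta> p * u p)"
    unfolding integral_on_D[OF Omega_sets(1)]
    by (rule Bochner_Integration.integral_cong)
      (use Cc_outside[OF \<alpha>] Cc_outside[OF \<beta>] in \<open>auto simp: tensor_def Omega_def mem_Times_iff\<close>)
  also have "\<dots> = (LINT p|leb2. tensor \<alpha> \<beta> p * u p)"
    by (rule integral_completion)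
      (simp, intro borel_measurable_continuous_onI continuous_on_mult tensor_continuous[OF \<alpha> \<beta>] u)
  finally show ?thesis .
qed

text \<open>
  A product test function is smooth, but its weak derivatives are defined by testing with arbitrary smooth
  functions, which need not be products; hence the preceding integration by parts for general \<open>v\<close>.
\<close>

lemma tensor_H2_star:
  assumes l: "l > 0" and \<alpha>: "\<alpha> \<in> Cc 0 pi" and \<beta>: "\<beta> \<in> Cc (-l) l"
  shows "tensor \<alpha> \<beta> \<in> H2_star l"
proof -
  have "is_weak_deriv (Omega l) i j (tensor \<alpha> \<beta>) (tensor ((deriv ^^ i) \<alpha>) ((deriv ^^ j) \<beta>))" for i j
    unfolding is_weak_deriv_def
  proof
    fix v assume "v \<in> test_functions (Omega l)"
    then have v: "C_k k v" for k by (rule test_C_k)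
    have c: "continuous_on UNIV v" "continuous_on UNIV ((dx ^^ i) ((dy ^^ j) v))"
      using v[of 0] C_k_derivs[OF v, of 0 i j] by simp_all
    show "(LINT p|lebesgue_on (Omega l). tensor \<alpha> \<beta> p * (dx ^^ i) ((dy ^^ j) v) p)
        = (- 1) ^ (i + j) * (LINT p|lebesgue_on (Omega l). tensor ((deriv ^^ i) \<alpha>) ((deriv ^^ j) \<beta>) p * v p)"
      unfolding tensor_Omega_integral[OF \<alpha> \<beta> c(2)] tensor_Omega_integral[OF Cc_derivs[OF \<alpha>] Cc_derivs[OF \<beta>] c(1)]
      by (rule tensor_by_parts_iterated[OF _ _ v \<alpha> \<beta>]) (use l in auto)
  qed
  moreover have "tensor ((deriv ^^ i) \<alpha>) ((deriv ^^ j) \<beta>) \<in> L2 (Omega l)" for i j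
    by (rule continuous_L2[OF continuous_on_subset[OF tensor_continuous[OF Cc_derivs[OF \<alpha>] Cc_derivs[OF \<beta>]] subset_UNIV]])
  moreover have "tensor \<alpha> \<beta> \<in> L2 (Omega l)" by (rule continuous_L2[OF continuous_on_subset[OF tensor_continuous[OF \<alpha> \<beta>] subset_UNIV]])
  ultimately have "tensor \<alpha> \<beta> \<in> H2 (Omega l)" unfolding H2_def by blast
  moreover have "continuous_on (closure (Omega l)) (tensor \<alpha> \<beta>)"
    by (rule continuous_on_subset[OF tensor_continuous[OF \<alpha> \<beta>]]) simp
  moreover have "\<forall>p\<in>{0, pi} \<times> {-l..l}. tensor \<alpha> \<beta> p = 0" using Cc_outside[OF \<alpha>] by (auto simp: tensor_def)
  ultimately show ?thesis unfolding H2_star_def by blast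
qed

lemma orthogonal_to_H2_star_imp_zero:
  assumes l: "l > 0" and g: "g \<in> L2 (Omega l)" and o: "\<And>V. V \<in> H2_star l \<Longrightarrow> emb (Omega l) g \<bullet> emb (Omega l) V = 0"
  shows "emb (Omega l) g = 0"
proof -
  have "AE p in leb2. bor l g p = 0"
  proof (rule tested_equal_imp_AE_equal[of _ "\<lambda>p. 0" l])
    fix \<alpha> \<beta> assume t: "\<alpha> \<in> Cc 0 pi" "\<beta> \<in> Cc (-l) l"
    have "(LINT p|lebesgue_on (Omega l). g p * tensor \<alpha> \<beta> p) = 0"
      using o[OF tensor_H2_star[OF l t]] emb_inner[OF Omega_sets(1) g H2_L2[OF H2_star_H2[OF tensor_H2_star[OF l t]]]]
      by (simp add: inner0_def)
    then show "(LINT p|leb2. bor l g p * (\<alpha> (fst p) * \<beta> (snd p))) = (LINT p|leb2. 0 * (\<alpha> (fst p) * \<beta> (snd p)))"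
      unfolding bor_tensor[OF g t] by simp
  qed (use bor_integrable[OF g] bor_off[OF g] in auto)
  then have "AE p in lebesgue_on (Omega l). g p = 0"
    unfolding AE_Omega_iff using bor_AE[OF g] by eventually_elim auto
  then have "emb (Omega l) g = emb (Omega l) (\<lambda>p. 0)" by (simp add: emb_eq_iff[OF Omega_sets(1) g L2_zero[OF Omega_sets(1)]])
  then show ?thesis by (simp add: emb_zero[OF Omega_sets(1)])
qed

section \<open>The plate equation\<close>

lemma L2_quotient:
  assumes "f \<in> L2 (Omega l)" "g \<in> L2 (Omega l)" "h \<in> L2 (Omega l)"
  shows "(\<lambda>p. (f p - g p) / c - h p) \<in> L2 (Omega l)"
    "norm0 (Omega l) (\<lambda>p. (f p - g p) / c - h p) = norm ((1 / c) *\<^sub>R (emb (Omega l) f - emb (Omega l) g) - emb (Omega l) h)"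
proof -
  note S = Omega_sets(1)[of l]
  note d = L2_diff[OF S assms(1,2)]
  have q: "(\<lambda>p. (1 / c) * (f p - g p)) \<in> L2 (Omega l)" by (rule L2_scale[OF S d])
  have eq: "(\<lambda>p. (f p - g p) / c - h p) = (\<lambda>p. (1 / c) * (f p - g p) - h p)" by simp
  show r: "(\<lambda>p. (f p - g p) / c - h p) \<in> L2 (Omega l)" unfolding eq by (rule L2_diff[OF S q assms(3)])
  show "norm0 (Omega l) (\<lambda>p. (f p - g p) / c - h p) = norm ((1 / c) *\<^sub>R (emb (Omega l) f - emb (Omega l) g) - emb (Omega l) h)"
    unfolding emb_norm[OF S r, symmetric] unfolding eq
    by (simp only: emb_diff[OF S q assms(3)] emb_scale[OF S d] emb_diff[OF S assms(1,2)])
qed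

lemma tendsto_norm_diff_iff:
  fixes f :: "'b \<Rightarrow> 'a::real_normed_vector"
  shows "((\<lambda>s. norm (f s - a)) \<longlongrightarrow> 0) F \<longleftrightarrow> (f \<longlongrightarrow> a) F"
  by (simp only: tendsto_norm_zero_iff LIM_zero_iff)

lemma C0_L2_iff:
  "u \<in> C0 I (L2 (Omega l)) (norm0 (Omega l)) \<longleftrightarrow> (\<forall>t\<in>I. u t \<in> L2 (Omega l)) \<and> continuous_on I (\<lambda>t. emb (Omega l) (u t))"
proof (cases "\<forall>t\<in>I. u t \<in> L2 (Omega l)")
  case True
  have "((\<lambda>s. norm0 (Omega l) (\<lambda>p. u s p - u t p)) \<longlongrightarrow> 0) (at t within I)
      \<longleftrightarrow> ((\<lambda>s. norm (emb (Omega l) (u s) - emb (Omega l) (u t))) \<longlongrightarrow> 0) (at t within I)" if t: "t \<in> I" for t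
    by (rule Lim_cong_within)
      (use True t in \<open>auto simp: emb_diff[OF Omega_sets(1), symmetric] emb_norm[OF Omega_sets(1)] L2_diff[OF Omega_sets(1)]\<close>)
  then show ?thesis using True unfolding C0_def continuous_on_def by (simp add: tendsto_norm_diff_iff)
qed (auto simp: C0_def)

lemma C1_L2_iff:
  "C1_with I (L2 (Omega l)) (norm0 (Omega l)) u u' \<longleftrightarrow>
    u \<in> C0 I (L2 (Omega l)) (norm0 (Omega l)) \<and> u' \<in> C0 I (L2 (Omega l)) (norm0 (Omega l)) \<and>
    (\<forall>t\<in>I. ((\<lambda>t. emb (Omega l) (u t)) has_vector_derivative emb (Omega l) (u' t)) (at t within I))"
proof (cases "(\<forall>t\<in>I. u t \<in> L2 (Omega l)) \<and> (\<forall>t\<in>I. u' t \<in> L2 (Omega l))")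
  case True
  have "((\<lambda>s. norm0 (Omega l) (\<lambda>p. (u s p - u t p) / (s - t) - u' t p)) \<longlongrightarrow> 0) (at t within I)
      \<longleftrightarrow> ((\<lambda>s. norm ((1 / (s - t)) *\<^sub>R (emb (Omega l) (u s) - emb (Omega l) (u t)) - emb (Omega l) (u' t))) \<longlongrightarrow> 0) (at t within I)"
    if t: "t \<in> I" for t
    by (rule Lim_cong_within) (use True t in \<open>auto simp: L2_quotient(2)\<close>)
  then show ?thesis unfolding C1_with_def has_vector_derivative_iff_quotient by (simp add: tendsto_norm_diff_iff)
qed (auto simp: C1_with_def C0_def)

context
  fixes \<sigma> l :: real
  assumes \<sigma>: "0 < \<sigma>" "\<sigma> < 1/2" and l: "l > 0"
begin

lemma state_scale: "V \<in> H2 (Omega l) \<Longrightarrow> state \<sigma> l (\<lambda>p. c * V p) = c *\<^sub>R state \<sigma> l V"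
  using state_lin[OF \<sigma> l, of V V c 0] by simp

lemma norm2_eq: "V \<in> H2_star l \<Longrightarrow> norm2 \<sigma> l V = norm (snd (snd (state \<sigma> l V)))"
  using stiff_norm[OF \<sigma> l H2_star_H2] by (simp add: state_def)

lemma H2_star_scale: "V \<in> H2_star l \<Longrightarrow> (\<lambda>p. c * V p) \<in> H2_star l"
  using H2_star_lin[of V l V c 0] by simp

lemma norm2_scale: "V \<in> H2_star l \<Longrightarrow> norm2 \<sigma> l (\<lambda>p. c * V p) = \<bar>c\<bar> * norm2 \<sigma> l V"
  by (simp add: norm2_eq H2_star_scale state_scale H2_star_H2)

lemma norm2_nonneg: "V \<in> H2_star l \<Longrightarrow> norm2 \<sigma> l V \<ge> 0"
  by (simp add: norm2_eq)

lemma norm2_zero: "norm2 \<sigma> l (\<lambda>p. 0) = 0"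
  using norm2_scale[OF H2_star_zero, of 0] by simp

lemma H2_star_diff: "U \<in> H2_star l \<Longrightarrow> V \<in> H2_star l \<Longrightarrow> (\<lambda>p. U p - V p) \<in> H2_star l"
  using H2_star_lin[of U l V 1 "-1"] by simp

text \<open>
  Convergence in \<open>\<parallel>\<cdot>\<parallel>\<^sub>2\<close> controls the whole state by coercivity.
\<close>

lemma C0_H2_star_iff:
  "U \<in> C0 I (H2_star l) (norm2 \<sigma> l) \<longleftrightarrow> (\<forall>t\<in>I. U t \<in> H2_star l) \<and> continuous_on I (\<lambda>t. state \<sigma> l (U t))"
proof (cases "\<forall>t\<in>I. U t \<in> H2_star l")
  case True
  obtain C where C: "C \<ge> 0" "\<And>V. V \<in> H2_star l \<Longrightarrow> norm (state \<sigma> l V) \<le> C * norm2 \<sigma> l V"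
    using coercive[OF \<sigma> l] by blast
  have sd: "state \<sigma> l (\<lambda>p. U s p - U t p) = state \<sigma> l (U s) - state \<sigma> l (U t)" if "s \<in> I" "t \<in> I" for s t
    using state_diff[OF \<sigma> l H2_star_H2 H2_star_H2] True that by blast
  have "((\<lambda>s. norm2 \<sigma> l (\<lambda>p. U s p - U t p)) \<longlongrightarrow> 0) (at t within I)
      \<longleftrightarrow> ((\<lambda>s. norm (state \<sigma> l (U s) - state \<sigma> l (U t))) \<longlongrightarrow> 0) (at t within I)" (is "?L \<longleftrightarrow> ?R") if t: "t \<in> I" for t
  proof
    have ev: "\<forall>\<^sub>F s in at t within I. s \<in> I" by (simp add: eventually_at_filter)
    have d: "(\<lambda>p. U s p - U t p) \<in> H2_star l" if "s \<in> I" for s using H2_star_diff True that t by blast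
    {
      assume L: ?L
      show ?R
      proof (rule tendsto_sandwich[OF _ _ tendsto_const[of 0]])
        show "((\<lambda>s. C * norm2 \<sigma> l (\<lambda>p. U s p - U t p)) \<longlongrightarrow> 0) (at t within I)" using tendsto_mult_right_zero[OF L] by simp
        show "\<forall>\<^sub>F s in at t within I. norm (state \<sigma> l (U s) - state \<sigma> l (U t)) \<le> C * norm2 \<sigma> l (\<lambda>p. U s p - U t p)"
          using ev
        proof eventually_elim
          case (elim s)
          then show ?case using C(2)[OF d] sd[OF _ t] by simp
        qed
      qed simp
    next
      assume R: ?R
      show ?L
      proof (rule tendsto_sandwich[OF _ _ tendsto_const[of 0] R])
        show "\<forall>\<^sub>F s in at t within I. 0 \<le> norm2 \<sigma> l (\<lambda>p. U s p - U t p)"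
          using ev by eventually_elim (simp add: norm2_nonneg d)
        show "\<forall>\<^sub>F s in at t within I. norm2 \<sigma> l (\<lambda>p. U s p - U t p) \<le> norm (state \<sigma> l (U s) - state \<sigma> l (U t))"
          using ev
        proof eventually_elim
          case (elim s)
          have le: "norm (snd (snd x)) \<le> norm x" for x :: "'x::real_normed_vector \<times> 'y::real_normed_vector \<times> 'z::real_normed_vector"
            using norm_snd_le[of "snd x" "fst x"] norm_snd_le[of "snd (snd x)" "fst (snd x)"] by simp
          show ?case unfolding norm2_eq[OF d[OF elim]] sd[OF elim t] by (rule le)
        qed
      qed
    }
  qed
  then show ?thesis using True unfolding C0_def continuous_on_def by (simp add: tendsto_norm_diff_iff)
qed (auto simp: C0_def)

lemma dual_norm_upper:
  assumes L: "L \<in> dual \<sigma> l" and V: "V \<in> H2_star l" "norm2 \<sigma> l V \<le> 1"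
  shows "\<bar>L V\<bar> \<le> dual_norm \<sigma> l L"
proof -
  obtain C where C: "\<And>V. V \<in> H2_star l \<Longrightarrow> \<bar>L V\<bar> \<le> C * norm2 \<sigma> l V" using L unfolding dual_def by blast
  have "bdd_above ((\<lambda>V. \<bar>L V\<bar>) ` {V \<in> H2_star l. norm2 \<sigma> l V \<le> 1})"
  proof (rule bdd_aboveI2)
    fix X assume X: "X \<in> {V \<in> H2_star l. norm2 \<sigma> l V \<le> 1}"
    then have "\<bar>L X\<bar> \<le> C * norm2 \<sigma> l X" using C by simp
    also have "\<dots> \<le> \<bar>C\<bar> * norm2 \<sigma> l X" using X norm2_nonneg by (intro mult_right_mono) auto
    also have "\<dots> \<le> \<bar>C\<bar> * 1" using X by (intro mult_left_mono) auto
    finally show "\<bar>L X\<bar> \<le> \<bar>C\<bar>" by simp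
  qed
  then show ?thesis unfolding dual_norm_def by (intro cSUP_upper) (use V in auto)
qed

lemma dual_norm_nonneg: "L \<in> dual \<sigma> l \<Longrightarrow> dual_norm \<sigma> l L \<ge> 0"
  using dual_norm_upper[OF _ H2_star_zero] by (simp add: norm2_zero) (meson abs_ge_zero order_trans)

text \<open>
  Where \<open>norm2\<close> vanishes the supremum defining \<open>dual_norm\<close> says nothing, but there boundedness of \<open>L\<close> gives
  \<open>L V = 0\<close>.
\<close>

lemma dual_bound:
  assumes L: "L \<in> dual \<sigma> l" and V: "V \<in> H2_star l"
  shows "\<bar>L V\<bar> \<le> dual_norm \<sigma> l L * norm2 \<sigma> l V"
proof -
  obtain C where lin: "\<And>V W a b. V \<in> H2_star l \<Longrightarrow> W \<in> H2_star l \<Longrightarrow> L (\<lambda>p. a * V p + b * W p) = a * L V + b * L W"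
    and C: "\<And>V. V \<in> H2_star l \<Longrightarrow> \<bar>L V\<bar> \<le> C * norm2 \<sigma> l V" using L unfolding dual_def by blast
  let ?n = "norm2 \<sigma> l V"
  show ?thesis
  proof (cases "?n = 0")
    case True
    then show ?thesis using C[OF V] by simp
  next
    case False
    then have n: "?n > 0" using norm2_nonneg[OF V] by simp
    let ?W = "\<lambda>p. (1 / ?n) * V p"
    have "?W \<in> H2_star l" "norm2 \<sigma> l ?W \<le> 1"
      by (rule H2_star_scale[OF V]) (use norm2_scale[OF V, of "1 / ?n"] n in simp)
    then have "\<bar>L ?W\<bar> \<le> dual_norm \<sigma> l L" by (rule dual_norm_upper[OF L])
    moreover have "L ?W = (1 / ?n) * L V" using lin[OF V V, of "1 / ?n" 0] by simp
    ultimately have "(1 / ?n) * \<bar>L V\<bar> \<le> dual_norm \<sigma> l L" using n by (simp only: abs_mult) simp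
    then show ?thesis using n by (simp add: field_simps)
  qed
qed

lemma dual_norm_le:
  assumes "\<And>V. V \<in> H2_star l \<Longrightarrow> \<bar>L V\<bar> \<le> C * norm2 \<sigma> l V" "C \<ge> 0"
  shows "dual_norm \<sigma> l L \<le> C"
  unfolding dual_norm_def
proof (rule cSUP_least)
  show "{V \<in> H2_star l. norm2 \<sigma> l V \<le> 1} \<noteq> {}" using H2_star_zero norm2_zero by fastforce
  fix V assume V: "V \<in> {V \<in> H2_star l. norm2 \<sigma> l V \<le> 1}"
  have "\<bar>L V\<bar> \<le> C * norm2 \<sigma> l V" using assms(1) V by simp
  also have "\<dots> \<le> C * 1" using V assms(2) by (intro mult_left_mono) auto
  finally show "\<bar>L V\<bar> \<le> C" by simp
qed

lemma dual_lin:
  assumes "L \<in> dual \<sigma> l" "L' \<in> dual \<sigma> l" shows "(\<lambda>V. a * L V + b * L' V) \<in> dual \<sigma> l"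
proof -
  have "\<bar>a * L V + b * L' V\<bar> \<le> (\<bar>a\<bar> * dual_norm \<sigma> l L + \<bar>b\<bar> * dual_norm \<sigma> l L') * norm2 \<sigma> l V" if V: "V \<in> H2_star l" for V
  proof -
    have "\<bar>a * L V + b * L' V\<bar> \<le> \<bar>a\<bar> * \<bar>L V\<bar> + \<bar>b\<bar> * \<bar>L' V\<bar>"
      using abs_triangle_ineq[of "a * L V" "b * L' V"] by (simp add: abs_mult)
    also have "\<dots> \<le> \<bar>a\<bar> * (dual_norm \<sigma> l L * norm2 \<sigma> l V) + \<bar>b\<bar> * (dual_norm \<sigma> l L' * norm2 \<sigma> l V)"
      by (intro add_mono mult_left_mono dual_bound assms V) auto
    finally show ?thesis by (simp add: algebra_simps)
  qed
  moreover have "\<forall>V\<in>H2_star l. \<forall>W\<in>H2_star l. \<forall>c d.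
      a * L (\<lambda>p. c * V p + d * W p) + b * L' (\<lambda>p. c * V p + d * W p) = c * (a * L V + b * L' V) + d * (a * L W + b * L' W)"
    using assms unfolding dual_def by (simp add: algebra_simps)
  ultimately show ?thesis unfolding dual_def by blast
qed

text \<open>
  By coercivity the vector \<open>a\<close> represents a bounded functional.  The vector is not unique, and
  \<open>L\<close> is constrained on \<open>H2_star\<close> only.
\<close>

lemma dual_state:
  "\<exists>C\<ge>0. \<forall>L a. (\<forall>V\<in>H2_star l. L V = a \<bullet> state \<sigma> l V) \<longrightarrow> L \<in> dual \<sigma> l \<and> dual_norm \<sigma> l L \<le> C * norm a"
proof -
  obtain C where C: "C \<ge> 0" "\<And>V. V \<in> H2_star l \<Longrightarrow> norm (state \<sigma> l V) \<le> C * norm2 \<sigma> l V"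
    using coercive[OF \<sigma> l] by blast
  have "L \<in> dual \<sigma> l \<and> dual_norm \<sigma> l L \<le> C * norm a" if L: "\<forall>V\<in>H2_star l. L V = a \<bullet> state \<sigma> l V" for L a
  proof
    have b: "\<bar>L V\<bar> \<le> (C * norm a) * norm2 \<sigma> l V" if V: "V \<in> H2_star l" for V
    proof -
      have "\<bar>L V\<bar> \<le> norm a * norm (state \<sigma> l V)" using L V Cauchy_Schwarz_ineq2[of a "state \<sigma> l V"] by simp
      also have "\<dots> \<le> norm a * (C * norm2 \<sigma> l V)" using C(2)[OF V] by (rule mult_left_mono) simp
      finally show ?thesis by (simp add: algebra_simps)
    qed
    have "L (\<lambda>p. c * V p + d * W p) = c * L V + d * L W" if "V \<in> H2_star l" "W \<in> H2_star l" for V W c d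
      using L that H2_star_lin[OF that, of c d]
      by (simp add: state_lin[OF \<sigma> l H2_star_H2 H2_star_H2] inner_add_right)
    then show "L \<in> dual \<sigma> l" unfolding dual_def using b by blast
    show "dual_norm \<sigma> l L \<le> C * norm a" by (rule dual_norm_le[OF b]) (use C in simp_all)
  qed
  then show ?thesis using C(1) by blast
qed

text \<open>
  A differentiable curve of representing vectors gives a differentiable curve in the dual space.
\<close>

lemma C1_dual:
  assumes b: "continuous_on I b" and b': "continuous_on I b'"
    and d: "\<And>t. t \<in> I \<Longrightarrow> (b has_vector_derivative b' t) (at t within I)"
    and L: "\<And>t V. t \<in> I \<Longrightarrow> V \<in> H2_star l \<Longrightarrow> L t V = b t \<bullet> state \<sigma> l V"
    and L': "\<And>t V. t \<in> I \<Longrightarrow> V \<in> H2_star l \<Longrightarrow> L' t V = b' t \<bullet> state \<sigma> l V"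
  shows "C1_with I (dual \<sigma> l) (dual_norm \<sigma> l) L L'"
proof -
  obtain C where C: "C \<ge> 0" "\<And>L a. (\<And>V. V \<in> H2_star l \<Longrightarrow> L V = a \<bullet> state \<sigma> l V) \<Longrightarrow> L \<in> dual \<sigma> l \<and> dual_norm \<sigma> l L \<le> C * norm a"
    using dual_state by metis
  have lim: "((\<lambda>s. dual_norm \<sigma> l (K s)) \<longlongrightarrow> 0) (at t within I)"
    if K: "\<And>s V. s \<in> I \<Longrightarrow> V \<in> H2_star l \<Longrightarrow> K s V = (k s - a) \<bullet> state \<sigma> l V" and k: "(k \<longlongrightarrow> a) (at t within I)" for K k a t
  proof (rule tendsto_sandwich[OF _ _ tendsto_const[of 0]])
    have ev: "\<forall>\<^sub>F s in at t within I. s \<in> I" by (simp add: eventually_at_filter)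
    show "\<forall>\<^sub>F s in at t within I. 0 \<le> dual_norm \<sigma> l (K s)"
      using ev by eventually_elim (use C(2)[OF K] dual_norm_nonneg in blast)
    show "\<forall>\<^sub>F s in at t within I. dual_norm \<sigma> l (K s) \<le> C * norm (k s - a)"
      using ev by eventually_elim (use C(2)[OF K] in blast)
    have "((\<lambda>s. norm (k s - a)) \<longlongrightarrow> 0) (at t within I)" unfolding tendsto_norm_diff_iff by (rule k)
    from tendsto_mult_right_zero[OF this] show "((\<lambda>s. C * norm (k s - a)) \<longlongrightarrow> 0) (at t within I)" .
  qed
  have c0: "M \<in> C0 I (dual \<sigma> l) (dual_norm \<sigma> l)"
    if M: "\<And>t V. t \<in> I \<Longrightarrow> V \<in> H2_star l \<Longrightarrow> M t V = m t \<bullet> state \<sigma> l V" and m: "continuous_on I m" for M m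
    unfolding C0_def
  proof (intro CollectI conjI ballI)
    fix t assume t: "t \<in> I"
    show "M t \<in> dual \<sigma> l" using C(2)[OF M[OF t]] by blast
    show "((\<lambda>s. dual_norm \<sigma> l (\<lambda>p. M s p - M t p)) \<longlongrightarrow> 0) (at t within I)"
      by (rule lim[of _ m "m t"]) (use m t in \<open>auto simp: M inner_diff_left continuous_on_def\<close>)
  qed
  show ?thesis unfolding C1_with_def
  proof (intro conjI ballI)
    show "L \<in> C0 I (dual \<sigma> l) (dual_norm \<sigma> l)" "L' \<in> C0 I (dual \<sigma> l) (dual_norm \<sigma> l)"
      by (rule c0[OF L b], assumption+, rule c0[OF L' b'])
    fix t assume t: "t \<in> I"
    show "((\<lambda>s. dual_norm \<sigma> l (\<lambda>p. (L s p - L t p) / (s - t) - L' t p)) \<longlongrightarrow> 0) (at t within I)"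
      by (rule lim[of _ "\<lambda>s. (1 / (s - t)) *\<^sub>R (b s - b t)" "b' t"])
        (use d[OF t] t in \<open>auto simp: L L' inner_diff_left has_vector_derivative_iff_quotient\<close>)
  qed
qed

text \<open>
  Conversely, differentiability in the dual space implies differentiability of every tested curve.
\<close>

lemma C1_dual_tested:
  assumes C1: "C1_with I (dual \<sigma> l) (dual_norm \<sigma> l) L L'" and V: "V \<in> H2_star l" and t: "t \<in> I"
  shows "((\<lambda>t. L t V) has_vector_derivative L' t V) (at t within I)"
proof -
  let ?K = "\<lambda>s p. (L s p - L t p) / (s - t) - L' t p"
  have mem: "L s \<in> dual \<sigma> l" "L' s \<in> dual \<sigma> l" if "s \<in> I" for s using C1 that unfolding C1_with_def C0_def by auto
  have "?K s \<in> dual \<sigma> l" if s: "s \<in> I" for s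
    using dual_lin[OF dual_lin[OF mem(1)[OF s] mem(1)[OF t], of 1 "-1"] mem(2)[OF t], of "1 / (s - t)" "-1"] by simp
  then have b: "norm (?K s V) \<le> dual_norm \<sigma> l (?K s) * norm2 \<sigma> l V" if "s \<in> I" for s
    using dual_bound[OF _ V, of "?K s"] that by simp
  have "((\<lambda>s. ?K s V) \<longlongrightarrow> 0) (at t within I)"
  proof (rule Lim_null_comparison)
    show "\<forall>\<^sub>F s in at t within I. norm (?K s V) \<le> dual_norm \<sigma> l (?K s) * norm2 \<sigma> l V"
      using b by (simp add: eventually_at_filter)
    have "((\<lambda>s. dual_norm \<sigma> l (?K s)) \<longlongrightarrow> 0) (at t within I)" using C1 t unfolding C1_with_def by blast
    from tendsto_mult_left_zero[OF this] show "((\<lambda>s. dual_norm \<sigma> l (?K s) * norm2 \<sigma> l V) \<longlongrightarrow> 0) (at t within I)" .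
  qed
  then have "((\<lambda>s. (L s V - L t V) / (s - t)) \<longlongrightarrow> L' t V) (at t within I)" by (rule LIM_zero_cancel)
  then show ?thesis unfolding has_vector_derivative_iff_quotient by simp
qed

lemma state_eqI:
  assumes U: "U \<in> H2_star l" and V: "V \<in> H2_star l" and e: "emb (Omega l) U = emb (Omega l) V"
  shows "state \<sigma> l U = state \<sigma> l V"
proof -
  have "state \<sigma> l (\<lambda>p. U p - V p) = state \<sigma> l U - state \<sigma> l V" by (rule state_diff[OF \<sigma> l H2_star_H2[OF U] H2_star_H2[OF V]])
  then have eq: "state \<sigma> l (\<lambda>p. U p - V p) = (0, fst (snd (state \<sigma> l U - state \<sigma> l V)), snd (snd (state \<sigma> l U - state \<sigma> l V)))"
    using e by (simp add: state_def prod_eq_iff)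
  have "state \<sigma> l (\<lambda>p. U p - V p) \<in> states \<sigma> l" unfolding states_def[OF \<sigma> l] using H2_star_diff[OF U V] by blast
  from states_determined[OF \<sigma> l this[unfolded eq]] show ?thesis using e by (simp add: prod_eq_iff state_def)
qed

lemma plate_kirchhoff: "S > 0 \<Longrightarrow> kirchhoff (states \<sigma> l) (recover_xx \<sigma>) S"
  by (rule kirchhoff.intro)
    (rule states_subspace[OF \<sigma> l] states_closed[OF \<sigma> l] states_determined[OF \<sigma> l] recover_xx_linear states_by_parts[OF \<sigma> l]; assumption)+

context
  fixes S P \<delta> T :: real and F :: "real \<Rightarrow> field"
  assumes S: "S > 0" and T: "T > 0" and F: "F \<in> C0 {0..T} (L2 (Omega l)) (norm0 (Omega l))"
begin

interpretation K: kirchhoff "states \<sigma> l" "recover_xx \<sigma>" S P \<delta>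
  by (rule plate_kirchhoff[OF S])

abbreviation (input) "e \<equiv> emb (Omega l)"
abbreviation (input) "force_curve \<equiv> \<lambda>t. emb (Omega l) (F t)"

lemma F_L2: "t \<in> {0..T} \<Longrightarrow> F t \<in> L2 (Omega l)" and F_continuous: "continuous_on {0..T} force_curve"
  using F unfolding C0_L2_iff by auto

lemma state_mem: "V \<in> H2_star l \<Longrightarrow> state \<sigma> l V \<in> states \<sigma> l"
  unfolding states_def[OF \<sigma> l] by blast

text \<open>
  The density of the energy space in \<open>L\<^sup>2(\<Omega>)\<close>: a vector \<open>q\<close> orthogonal to it projects to zero in the
  range of \<open>emb\<close>.
\<close>

lemma emb_H0: assumes f: "f \<in> L2 (Omega l)" shows "e f \<in> K.H0"
  unfolding K.H0_def
proof (intro CollectI allI impI)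
  fix q assume q: "\<forall>a z. (a, z) \<in> K.state_graph \<longrightarrow> q \<bullet> a = 0"
  obtain R where R: "\<And>x. R x \<in> e ` L2 (Omega l)" "\<And>x z. z \<in> e ` L2 (Omega l) \<Longrightarrow> R x \<bullet> z = x \<bullet> z"
    using orthogonal_projection[OF emb_range_subspace[OF Omega_sets(1)] emb_range_closed[OF Omega_sets(1)]] by metis
  obtain g where g: "g \<in> L2 (Omega l)" "R q = e g" using R(1)[of q] by auto
  have "e g = 0"
  proof (rule orthogonal_to_H2_star_imp_zero[OF l g(1)])
    fix V assume V: "V \<in> H2_star l"
    have "e g \<bullet> e V = q \<bullet> e V" unfolding g(2)[symmetric] by (rule R(2)) (use H2_L2[OF H2_star_H2[OF V]] in blast)
    also have "\<dots> = 0"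
    proof -
      have "(e V, state \<sigma> l V) \<in> K.state_graph" using state_mem[OF V] by (simp add: K.state_graph_iff state_def del: One_nat_def)
      then show ?thesis using q by blast
    qed
    finally show "e g \<bullet> e V = 0" .
  qed
  then show "e f \<bullet> q = 0" using R(2)[of "e f" q] f g(2) by (simp add: inner_commute)
qed

text \<open>
  Conversely, the range of \<open>emb\<close> is closed and contains the energy space.
\<close>

lemma H0_emb: assumes v: "v \<in> K.H0" shows "\<exists>f\<in>L2 (Omega l). v = e f"
proof -
  obtain R where R: "\<And>x. R x \<in> e ` L2 (Omega l)" "\<And>x z. z \<in> e ` L2 (Omega l) \<Longrightarrow> R x \<bullet> z = x \<bullet> z"
    using orthogonal_projection[OF emb_range_subspace[OF Omega_sets(1)] emb_range_closed[OF Omega_sets(1)]] by metis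
  have "(v - R v) \<bullet> a = 0" if "(a, z) \<in> K.state_graph" for a z
  proof -
    have za: "z \<in> states \<sigma> l" "a = fst z" using that by (simp_all add: K.state_graph_iff)
    then obtain V where V: "V \<in> H2_star l" "z = state \<sigma> l V" unfolding states_def[OF \<sigma> l] by blast
    have "a = e V" by (simp add: za(2) V(2) state_def)
    then show ?thesis using R(2)[of a v] H2_L2[OF H2_star_H2[OF V(1)]] by (simp add: inner_diff_left)
  qed
  then have "v \<bullet> (v - R v) = 0" using v unfolding K.H0_def by blast
  moreover have "R v \<bullet> (v - R v) = 0" using R(2)[OF R(1), of v v] by (simp add: inner_diff_right inner_commute)
  ultimately have "(v - R v) \<bullet> (v - R v) = 0" by (simp add: inner_diff_left)
  then show ?thesis using R(1)[of v] by auto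
qed

lemma phi_eq: "U \<in> H2_star l \<Longrightarrow> phi l S P U = K.phi (ew l 1 0 U)"
  unfolding phi_def K.phi_def using ew_inner[OF H2_star_H2 H2_star_H2, of U l U 1 0 1 0]
  by (simp add: inner0_def power2_eq_square)

lemma equation_iff:
  assumes U: "U \<in> H2_star l" and V: "V \<in> H2_star l" and u': "u' \<in> L2 (Omega l)" and f: "f \<in> L2 (Omega l)"
  shows "x + \<delta> * inner0 (Omega l) u' V + inner2 \<sigma> l U V + phi l S P U * inner0 (Omega l) (wd (Omega l) 1 0 U) (wd (Omega l) 1 0 V) = inner0 (Omega l) f V
    \<longleftrightarrow> x = e f \<bullet> fst (state \<sigma> l V) - \<delta> * (e u' \<bullet> fst (state \<sigma> l V))
        - snd (snd (state \<sigma> l U)) \<bullet> snd (snd (state \<sigma> l V))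
        - K.phi (fst (snd (state \<sigma> l U))) * (fst (snd (state \<sigma> l U)) \<bullet> fst (snd (state \<sigma> l V)))"
proof -
  note V2 = H2_L2[OF H2_star_H2[OF V]]
  have eqs: "e f \<bullet> e V = inner0 (Omega l) f V" "e u' \<bullet> e V = inner0 (Omega l) u' V" "stiff \<sigma> l U \<bullet> stiff \<sigma> l V = inner2 \<sigma> l U V"
    "ew l 1 0 U \<bullet> ew l 1 0 V = inner0 (Omega l) (wd (Omega l) 1 0 U) (wd (Omega l) 1 0 V)"
    by (rule emb_inner[OF Omega_sets(1) f V2], rule emb_inner[OF Omega_sets(1) u' V2],
        rule stiff_inner[OF \<sigma> l H2_star_H2[OF U] H2_star_H2[OF V]], rule ew_inner[OF H2_star_H2[OF U] H2_star_H2[OF V]]) simp_all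
  show ?thesis unfolding state_def fst_conv snd_conv eqs phi_eq[OF U] by (auto simp: algebra_simps)
qed

text \<open>
  The derivative in the dual space, tested with \<open>V\<close>, is an ordinary derivative and can be integrated.  Any
  \<open>L\<^sup>2\<close>-derivative of \<open>U\<close> may be used as the velocity because derivatives on a nondegenerate interval are
  unique.
\<close>

lemma weak_solution_imp_sol:
  assumes W: "weak_solution \<sigma> l \<delta> S P T F U0 V0 U" and U0: "U0 \<in> H2_star l" and V0: "V0 \<in> L2 (Omega l)"
    and C1: "C1_with {0..T} (L2 (Omega l)) (norm0 (Omega l)) U U'"
  shows "K.sol force_curve T (\<lambda>t. state \<sigma> l (U t)) (\<lambda>t. e (U' t))"
    and "state \<sigma> l (U 0) = state \<sigma> l U0" and "e (U' 0) = e V0"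
proof -
  obtain U1 U'' where C1': "C1_with {0..T} (L2 (Omega l)) (norm0 (Omega l)) U U1"
    and C2: "C1_with {0..T} (dual \<sigma> l) (dual_norm \<sigma> l) (\<lambda>t. inner0 (Omega l) (U1 t)) U''"
    and i: "AE p in lebesgue_on (Omega l). U 0 p = U0 p" "AE p in lebesgue_on (Omega l). U1 0 p = V0 p"
    and eq: "\<And>t V. t \<in> {0..T} \<Longrightarrow> V \<in> H2_star l \<Longrightarrow> U'' t V + \<delta> * inner0 (Omega l) (U1 t) V + inner2 \<sigma> l (U t) V
           + phi l S P (U t) * inner0 (Omega l) (wd (Omega l) 1 0 (U t)) (wd (Omega l) 1 0 V) = inner0 (Omega l) (F t) V"
    using W unfolding weak_solution_def by blast
  have Uc: "continuous_on {0..T} (\<lambda>t. state \<sigma> l (U t))" and UC: "\<And>t. t \<in> {0..T} \<Longrightarrow> U t \<in> H2_star l"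
    using W unfolding weak_solution_def C0_H2_star_iff by auto
  have UL: "U' t \<in> L2 (Omega l)" "U1 t \<in> L2 (Omega l)" if "t \<in> {0..T}" for t
    using C1 C1' that unfolding C1_L2_iff C0_L2_iff by auto
  have vc: "continuous_on {0..T} (\<lambda>t. e (U' t))" using C1 unfolding C1_L2_iff C0_L2_iff by auto
  have d: "((\<lambda>t. e (U t)) has_vector_derivative e (U' t)) (at t within {0..T})"
    "((\<lambda>t. e (U t)) has_vector_derivative e (U1 t)) (at t within {0..T})" if "t \<in> {0..T}" for t
    using C1 C1' that unfolding C1_L2_iff by auto
  have same: "e (U1 t) = e (U' t)" if t: "t \<in> {0..T}" for t
    using vector_derivative_unique_within_closed_interval[of 0 T t "\<lambda>t. e (U t)" "e (U1 t)" "e (U' t)"] d[OF t] t T by simp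
  have zero: "0 \<in> {0..T}" using T by simp
  show init: "state \<sigma> l (U 0) = state \<sigma> l U0"
    using i(1) by (intro state_eqI UC zero U0) (simp add: emb_eq_iff[OF Omega_sets(1)] H2_L2 H2_star_H2 UC[OF zero] U0)
  show "e (U' 0) = e V0"
    using i(2) unfolding same[OF zero, symmetric] by (simp add: emb_eq_iff[OF Omega_sets(1)] UL[OF zero] V0)
  show "K.sol force_curve T (\<lambda>t. state \<sigma> l (U t)) (\<lambda>t. e (U' t))"
    unfolding K.sol_def
  proof (intro conjI ballI Uc vc)
    fix t assume t: "t \<in> {0..T}"
    show "state \<sigma> l (U t) \<in> states \<sigma> l" by (rule state_mem[OF UC[OF t]])
    show "e (U' t) \<in> K.H0" by (rule emb_H0[OF UL(1)[OF t]])
    show "fst (state \<sigma> l (U t)) = fst (state \<sigma> l (U 0)) + integral {0..t} (\<lambda>t. e (U' t))"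
      using integral_of_vector_derivative[OF d(1) t] by (simp add: state_def)
    fix z assume "z \<in> states \<sigma> l"
    then obtain V where V: "V \<in> H2_star l" "z = state \<sigma> l V" unfolding states_def[OF \<sigma> l] by blast
    have fz: "fst z = e V" by (simp add: V(2) state_def)
    have inn: "inner0 (Omega l) (U1 s) V = e (U' s) \<bullet> fst z" if "s \<in> {0..T}" for s
      unfolding fz same[OF that, symmetric] by (rule emb_inner[OF Omega_sets(1) UL(2)[OF that] H2_L2[OF H2_star_H2[OF V(1)]], symmetric])
    have "integral {0..t} (\<lambda>s. U'' s V) = inner0 (Omega l) (U1 t) V - inner0 (Omega l) (U1 0) V"
      by (rule integral_of_vector_derivative[OF C1_dual_tested[OF C2 V(1)] t])
    then have "e (U' t) \<bullet> fst z = e (U' 0) \<bullet> fst z + integral {0..t} (\<lambda>s. U'' s V)"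
      by (simp add: inn[OF t] inn[OF zero])
    also have "integral {0..t} (\<lambda>s. U'' s V) = integral {0..t} (\<lambda>s. e (F s) \<bullet> fst z - \<delta> * (e (U' s) \<bullet> fst z)
        - snd (snd (state \<sigma> l (U s))) \<bullet> snd (snd z) - K.phi (fst (snd (state \<sigma> l (U s)))) * (fst (snd (state \<sigma> l (U s))) \<bullet> fst (snd z)))"
    proof (rule integral_cong)
      fix s assume "s \<in> {0..t}"
      then have s: "s \<in> {0..T}" using t by auto
      show "U'' s V = e (F s) \<bullet> fst z - \<delta> * (e (U' s) \<bullet> fst z)
        - snd (snd (state \<sigma> l (U s))) \<bullet> snd (snd z) - K.phi (fst (snd (state \<sigma> l (U s)))) * (fst (snd (state \<sigma> l (U s))) \<bullet> fst (snd z))"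
        using eq[OF s V(1)] unfolding equation_iff[OF UC[OF s] V(1) UL(2)[OF s] F_L2[OF s]] same[OF s] V(2) .
    qed
    finally show "e (U' t) \<bullet> fst z = e (U' 0) \<bullet> fst z + integral {0..t} (\<lambda>s. e (F s) \<bullet> fst z - \<delta> * (e (U' s) \<bullet> fst z)
        - snd (snd (state \<sigma> l (U s))) \<bullet> snd (snd z) - K.phi (fst (snd (state \<sigma> l (U s)))) * (fst (snd (state \<sigma> l (U s))) \<bullet> fst (snd z)))" .
  qed
qed

text \<open>
  The second derivative is the functional represented by \<open>a = (F - \<delta> v, - \<phi> d, - k)\<close>.  The velocity itself
  is not differentiable in \<open>L\<^sup>2\<close>, but on \<open>H2_star\<close> it is also represented by \<open>b = b\<^sub>0 + \<integral> a\<close>, which is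
  continuously differentiable.
\<close>

lemma sol_imp_weak_solution:
  assumes s: "K.sol force_curve T w v" and w0: "w 0 = state \<sigma> l U0" and v0: "v 0 = e V0"
    and U0: "U0 \<in> H2_star l" and V0: "V0 \<in> L2 (Omega l)"
  shows "\<exists>U. weak_solution \<sigma> l \<delta> S P T F U0 V0 U"
proof -
  note P = K.sol_parts[OF s]
  have zero: "0 \<in> {0..T}" using T by simp
  have "\<forall>t\<in>{0..T}. \<exists>U. U \<in> H2_star l \<and> w t = state \<sigma> l U" using P(3) unfolding states_def[OF \<sigma> l] by blast
  from bchoice[OF this] obtain U where U: "\<And>t. t \<in> {0..T} \<Longrightarrow> U t \<in> H2_star l" "\<And>t. t \<in> {0..T} \<Longrightarrow> w t = state \<sigma> l (U t)" by blast
  have "\<forall>t\<in>{0..T}. \<exists>f. f \<in> L2 (Omega l) \<and> v t = e f" using P(4) H0_emb by blast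
  from bchoice[OF this] obtain U' where U': "\<And>t. t \<in> {0..T} \<Longrightarrow> U' t \<in> L2 (Omega l)" "\<And>t. t \<in> {0..T} \<Longrightarrow> v t = e (U' t)" by blast
  have UL: "U t \<in> L2 (Omega l)" if "t \<in> {0..T}" for t by (rule H2_L2[OF H2_star_H2[OF U(1)[OF that]]])
  define a where "a t = (e (F t) - \<delta> *\<^sub>R v t, - K.phi (fst (snd (w t))) *\<^sub>R fst (snd (w t)), - snd (snd (w t)))" for t
  have ac: "continuous_on {0..T} a"
    unfolding a_def K.phi_def by (intro continuous_intros F_continuous P(1,2))
  define b where "b t = (e V0, 0, 0) + integral {0..t} a" for t
  have bd: "(b has_vector_derivative a t) (at t within {0..T})" if "t \<in> {0..T}" for t
    by (rule integral_eq_imp_has_vector_derivative[OF ac _ that]) (simp add: b_def)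
  have bc: "continuous_on {0..T} b"
    unfolding continuous_on_eq_continuous_within using has_vector_derivative_continuous[OF bd] by blast
  have a_inner: "a t \<bullet> z = e (F t) \<bullet> fst z - \<delta> * (v t \<bullet> fst z) - snd (snd (w t)) \<bullet> snd (snd z)
      - K.phi (fst (snd (w t))) * (fst (snd (w t)) \<bullet> fst (snd z))" for t z
    by (cases z) (simp add: a_def inner_Pair inner_diff_left)
  have vb: "v t \<bullet> e V = b t \<bullet> state \<sigma> l V" if t: "t \<in> {0..T}" and V: "V \<in> H2_star l" for t V
  proof -
    let ?z = "state \<sigma> l V"
    have fz: "fst ?z = e V" by (simp add: state_def)
    have "a integrable_on {0..t}" by (rule integrable_continuous_real, rule continuous_on_subset[OF ac]) (use t in auto)
    then have i: "integral {0..t} a \<bullet> ?z = integral {0..t} (\<lambda>s. a s \<bullet> ?z)"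
      by (simp add: integral_inner_left)
    have "v t \<bullet> fst ?z = v 0 \<bullet> fst ?z + integral {0..t} (\<lambda>s. a s \<bullet> ?z)"
      unfolding a_inner using s t state_mem[OF V] unfolding K.sol_def by blast
    then show ?thesis unfolding b_def inner_add_left i by (simp add: v0 fz state_def inner_Pair)
  qed
  have ud: "((\<lambda>t. e (U t)) has_vector_derivative v t) (at t within {0..T})" if t: "t \<in> {0..T}" for t
  proof (rule integral_eq_imp_has_vector_derivative[OF P(2) _ t])
    show "e (U s) = fst (w 0) + integral {0..s} v" if "s \<in> {0..T}" for s
      using P(5)[OF that] U(2)[OF that] by (simp add: state_def)
  qed
  have uc: "continuous_on {0..T} (\<lambda>t. e (U t))"
    unfolding continuous_on_eq_continuous_within using has_vector_derivative_continuous[OF ud] by blast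
  have U'c: "continuous_on {0..T} (\<lambda>t. e (U' t))" by (rule continuous_on_eq[OF P(2) U'(2)])
  have Sc: "continuous_on {0..T} (\<lambda>t. state \<sigma> l (U t))" by (rule continuous_on_eq[OF P(1) U(2)])
  have inn: "inner0 (Omega l) f V = e f \<bullet> e V" if "f \<in> L2 (Omega l)" "V \<in> H2_star l" for f V
    by (rule emb_inner[OF Omega_sets(1) that(1) H2_L2[OF H2_star_H2[OF that(2)]], symmetric])
  have "weak_solution \<sigma> l \<delta> S P T F U0 V0 U" unfolding weak_solution_def
  proof (intro conjI exI)
    show "U \<in> C0 {0..T} (H2_star l) (norm2 \<sigma> l)" unfolding C0_H2_star_iff using U(1) Sc by blast
    show "C1_with {0..T} (L2 (Omega l)) (norm0 (Omega l)) U U'"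
      unfolding C1_L2_iff C0_L2_iff using ud U' UL uc U'c by auto
    show "C1_with {0..T} (dual \<sigma> l) (dual_norm \<sigma> l) (\<lambda>t. inner0 (Omega l) (U t)) (\<lambda>t. inner0 (Omega l) (U' t))"
    proof (rule C1_dual[of _ "\<lambda>t. (e (U t), 0, 0)" "\<lambda>t. (v t, 0, 0)"])
      show "continuous_on {0..T} (\<lambda>t. (e (U t), 0, 0))" "continuous_on {0..T} (\<lambda>t. (v t, 0, 0))"
        by (intro continuous_intros uc P(2))+
      show "((\<lambda>t. (e (U t), 0, 0)) has_vector_derivative (v t, 0, 0)) (at t within {0..T})" if "t \<in> {0..T}" for t
        by (intro has_vector_derivative_Pair ud that has_vector_derivative_const)
    qed (simp_all add: inn UL U' state_def inner_Pair)
    show "C1_with {0..T} (dual \<sigma> l) (dual_norm \<sigma> l) (\<lambda>t. inner0 (Omega l) (U' t)) (\<lambda>t V. a t \<bullet> state \<sigma> l V)"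
      by (rule C1_dual[OF bc ac bd]) (simp_all add: inn U' vb[symmetric])
    show "AE p in lebesgue_on (Omega l). U 0 p = U0 p"
    proof -
      have "e (U 0) = e U0" using w0 U(2)[OF zero] by (simp add: state_def)
      then show ?thesis using UL[OF zero] H2_L2[OF H2_star_H2[OF U0]] by (simp add: emb_eq_iff[OF Omega_sets(1)])
    qed
    show "AE p in lebesgue_on (Omega l). U' 0 p = V0 p"
      using v0 U'(2)[OF zero] U'(1)[OF zero] V0 by (simp add: emb_eq_iff[OF Omega_sets(1)])
    show "\<forall>t\<in>{0..T}. \<forall>V\<in>H2_star l. a t \<bullet> state \<sigma> l V + \<delta> * inner0 (Omega l) (U' t) V + inner2 \<sigma> l (U t) V
           + phi l S P (U t) * inner0 (Omega l) (wd (Omega l) 1 0 (U t)) (wd (Omega l) 1 0 V) = inner0 (Omega l) (F t) V"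
    proof (intro ballI)
      fix t V assume t: "t \<in> {0..T}" and V: "V \<in> H2_star l"
      show "a t \<bullet> state \<sigma> l V + \<delta> * inner0 (Omega l) (U' t) V + inner2 \<sigma> l (U t) V
           + phi l S P (U t) * inner0 (Omega l) (wd (Omega l) 1 0 (U t)) (wd (Omega l) 1 0 V) = inner0 (Omega l) (F t) V"
        unfolding equation_iff[OF U(1)[OF t] V U'(1)[OF t] F_L2[OF t]] a_inner U(2)[OF t] U'(2)[OF t] ..
    qed
  qed
  then show ?thesis by blast
qed

lemma weak_solution_exists:
  assumes U0: "U0 \<in> H2_star l" and V0: "V0 \<in> L2 (Omega l)"
  shows "\<exists>U. weak_solution \<sigma> l \<delta> S P T F U0 V0 U"
proof -
  obtain w v where "K.sol force_curve T w v" "w 0 = state \<sigma> l U0" "v 0 = e V0"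
    using K.sol_exists[OF F_continuous _ state_mem[OF U0] emb_H0[OF V0]] T by auto
  then show ?thesis by (rule sol_imp_weak_solution[OF _ _ _ U0 V0])
qed

lemma weak_solution_C1: "weak_solution \<sigma> l \<delta> S P T F U0 V0 U \<Longrightarrow> \<exists>U'. C1_with {0..T} (L2 (Omega l)) (norm0 (Omega l)) U U'"
  unfolding weak_solution_def by blast

lemma weak_solution_unique:
  assumes W: "weak_solution \<sigma> l \<delta> S P T F U0 V0 U" "weak_solution \<sigma> l \<delta> S P T F U0 V0 W"
    and U0: "U0 \<in> H2_star l" and V0: "V0 \<in> L2 (Omega l)" and t: "t \<in> {0..T}"
  shows "AE p in lebesgue_on (Omega l). W t p = U t p"
proof -
  obtain U' W' where C1: "C1_with {0..T} (L2 (Omega l)) (norm0 (Omega l)) U U'" "C1_with {0..T} (L2 (Omega l)) (norm0 (Omega l)) W W'"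
    using W[THEN weak_solution_C1] by blast
  note s = weak_solution_imp_sol[OF W(1) U0 V0 C1(1)] and s' = weak_solution_imp_sol[OF W(2) U0 V0 C1(2)]
  have "state \<sigma> l (W t) = state \<sigma> l (U t)"
    using K.sol_unique[OF s'(1) s(1) F_continuous _ _ t] s(2,3) s'(2,3) by simp
  then have "e (W t) = e (U t)" by (simp add: state_def)
  moreover have "W t \<in> L2 (Omega l)" "U t \<in> L2 (Omega l)" using C1 t unfolding C1_L2_iff C0_L2_iff by auto
  ultimately show ?thesis by (simp add: emb_eq_iff[OF Omega_sets(1)])
qed

lemma energy_state:
  assumes U: "U \<in> H2_star l" and v: "v \<in> L2 (Omega l)"
  shows "K.energy (state \<sigma> l U) (e v) = 1/2 * (norm0 (Omega l) v)\<^sup>2 + 1/2 * (norm2 \<sigma> l U)\<^sup>2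
     - P/2 * (norm0 (Omega l) (wd (Omega l) 1 0 U))\<^sup>2 + S/4 * (norm0 (Omega l) (wd (Omega l) 1 0 U)) ^ 4"
proof -
  note U2 = H2_star_H2[OF U]
  have "norm (ew l 1 0 U) = norm0 (Omega l) (wd (Omega l) 1 0 U)"
    unfolding ew_def by (rule emb_norm[OF Omega_sets(1) wd_L2[OF U2]]) simp
  moreover have "(x::real) ^ 4 = (x\<^sup>2)\<^sup>2" for x by simp
  ultimately show ?thesis unfolding K.energy_def state_def fst_conv snd_conv
    by (simp only: power2_norm_eq_inner[symmetric] emb_norm[OF Omega_sets(1) v] stiff_norm[OF \<sigma> l U2])
qed

lemma weak_solution_energy:
  assumes W: "weak_solution \<sigma> l \<delta> S P T F U0 V0 U" and U0: "U0 \<in> H2_star l" and V0: "V0 \<in> L2 (Omega l)"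
    and C1: "C1_with {0..T} (L2 (Omega l)) (norm0 (Omega l)) U U'" and t: "t \<in> {0..T}"
  shows "1/2 * (norm0 (Omega l) (U' t))\<^sup>2 + 1/2 * (norm2 \<sigma> l (U t))\<^sup>2
               - P/2 * (norm0 (Omega l) (wd (Omega l) 1 0 (U t)))\<^sup>2
               + S/4 * (norm0 (Omega l) (wd (Omega l) 1 0 (U t))) ^ 4
               - integral {0..t} (\<lambda>s. inner0 (Omega l) (F s) (U' s))
               + \<delta> * integral {0..t} (\<lambda>s. (norm0 (Omega l) (U' s))\<^sup>2)
               = 1/2 * (norm0 (Omega l) V0)\<^sup>2 + 1/2 * (norm2 \<sigma> l U0)\<^sup>2
               - P/2 * (norm0 (Omega l) (wd (Omega l) 1 0 U0))\<^sup>2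
               + S/4 * (norm0 (Omega l) (wd (Omega l) 1 0 U0)) ^ 4"
proof -
  note s = weak_solution_imp_sol[OF W U0 V0 C1]
  have U: "U s \<in> H2_star l" "U' s \<in> L2 (Omega l)" if "s \<in> {0..T}" for s
    using W C1 that unfolding weak_solution_def C0_H2_star_iff C1_L2_iff C0_L2_iff by auto
  have sub: "s \<in> {0..T}" if "s \<in> {0..t}" for s using that t by auto
  have "integral {0..t} (\<lambda>s. e (F s) \<bullet> e (U' s)) = integral {0..t} (\<lambda>s. inner0 (Omega l) (F s) (U' s))"
    by (rule integral_cong) (rule emb_inner[OF Omega_sets(1) F_L2[OF sub] U(2)[OF sub]])
  moreover have "integral {0..t} (\<lambda>s. e (U' s) \<bullet> e (U' s)) = integral {0..t} (\<lambda>s. (norm0 (Omega l) (U' s))\<^sup>2)"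
    by (rule integral_cong) (simp add: power2_norm_eq_inner[symmetric] emb_norm[OF Omega_sets(1) U(2)[OF sub]])
  ultimately show ?thesis
    using K.sol_energy[OF s(1) F_continuous t] unfolding s(2,3) energy_state[OF U(1)[OF t] U(2)[OF t]] energy_state[OF U0 V0]
    by simp
qed

end

end

theorem theorem3:
  fixes \<sigma> l \<delta> S P T :: real
    and U0 V0 :: field
    and F :: "real \<Rightarrow> field"
  assumes "0 < \<sigma>" and "\<sigma> < 1/2" and "l > 0"
    and "S > 0" and "P \<ge> 0" and "T > 0"
    and "U0 \<in> H2_star l"
    and "V0 \<in> L2 (Omega l)"
    and "F \<in> C0 {0..T} (L2 (Omega l)) (norm0 (Omega l))"
  shows "(\<exists>U. weak_solution \<sigma> l \<delta> S P T F U0 V0 U \<and>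
              (\<forall>W. weak_solution \<sigma> l \<delta> S P T F U0 V0 W \<longrightarrow>
                   (\<forall>t\<in>{0..T}. AE p in lebesgue_on (Omega l). W t p = U t p))) \<and>
         (\<forall>U U'. weak_solution \<sigma> l \<delta> S P T F U0 V0 U \<longrightarrow>
            C1_with {0..T} (L2 (Omega l)) (norm0 (Omega l)) U U' \<longrightarrow>
            (\<forall>t\<in>{0..T}.
               1/2 * (norm0 (Omega l) (U' t))\<^sup>2 + 1/2 * (norm2 \<sigma> l (U t))\<^sup>2
               - P/2 * (norm0 (Omega l) (wd (Omega l) 1 0 (U t)))\<^sup>2
               + S/4 * (norm0 (Omega l) (wd (Omega l) 1 0 (U t))) ^ 4
               - integral {0..t} (\<lambda>s. inner0 (Omega l) (F s) (U' s))
               + \<delta> * integral {0..t} (\<lambda>s. (norm0 (Omega l) (U' s))\<^sup>2)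
               = 1/2 * (norm0 (Omega l) V0)\<^sup>2 + 1/2 * (norm2 \<sigma> l U0)\<^sup>2
               - P/2 * (norm0 (Omega l) (wd (Omega l) 1 0 U0))\<^sup>2
               + S/4 * (norm0 (Omega l) (wd (Omega l) 1 0 U0)) ^ 4))"
proof (intro conjI allI impI ballI)
  note D = assms(1-4,6,9)
  obtain U where "weak_solution \<sigma> l \<delta> S P T F U0 V0 U"
    using weak_solution_exists[OF D assms(7,8)] by blast
  then show "\<exists>U. weak_solution \<sigma> l \<delta> S P T F U0 V0 U \<and>
      (\<forall>W. weak_solution \<sigma> l \<delta> S P T F U0 V0 W \<longrightarrow> (\<forall>t\<in>{0..T}. AE p in lebesgue_on (Omega l). W t p = U t p))"
    using weak_solution_unique[OF D _ _ assms(7,8)] by blast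
qed (rule weak_solution_energy[OF assms(1-4,6,9) _ assms(7,8)])

end
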